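(* Fix a point $X\in\mathbb{P}^3$ and a line $L\subseteq\mathbb{P}^3$ and let $\mathcal{C}$ be a generic arrangement of $m$ cameras. (1) $\mathrm{EDD}(\mathcal{M}_\mathcal{C}^L)=3m-2$. (2) If $m\ge3$, then $\mathrm{EDD}(\mathcal{L}_\mathcal{C}^X)=\frac92m^2-\frac{19}{2}m+3$.
   Context: All spaces are complex projective. A camera is a full-rank $3\times4$ matrix $C:\mathbb{P}^3\dashrightarrow\mathbb{P}^2$ with center its kernel; a camera arrangement $\mathcal{C}=(C_1,\ldots,C_m)$, $m\ge2$, has pairwise distinct centers; "generic" means outside a proper Zariski closed subset. For a line $L'$ spanned by $u,v$, $C\cdot L':=Cu\times Cv\in\mathbb{P}^2$. $\mathcal{M}_\mathcal{C}^L$ is the Zariski closure in $(\mathbb{P}^2)^m$ of the image of $L\ni Y\mapsto(C_1Y,\ldots,C_mY)$; $\mathcal{L}_\mathcal{C}^X$ is the Zariski closure in $(\mathbb{P}^2)^m$ of the image of $\Lambda(X)\ni L'\mapsto(C_1\cdot L',\ldots,C_m\cdot L')$, $\Lambda(X)$ being the set of lines through $X$. For a variety $\mathcal{V}\subseteq(\mathbb{P}^2)^m$, $\mathrm{EDD}(\mathcal{V})$ denotes the (affine) Euclidean distance degree: fix an affine chart $\mathbb{C}^2\subseteq\mathbb{P}^2$ in each factor, let $V=\mathcal{V}\cap\mathbb{C}^{2m}$; for generic data $u\in\mathbb{C}^{2m}$, it is the number of complex critical points of $z\mapsto\sum_{i=1}^{2m}(u_i-z_i)^2$ on the smooth locus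 of $V$. *)

theory Defs
  imports "HOL-Analysis.Analysis"
begin

inductive_set cpoly :: "(complex^'n \<Rightarrow> complex) set" where
  cpoly_const: "(\<lambda>x. c) \<in> cpoly"
| cpoly_coord: "(\<lambda>x. x $ i) \<in> cpoly"
| cpoly_add: "f \<in> cpoly \<Longrightarrow> g \<in> cpoly \<Longrightarrow> (\<lambda>x. f x + g x) \<in> cpoly"
| cpoly_mult: "f \<in> cpoly \<Longrightarrow> g \<in> cpoly \<Longrightarrow> (\<lambda>x. f x * g x) \<in> cpoly"

definition zariski_closed :: "(complex^'n) set \<Rightarrow> bool" where
  "zariski_closed S \<longleftrightarrow> (\<exists>F \<subseteq> cpoly. S = {x. \<forall>f\<in>F. f x = 0})"

definition proper_zariski_closed :: "(complex^'n) set \<Rightarrow> bool" where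
  "proper_zariski_closed S \<longleftrightarrow> zariski_closed S \<and> S \<noteq> UNIV"

definition zclosure :: "(complex^'n) set \<Rightarrow> (complex^'n) set" where
  "zclosure S = \<Inter>{T. zariski_closed T \<and> S \<subseteq> T}"

definition zirreducible :: "(complex^'n) set \<Rightarrow> bool" where
  "zirreducible S \<longleftrightarrow> S \<noteq> {} \<and>
     (\<forall>A B. zariski_closed A \<longrightarrow> zariski_closed B \<longrightarrow> S \<subseteq> A \<union> B \<longrightarrow> S \<subseteq> A \<or> S \<subseteq> B)"

definition local_dim :: "(complex^'n) set \<Rightarrow> complex^'n \<Rightarrow> nat" where
  "local_dim V p = Sup {d. \<exists>S :: nat \<Rightarrow> (complex^'n) set.
      (\<forall>k\<le>d. zariski_closed (S k) \<and> zirreducible (S k) \<and> S k \<subseteq> V) \<and>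
      (\<forall>k<d. S k \<subset> S (Suc k)) \<and> p \<in> S d}"

definition vanishing_ideal :: "(complex^'n) set \<Rightarrow> (complex^'n \<Rightarrow> complex) set" where
  "vanishing_ideal V = {f \<in> cpoly. \<forall>x\<in>V. f x = 0}"

definition dir_deriv :: "(complex^'n \<Rightarrow> complex) \<Rightarrow> complex^'n \<Rightarrow> complex^'n \<Rightarrow> complex" where
  "dir_deriv f p v = deriv (\<lambda>t. f (p + t *s v)) 0"

definition tangent_space :: "(complex^'n) set \<Rightarrow> complex^'n \<Rightarrow> (complex^'n) set" where
  "tangent_space V p = {v. \<forall>f\<in>vanishing_ideal V. dir_deriv f p v = 0}"

definition smooth_point :: "(complex^'n) set \<Rightarrow> complex^'n \<Rightarrow> bool" where
  "smooth_point V p \<longleftrightarrow> p \<in> V \<and> vec.dim (tangent_space V p) = local_dim V p"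

definition sqdist_fun :: "complex^'n \<Rightarrow> complex^'n \<Rightarrow> complex" where
  "sqdist_fun u z = (\<Sum>i\<in>UNIV. (u $ i - z $ i)^2)"

definition ed_critical_points :: "(complex^'n) set \<Rightarrow> complex^'n \<Rightarrow> (complex^'n) set" where
  "ed_critical_points V u = {z. smooth_point V z \<and>
      (\<forall>v\<in>tangent_space V z. dir_deriv (sqdist_fun u) z v = 0)}"

definition EDD_is :: "(complex^'n) set \<Rightarrow> nat \<Rightarrow> bool" where
  "EDD_is V N \<longleftrightarrow> (\<exists>Z. proper_zariski_closed Z \<and>
      (\<forall>u. u \<notin> Z \<longrightarrow> finite (ed_critical_points V u) \<and> card (ed_critical_points V u) = N))"

definition camera_arrangement :: "('m::finite \<Rightarrow> complex^4^3) \<Rightarrow> bool" where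
  "camera_arrangement C \<longleftrightarrow> (\<forall>i. rank (C i) = 3) \<and>
     (\<forall>i j. i \<noteq> j \<longrightarrow> {Y. C i *v Y = 0} \<noteq> {Y. C j *v Y = 0})"

definition arr_vec :: "('m::finite \<Rightarrow> complex^4^3) \<Rightarrow> complex^('m \<times> 3 \<times> 4)" where
  "arr_vec C = (\<chi> p. case p of (i, r, c) \<Rightarrow> C i $ r $ c)"

definition ccross :: "complex^3 \<Rightarrow> complex^3 \<Rightarrow> complex^3" where
  "ccross u v = vector [u$2 * v$3 - u$3 * v$2, u$3 * v$1 - u$1 * v$3, u$1 * v$2 - u$2 * v$1]"

text \<open>Standard affine chart of each factor P^2: (y1:y2:y3) with y3 \<noteq> 0 goes to (y1/y3, y2/y3).\<close>
definition chart :: "('m::finite \<Rightarrow> complex^3) \<Rightarrow> complex^('m \<times> 2)" where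
  "chart y = (\<chi> p. case p of (i, k) \<Rightarrow> (if k = 1 then y i $ 1 else y i $ 2) / y i $ 3)"

definition line_multiview_affine ::
  "('m::finite \<Rightarrow> complex^4^3) \<Rightarrow> complex^4 \<Rightarrow> complex^4 \<Rightarrow> (complex^('m \<times> 2)) set" where
  "line_multiview_affine C a b = zclosure
     {chart (\<lambda>i. C i *v Y) | Y. Y \<in> vec.span {a, b} \<and> Y \<noteq> 0 \<and> (\<forall>i. (C i *v Y) $ 3 \<noteq> 0)}"

text \<open>Affine part of the variety of images of the lines through the point X = [x];
  a line L' through X is spanned by x and w, and C.L' = Cx \<times> Cw.\<close>
definition point_line_multiview_affine ::
  "('m::finite \<Rightarrow> complex^4^3) \<Rightarrow> complex^4 \<Rightarrow> (complex^('m \<times> 2)) set" where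
  "point_line_multiview_affine C x = zclosure
     {chart (\<lambda>i. ccross (C i *v x) (C i *v w)) | w. vec.independent {x, w} \<and> x \<noteq> w \<and>
        (\<forall>i. ccross (C i *v x) (C i *v w) $ 3 \<noteq> 0)}"

end

theory Submission
  imports Defs "Jordan_Normal_Form.Char_Poly" "HOL-Computational_Algebra.Fundamental_Theorem_Algebra"
begin

text \<open>(1) In suitable coordinates one camera sees the points of \<open>L\<close> as \<open>P + R t\<close> and every other camera as
  \<open>P i + R i / (t - tau i)\<close>. The derivative of the squared distance then has a numerator of degree
  \<open>3 m - 2\<close>; its coefficients move in a pencil with the data, so it is squarefree for generic data.

  (2) The images of the lines through \<open>X\<close> in one factor lie on a line, with scalar coordinate \<open>x\<close> for one
  camera and \<open>a i (x - xx i) / (t - tau i x)\<close>, \<open>tau i\<close> affine, for the other \<open>k = m - 1\<close> cameras. The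
  critical points are the common zeros of two plane curves of degrees \<open>3 k - 1\<close> and \<open>3 k + 1\<close> off the pole
  lines \<open>t = tau i x\<close>. Their resultant has degree at most \<open>(3 k - 1) (3 k + 1) - 1\<close>, because they share a
  point at infinity, and it vanishes to order 9 at each crossing of two pole lines and to order 5 at each camera
  centre. This leaves at most \<open>9 (k choose 2) + 4 k - 2\<close> critical points. Equality is attained when the last
  coordinate of the data tends to infinity: by a persistence argument 9 zeros stay near each crossing, one near
  each centre and \<open>3 k - 2\<close> near infinity. That the reduced resultant is squarefree of full degree is then a
  nonempty Zariski open condition on the data.

  For the cameras, every nondegeneracy condition is polynomial in the entries, so it suffices to give a separate
  witness for each of them.\<close>

text \<open>Intersection multiplicities are never computed. They enter only as divisibilities of a
  Sylvester determinant, which bound the number of critical points from above; from below the mere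
  existence of enough zeros is shown, and both counts agree. A crossing is a triple point of both
  curves, hence 9 = 3 * 3; at a camera centre both have a double point and their tangent cones share
  a line, hence 5 = 2 * 2 + 1. With \<open>1 / \<kappa> ^ 3\<close> as last coordinate of the data,
  rescaling by \<kappa> at a crossing leaves two equations in the cubes of the local coordinates,
  which is the origin of the 9 zeros there. The ED degree is defined through the Zariski closure,
  and its points over lines through a camera centre might be critical as well. Two explicit tangent
  vectors at each of them turn criticality into a polynomial equation on the data, so smoothness
  need not be decided there. Local dimension is bounded by counting: on a rational image in
  \<open>r\<close> parameters, \<open>r + 1\<close> functions have more monomials than the space
  containing them has dimensions, whereas functions separating a chain of irreducible sets are
  algebraically independent.\<close>

no_notation vec_index (infixl "$" 100)

section \<open>Determinants of coefficient matrices and resultants\<close>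

definition coeff_det :: "nat \<Rightarrow> (nat \<Rightarrow> 'a::comm_ring_1 poly) \<Rightarrow> 'a" where
  "coeff_det n P = Determinant.det (Matrix.mat n n (\<lambda>(i,j). coeff (P i) j))"

definition syl_row :: "nat \<Rightarrow> 'a::comm_ring_1 poly \<Rightarrow> 'a poly \<Rightarrow> nat \<Rightarrow> 'a poly" where
  "syl_row q F G i = (if i < q then monom 1 i * F else monom 1 (i - q) * G)"

text \<open>Up to sign the resultant, but for prescribed degree bounds \<open>p\<close> and
  \<open>q\<close> instead of the actual degrees. It is therefore polynomial in the coefficients and
  commutes with every ring homomorphism applied to them (\<open>sylv_hom\<close>).\<close>

definition sylv :: "nat \<Rightarrow> nat \<Rightarrow> 'a::comm_ring_1 poly \<Rightarrow> 'a poly \<Rightarrow> 'a" where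
  "sylv p q F G = coeff_det (p + q) (syl_row q F G)"

lemma leibniz:
  "Determinant.det (Matrix.mat n n f) =
   (\<Sum>\<pi> | \<pi> permutes {0..<n}. signof \<pi> * (\<Prod>i = 0..<n. f (i, \<pi> i)))"
proof -
  have "i < n \<Longrightarrow> \<pi> i < n" if "\<pi> permutes {0..<n}" for \<pi> i
    using permutes_in_image[OF that, of i] by auto
  then have "(\<Prod>i = 0..<n. Matrix.mat n n f $$ (i, \<pi> i)) = (\<Prod>i = 0..<n. f (i, \<pi> i))"
    if "\<pi> permutes {0..<n}" for \<pi>
    using that by (intro prod.cong) auto
  then show ?thesis
    by (subst det_def'[of _ n]) auto
qed

lemma coeff_det_leibniz:
  "coeff_det n P = (\<Sum>\<pi> | \<pi> permutes {0..<n}. signof \<pi> * (\<Prod>i = 0..<n. coeff (P i) (\<pi> i)))"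
  unfolding coeff_det_def leibniz by simp

lemma det_eq_0_kernel:
  fixes A :: "nat \<Rightarrow> nat \<Rightarrow> 'a::field"
  assumes "\<And>i. i < n \<Longrightarrow> (\<Sum>j<n. A i j * x j) = 0" and "k < n" "x k \<noteq> 0"
  shows "Determinant.det (Matrix.mat n n (\<lambda>(i,j). A i j)) = 0"
proof -
  let ?A = "Matrix.mat n n (\<lambda>(i,j). A i j)" and ?v = "Matrix.vec n x"
  have "?v \<noteq> 0\<^sub>v n"
    using assms(2,3) by (metis index_vec index_zero_vec(1))
  moreover have "?A *\<^sub>v ?v = 0\<^sub>v n"
    using assms(1) by (intro eq_vecI) (auto simp: scalar_prod_def atLeast0LessThan)
  ultimately show ?thesis
    by (subst det_0_iff_vec_prod_zero_field[of _ n]) (auto intro!: exI[of _ ?v])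
qed

lemma det_eq_0_rows:
  fixes A :: "nat \<Rightarrow> nat \<Rightarrow> 'a::field"
  assumes "Determinant.det (Matrix.mat n n (\<lambda>(i,j). A i j)) = 0"
  obtains w k where "k < n" "w k \<noteq> 0" "\<And>j. j < n \<Longrightarrow> (\<Sum>i<n. w i * A i j) = 0"
proof -
  let ?A = "Matrix.mat n n (\<lambda>(i,j). A i j)"
  have "Determinant.det (transpose_mat ?A) = 0"
    using assms by (subst det_transpose[of _ n]) auto
  then obtain v where v: "v \<in> carrier_vec n" "v \<noteq> 0\<^sub>v n" "transpose_mat ?A *\<^sub>v v = 0\<^sub>v n"
    by (subst (asm) det_0_iff_vec_prod_zero_field[of _ n]) auto
  obtain k where "k < n" "vec_index v k \<noteq> 0"
    using v(1,2) by (metis carrier_vecD eq_vecI index_zero_vec(1,2))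
  moreover have "(\<Sum>i<n. vec_index v i * A i j) = 0" if "j < n" for j
  proof -
    have "vec_index (transpose_mat ?A *\<^sub>v v) j = 0"
      using v(3) that by simp
    then show ?thesis
      using that v(1) by (simp add: scalar_prod_def atLeast0LessThan mult.commute)
  qed
  ultimately show ?thesis
    using that by blast
qed

lemma poly_sum_coeff_less: "degree P < n \<Longrightarrow> (\<Sum>j<n. coeff P j * x ^ j) = poly (P::'a::comm_ring_1 poly) x"
  unfolding poly_altdef by (rule sum.mono_neutral_right) (auto simp: coeff_eq_0)

text \<open>The powers \<open>z ^ j\<close> form a kernel vector of the coefficient matrix; its
  entry \<open>z ^ 0\<close> is nonzero whatever \<open>z\<close> is.\<close>

lemma coeff_det_common_root:
  fixes P :: "nat \<Rightarrow> 'a::field poly"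
  assumes "n > 0" "\<And>i. i < n \<Longrightarrow> degree (P i) < n" "\<And>i. i < n \<Longrightarrow> poly (P i) z = 0"
  shows "coeff_det n P = 0"
  unfolding coeff_det_def
  by (rule det_eq_0_kernel[where k = 0 and x = "\<lambda>j. z ^ j"]) (use assms in \<open>auto simp: poly_sum_coeff_less\<close>)

lemma degree_monom_mult_less:
  fixes F :: "'a::comm_ring_1 poly"
  assumes "degree F \<le> p" "i < q" shows "degree (monom 1 i * F) < p + q"
proof -
  have "degree (monom 1 i * F) \<le> degree (monom (1::'a::comm_ring_1) i) + degree F"
    by (rule degree_mult_le)
  also have "degree (monom (1::'a) i) \<le> i"
    by (rule degree_monom_le)
  finally show ?thesis using assms by linarith
qed

lemma degree_syl_row:
  assumes "degree F \<le> p" "degree G \<le> q" "i < p + q"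
  shows "degree (syl_row q F G i) < p + q"
  using degree_monom_mult_less[of F p i q] degree_monom_mult_less[of G q "i - q" p] assms
  by (auto simp: syl_row_def add.commute)

lemma sylv_common_root:
  fixes F G :: "'a::field poly"
  assumes "degree F \<le> p" "degree G \<le> q" "p + q > 0" "poly F z = 0" "poly G z = 0"
  shows "sylv p q F G = 0"
  unfolding sylv_def
proof (rule coeff_det_common_root[where z = z])
  show "degree (syl_row q F G i) < p + q" if "i < p + q" for i
    using degree_syl_row assms(1,2) that .
  show "poly (syl_row q F G i) z = 0" for i
    using assms(4,5) by (simp add: syl_row_def)
qed (use assms(3) in simp)

text \<open>Over the complex numbers coprimality means having no common root. The induction splits
  one linear factor after another off \<open>F\<close>; each of them must divide
  \<open>B\<close>.\<close>

lemma dvd_cancel_no_common_root: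
  fixes F G B :: "complex poly"
  assumes "F dvd B * G" "F \<noteq> 0" "\<And>z. poly F z = 0 \<Longrightarrow> poly G z \<noteq> 0"
  shows "F dvd B"
  using assms
proof (induction "degree F" arbitrary: F B)
  case 0
  then show ?case
    by (metis is_unit_iff_degree unit_imp_dvd)
next
  case (Suc n)
  then obtain r where r: "poly F r = 0"
    by (metis fundamental_theorem_of_algebra constant_degree nat.simps(3))
  then obtain F' where F': "F = [:-r,1:] * F'"
    by (auto simp: poly_eq_0_iff_dvd elim: dvdE)
  have "poly (B * G) r = 0"
    using Suc.prems(1) r by (auto elim!: dvdE simp del: poly_mult simp: poly_mult[of F])
  then have "poly B r = 0"
    using Suc.prems(3)[OF r] by simp
  then obtain B' where B': "B = [:-r,1:] * B'"
    by (auto simp: poly_eq_0_iff_dvd elim: dvdE)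
  have "F' \<noteq> 0"
    using F' Suc.prems(2) by auto
  have "degree F' = n"
    using Suc.hyps(2) \<open>F' \<noteq> 0\<close> unfolding F' by (subst (asm) degree_mult_eq) auto
  moreover have "F' dvd B' * G"
    using Suc.prems(1) unfolding F' B' mult.assoc by (subst (asm) dvd_mult_cancel_left) auto
  ultimately have "F' dvd B'"
    using Suc.hyps(1)[of F' B'] Suc.prems(3) \<open>F' \<noteq> 0\<close> F' by auto
  then show ?case
    unfolding F' B' by (rule mult_dvd_mono[OF dvd_refl])
qed

text \<open>A linear relation between the rows reads \<open>A * F + B * G = 0\<close> with
  \<open>B\<close> of degree below \<open>p\<close>. Without a common root \<open>F\<close> would
  divide \<open>B\<close>. The exact degree is asked of \<open>F\<close> only, so the degree of
  \<open>G\<close> may drop under specialisation.\<close>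

lemma sylv_eq_0_imp_common_root:
  fixes F G :: "complex poly"
  assumes "sylv p q F G = 0" "degree F = p" "degree G \<le> q" "F \<noteq> 0"
  obtains z where "poly F z = 0" "poly G z = 0"
proof -
  obtain w k where w: "k < p + q" "w k \<noteq> 0"
    and w0: "\<And>j. j < p + q \<Longrightarrow> (\<Sum>i<p+q. w i * coeff (syl_row q F G i) j) = 0"
    using assms(1) unfolding sylv_def coeff_det_def by (rule det_eq_0_rows) blast
  define A where "A = (\<Sum>i<q. monom (w i) i)"
  define B where "B = (\<Sum>i<p. monom (w (q + i)) i)"
  have cA: "coeff A i = (if i < q then w i else 0)" for i
    by (auto simp: A_def coeff_sum)
  have cB: "coeff B i = (if i < p then w (q + i) else 0)" for i
    by (auto simp: B_def coeff_sum)
  have split: "(\<Sum>i<p+q. f i) = (\<Sum>i<q. f i) + (\<Sum>i<p. f (q + i))" for f :: "nat \<Rightarrow> complex poly"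
    unfolding lessThan_atLeast0 add.commute[of p q]
    by (subst sum.atLeastLessThan_concat[of 0 q "q + p", symmetric])
       (auto simp: sum.shift_bounds_nat_ivl[of f 0 q p, simplified, symmetric] add.commute)
  have eq: "(\<Sum>i<p+q. Polynomial.smult (w i) (syl_row q F G i)) = A * F + B * G"
    unfolding split A_def B_def sum_distrib_right
    by (intro arg_cong2[of _ _ _ _ "(+)"] sum.cong)
       (auto simp: syl_row_def smult_monom_mult simp flip: mult_smult_left simp: smult_monom)
  have "coeff (A * F + B * G) j = 0" for j
  proof (cases "j < p + q")
    case True
    then show ?thesis using w0[OF True] unfolding eq[symmetric] by (simp add: coeff_sum)
  next
    case False
    have "degree (Polynomial.smult (w i) (syl_row q F G i)) < p + q" if "i < p + q" for i
      using degree_syl_row[of F p G q i] assms(2,3) that le_less_trans[OF degree_smult_le] by blast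
    then have "coeff (Polynomial.smult (w i) (syl_row q F G i)) j = 0" if "i < p + q" for i
      using False that by (intro coeff_eq_0) (metis less_le_trans not_less)
    then have "w i * coeff (syl_row q F G i) j = 0" if "i < p + q" for i
      using that by simp
    then show ?thesis unfolding eq[symmetric] coeff_sum coeff_smult by (intro sum.neutral) simp
  qed
  then have AB: "A * F + B * G = 0"
    by (intro poly_eqI) auto
  have "B \<noteq> 0"
  proof
    assume "B = 0"
    then have "A = 0" using AB assms(4) by auto
    then have "w k = 0"
      using cA[of k] cB[of "k - q"] \<open>B = 0\<close> w(1) by (auto split: if_splits)
    then show False using w(2) by simp
  qed
  have "degree B < p"
  proof -
    have "coeff B (degree B) \<noteq> 0" using \<open>B \<noteq> 0\<close> by auto
    then show ?thesis using cB by metis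
  qed
  have "B * G = - A * F" using AB by (simp add: add_eq_0_iff2)
  then have "F dvd B * G" by simp
  moreover have "\<not> F dvd B"
    using dvd_imp_degree_le[of F B] \<open>B \<noteq> 0\<close> \<open>degree B < p\<close> assms(2) by auto
  ultimately show ?thesis
    using dvd_cancel_no_common_root[of F B G] assms(4) that by blast
qed

lemma pcompose_power: "pcompose (P ^ k) L = (pcompose P L :: 'a::comm_ring_1 poly) ^ k"
  by (induction k) (auto simp: pcompose_mult pcompose_1)

lemma pcompose_as_sum:
  fixes P L :: "'a::comm_ring_1 poly"
  assumes "degree P < n"
  shows "pcompose P L = (\<Sum>c<n. Polynomial.smult (coeff P c) (L ^ c))"
proof -
  obtain m where n: "n = Suc m" using assms by (cases n) auto
  have "pcompose P L = pcompose (\<Sum>c\<le>m. Polynomial.smult (coeff P c) ([:0, 1:] ^ c)) L"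
    using poly_as_sum_of_monoms'[of P m] assms n by (simp add: monom_altdef)
  also have "\<dots> = (\<Sum>c\<le>m. Polynomial.smult (coeff P c) (L ^ c))"
    by (simp add: pcompose_sum pcompose_smult pcompose_power pcompose_pCons)
  finally show ?thesis by (simp add: n lessThan_Suc_atMost)
qed

lemma coeff_linear_power:
  "j > i \<Longrightarrow> coeff ([:c, 1::'a::comm_ring_1:] ^ i) j = 0" "coeff ([:c, 1:] ^ i) i = 1"
proof -
  have "coeff ([:c, 1::'a:] ^ i) i = 1 \<and> (\<forall>j>i. coeff ([:c, 1:] ^ i) j = 0)"
  proof (induction i)
    case (Suc i)
    have "coeff ([:c, 1:] ^ Suc i) j = c * coeff ([:c, 1:] ^ i) j + (if j = 0 then 0 else coeff ([:c, 1:] ^ i) (j - 1))" for j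
      by (cases j) auto
    then show ?case using Suc by auto
  qed auto
  then show "j > i \<Longrightarrow> coeff ([:c, 1::'a:] ^ i) j = 0" "coeff ([:c, 1::'a:] ^ i) i = 1" by auto
qed

lemma coeff_det_row_op:
  assumes "\<And>i j. i < n \<Longrightarrow> j < n \<Longrightarrow> coeff (Q i) j = (\<Sum>k<n. L i k * coeff (P k) j)"
  shows "coeff_det n Q = Determinant.det (Matrix.mat n n (\<lambda>(i,k). L i k)) * coeff_det n P"
proof -
  have "Matrix.mat n n (\<lambda>(i,j). coeff (Q i) j) =
      Matrix.mat n n (\<lambda>(i,k). L i k) * Matrix.mat n n (\<lambda>(k,j). coeff (P k) j)"
    by (rule eq_matI) (auto simp: assms scalar_prod_def atLeast0LessThan)
  then show ?thesis
    unfolding coeff_det_def by (simp add: det_mult[of _ n])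
qed

lemma coeff_det_col_op:
  assumes "\<And>i j. i < n \<Longrightarrow> j < n \<Longrightarrow> coeff (Q i) j = (\<Sum>k<n. coeff (P i) k * U k j)"
  shows "coeff_det n Q = coeff_det n P * Determinant.det (Matrix.mat n n (\<lambda>(k,j). U k j))"
proof -
  have "Matrix.mat n n (\<lambda>(i,j). coeff (Q i) j) =
      Matrix.mat n n (\<lambda>(i,k). coeff (P i) k) * Matrix.mat n n (\<lambda>(k,j). U k j)"
    by (rule eq_matI) (auto simp: assms scalar_prod_def atLeast0LessThan)
  then show ?thesis
    unfolding coeff_det_def by (simp add: det_mult[of _ n])
qed

lemma det_unipotent:
  fixes L :: "nat \<Rightarrow> nat \<Rightarrow> 'a::idom"
  assumes "\<And>i j. i < j \<Longrightarrow> j < n \<Longrightarrow> L i j = 0" "\<And>i. i < n \<Longrightarrow> L i i = 1"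
  shows "Determinant.det (Matrix.mat n n (\<lambda>(i,j). L i j)) = 1"
proof -
  have "Determinant.det (Matrix.mat n n (\<lambda>(i,j). L i j)) = prod_list (diag_mat (Matrix.mat n n (\<lambda>(i,j). L i j)))"
    by (rule det_lower_triangular[of n]) (use assms(1) in auto)
  also have "diag_mat (Matrix.mat n n (\<lambda>(i,j). L i j)) = replicate n 1"
    by (rule nth_equalityI) (use assms(2) in \<open>auto simp: diag_mat_def\<close>)
  finally show ?thesis by simp
qed

text \<open>Substituting \<open>z + c\<close> multiplies the coefficient matrix on the right by the
  coefficients of the powers \<open>[:c, 1:] ^ k\<close>, a unipotent triangular matrix.\<close>

lemma coeff_det_shift:
  fixes P :: "nat \<Rightarrow> 'a::idom poly"
  assumes "\<And>i. i < n \<Longrightarrow> degree (P i) < n"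
  shows "coeff_det n (\<lambda>i. pcompose (P i) [:c, 1:]) = coeff_det n P"
proof -
  have "coeff_det n (\<lambda>i. pcompose (P i) [:c, 1:]) =
      coeff_det n P * Determinant.det (Matrix.mat n n (\<lambda>(k,j). coeff ([:c, 1:] ^ k) j))"
    by (rule coeff_det_col_op) (simp add: pcompose_as_sum[OF assms] coeff_sum)
  then show ?thesis
    by (simp add: det_unipotent coeff_linear_power)
qed

text \<open>The rows on the left are \<open>z ^ i\<close> times the shifted polynomial, not shifts
  of whole rows. Expanding \<open>z ^ i\<close> in powers of \<open>z + c\<close> is a row operation
  with unipotent triangular blocks; the column operation that remains is
  \<open>coeff_det_shift\<close>.\<close>

lemma sylv_shift:
  fixes F G :: "'a::idom poly"
  assumes "degree F \<le> p" "degree G \<le> q"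
  shows "sylv p q (pcompose F [:c, 1:]) (pcompose G [:c, 1:]) = sylv p q F G"
proof -
  let ?s = "\<lambda>P. pcompose P [:c, 1:]"
  define L where "L i k = (if i < q \<and> k < q then coeff ([:-c, 1:] ^ i) k
      else if \<not> i < q \<and> \<not> k < q then coeff ([:-c, 1:] ^ (i - q)) (k - q) else 0)" for i k
  have mon: "monom 1 i = (\<Sum>k<n. Polynomial.smult (coeff ([:-c, 1:] ^ i) k) ([:c, 1:] ^ k))" if "i < n" for i n
  proof -
    have "degree ([:-c, 1:] ^ i) < n"
      using that by (simp add: degree_linear_power)
    then have "(\<Sum>k<n. Polynomial.smult (coeff ([:-c, 1:] ^ i) k) ([:c, 1:] ^ k)) = ?s ([:-c, 1:] ^ i)"
      by (simp add: pcompose_as_sum)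
    also have "\<dots> = [:0, 1:] ^ i"
      by (simp add: pcompose_power pcompose_pCons)
    finally show ?thesis by (simp add: monom_altdef)
  qed
  have row: "syl_row q (?s F) (?s G) i = (\<Sum>k<p+q. Polynomial.smult (L i k) (?s (syl_row q F G k)))" if "i < p + q" for i
  proof (cases "i < q")
    case True
    have "(\<Sum>k<p+q. Polynomial.smult (L i k) (?s (syl_row q F G k))) = (\<Sum>k<q. Polynomial.smult (L i k) (?s (syl_row q F G k)))"
      using True by (intro sum.mono_neutral_right) (auto simp: L_def)
    also have "\<dots> = (\<Sum>k<q. Polynomial.smult (coeff ([:-c, 1:] ^ i) k) ([:c, 1:] ^ k)) * ?s F"
      unfolding sum_distrib_right using True
      by (intro sum.cong) (auto simp: L_def syl_row_def pcompose_mult monom_altdef pcompose_power pcompose_pCons)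
    finally show ?thesis
      using True mon[of i q] by (simp add: syl_row_def)
  next
    case False
    have "(\<Sum>k<p+q. Polynomial.smult (L i k) (?s (syl_row q F G k))) = (\<Sum>k\<in>{q..<p+q}. Polynomial.smult (L i k) (?s (syl_row q F G k)))"
      using False by (intro sum.mono_neutral_right) (auto simp: L_def)
    also have "\<dots> = (\<Sum>k<p. Polynomial.smult (L i (k + q)) (?s (syl_row q F G (k + q))))"
      using sum.shift_bounds_nat_ivl[of _ 0 q p] by (simp add: lessThan_atLeast0)
    also have "\<dots> = (\<Sum>k<p. Polynomial.smult (coeff ([:-c, 1:] ^ (i - q)) k) ([:c, 1:] ^ k)) * ?s G"
      unfolding sum_distrib_right using False
      by (intro sum.cong) (auto simp: L_def syl_row_def pcompose_mult monom_altdef pcompose_power pcompose_pCons)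
    finally show ?thesis
      using False that mon[of "i - q" p] by (simp add: syl_row_def)
  qed
  have "sylv p q (?s F) (?s G) = Determinant.det (Matrix.mat (p+q) (p+q) (\<lambda>(i,k). L i k)) *
      coeff_det (p + q) (\<lambda>i. ?s (syl_row q F G i))"
    unfolding sylv_def by (rule coeff_det_row_op) (simp add: row coeff_sum)
  also have "Determinant.det (Matrix.mat (p+q) (p+q) (\<lambda>(i,k). L i k)) = 1"
    by (rule det_unipotent) (auto simp: L_def coeff_linear_power)
  also have "coeff_det (p + q) (\<lambda>i. ?s (syl_row q F G i)) = sylv p q F G"
    unfolding sylv_def by (rule coeff_det_shift) (rule degree_syl_row[OF assms])
  finally show ?thesis by simp
qed

section \<open>Order and degree of resultants of bivariate polynomials\<close>

text \<open>The index is an integer because the exponent \<open>w j - r i\<close> expected in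
  \<open>det_low_ge\<close> and \<open>det_top_le\<close> can be negative; such an entry has to
  count as 0 in the matrix of extremal coefficients.\<close>

definition hcoef :: "int \<Rightarrow> 'a::zero poly \<Rightarrow> 'a" where
  "hcoef h p = (if h < 0 then 0 else coeff p (nat h))"

definition low_ge :: "int \<Rightarrow> 'a::zero poly \<Rightarrow> bool" where
  "low_ge h p \<longleftrightarrow> (\<forall>k. int k < h \<longrightarrow> coeff p k = 0)"

definition top_le :: "int \<Rightarrow> 'a::zero poly \<Rightarrow> bool" where
  "top_le h p \<longleftrightarrow> (\<forall>k. int k > h \<longrightarrow> coeff p k = 0)"

lemma hcoef_int [simp]: "hcoef (int k) p = coeff p k"
  by (simp add: hcoef_def)

lemma low_ge_mult:
  fixes P Q :: "'a::comm_ring_1 poly"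
  assumes "low_ge h P" "low_ge g Q"
  shows "low_ge (h + g) (P * Q)" "hcoef (h + g) (P * Q) = hcoef h P * hcoef g Q"
proof -
  have z: "coeff P i * coeff Q (k - i) = 0" if "int i < h \<or> int (k - i) < g" for i k
    using that assms by (auto simp: low_ge_def)
  show "low_ge (h + g) (P * Q)"
    unfolding low_ge_def coeff_mult
  proof (intro allI impI sum.neutral ballI)
    fix k i assume "int k < h + g" "i \<in> {..k}"
    then show "coeff P i * coeff Q (k - i) = 0"
      by (intro z) auto
  qed
  show "hcoef (h + g) (P * Q) = hcoef h P * hcoef g Q"
  proof (cases "h + g < 0")
    case True
    then show ?thesis by (auto simp: hcoef_def)
  next
    case False
    define k where "k = nat (h + g)"
    have k: "int k = h + g" using False by (simp add: k_def)
    have eq: "hcoef (h + g) (P * Q) = (\<Sum>i\<le>k. coeff P i * coeff Q (k - i))"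
      using False by (simp add: hcoef_def k_def coeff_mult)
    show ?thesis
    proof (cases "h \<ge> 0 \<and> g \<ge> 0")
      case True
      have "(\<Sum>i\<le>k. coeff P i * coeff Q (k - i)) = (\<Sum>i\<in>{nat h}. coeff P i * coeff Q (k - i))"
        by (rule sum.mono_neutral_right) (use True k in \<open>auto intro!: z\<close>)
      then show ?thesis using eq True by (simp add: hcoef_def k_def nat_add_distrib)
    next
      case False
      have "(\<Sum>i\<le>k. coeff P i * coeff Q (k - i)) = 0"
        by (intro sum.neutral ballI z) (use False k in auto)
      then show ?thesis using eq False by (auto simp: hcoef_def)
    qed
  qed
qed

lemma top_le_mult:
  fixes P Q :: "'a::comm_ring_1 poly"
  assumes "top_le h P" "top_le g Q"
  shows "top_le (h + g) (P * Q)" "hcoef (h + g) (P * Q) = hcoef h P * hcoef g Q"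
proof -
  have z: "coeff P i * coeff Q (k - i) = 0" if "int i > h \<or> int (k - i) > g" for i k
    using that assms by (auto simp: top_le_def)
  show "top_le (h + g) (P * Q)"
    unfolding top_le_def coeff_mult
  proof (intro allI impI sum.neutral ballI)
    fix k i assume "int k > h + g" "i \<in> {..k}"
    then show "coeff P i * coeff Q (k - i) = 0"
      by (intro z) auto
  qed
  have neg: "h < 0 \<Longrightarrow> P = 0" "g < 0 \<Longrightarrow> Q = 0"
    using assms by (auto simp: top_le_def poly_eq_iff)
  show "hcoef (h + g) (P * Q) = hcoef h P * hcoef g Q"
  proof (cases "h \<ge> 0 \<and> g \<ge> 0")
    case True
    define k where "k = nat (h + g)"
    have k: "int k = h + g" using True by (simp add: k_def)
    have eq: "hcoef (h + g) (P * Q) = (\<Sum>i\<le>k. coeff P i * coeff Q (k - i))"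
      using True by (simp add: hcoef_def k_def coeff_mult)
    have "(\<Sum>i\<le>k. coeff P i * coeff Q (k - i)) = (\<Sum>i\<in>{nat h}. coeff P i * coeff Q (k - i))"
      by (rule sum.mono_neutral_right) (use True k in \<open>auto intro!: z\<close>)
    then show ?thesis using eq True by (simp add: hcoef_def k_def nat_add_distrib)
  next
    case False
    then show ?thesis using neg by (auto simp: hcoef_def)
  qed
qed

lemma low_ge_prod:
  fixes P :: "'i \<Rightarrow> 'a::comm_ring_1 poly"
  assumes "finite A" "\<And>i. i \<in> A \<Longrightarrow> low_ge (h i) (P i)"
  shows "low_ge (\<Sum>i\<in>A. h i) (\<Prod>i\<in>A. P i) \<and> hcoef (\<Sum>i\<in>A. h i) (\<Prod>i\<in>A. P i) = (\<Prod>i\<in>A. hcoef (h i) (P i))"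
  using assms
proof (induction A rule: finite_induct)
  case empty
  then show ?case by (auto simp: low_ge_def hcoef_def)
next
  case (insert x F)
  then show ?case using low_ge_mult[of "h x" "P x" "sum h F" "prod P F"] by auto
qed

lemma top_le_prod:
  fixes P :: "'i \<Rightarrow> 'a::comm_ring_1 poly"
  assumes "finite A" "\<And>i. i \<in> A \<Longrightarrow> top_le (h i) (P i)"
  shows "top_le (\<Sum>i\<in>A. h i) (\<Prod>i\<in>A. P i) \<and> hcoef (\<Sum>i\<in>A. h i) (\<Prod>i\<in>A. P i) = (\<Prod>i\<in>A. hcoef (h i) (P i))"
  using assms
proof (induction A rule: finite_induct)
  case empty
  then show ?case by (auto simp: top_le_def hcoef_def)
next
  case (insert x F)
  then show ?case using top_le_mult[of "h x" "P x" "sum h F" "prod P F"] by auto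
qed

lemma hcoef_sum: "hcoef h (\<Sum>i\<in>A. P i) = (\<Sum>i\<in>A. hcoef h (P i))"
  by (simp add: hcoef_def coeff_sum)

lemma hcoef_signof: "hcoef h (signof \<pi> * (P :: 'a::comm_ring_1 poly)) = signof \<pi> * hcoef h P"
  by (auto simp: sign_def hcoef_def)

lemma low_ge_signof: "low_ge h P \<Longrightarrow> low_ge h (signof \<pi> * (P :: 'a::comm_ring_1 poly))"
  by (auto simp: sign_def low_ge_def)

lemma top_le_signof: "top_le h P \<Longrightarrow> top_le h (signof \<pi> * (P :: 'a::comm_ring_1 poly))"
  by (auto simp: sign_def top_le_def)

lemma low_ge_sum: "(\<And>i. i \<in> A \<Longrightarrow> low_ge h (P i)) \<Longrightarrow> low_ge h (sum P A)"
  by (auto simp: low_ge_def coeff_sum)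

lemma top_le_sum: "(\<And>i. i \<in> A \<Longrightarrow> top_le h (P i)) \<Longrightarrow> top_le h (sum P A)"
  by (auto simp: top_le_def coeff_sum)

lemma sum_weights_permute:
  fixes w r :: "nat \<Rightarrow> int"
  assumes "\<pi> permutes {0..<n}"
  shows "(\<Sum>i = 0..<n. w (\<pi> i) - r i) = (\<Sum>i<n. w i) - (\<Sum>i<n. r i)"
  using sum.permute[OF assms, of w] by (simp add: sum_subtractf atLeast0LessThan comp_def)

text \<open>In the Leibniz sum every permutation collects the same total weight, the sum of all
  \<open>w\<close> minus the sum of all \<open>r\<close>. So bounds on the entries add up to one
  bound, and the coefficient at that exponent is again a determinant.\<close>

lemma det_low_ge:
  fixes A :: "nat \<Rightarrow> nat \<Rightarrow> 'a::comm_ring_1 poly" and w r :: "nat \<Rightarrow> int"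
  assumes "\<And>i j. i < n \<Longrightarrow> j < n \<Longrightarrow> low_ge (w j - r i) (A i j)"
  shows "low_ge ((\<Sum>i<n. w i) - (\<Sum>i<n. r i)) (Determinant.det (Matrix.mat n n (\<lambda>(i,j). A i j)))"
    "hcoef ((\<Sum>i<n. w i) - (\<Sum>i<n. r i)) (Determinant.det (Matrix.mat n n (\<lambda>(i,j). A i j)))
      = Determinant.det (Matrix.mat n n (\<lambda>(i,j). hcoef (w j - r i) (A i j)))"
proof -
  let ?h = "(\<Sum>i<n. w i) - (\<Sum>i<n. r i)"
  have *: "low_ge ?h (\<Prod>i = 0..<n. A i (\<pi> i)) \<and>
    hcoef ?h (\<Prod>i = 0..<n. A i (\<pi> i)) = (\<Prod>i = 0..<n. hcoef (w (\<pi> i) - r i) (A i (\<pi> i)))"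
    if "\<pi> permutes {0..<n}" for \<pi>
    using low_ge_prod[of "{0..<n}" "\<lambda>i. w (\<pi> i) - r i" "\<lambda>i. A i (\<pi> i)"] assms
      permutes_in_image[OF that] sum_weights_permute[OF that, of w r] by auto
  show "low_ge ?h (Determinant.det (Matrix.mat n n (\<lambda>(i,j). A i j)))"
    unfolding leibniz using * by (intro low_ge_sum low_ge_signof) auto
  show "hcoef ?h (Determinant.det (Matrix.mat n n (\<lambda>(i,j). A i j)))
      = Determinant.det (Matrix.mat n n (\<lambda>(i,j). hcoef (w j - r i) (A i j)))"
    unfolding leibniz hcoef_sum hcoef_signof using * by (intro sum.cong) auto
qed

lemma det_top_le:
  fixes A :: "nat \<Rightarrow> nat \<Rightarrow> 'a::comm_ring_1 poly" and w r :: "nat \<Rightarrow> int"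
  assumes "\<And>i j. i < n \<Longrightarrow> j < n \<Longrightarrow> top_le (w j - r i) (A i j)"
  shows "top_le ((\<Sum>i<n. w i) - (\<Sum>i<n. r i)) (Determinant.det (Matrix.mat n n (\<lambda>(i,j). A i j)))"
    "hcoef ((\<Sum>i<n. w i) - (\<Sum>i<n. r i)) (Determinant.det (Matrix.mat n n (\<lambda>(i,j). A i j)))
      = Determinant.det (Matrix.mat n n (\<lambda>(i,j). hcoef (w j - r i) (A i j)))"
proof -
  let ?h = "(\<Sum>i<n. w i) - (\<Sum>i<n. r i)"
  have *: "top_le ?h (\<Prod>i = 0..<n. A i (\<pi> i)) \<and>
    hcoef ?h (\<Prod>i = 0..<n. A i (\<pi> i)) = (\<Prod>i = 0..<n. hcoef (w (\<pi> i) - r i) (A i (\<pi> i)))"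
    if "\<pi> permutes {0..<n}" for \<pi>
    using top_le_prod[of "{0..<n}" "\<lambda>i. w (\<pi> i) - r i" "\<lambda>i. A i (\<pi> i)"] assms
      permutes_in_image[OF that] sum_weights_permute[OF that, of w r] by auto
  show "top_le ?h (Determinant.det (Matrix.mat n n (\<lambda>(i,j). A i j)))"
    unfolding leibniz using * by (intro top_le_sum top_le_signof) auto
  show "hcoef ?h (Determinant.det (Matrix.mat n n (\<lambda>(i,j). A i j)))
      = Determinant.det (Matrix.mat n n (\<lambda>(i,j). hcoef (w j - r i) (A i j)))"
    unfolding leibniz hcoef_sum hcoef_signof using * by (intro sum.cong) auto
qed

text \<open>In a polynomial in two variables the outer variable is \<open>z\<close>, with exponent
  \<open>l\<close>, and the inner one is \<open>y\<close>, with exponent \<open>j\<close>, as in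
  \<open>bev\<close>. Resultants eliminate \<open>z\<close> and are polynomials in
  \<open>y\<close>.\<close>

definition tdeg_le :: "nat \<Rightarrow> 'a::zero poly poly \<Rightarrow> bool" where
  "tdeg_le p F \<longleftrightarrow> (\<forall>l j. p < l + j \<longrightarrow> coeff (coeff F l) j = 0)"

definition ord_ge :: "nat \<Rightarrow> 'a::zero poly poly \<Rightarrow> bool" where
  "ord_ge a F \<longleftrightarrow> (\<forall>l j. l + j < a \<longrightarrow> coeff (coeff F l) j = 0)"

text \<open>The homogeneous part of degree \<open>a\<close> of a polynomial in \<open>(y, z)\<close>, dehomogenised at \<open>y = 1\<close>.\<close>
definition hform :: "nat \<Rightarrow> 'a::comm_ring_1 poly poly \<Rightarrow> 'a poly" where
  "hform a F = (\<Sum>l\<le>a. monom (coeff (coeff F l) (a - l)) l)"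

lemma coeff_hform: "coeff (hform a F) l = (if l \<le> a then coeff (coeff F l) (a - l) else 0)"
  by (auto simp: hform_def coeff_sum)

lemma degree_hform: "degree (hform a F) \<le> a"
  by (rule degree_le) (auto simp: coeff_hform)

lemma tdeg_le_degree: "tdeg_le p F \<Longrightarrow> degree F \<le> p"
  by (rule degree_le) (auto simp: tdeg_le_def poly_eq_iff)

lemma coeff_syl_row:
  "coeff (syl_row q F G i) j =
    (if i < q then (if j < i then 0 else coeff F (j - i))
     else (if j < i - q then 0 else coeff G (j - (i - q))))"
  by (auto simp: syl_row_def coeff_monom_mult)

text \<open>Bezout's bound as a degree estimate. The coefficient at \<open>p * q\<close> is the
  resultant of the forms at infinity, so a common root of these forms lowers the degree.\<close>

lemma sylv_tdeg:
  fixes F G :: "'a::comm_ring_1 poly poly"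
  assumes "tdeg_le p F" "tdeg_le q G"
  shows "top_le (int (p * q)) (sylv p q F G)"
    and "coeff (sylv p q F G) (p * q) = sylv p q (hform p F) (hform q G)"
proof -
  let ?n = "p + q"
  \<comment> \<open>Row \<open>i\<close> is \<open>z ^ i * F\<close> of total degree
    \<open>p + i\<close>, or \<open>z ^ (i - q) * G\<close> of total degree
    \<open>q + (i - q) = i\<close>, and column \<open>j\<close> takes \<open>z ^ j\<close> away. The
    signs make \<open>w j - r i\<close> the degree in \<open>y\<close> that is left.\<close>
  define r where "r i = - int (if i < q then p + i else i)" for i :: nat
  define w where "w j = - int j" for j :: nat
  have "(\<Sum>i<?n. r i) = (\<Sum>i<?n. - int i - (if i < q then int p else 0))"
    by (intro sum.cong) (auto simp: r_def)
  also have "\<dots> = (\<Sum>i<?n. w i) - (\<Sum>i<?n. if i < q then int p else 0)"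
    by (simp add: w_def sum_subtractf)
  also have "(\<Sum>i<?n. if i < q then int p else 0) = (\<Sum>i\<in>{..<?n} \<inter> {i. i < q}. int p)"
    by (simp add: sum.If_cases)
  also have "{..<?n} \<inter> {i. i < q} = {..<q}" by auto
  finally have tot: "(\<Sum>i<?n. w i) - (\<Sum>i<?n. r i) = int (p * q)"
    by (simp add: mult.commute)
  have top: "top_le (w j - r i) (coeff (syl_row q F G i) j)" if "i < ?n" "j < ?n" for i j
    using that assms
    by (auto simp: coeff_syl_row top_le_def tdeg_le_def w_def r_def)
  have hc: "hcoef (w j - r i) (coeff (syl_row q F G i) j) = coeff (syl_row q (hform p F) (hform q G) i) j"
    if "i < ?n" "j < ?n" for i j
  proof (cases "i < q")
    case True
    then show ?thesis
      by (auto simp: coeff_syl_row hcoef_def coeff_hform w_def r_def intro!: arg_cong[where f = "coeff _"])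
  next
    case False
    then have "nat (int i - int j) = q - (j - (i - q))" if "j \<le> i" "i - q \<le> j"
      using that by linarith
    then show ?thesis using False
      by (auto simp: coeff_syl_row hcoef_def coeff_hform w_def r_def)
  qed
  show "top_le (int (p * q)) (sylv p q F G)"
    using det_top_le(1)[of ?n w r "\<lambda>i j. coeff (syl_row q F G i) j", OF top] tot
    by (simp add: sylv_def coeff_det_def)
  have "coeff (sylv p q F G) (p * q) = hcoef (int (p * q)) (sylv p q F G)"
    by (simp only: hcoef_int)
  also have "\<dots> = Determinant.det (Matrix.mat ?n ?n (\<lambda>(i,j). hcoef (w j - r i) (coeff (syl_row q F G i) j)))"
    using det_top_le(2)[of ?n w r "\<lambda>i j. coeff (syl_row q F G i) j", OF top] tot
    by (simp add: sylv_def coeff_det_def)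
  also have "\<dots> = sylv p q (hform p F) (hform q G)"
    unfolding sylv_def coeff_det_def using hc by (intro arg_cong[where f = Determinant.det] cong_mat) auto
  finally show "coeff (sylv p q F G) (p * q) = sylv p q (hform p F) (hform q G)" .
qed

lemma sum_trunc: "s \<le> n \<Longrightarrow> (\<Sum>j<n. s - 1 - j) = (\<Sum>j<s. j::nat)"
proof -
  assume "s \<le> n"
  then have "(\<Sum>j<n. s - 1 - j) = (\<Sum>j<s. s - 1 - j)"
    by (intro sum.mono_neutral_right) auto
  also have "\<dots> = (\<Sum>j<s. j)"
    using sum.nat_diff_reindex[of "\<lambda>j. j" s] by simp
  finally show ?thesis .
qed

lemma sum_lessThan_add: "(\<Sum>j<a+b. j) = (\<Sum>j<a. j) + (\<Sum>j<b. j) + a * (b::nat)"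
  by (induction b) auto

lemma sum_split: "(\<Sum>i<p+q. f i) = (\<Sum>i<q. f i) + (\<Sum>i<p. f (i + q))" for f :: "nat \<Rightarrow> 'a::comm_monoid_add"
proof -
  have "(\<Sum>i<p+q. f i) = (\<Sum>i\<in>{0..<q}. f i) + (\<Sum>i\<in>{q..<p+q}. f i)"
    by (simp add: lessThan_atLeast0 sum.atLeastLessThan_concat)
  then show ?thesis
    using sum.shift_bounds_nat_ivl[of f 0 q p] by (simp add: lessThan_atLeast0)
qed

text \<open>A common zero of multiplicities \<open>a\<close> and \<open>b\<close> contributes at least \<open>a b\<close> to the order of the
  resultant, and more if the tangent cones share a line.\<close>
lemma sylv_ord:
  fixes F G :: "'a::field poly poly"
  assumes "ord_ge a F" "ord_ge b G" "a \<le> p" "b \<le> q"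
  shows "low_ge (int (a * b)) (sylv p q F G)"
    and "a + b > 0 \<Longrightarrow> poly (hform a F) z = 0 \<Longrightarrow> poly (hform b G) z = 0 \<Longrightarrow>
      low_ge (int (a * b + 1)) (sylv p q F G)"
proof -
  let ?n = "p + q"
  \<comment> \<open>The subtraction is truncated on purpose. In rows with \<open>i < b\<close> or
    \<open>i - q < a\<close> and columns with \<open>j < a + b\<close> the difference
    \<open>w j - r i\<close> is the order forced on the entry. Elsewhere a row or a column has
    weight 0 and the claimed order is weaker or trivial, and the totals differ by exactly
    \<open>a * b\<close>.\<close>
  define r where "r i = int (if i < q then b - 1 - i else a - 1 - (i - q))" for i :: nat
  define w where "w j = int (a + b - 1 - j)" for j :: nat
  have "(\<Sum>i<?n. r i) = int ((\<Sum>i<q. b - 1 - i) + (\<Sum>i<p. a - 1 - i))"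
    unfolding sum_split by (simp add: r_def)
  also have "\<dots> = int ((\<Sum>i<b. i) + (\<Sum>i<a. i))"
    using assms by (simp only: sum_trunc)
  finally have sr: "(\<Sum>i<?n. r i) = int ((\<Sum>i<b. i) + (\<Sum>i<a. i))" .
  have "(\<Sum>i<?n. w i) = int (\<Sum>j<?n. a + b - 1 - j)"
    by (simp add: w_def)
  also have "\<dots> = int (\<Sum>j<a+b. j)"
    using assms by (subst sum_trunc) auto
  finally have tot: "(\<Sum>i<?n. w i) - (\<Sum>i<?n. r i) = int (a * b)"
    using sr unfolding sum_lessThan_add by simp
  have low: "low_ge (w j - r i) (coeff (syl_row q F G i) j)" if "i < ?n" "j < ?n" for i j
    using that assms
    by (auto simp: coeff_syl_row low_ge_def ord_ge_def w_def r_def)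
  show *: "low_ge (int (a * b)) (sylv p q F G)"
    using det_low_ge(1)[of ?n w r "\<lambda>i j. coeff (syl_row q F G i) j", OF low] tot
    by (simp add: sylv_def coeff_det_def)
  assume ab: "a + b > 0" and z: "poly (hform a F) z = 0" "poly (hform b G) z = 0"
  have van: "coeff (coeff F l) j = 0" if "l + j < a" for l j
    using assms(1) that by (auto simp: ord_ge_def)
  have van': "coeff (coeff G l) j = 0" if "l + j < b" for l j
    using assms(2) that by (auto simp: ord_ge_def)
  let ?C = "\<lambda>i j. hcoef (w j - r i) (coeff (syl_row q F G i) j)"
  \<comment> \<open>On the first \<open>a + b\<close> columns, the rows with \<open>i < b\<close>
    and \<open>i - q < a\<close> of the initial matrix form the Sylvester matrix of the tangent
    cones, and all other rows vanish. A common root of the cones thus gives a kernel vector,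
    extended by 0.\<close>
  have "Determinant.det (Matrix.mat ?n ?n (\<lambda>(i,j). ?C i j)) = 0"
  proof (rule det_eq_0_kernel[where k = 0 and x = "\<lambda>j. if j < a + b then z ^ j else 0"])
    fix i assume i: "i < ?n"
    have "(\<Sum>j<?n. ?C i j * (if j < a + b then z ^ j else 0)) = (\<Sum>j<a+b. ?C i j * z ^ j)"
      using assms by (intro sum.mono_neutral_cong_right) auto
    also have "\<dots> = 0"
    proof (cases "i < q")
      case iq: True
      show ?thesis
      proof (cases "i < b")
        case True
        have "(\<Sum>j<a+b. ?C i j * z ^ j) = (\<Sum>j<a+b. coeff (monom 1 i * hform a F) j * z ^ j)"
        proof (intro sum.cong refl)
          fix j assume "j \<in> {..<a+b}"
          then have wr: "w j - r i = int a + int i - int j"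
            using True iq by (auto simp: w_def r_def)
          show "?C i j * z ^ j = coeff (monom 1 i * hform a F) j * z ^ j"
            using iq unfolding wr
            by (auto simp: coeff_syl_row coeff_monom_mult hcoef_def coeff_hform nat_diff_distrib'
                intro!: arg_cong[where f = "coeff _"])
        qed
        also have "\<dots> = poly (monom 1 i * hform a F) z"
          by (intro poly_sum_coeff_less degree_monom_mult_less degree_hform True)
        finally show ?thesis using z by simp
      next
        case False
        have "?C i j = 0" if "j < a + b" for j
          using that False iq
          by (auto simp: hcoef_def coeff_syl_row w_def r_def intro!: van)
        then show ?thesis by simp
      qed
    next
      case iq: False
      show ?thesis
      proof (cases "i - q < a")
        case True
        have "(\<Sum>j<a+b. ?C i j * z ^ j) = (\<Sum>j<a+b. coeff (monom 1 (i - q) * hform b G) j * z ^ j)"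
        proof (intro sum.cong refl)
          fix j assume "j \<in> {..<a+b}"
          then have wr: "w j - r i = int b + int (i - q) - int j"
            using True iq by (auto simp: w_def r_def)
          show "?C i j * z ^ j = coeff (monom 1 (i - q) * hform b G) j * z ^ j"
            using iq unfolding wr
            by (auto simp: coeff_syl_row coeff_monom_mult hcoef_def coeff_hform nat_diff_distrib'
                intro!: arg_cong[where f = "coeff _"])
        qed
        also have "\<dots> = poly (monom 1 (i - q) * hform b G) z"
          unfolding add.commute[of a b]
          by (intro poly_sum_coeff_less degree_monom_mult_less degree_hform True)
        finally show ?thesis using z by simp
      next
        case False
        have "?C i j = 0" if "j < a + b" for j
          using that False iq
          by (auto simp: hcoef_def coeff_syl_row w_def r_def intro!: van')
        then show ?thesis by simp
      qed
    qed
    finally show "(\<Sum>j<?n. ?C i j * (if j < a + b then z ^ j else 0)) = 0" .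
  qed (use ab assms in auto)
  then have "hcoef (int (a * b)) (sylv p q F G) = 0"
    using det_low_ge(2)[of ?n w r "\<lambda>i j. coeff (syl_row q F G i) j", OF low] tot
    by (simp add: sylv_def coeff_det_def)
  then have "coeff (sylv p q F G) (a * b) = 0" by (simp only: hcoef_int)
  then show "low_ge (int (a * b + 1)) (sylv p q F G)"
    using * unfolding low_ge_def
    by (metis int_ops(4) less_le_not_le linorder_neqE_nat nat_int_comparison(2) of_nat_add of_nat_less_iff Suc_eq_plus1 less_Suc_eq)
qed

subsection \<open>Bivariate polynomials\<close>

lemma coeff2_mult:
  "coeff (coeff (F * G) l) j = (\<Sum>i\<le>l. \<Sum>k\<le>j. coeff (coeff F i) k * coeff (coeff G (l - i)) (j - k))"
  for F G :: "'a::comm_ring_1 poly poly"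
  by (simp add: coeff_mult coeff_sum)

text \<open>Shared by top forms and initial forms: in both cases only the products with
  \<open>i + k = p\<close> survive in degree \<open>p + q\<close>.\<close>

lemma hform_mult_aux:
  fixes F G :: "'a::comm_ring_1 poly poly"
  assumes van: "\<And>i k l. i \<le> l \<Longrightarrow> l \<le> p + q \<Longrightarrow> k \<le> p + q - l \<Longrightarrow> i + k \<noteq> p \<Longrightarrow>
    coeff (coeff F i) k * coeff (coeff G (l - i)) (p + q - l - k) = 0"
  shows "hform (p + q) (F * G) = hform p F * hform q G"
proof (rule poly_eqI)
  fix l
  show "coeff (hform (p + q) (F * G)) l = coeff (hform p F * hform q G) l"
  proof (cases "l \<le> p + q")
    case False
    have "degree (hform p F * hform q G) \<le> p + q"
      using degree_mult_le[of "hform p F" "hform q G"] degree_hform[of p F] degree_hform[of q G] by linarith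
    then show ?thesis using False by (simp add: coeff_hform coeff_eq_0)
  next
    case True
    have "(\<Sum>k\<le>p + q - l. coeff (coeff F i) k * coeff (coeff G (l - i)) (p + q - l - k))
        = coeff (hform p F) i * coeff (hform q G) (l - i)" if "i \<le> l" for i
    proof (cases "i \<le> p \<and> l - i \<le> q")
      case ipq: True
      then have "p - i \<le> p + q - l" using that True by linarith
      have "(\<Sum>k\<le>p + q - l. coeff (coeff F i) k * coeff (coeff G (l - i)) (p + q - l - k))
          = (\<Sum>k\<in>{p - i}. coeff (coeff F i) k * coeff (coeff G (l - i)) (p + q - l - k))"
      proof (rule sum.mono_neutral_right)
        show "\<forall>k\<in>{..p + q - l} - {p - i}. coeff (coeff F i) k * coeff (coeff G (l - i)) (p + q - l - k) = 0"
        proof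
          fix k assume "k \<in> {..p + q - l} - {p - i}"
          then have "k \<le> p + q - l" "i + k \<noteq> p"
            using ipq by auto
          then show "coeff (coeff F i) k * coeff (coeff G (l - i)) (p + q - l - k) = 0"
            using that True by (intro van)
        qed
        show "{p - i} \<subseteq> {..p + q - l}"
          using \<open>p - i \<le> p + q - l\<close> by simp
      qed simp
      also have "\<dots> = coeff (coeff F i) (p - i) * coeff (coeff G (l - i)) (p + q - l - (p - i))"
        by simp
      also have "p + q - l - (p - i) = q - (l - i)"
        using that True ipq by linarith
      also have "coeff (coeff F i) (p - i) * coeff (coeff G (l - i)) (q - (l - i))
          = coeff (hform p F) i * coeff (hform q G) (l - i)"
        unfolding coeff_hform using ipq by simp
      finally show ?thesis .
    next
      case False
      have "(\<Sum>k\<le>p + q - l. coeff (coeff F i) k * coeff (coeff G (l - i)) (p + q - l - k)) = 0"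
        by (intro sum.neutral ballI van) (use False that True in auto)
      then show ?thesis using False by (auto simp: coeff_hform)
    qed
    note inner = this
    have "coeff (hform (p + q) (F * G)) l =
        (\<Sum>i\<le>l. \<Sum>k\<le>p + q - l. coeff (coeff F i) k * coeff (coeff G (l - i)) (p + q - l - k))"
      using True by (simp only: coeff_hform if_True coeff2_mult)
    also have "\<dots> = coeff (hform p F * hform q G) l"
      unfolding coeff_mult by (intro sum.cong refl inner) simp
    finally show ?thesis .
  qed
qed

lemma hform_mult_tdeg:
  fixes F G :: "'a::comm_ring_1 poly poly"
  assumes "tdeg_le p F" "tdeg_le q G"
  shows "hform (p + q) (F * G) = hform p F * hform q G"
proof (rule hform_mult_aux)
  fix i k l assume "i \<le> l" "l \<le> p + q" "k \<le> p + q - l" "i + k \<noteq> p"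
  then have "p < i + k \<or> q < (l - i) + (p + q - l - k)" by linarith
  then show "coeff (coeff F i) k * coeff (coeff G (l - i)) (p + q - l - k) = 0"
    using assms by (auto simp: tdeg_le_def)
qed

lemma hform_mult_ord:
  fixes F G :: "'a::comm_ring_1 poly poly"
  assumes "ord_ge p F" "ord_ge q G"
  shows "hform (p + q) (F * G) = hform p F * hform q G"
proof (rule hform_mult_aux)
  fix i k l assume "i \<le> l" "l \<le> p + q" "k \<le> p + q - l" "i + k \<noteq> p"
  then have "i + k < p \<or> (l - i) + (p + q - l - k) < q" by linarith
  then show "coeff (coeff F i) k * coeff (coeff G (l - i)) (p + q - l - k) = 0"
    using assms by (auto simp: ord_ge_def)
qed

lemma tdeg_le_mult:
  fixes F G :: "'a::comm_ring_1 poly poly"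
  assumes "tdeg_le p F" "tdeg_le q G"
  shows "tdeg_le (p + q) (F * G)"
  unfolding tdeg_le_def coeff2_mult
proof (intro allI impI sum.neutral ballI)
  fix l j i k assume "p + q < l + j" "i \<in> {..l}" "k \<in> {..j}"
  then have "p < i + k \<or> q < (l - i) + (j - k)" by auto
  then show "coeff (coeff F i) k * coeff (coeff G (l - i)) (j - k) = 0"
    using assms by (auto simp: tdeg_le_def)
qed

lemma ord_ge_mult:
  fixes F G :: "'a::comm_ring_1 poly poly"
  assumes "ord_ge p F" "ord_ge q G"
  shows "ord_ge (p + q) (F * G)"
  unfolding ord_ge_def coeff2_mult
proof (intro allI impI sum.neutral ballI)
  fix l j i k assume "l + j < p + q" "i \<in> {..l}" "k \<in> {..j}"
  then have "i + k < p \<or> (l - i) + (j - k) < q" by auto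
  then show "coeff (coeff F i) k * coeff (coeff G (l - i)) (j - k) = 0"
    using assms by (auto simp: ord_ge_def)
qed

lemma tdeg_le_sum: "(\<And>i. i \<in> A \<Longrightarrow> tdeg_le p (F i)) \<Longrightarrow> tdeg_le p (\<Sum>i\<in>A. F i)"
  by (auto simp: tdeg_le_def coeff_sum)

lemma ord_ge_sum: "(\<And>i. i \<in> A \<Longrightarrow> ord_ge p (F i)) \<Longrightarrow> ord_ge p (\<Sum>i\<in>A. F i)"
  by (auto simp: ord_ge_def coeff_sum)

lemma tdeg_le_add: "tdeg_le p F \<Longrightarrow> tdeg_le p G \<Longrightarrow> tdeg_le p (F + G)"
  by (auto simp: tdeg_le_def)

lemma ord_ge_add: "ord_ge p F \<Longrightarrow> ord_ge p G \<Longrightarrow> ord_ge p (F + G)"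
  by (auto simp: ord_ge_def)

lemma hform_add: "hform p (F + G) = hform p F + hform p G"
  by (rule poly_eqI) (simp add: coeff_hform)

lemma hform_sum: "hform p (\<Sum>i\<in>A. F i) = (\<Sum>i\<in>A. hform p (F i))"
  by (rule poly_eqI) (simp add: coeff_hform coeff_sum)

lemma tdeg_le_mono: "tdeg_le p F \<Longrightarrow> p \<le> q \<Longrightarrow> tdeg_le q F"
  by (auto simp: tdeg_le_def)

lemma ord_ge_mono: "ord_ge q F \<Longrightarrow> p \<le> q \<Longrightarrow> ord_ge p F"
  by (auto simp: ord_ge_def)

lemma ord_ge_0: "ord_ge 0 F"
  by (auto simp: ord_ge_def)

lemma hform_tdeg_less: "tdeg_le p F \<Longrightarrow> p < q \<Longrightarrow> hform q F = 0"
  by (rule poly_eqI) (auto simp: coeff_hform tdeg_le_def)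

lemma hform_ord_greater: "ord_ge q F \<Longrightarrow> p < q \<Longrightarrow> hform p F = 0"
  by (rule poly_eqI) (auto simp: coeff_hform ord_ge_def)

lemma coeff2_1: "coeff (coeff (1 :: 'a::comm_ring_1 poly poly) l) j = (if l = 0 \<and> j = 0 then 1 else 0)"
  by (cases l; cases j) auto

lemma tdeg_le_1: "tdeg_le 0 (1 :: 'a::comm_ring_1 poly poly)"
  by (auto simp: tdeg_le_def coeff2_1)

lemma hform_1: "hform 0 (1 :: 'a::comm_ring_1 poly poly) = 1"
  by (simp add: hform_def coeff2_1)

lemma tdeg_le_prod:
  fixes F :: "'i \<Rightarrow> 'a::comm_ring_1 poly poly"
  assumes "finite A" "\<And>i. i \<in> A \<Longrightarrow> tdeg_le (p i) (F i)"
  shows "tdeg_le (\<Sum>i\<in>A. p i) (\<Prod>i\<in>A. F i)" "hform (\<Sum>i\<in>A. p i) (\<Prod>i\<in>A. F i) = (\<Prod>i\<in>A. hform (p i) (F i))"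
  using assms by (induction A rule: finite_induct)
    (auto simp: tdeg_le_1 hform_1 tdeg_le_mult hform_mult_tdeg)

lemma tdeg_le_power:
  fixes F :: "'a::comm_ring_1 poly poly"
  assumes "tdeg_le p F"
  shows "tdeg_le (k * p) (F ^ k)" "hform (k * p) (F ^ k) = hform p F ^ k"
  using assms by (induction k) (auto simp: tdeg_le_1 hform_1 tdeg_le_mult hform_mult_tdeg)

lemma ord_ge_power:
  fixes F :: "'a::comm_ring_1 poly poly"
  assumes "ord_ge p F"
  shows "ord_ge (k * p) (F ^ k)"
  using assms by (induction k) (auto simp: ord_ge_0 ord_ge_mult)

section \<open>Evaluation and translation of polynomials in two variables\<close>

definition bev :: "'a::comm_ring_1 poly poly \<Rightarrow> 'a \<Rightarrow> 'a \<Rightarrow> 'a" where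
  "bev F y z = poly (poly F [:z:]) y"

definition blin :: "'a \<Rightarrow> 'a \<Rightarrow> 'a \<Rightarrow> 'a::comm_ring_1 poly poly" where
  "blin c a b = [:[:c, a:], [:b:]:]"

lemma bev_simps [simp]:
  "bev (F + G) y z = bev F y z + bev G y z" "bev (F * G) y z = bev F y z * bev G y z"
  "bev (F ^ k) y z = bev F y z ^ k" "bev (sum H A) y z = (\<Sum>i\<in>A. bev (H i) y z)"
  "bev (prod H A) y z = (\<Prod>i\<in>A. bev (H i) y z)" "bev (blin c a b) y z = c + a * y + b * z"
  by (simp_all add: bev_def blin_def poly_sum poly_prod algebra_simps)

lemma bev_conv: "bev F y z = poly (map_poly (\<lambda>c. poly c y) F) z"
proof -
  have "bev F y z = poly (map_poly (\<lambda>c. poly c y) F) (poly [:z:] y)"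
    unfolding bev_def by (rule poly_hom.poly_map_poly[symmetric])
  then show ?thesis by simp
qed

lemma tdeg_le_blin: "tdeg_le 1 (blin c a b)"
  by (auto simp: tdeg_le_def blin_def coeff_pCons split: nat.splits)

lemma hform_blin: "hform 1 (blin c a b) = [:a, b:]"
  by (rule poly_eqI) (auto simp: coeff_hform blin_def coeff_pCons split: nat.splits)

lemma tdeg_le_blin0: "tdeg_le 0 (blin c 0 0)"
  by (auto simp: tdeg_le_def blin_def coeff_pCons split: nat.splits)

lemma hform_blin0: "hform 0 (blin c 0 0) = [:c:]"
  by (rule poly_eqI) (auto simp: coeff_hform blin_def coeff_pCons split: nat.splits)

lemma ord_ge_blin: "ord_ge 1 (blin 0 a b)"
  by (auto simp: ord_ge_def blin_def)

lemma sylv_hom: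
  assumes "comm_ring_hom h"
  shows "h (sylv p q F G) = sylv p q (map_poly h F) (map_poly h G)"
proof -
  interpret comm_ring_hom h by fact
  have "h (coeff (syl_row q F G i) j) = coeff (syl_row q (map_poly h F) (map_poly h G) i) j" for i j
    by (cases "i < q"; cases "j < i"; cases "j < i - q") (simp_all add: coeff_syl_row coeff_map_poly[of h, OF hom_zero])
  then show ?thesis
    unfolding sylv_def coeff_det_leibniz by (simp only: hom_sum hom_mult hom_prod hom_signof)
qed

text \<open>The translation that moves the point \<open>(y, z)\<close> to the origin, so that
  \<open>ord_ge\<close> measures the multiplicity at this point.\<close>

definition bshift :: "'a \<Rightarrow> 'a \<Rightarrow> 'a::comm_ring_1 poly poly \<Rightarrow> 'a poly poly" where
  "bshift y z F = pcompose (map_poly (\<lambda>c. pcompose c [:y, 1:]) F) [:[:z:], 1:]"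

lemma bshift_simps:
  fixes F G :: "'a::comm_ring_1 poly poly"
  shows "bshift y z (F + G) = bshift y z F + bshift y z G"
    "bshift y z (F * G) = bshift y z F * bshift y z G"
    "bshift y z (F ^ k) = bshift y z F ^ k"
    "bshift y z (sum H A) = (\<Sum>i\<in>A. bshift y z (H i))"
    "bshift y z (prod H A) = (\<Prod>i\<in>A. bshift y z (H i))"
    "bshift y z (blin c a b) = blin (c + a * y + b * z) a b"
proof -
  interpret h: map_poly_comm_ring_hom "\<lambda>c::'a poly. pcompose c [:y, 1:]" ..
  show "bshift y z (F + G) = bshift y z F + bshift y z G"
    "bshift y z (F * G) = bshift y z F * bshift y z G"
    "bshift y z (F ^ k) = bshift y z F ^ k"
    "bshift y z (sum H A) = (\<Sum>i\<in>A. bshift y z (H i))"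
    "bshift y z (prod H A) = (\<Prod>i\<in>A. bshift y z (H i))"
    by (simp_all add: bshift_def h.hom_add h.hom_mult h.hom_power h.hom_sum h.hom_prod
        pcompose_add pcompose_mult pcompose_power pcompose_sum pcompose_prod)
  show "bshift y z (blin c a b) = blin (c + a * y + b * z) a b"
  proof -
    have "map_poly (\<lambda>c. pcompose c [:y, 1:]) (blin c a b) = [:[:c + a * y, a:], [:b:]:]"
      by (simp add: blin_def Polynomial.map_poly_pCons pcompose_pCons)
    then show ?thesis
      by (simp add: bshift_def blin_def pcompose_pCons algebra_simps)
  qed
qed

text \<open>Translating the eliminated variable does not change the resultant, by
  \<open>sylv_shift\<close>; translating the other one is a ring homomorphism of the
  coefficients.\<close>

lemma sylv_bshift:
  fixes F G :: "'a::idom poly poly"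
  assumes "tdeg_le p F" "tdeg_le q G"
  shows "pcompose (sylv p q F G) [:y, 1:] = sylv p q (bshift y z F) (bshift y z G)"
proof -
  let ?m = "map_poly (\<lambda>c. pcompose c [:y, 1:])"
  have "degree (?m F) \<le> p" "degree (?m G) \<le> q"
    using degree_map_poly_le[of _ F] degree_map_poly_le[of _ G] assms[THEN tdeg_le_degree]
    by (meson order_trans)+
  then have "sylv p q (bshift y z F) (bshift y z G) = sylv p q (?m F) (?m G)"
    unfolding bshift_def by (rule sylv_shift)
  also have "\<dots> = pcompose (sylv p q F G) [:y, 1:]"
    by (rule sylv_hom[symmetric]) (rule pcompose_hom.comm_ring_hom_axioms)
  finally show ?thesis ..
qed

lemma low_ge_imp_dvd:
  fixes R :: "complex poly"
  assumes "low_ge (int m) (pcompose R [:a, 1:])"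
  shows "[:-a, 1:] ^ m dvd R"
proof -
  have "monom 1 m dvd pcompose R [:a, 1:]"
    using assms unfolding monom_1_dvd_iff' low_ge_def by auto
  then obtain K where K: "pcompose R [:a, 1:] = monom 1 m * K" by (rule dvdE)
  have "R = pcompose (pcompose R [:a, 1:]) [:-a, 1:]"
    by (simp add: pcompose_assoc[symmetric] pcompose_pCons)
  also have "\<dots> = [:-a, 1:] ^ m * pcompose K [:-a, 1:]"
    unfolding K pcompose_mult monom_altdef by (simp add: pcompose_power pcompose_pCons)
  finally show ?thesis by simp
qed

lemma prod_linear_powers_dvd:
  fixes R :: "complex poly"
  assumes "finite A" "inj_on a A" "\<And>s. s \<in> A \<Longrightarrow> [:-a s, 1:] ^ m s dvd R"
  shows "(\<Prod>s\<in>A. [:-a s, 1:] ^ m s) dvd R"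
  using assms
proof (induction A rule: finite_induct)
  case (insert s A)
  let ?P = "\<Prod>s\<in>A. [:-a s, 1:] ^ m s"
  obtain K where K: "R = ?P * K"
    using insert by (auto elim: dvdE)
  have "poly ?P (a s) \<noteq> 0"
    using insert by (auto simp: poly_prod poly_power)
  then have "[:-a s, 1:] ^ m s dvd K"
    by (intro dvd_cancel_no_common_root[of _ K ?P]) (use insert.prems(2)[of s] K in \<open>auto simp: mult.commute poly_power\<close>)
  then show ?case
    using insert K by (simp add: mult_dvd_mono mult.commute)
qed auto

subsection \<open>Common zeros of two plane curves\<close>

lemma tdeg_le_lead:
  assumes "tdeg_le p F"
  shows "poly (coeff F p) y = coeff (coeff F p) (0::nat)"
proof -
  have "degree (coeff F p) = 0"
    using assms by (intro le_antisym degree_le) (auto simp: tdeg_le_def)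
  then obtain c where "coeff F p = [:c:]" by (rule degree_eq_zeroE)
  then show ?thesis by simp
qed

text \<open>For total degree at most \<open>p\<close> the coefficient of \<open>z ^ p\<close> is
  constant in \<open>y\<close>. If it is nonzero, no value of \<open>y\<close> lowers the degree in
  \<open>z\<close>, and so no zero over any \<open>y\<close> is lost at infinity.\<close>

lemma degree_map_eval:
  fixes F :: "complex poly poly"
  assumes "tdeg_le p F" "coeff (coeff F p) 0 \<noteq> 0"
  shows "degree (map_poly (\<lambda>c. poly c y) F) = p" "map_poly (\<lambda>c. poly c y) F \<noteq> 0"
proof -
  have 1: "degree (map_poly (\<lambda>c. poly c y) F) \<le> p"
    using degree_map_poly_le[of "\<lambda>c. poly c y" F] tdeg_le_degree[OF assms(1)] by linarith
  have 2: "coeff (map_poly (\<lambda>c. poly c y) F) p \<noteq> 0"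
    using assms tdeg_le_lead[OF assms(1), of y] by (simp add: coeff_map_poly)
  show "degree (map_poly (\<lambda>c. poly c y) F) = p"
    using 1 2 le_degree by (metis le_antisym)
  show "map_poly (\<lambda>c. poly c y) F \<noteq> 0"
    using 2 by (metis coeff_0)
qed

lemma poly_sylv: "poly (sylv p q F G) y = sylv p q (map_poly (\<lambda>c. poly c y) F) (map_poly (\<lambda>c. poly c y) G)"
  by (rule sylv_hom) (rule poly_hom.comm_ring_hom_axioms)

lemma sylv_zero_iff:
  fixes F G :: "complex poly poly"
  assumes "tdeg_le p F" "tdeg_le q G" "coeff (coeff F p) 0 \<noteq> 0" "p > 0"
  shows "poly (sylv p q F G) y = 0 \<longleftrightarrow> (\<exists>z. bev F y z = 0 \<and> bev G y z = 0)"
proof -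
  let ?m = "map_poly (\<lambda>c. poly c y)"
  have dG: "degree (?m G) \<le> q"
    using degree_map_poly_le[of "\<lambda>c. poly c y" G] tdeg_le_degree[OF assms(2)] by linarith
  note dF = degree_map_eval[OF assms(1,3), of y]
  show ?thesis
  proof
    assume "poly (sylv p q F G) y = 0"
    then obtain z where "poly (?m F) z = 0" "poly (?m G) z = 0"
      using sylv_eq_0_imp_common_root[of p q "?m F" "?m G"] dF dG by (auto simp: poly_sylv)
    then show "\<exists>z. bev F y z = 0 \<and> bev G y z = 0"
      by (auto simp: bev_conv)
  next
    assume "\<exists>z. bev F y z = 0 \<and> bev G y z = 0"
    then obtain z where "poly (?m F) z = 0" "poly (?m G) z = 0"
      by (auto simp: bev_conv)
    then show "poly (sylv p q F G) y = 0"
      unfolding poly_sylv using dF dG assms(4) by (intro sylv_common_root) auto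
  qed
qed

lemma finite_zeros_iff_sylv:
  fixes F G :: "complex poly poly"
  assumes "tdeg_le p F" "tdeg_le q G" "coeff (coeff F p) 0 \<noteq> 0" "p > 0"
  shows "finite {(y, z). bev F y z = 0 \<and> bev G y z = 0} \<longleftrightarrow> sylv p q F G \<noteq> 0"
proof
  assume R: "sylv p q F G \<noteq> 0"
  have "{(y, z). bev F y z = 0 \<and> bev G y z = 0} \<subseteq>
     (\<Union>y\<in>{y. poly (sylv p q F G) y = 0}. Pair y ` {z. poly (map_poly (\<lambda>c. poly c y) F) z = 0})"
    using sylv_zero_iff[OF assms] by (auto simp: bev_conv)
  moreover have "finite \<dots>"
    using R degree_map_eval(2)[OF assms(1,3)] by (intro finite_UN_I finite_imageI poly_roots_finite) auto
  ultimately show "finite {(y, z). bev F y z = 0 \<and> bev G y z = 0}"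
    by (rule finite_subset)
next
  assume fin: "finite {(y, z). bev F y z = 0 \<and> bev G y z = 0}"
  show "sylv p q F G \<noteq> 0"
  proof
    assume "sylv p q F G = 0"
    then have "\<exists>z. bev F y z = 0 \<and> bev G y z = 0" for y
      using sylv_zero_iff[OF assms, of y] by simp
    then have "y \<in> fst ` {(y, z). bev F y z = 0 \<and> bev G y z = 0}" for y
      by (auto simp: image_iff)
    then have "finite (UNIV :: complex set)"
      using finite_subset[OF _ finite_imageI[OF fin, of fst]] by blast
    then show False
      using infinite_UNIV_char_0 by blast
  qed
qed

text \<open>A common point at infinity annihilates the coefficient at \<open>p * q\<close>.\<close>

lemma degree_sylv_less:
  fixes F G :: "complex poly poly"
  assumes "tdeg_le p F" "tdeg_le q G" "p > 0" "q > 0"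
    and "poly (hform p F) z = 0" "poly (hform q G) z = 0"
  shows "degree (sylv p q F G) < p * q"
proof -
  have "coeff (sylv p q F G) (p * q) = 0"
    unfolding sylv_tdeg(2)[OF assms(1,2)] using assms degree_hform by (intro sylv_common_root) auto
  moreover have "coeff (sylv p q F G) k = 0" if "k > p * q" for k
    using sylv_tdeg(1)[OF assms(1,2)] that unfolding top_le_def by (metis of_nat_less_iff)
  ultimately have "coeff (sylv p q F G) k = 0" if "k \<ge> p * q" for k
    using that by (cases "k = p * q") auto
  then have "degree (sylv p q F G) \<le> p * q - 1"
    by (intro degree_le) simp
  then show ?thesis
    using assms(3,4) mult_pos_pos[of p q] by linarith
qed

lemma sylv_dvd_triple:
  fixes F G :: "complex poly poly"
  assumes "tdeg_le p F" "tdeg_le q G" "p \<ge> 3" "q \<ge> 3"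
    and "ord_ge 3 (bshift y z F)" "ord_ge 3 (bshift y z G)"
  shows "[:-y, 1:] ^ 9 dvd sylv p q F G"
  using sylv_ord(1)[OF assms(5,6,3,4)] sylv_bshift[OF assms(1,2), of y z]
  by (intro low_ge_imp_dvd) simp

lemma sylv_dvd_double:
  fixes F G :: "complex poly poly"
  assumes "tdeg_le p F" "tdeg_le q G" "p \<ge> 2" "q \<ge> 2"
    and "ord_ge 2 (bshift y z F)" "ord_ge 2 (bshift y z G)"
    and "poly (hform 2 (bshift y z F)) s = 0" "poly (hform 2 (bshift y z G)) s = 0"
  shows "[:-y, 1:] ^ 5 dvd sylv p q F G"
  using sylv_ord(2)[OF assms(5,6,3,4) _ assms(7,8)] sylv_bshift[OF assms(1,2), of y z]
  by (intro low_ge_imp_dvd) simp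

text \<open>\<open>sylv N (N - 1) Q (pderiv Q)\<close> plays the role of a discriminant. Unlike
  \<open>rsquarefree Q\<close> it is a polynomial expression in the coefficients, so in a family its
  nonvanishing is an open condition.\<close>

lemma no_common_root_imp_card_roots:
  fixes Q :: "complex poly"
  assumes "degree Q = N" "N > 0" "sylv N (N - 1) Q (pderiv Q) \<noteq> 0"
  shows "card {x. poly Q x = 0} = N"
proof -
  have Q: "Q \<noteq> 0" using assms by auto
  have "rsquarefree Q"
    unfolding rsquarefree_roots
  proof (intro allI notI)
    fix x assume "poly Q x = 0 \<and> poly (pderiv Q) x = 0"
    then have "sylv N (N - 1) Q (pderiv Q) = 0"
      using assms by (intro sylv_common_root[where z = x]) (auto simp: degree_pderiv)
    then show False using assms by simp
  qed
  then have "Polynomial.smult (lead_coeff Q) (\<Prod>z | poly Q z = 0. [:-z, 1:]) = Q"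
    by (rule complex_poly_decompose_rsquarefree)
  then have "N = degree (Polynomial.smult (lead_coeff Q) (\<Prod>z | poly Q z = 0. [:-z, 1:]))"
    using assms(1) by simp
  also have "\<dots> = card {x. poly Q x = 0}"
    using Q by (simp add: degree_prod_eq_sum_degree)
  finally show ?thesis ..
qed

lemma card_roots_imp_no_common_root:
  fixes Q :: "complex poly"
  assumes "degree Q = N" "N > 0" "card {x. poly Q x = 0} = N"
  shows "sylv N (N - 1) Q (pderiv Q) \<noteq> 0"
proof
  have Q: "Q \<noteq> 0" using assms by auto
  assume "sylv N (N - 1) Q (pderiv Q) = 0"
  then obtain x where "poly Q x = 0" "poly (pderiv Q) x = 0"
    using sylv_eq_0_imp_common_root[of N "N - 1" Q "pderiv Q"] assms Q by (auto simp: degree_pderiv)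
  then obtain K where K: "Q = [:-x, 1:] * K"
    by (auto simp: poly_eq_0_iff_dvd elim: dvdE)
  then have "poly K x = 0"
    using \<open>poly (pderiv Q) x = 0\<close> unfolding K pderiv_mult by (simp add: pderiv_pCons)
  then have "{x. poly Q x = 0} = {x. poly K x = 0}"
    unfolding K by auto
  moreover have "K \<noteq> 0" using K Q by auto
  then have "degree Q = Suc (degree K)"
    unfolding K by (subst degree_mult_eq) auto
  ultimately show False
    using card_poly_roots_bound[of K] \<open>K \<noteq> 0\<close> assms by simp
qed

subsection \<open>Polynomial families\<close>

lemma cpoly_sum [intro]: "(\<And>i. i \<in> A \<Longrightarrow> f i \<in> cpoly) \<Longrightarrow> (\<lambda>u. \<Sum>i\<in>A. f i u) \<in> cpoly"
  by (induction A rule: infinite_finite_induct) (auto intro: cpoly_const cpoly_add)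

lemma cpoly_prod [intro]: "(\<And>i. i \<in> A \<Longrightarrow> f i \<in> cpoly) \<Longrightarrow> (\<lambda>u. \<Prod>i\<in>A. f i u) \<in> cpoly"
  by (induction A rule: infinite_finite_induct) (auto intro: cpoly_const cpoly_mult)

lemma cpoly_power: "f \<in> cpoly \<Longrightarrow> (\<lambda>u. f u ^ k) \<in> cpoly"
  by (induction k) (auto intro: cpoly_const cpoly_mult)

lemma cpoly_uminus: "f \<in> cpoly \<Longrightarrow> (\<lambda>u. - f u) \<in> cpoly"
  using cpoly_mult[OF cpoly_const[of "-1"]] by fastforce

lemma cpoly_diff: "f \<in> cpoly \<Longrightarrow> g \<in> cpoly \<Longrightarrow> (\<lambda>u. f u - g u) \<in> cpoly"
  using cpoly_add[OF _ cpoly_uminus] by fastforce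

lemmas cpoly_intros = cpoly_const cpoly_coord cpoly_add cpoly_mult cpoly_sum cpoly_prod
  cpoly_power cpoly_uminus cpoly_diff

definition pfam :: "(complex^'n \<Rightarrow> complex poly) \<Rightarrow> bool" where
  "pfam Q \<longleftrightarrow> (\<forall>k. (\<lambda>u. coeff (Q u) k) \<in> cpoly)"

definition bfam :: "(complex^'n \<Rightarrow> complex poly poly) \<Rightarrow> bool" where
  "bfam F \<longleftrightarrow> (\<forall>l. pfam (\<lambda>u. coeff (F u) l))"

lemma pfam_const: "pfam (\<lambda>u. P)"
  by (auto simp: pfam_def intro: cpoly_intros)

lemma pfam_add: "pfam P \<Longrightarrow> pfam Q \<Longrightarrow> pfam (\<lambda>u. P u + Q u)"
  by (auto simp: pfam_def intro: cpoly_intros)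

lemma pfam_mult: "pfam P \<Longrightarrow> pfam Q \<Longrightarrow> pfam (\<lambda>u. P u * Q u)"
  unfolding pfam_def coeff_mult by (auto intro!: cpoly_intros)

lemma pfam_sum: "(\<And>i. i \<in> A \<Longrightarrow> pfam (P i)) \<Longrightarrow> pfam (\<lambda>u. \<Sum>i\<in>A. P i u)"
  by (auto simp: pfam_def coeff_sum intro!: cpoly_intros)

lemma pfam_prod: "(\<And>i. i \<in> A \<Longrightarrow> pfam (P i)) \<Longrightarrow> pfam (\<lambda>u. \<Prod>i\<in>A. P i u)"
  by (induction A rule: infinite_finite_induct) (auto intro: pfam_const pfam_mult)

lemma pfam_pderiv: "pfam P \<Longrightarrow> pfam (\<lambda>u. pderiv (P u))"
  unfolding pfam_def coeff_pderiv by (auto intro!: cpoly_intros)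

lemma pfam_pCons: "f \<in> cpoly \<Longrightarrow> pfam P \<Longrightarrow> pfam (\<lambda>u. pCons (f u) (P u))"
  unfolding pfam_def by (intro allI, case_tac k) auto

lemma bfam_const: "bfam (\<lambda>u. P)"
  by (auto simp: bfam_def intro: pfam_const)

lemma bfam_add: "bfam P \<Longrightarrow> bfam Q \<Longrightarrow> bfam (\<lambda>u. P u + Q u)"
  by (auto simp: bfam_def intro: pfam_add)

lemma bfam_mult: "bfam P \<Longrightarrow> bfam Q \<Longrightarrow> bfam (\<lambda>u. P u * Q u)"
  unfolding bfam_def coeff_mult by (auto intro!: pfam_sum pfam_mult)

lemma bfam_sum: "(\<And>i. i \<in> A \<Longrightarrow> bfam (P i)) \<Longrightarrow> bfam (\<lambda>u. \<Sum>i\<in>A. P i u)"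
  by (auto simp: bfam_def coeff_sum intro!: pfam_sum)

lemma bfam_blin:
  assumes "f \<in> cpoly" "g \<in> cpoly" "h \<in> cpoly"
  shows "bfam (\<lambda>u. blin (f u) (g u) (h u))"
proof -
  have "pfam (\<lambda>u. coeff (blin (f u) (g u) (h u)) l)" for l
    using assms pfam_const[of 0]
    by (cases l; cases "l - 1") (auto simp: blin_def intro!: pfam_pCons)
  then show ?thesis by (simp add: bfam_def)
qed

lemma pfam_det:
  fixes A :: "complex^'n \<Rightarrow> nat \<Rightarrow> nat \<Rightarrow> complex poly"
  assumes "\<And>i j. pfam (\<lambda>u. A u i j)"
  shows "pfam (\<lambda>u. Determinant.det (Matrix.mat n n (\<lambda>(i,j). A u i j)))"
  unfolding leibniz by (auto intro!: pfam_sum pfam_mult pfam_const pfam_prod assms)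

lemma cpoly_det:
  fixes A :: "complex^'n \<Rightarrow> nat \<Rightarrow> nat \<Rightarrow> complex"
  assumes "\<And>i j. (\<lambda>u. A u i j) \<in> cpoly"
  shows "(\<lambda>u. Determinant.det (Matrix.mat n n (\<lambda>(i,j). A u i j))) \<in> cpoly"
  unfolding leibniz by (auto intro!: cpoly_intros assms)

lemma pfam_sylv:
  assumes "bfam F" "bfam G"
  shows "pfam (\<lambda>u. sylv p q (F u) (G u))"
proof -
  have "pfam (\<lambda>u. coeff (syl_row q (F u) (G u) i) j)" for i j
    using assms pfam_const[of 0] unfolding coeff_syl_row bfam_def
    by (cases "i < q"; cases "j < i"; cases "j < i - q") simp_all
  then show ?thesis
    unfolding sylv_def coeff_det_def by (rule pfam_det)
qed

lemma cpoly_sylv: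
  assumes "pfam F" "pfam G"
  shows "(\<lambda>u. sylv p q (F u) (G u)) \<in> cpoly"
proof -
  have "(\<lambda>u. coeff (syl_row q (F u) (G u) i) j) \<in> cpoly" for i j
    using assms cpoly_const[of 0] unfolding coeff_syl_row pfam_def
    by (cases "i < q"; cases "j < i"; cases "j < i - q") simp_all
  then show ?thesis
    unfolding sylv_def coeff_det_def by (rule cpoly_det)
qed

lemma cpoly_poly_pfam:
  assumes "pfam Q" "\<And>u. degree (Q u) \<le> M"
  shows "(\<lambda>u. poly (Q u) y) \<in> cpoly"
proof -
  have "poly (Q u) y = (\<Sum>j<Suc M. coeff (Q u) j * y ^ j)" for u
    using assms(2)[of u] by (intro poly_sum_coeff_less[symmetric]) simp
  then show ?thesis
    using assms(1) by (auto simp: pfam_def intro!: cpoly_intros)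
qed

text \<open>Horner's scheme, run downwards from the common degree bound \<open>M\<close>, expresses
  the coefficients of the quotient polynomially in those of \<open>R u\<close>. The induction is
  over the distance from \<open>M\<close>.\<close>

lemma pfam_synthetic_div:
  assumes "pfam R" "\<And>u. degree (R u) \<le> M"
  shows "pfam (\<lambda>u. synthetic_div (R u) a)"
proof -
  have rec: "coeff (synthetic_div (R u) a) n = coeff (R u) (Suc n) + a * coeff (synthetic_div (R u) a) (Suc n)" for u n
    using arg_cong[OF synthetic_div_correct'[of a "R u"], of "\<lambda>p. coeff p (Suc n)"]
    by (simp add: algebra_simps)
  have "(\<lambda>u. coeff (synthetic_div (R u) a) (M - d)) \<in> cpoly" for d
  proof (induction d)
    case 0
    have "coeff (synthetic_div (R u) a) M = 0" for u
    proof (cases "degree (R u)")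
      case 0
      then show ?thesis by (metis coeff_0 synthetic_div_eq_0_iff)
    next
      case (Suc k)
      then show ?thesis using assms(2)[of u] by (intro coeff_eq_0) (simp add: degree_synthetic_div)
    qed
    then show ?case by (simp add: cpoly_const)
  next
    case (Suc d)
    show ?case
    proof (cases "d < M")
      case True
      then have "Suc (M - Suc d) = M - d" by simp
      then show ?thesis
        using rec[of _ "M - Suc d"] Suc assms(1) unfolding pfam_def by (simp add: cpoly_intros)
    next
      case False
      then show ?thesis using Suc by simp
    qed
  qed
  moreover have "coeff (synthetic_div (R u) a) n = 0" if "n > M" for u n
    using assms(2)[of u] that by (intro coeff_eq_0) (simp add: degree_synthetic_div)
  ultimately have "(\<lambda>u. coeff (synthetic_div (R u) a) n) \<in> cpoly" for n
    by (cases "n \<le> M") (metis diff_diff_cancel, simp add: cpoly_const)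
  then show ?thesis
    by (simp add: pfam_def)
qed

text \<open>Synthetic division discards remainders. So \<open>Q\<close> is a polynomial family on
  the whole parameter space, although it is the quotient only where \<open>S\<close> divides
  \<open>R u\<close>.\<close>

lemma pfam_divide:
  fixes S :: "complex poly"
  assumes "S \<noteq> 0" "pfam R" "\<And>u. degree (R u) \<le> M"
  shows "\<exists>Q. pfam Q \<and> (\<forall>u. degree (Q u) \<le> M) \<and> (\<forall>u. S dvd R u \<longrightarrow> R u = S * Q u)"
  using assms
proof (induction "degree S" arbitrary: S R)
  case 0
  then obtain c where c: "S = [:c:]" "c \<noteq> 0" by (metis degree_eq_zeroE pCons_0_0)
  show ?case
  proof (intro exI[of _ "\<lambda>u. [:1 / c:] * R u"] conjI allI impI)
    show "pfam (\<lambda>u. [:1 / c:] * R u)"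
      using 0 by (intro pfam_mult pfam_const)
    show "degree ([:1 / c:] * R u) \<le> M" for u
      using 0 c by simp
  qed (use c in simp)
next
  case (Suc n)
  obtain r where r: "poly S r = 0"
    using Suc.hyps(2) by (metis Fundamental_Theorem_Algebra.fundamental_theorem_of_algebra constant_degree nat.simps(3))
  then obtain S' where S': "S = [:-r,1:] * S'"
    by (auto simp: poly_eq_0_iff_dvd elim: dvdE)
  have "S' \<noteq> 0" "degree S' = n"
    using Suc.hyps(2) Suc.prems(1) unfolding S' by (auto simp: degree_mult_eq simp del: mult_pCons_left)
  moreover have "degree (synthetic_div (R u) r) \<le> M" for u
    using Suc.prems(3)[of u] by (simp add: degree_synthetic_div)
  ultimately obtain Q where Q: "pfam Q" "\<And>u. degree (Q u) \<le> M"
    "\<And>u. S' dvd synthetic_div (R u) r \<Longrightarrow> synthetic_div (R u) r = S' * Q u"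
    using Suc.hyps(1)[of S' "\<lambda>u. synthetic_div (R u) r"] pfam_synthetic_div[OF Suc.prems(2,3), of r]
    by blast
  have "R u = S * Q u" if "S dvd R u" for u
  proof -
    from \<open>S dvd R u\<close> obtain K where K: "R u = S * K" by (rule dvdE)
    then have "poly (R u) r = 0" using r by simp
    then have *: "R u = [:-r,1:] * synthetic_div (R u) r"
      using synthetic_div_correct'[of r "R u"] by simp
    then have "[:-r,1:] * synthetic_div (R u) r = [:-r,1:] * (S' * K)"
      using K S' by (simp only: mult.assoc)
    then have "synthetic_div (R u) r = S' * K"
      by (subst (asm) mult_cancel_left) auto
    then have "synthetic_div (R u) r = S' * Q u"
      using Q(3)[of u] by simp
    then show ?thesis using * S' by (simp only: mult.assoc)
  qed
  then show ?case using Q(1,2) by blast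
qed

section \<open>The critical equations on the plane\<close>

lemma top_le_power:
  fixes F :: "'a::comm_ring_1 poly"
  assumes "top_le h F"
  shows "top_le (int k * h) (F ^ k) \<and> hcoef (int k * h) (F ^ k) = hcoef h F ^ k"
proof (induction k)
  case 0
  then show ?case by (simp add: top_le_def hcoef_def)
next
  case (Suc k)
  then show ?case
    using top_le_mult[OF assms, of "int k * h" "F ^ k"] by (simp add: algebra_simps)
qed

text \<open>Two points can have the same image only if \<open>c\<close> is the slope
  \<open>(x - x') / (t - t')\<close> of the line joining them.\<close>

lemma finite_not_inj_projection:
  fixes S :: "(complex \<times> complex) set"
  assumes "finite S"
  shows "finite {c. \<not> inj_on (\<lambda>(x, t). x - c * t) S}"
proof -
  have "{c. \<not> inj_on (\<lambda>(x, t). x - c * t) S} \<subseteq>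
      (\<lambda>((x, t), (x', t')). (x - x') / (t - t')) ` (S \<times> S)"
  proof
    fix c assume "c \<in> {c. \<not> inj_on (\<lambda>(x, t). x - c * t) S}"
    then obtain x t x' t' where *: "(x, t) \<in> S" "(x', t') \<in> S" "(x, t) \<noteq> (x', t')" "x - c * t = x' - c * t'"
      unfolding inj_on_def by auto
    then have "c * (t - t') = x - x'" by (simp add: algebra_simps)
    moreover from this have "t \<noteq> t'" using * by auto
    ultimately have "c = (x - x') / (t - t')" by (simp add: field_simps)
    then show "c \<in> (\<lambda>((x, t), (x', t')). (x - x') / (t - t')) ` (S \<times> S)"
      using * by (intro image_eqI[of _ _ "((x, t), (x', t'))"]) auto
  qed
  then show ?thesis
    using assms by (meson finite_SigmaI finite_imageI finite_subset)
qed

text \<open>Affine coordinates \<open>(x, t)\<close> on the lines through \<open>X\<close>: the poles of the images of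
  the remaining cameras are the lines \<open>dd i = 0\<close>, and the centre of camera \<open>i\<close> is seen at
  \<open>(xx i, tt i)\<close>.\<close>
locale plane_system =
  fixes I :: "'i set" and a al xx tt :: "'i \<Rightarrow> complex"
  assumes fin: "finite I" and card2: "card I \<ge> 2"
    and a_nz: "\<And>i. i \<in> I \<Longrightarrow> a i \<noteq> 0" and al_nz: "\<And>i. i \<in> I \<Longrightarrow> al i \<noteq> 0"
    and al_inj: "inj_on al I" and xx_inj: "inj_on xx I"
    and e_off: "\<And>i j. i \<in> I \<Longrightarrow> j \<in> I \<Longrightarrow> i \<noteq> j \<Longrightarrow> tt j - tt i - al i * (xx j - xx i) \<noteq> 0"
    and no3: "\<And>i j l x t. i \<in> I \<Longrightarrow> j \<in> I \<Longrightarrow> l \<in> I \<Longrightarrow> i \<noteq> j \<Longrightarrow> i \<noteq> l \<Longrightarrow> j \<noteq> l \<Longrightarrow>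
      t - tt i - al i * (x - xx i) = 0 \<Longrightarrow> t - tt j - al j * (x - xx j) = 0 \<Longrightarrow>
      t - tt l - al l * (x - xx l) \<noteq> 0"
begin

definition dd :: "'i \<Rightarrow> complex \<Rightarrow> complex \<Rightarrow> complex" where
  "dd i x t = t - tt i - al i * (x - xx i)"

text \<open>The squared distance is \<open>(x - w)^2 + (\<Sum>i\<in>I. (a i * (x - xx i) / dd i x t
  - v i)^2)\<close>. For the common denominator \<open>\<Prod>i\<in>I. dd i x t ^ 3\<close>,
  \<open>fh\<close> is minus the numerator of half its \<open>t\<close>-derivative, and
  \<open>gh\<close> is the numerator of half its \<open>x\<close>-derivative.\<close>

definition fh :: "('i \<Rightarrow> complex) \<Rightarrow> complex \<Rightarrow> complex \<Rightarrow> complex" where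
  "fh v x t = (\<Sum>i\<in>I. a i * (x - xx i) * (a i * (x - xx i) - v i * dd i x t) * (\<Prod>j\<in>I-{i}. dd j x t ^ 3))"

definition gh :: "('i \<Rightarrow> complex) \<Rightarrow> complex \<Rightarrow> complex \<Rightarrow> complex \<Rightarrow> complex" where
  "gh v w x t = (x - w) * (\<Prod>j\<in>I. dd j x t ^ 3) +
    (\<Sum>i\<in>I. a i * (t - tt i) * (a i * (x - xx i) - v i * dd i x t) * (\<Prod>j\<in>I-{i}. dd j x t ^ 3))"

definition zeros :: "('i \<Rightarrow> complex) \<Rightarrow> complex \<Rightarrow> (complex \<times> complex) set" where
  "zeros v w = {(x, t). fh v x t = 0 \<and> gh v w x t = 0}"

definition genuine :: "('i \<Rightarrow> complex) \<Rightarrow> complex \<Rightarrow> (complex \<times> complex) set" where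
  "genuine v w = {(x, t). fh v x t = 0 \<and> gh v w x t = 0 \<and> (\<forall>i\<in>I. dd i x t \<noteq> 0)}"

definition Pts :: "(complex \<times> complex) set" where
  "Pts = {(x, t). \<exists>i\<in>I. \<exists>j\<in>I. i \<noteq> j \<and> dd i x t = 0 \<and> dd j x t = 0}"

definition Ept :: "(complex \<times> complex) set" where
  "Ept = (\<lambda>i. (xx i, tt i)) ` I"

lemma prod_dd_zero: "j \<in> J \<Longrightarrow> finite J \<Longrightarrow> dd j x t = 0 \<Longrightarrow> (\<Prod>j\<in>J. dd j x t ^ 3) = 0"
  by (rule prod_zero) auto

lemma fh_on_line:
  assumes "i \<in> I" "dd i x t = 0"
  shows "fh v x t = (a i * (x - xx i))^2 * (\<Prod>j\<in>I-{i}. dd j x t ^ 3)"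
proof -
  have "fh v x t = (\<Sum>l\<in>{i}. a l * (x - xx l) * (a l * (x - xx l) - v l * dd l x t) * (\<Prod>j\<in>I-{l}. dd j x t ^ 3))"
    unfolding fh_def
  proof (rule sum.mono_neutral_right[OF fin])
    show "\<forall>l\<in>I - {i}. a l * (x - xx l) * (a l * (x - xx l) - v l * dd l x t) * (\<Prod>j\<in>I-{l}. dd j x t ^ 3) = 0"
    proof
      fix l assume "l \<in> I - {i}"
      then have "(\<Prod>j\<in>I-{l}. dd j x t ^ 3) = 0"
        using assms fin by (intro prod_dd_zero[of i]) auto
      then show "a l * (x - xx l) * (a l * (x - xx l) - v l * dd l x t) * (\<Prod>j\<in>I-{l}. dd j x t ^ 3) = 0"
        by simp
    qed
  qed (use assms in auto)
  then show ?thesis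
    using assms(2) by (simp add: power2_eq_square)
qed

text \<open>On the pole line of camera \<open>i\<close> all summands except the \<open>i\<close>-th
  contain the factor \<open>dd i\<close>. So clearing denominators adds zeros of \<open>fh\<close>
  on the pole lines only at crossings and centres.\<close>

lemma fh_zero_on_line:
  assumes "i \<in> I" "dd i x t = 0" "fh v x t = 0"
  shows "(x, t) \<in> Pts \<union> Ept"
proof (cases "x = xx i")
  case True
  then have "t = tt i" using assms(2) by (simp add: dd_def)
  then show ?thesis using True assms(1) by (auto simp: Ept_def)
next
  case False
  then have "(\<Prod>j\<in>I-{i}. dd j x t ^ 3) = 0"
    using assms fh_on_line[OF assms(1,2), of v] a_nz by auto
  then obtain j where "j \<in> I - {i}" "dd j x t = 0"
    using fin by auto
  then show ?thesis using assms by (auto simp: Pts_def)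
qed

lemma zeros_cases: "(x, t) \<in> zeros v w \<Longrightarrow> (x, t) \<notin> Pts \<union> Ept \<Longrightarrow> (x, t) \<in> genuine v w"
  using fh_zero_on_line by (auto simp: zeros_def genuine_def)

lemma genuine_subset: "genuine v w \<subseteq> zeros v w"
  by (auto simp: genuine_def zeros_def)

lemma dd_Ept: "i \<in> I \<Longrightarrow> j \<in> I \<Longrightarrow> dd i (xx j) (tt j) = 0 \<longleftrightarrow> i = j"
  using e_off[of i j] by (auto simp: dd_def)

lemma disj_Pts_Ept: "Pts \<inter> Ept = {}"
  using dd_Ept by (fastforce simp: Pts_def Ept_def)

lemma disj_genuine: "genuine v w \<inter> (Pts \<union> Ept) = {}"
  using dd_Ept by (auto simp: Pts_def Ept_def genuine_def)

lemma card_Ept: "card Ept = card I"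
  unfolding Ept_def using xx_inj by (intro card_image) (auto simp: inj_on_def)

lemma lines_meet:
  assumes "i \<in> I" "j \<in> I" "i \<noteq> j"
  shows "\<exists>x t. dd i x t = 0 \<and> dd j x t = 0"
proof -
  have n: "al j - al i \<noteq> 0" using al_inj assms by (auto simp: inj_on_def)
  define x where "x = (tt i - al i * xx i - tt j + al j * xx j) / (al j - al i)"
  have "x * (al j - al i) = tt i - al i * xx i - tt j + al j * xx j"
    using n by (simp add: x_def)
  then have "dd i x (tt i + al i * (x - xx i)) = 0 \<and> dd j x (tt i + al i * (x - xx i)) = 0"
    by (simp add: dd_def algebra_simps)
  then show ?thesis by blast
qed

lemma lines_meet_unique:
  assumes "i \<in> I" "j \<in> I" "i \<noteq> j" "dd i x t = 0" "dd j x t = 0" "dd i x' t' = 0" "dd j x' t' = 0"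
  shows "x = x' \<and> t = t'"
proof -
  have n: "al j - al i \<noteq> 0" using al_inj assms by (auto simp: inj_on_def)
  have "t - t' = (dd l x t - dd l x' t') + al l * (x - x')" for l
    by (simp add: dd_def algebra_simps)
  from this[of i] this[of j] have *: "t - t' = al i * (x - x')" "t - t' = al j * (x - x')"
    unfolding assms(4-7) by auto
  have "(al j - al i) * (x - x') = 0"
    using * by (simp add: left_diff_distrib)
  then have "x = x'" using n by simp
  then show ?thesis using *(1) by simp
qed

text \<open>A crossing corresponds to the pair of lines through it: two lines meet exactly once
  because the slopes \<open>al\<close> differ, and \<open>no3\<close> excludes a third line.\<close>

lemma card_Pts: "card Pts = card I choose 2" and finite_Pts: "finite Pts"
proof -
  let ?z = "\<lambda>(x, t). {i \<in> I. dd i x t = 0}"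
  have z2: "?z (x, t) = {i, j}" if "i \<in> I" "j \<in> I" "i \<noteq> j" "dd i x t = 0" "dd j x t = 0" for i j x t
    using no3[of i j _ t x] that unfolding dd_def by auto
  have "bij_betw ?z Pts {A. A \<subseteq> I \<and> card A = 2}"
    unfolding bij_betw_def
  proof
    show "inj_on ?z Pts"
    proof (rule inj_onI)
      fix p p' assume p: "p \<in> Pts" "p' \<in> Pts" "?z p = ?z p'"
      obtain x t x' t' where pp: "p = (x, t)" "p' = (x', t')" by (cases p; cases p') auto
      obtain i j where ij: "i \<in> I" "j \<in> I" "i \<noteq> j" "dd i x t = 0" "dd j x t = 0"
        using p(1) pp by (auto simp: Pts_def)
      then have "dd i x' t' = 0" "dd j x' t' = 0"
        using p(3) unfolding pp by auto
      then show "p = p'" using lines_meet_unique[OF ij] pp by simp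
    qed
    show "?z ` Pts = {A. A \<subseteq> I \<and> card A = 2}"
    proof (intro equalityI subsetI)
      fix A assume "A \<in> ?z ` Pts"
      then show "A \<in> {A. A \<subseteq> I \<and> card A = 2}"
        using z2 by (fastforce simp: Pts_def)
    next
      fix A assume "A \<in> {A. A \<subseteq> I \<and> card A = 2}"
      then obtain i j where A: "A = {i, j}" "i \<noteq> j" "i \<in> I" "j \<in> I"
        by (auto simp: card_2_iff)
      obtain x t where "dd i x t = 0" "dd j x t = 0"
        using lines_meet[OF A(3,4,2)] by auto
      then have "A = ?z (x, t)" "(x, t) \<in> Pts"
        using z2[of i j x t] A by (auto simp: Pts_def)
      then show "A \<in> ?z ` Pts" by blast
    qed
  qed
  moreover have "finite {A. A \<subseteq> I \<and> card A = 2}"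
    using fin by simp
  moreover note bij_betw_same_card[OF calculation(1)] bij_betw_finite[OF calculation(1)]
  ultimately show "card Pts = card I choose 2" "finite Pts"
    using n_subsets[OF fin, of 2] by simp_all
qed

lemma finite_Ept: "finite Ept"
  using fin by (simp add: Ept_def)

text \<open>The equations in the coordinates \<open>y = x - c t\<close>, \<open>z = t\<close>.\<close>
definition DD :: "complex \<Rightarrow> 'i \<Rightarrow> complex poly poly" where
  "DD c i = blin (al i * xx i - tt i) (- al i) (1 - al i * c)"

definition LL :: "complex \<Rightarrow> ('i \<Rightarrow> complex) \<Rightarrow> 'i \<Rightarrow> complex poly poly" where
  "LL c v i = blin (- a i * xx i - v i * (al i * xx i - tt i)) (a i + v i * al i) (a i * c - v i * (1 - al i * c))"

definition FF :: "complex \<Rightarrow> ('i \<Rightarrow> complex) \<Rightarrow> complex poly poly" where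
  "FF c v = (\<Sum>i\<in>I. blin (a i) 0 0 * blin (- xx i) 1 c * LL c v i * (\<Prod>j\<in>I-{i}. DD c j ^ 3))"

definition GG :: "complex \<Rightarrow> ('i \<Rightarrow> complex) \<Rightarrow> complex \<Rightarrow> complex poly poly" where
  "GG c v w = blin (- w) 1 c * (\<Prod>j\<in>I. DD c j ^ 3) +
    (\<Sum>i\<in>I. blin (a i) 0 0 * blin (- tt i) 0 1 * LL c v i * (\<Prod>j\<in>I-{i}. DD c j ^ 3))"

lemma bev_DD: "bev (DD c i) y z = dd i (y + c * z) z"
  by (simp add: DD_def dd_def algebra_simps)

lemma bev_LL: "bev (LL c v i) y z = a i * (y + c * z - xx i) - v i * dd i (y + c * z) z"
  by (simp add: LL_def dd_def algebra_simps)

lemma bev_FF: "bev (FF c v) y z = fh v (y + c * z) z"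
  unfolding FF_def fh_def bev_simps bev_DD bev_LL
  by (intro sum.cong refl arg_cong2[of _ _ _ _ "(*)"]) simp_all

lemma bev_GG: "bev (GG c v w) y z = gh v w (y + c * z) z"
  unfolding GG_def gh_def bev_simps bev_DD bev_LL
  by (intro sum.cong refl arg_cong2[of _ _ _ _ "(*)"] arg_cong2[of _ _ _ _ "(+)"]) simp_all

abbreviation k where "k \<equiv> card I"

lemma tdeg_prod_DD:
  assumes "finite J"
  shows "tdeg_le (3 * card J) (\<Prod>j\<in>J. DD c j ^ 3)"
    "hform (3 * card J) (\<Prod>j\<in>J. DD c j ^ 3) = (\<Prod>j\<in>J. [:- al j, 1 - al j * c:] ^ 3)"
proof -
  have 1: "tdeg_le 3 (DD c j ^ 3)" "hform 3 (DD c j ^ 3) = [:- al j, 1 - al j * c:] ^ 3" for j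
    using tdeg_le_power[OF tdeg_le_blin, of 3 "al j * xx j - tt j" "- al j" "1 - al j * c"]
    unfolding DD_def hform_blin by simp_all
  show "tdeg_le (3 * card J) (\<Prod>j\<in>J. DD c j ^ 3)"
    "hform (3 * card J) (\<Prod>j\<in>J. DD c j ^ 3) = (\<Prod>j\<in>J. [:- al j, 1 - al j * c:] ^ 3)"
    using tdeg_le_prod[OF assms, of "\<lambda>_. 3" "\<lambda>j. DD c j ^ 3"] 1 by (simp_all add: mult.commute)
qed

lemma card_remove: "i \<in> I \<Longrightarrow> 1 + 1 + 3 * card (I - {i}) = 3 * k - 1"
  using card2 fin by simp

lemma tdeg_term:
  assumes "i \<in> I"
  shows "tdeg_le (3 * k - 1) (blin (a i) 0 0 * blin b b' b'' * LL c v i * (\<Prod>j\<in>I-{i}. DD c j ^ 3))"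
    "hform (3 * k - 1) (blin (a i) 0 0 * blin b b' b'' * LL c v i * (\<Prod>j\<in>I-{i}. DD c j ^ 3)) =
      [:a i:] * [:b', b'':] * [:a i + v i * al i, a i * c - v i * (1 - al i * c):] *
      (\<Prod>j\<in>I-{i}. [:- al j, 1 - al j * c:] ^ 3)"
proof -
  note P = tdeg_prod_DD[of "I - {i}" c]
  have J: "finite (I - {i})" using fin by simp
  have A: "tdeg_le (0 + 1) (blin (a i) 0 0 * blin b b' b'')"
    by (intro tdeg_le_mult tdeg_le_blin tdeg_le_blin0)
  have B: "tdeg_le (0 + 1 + 1) (blin (a i) 0 0 * blin b b' b'' * LL c v i)"
    unfolding LL_def by (intro tdeg_le_mult A tdeg_le_blin)
  show "tdeg_le (3 * k - 1) (blin (a i) 0 0 * blin b b' b'' * LL c v i * (\<Prod>j\<in>I-{i}. DD c j ^ 3))"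
    using tdeg_le_mult[OF B P(1)[OF J]] card_remove[OF assms] by simp
  have "hform (0 + 1 + 1 + 3 * card (I - {i})) (blin (a i) 0 0 * blin b b' b'' * LL c v i * (\<Prod>j\<in>I-{i}. DD c j ^ 3))
      = hform 0 (blin (a i) 0 0) * hform 1 (blin b b' b'') * hform 1 (LL c v i) *
        hform (3 * card (I - {i})) (\<Prod>j\<in>I-{i}. DD c j ^ 3)"
    unfolding hform_mult_tdeg[OF B P(1)[OF J]]
      hform_mult_tdeg[OF A tdeg_le_blin[of "- a i * xx i - v i * (al i * xx i - tt i)" "a i + v i * al i"
          "a i * c - v i * (1 - al i * c)", folded LL_def]]
      hform_mult_tdeg[OF tdeg_le_blin0 tdeg_le_blin] ..
  then show "hform (3 * k - 1) (blin (a i) 0 0 * blin b b' b'' * LL c v i * (\<Prod>j\<in>I-{i}. DD c j ^ 3)) =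
      [:a i:] * [:b', b'':] * [:a i + v i * al i, a i * c - v i * (1 - al i * c):] *
      (\<Prod>j\<in>I-{i}. [:- al j, 1 - al j * c:] ^ 3)"
    unfolding P(2)[OF J] hform_blin hform_blin0 LL_def using card_remove[OF assms] by simp
qed

lemma tdeg_FF: "tdeg_le (3 * k - 1) (FF c v)"
  unfolding FF_def by (intro tdeg_le_sum tdeg_term)

lemma tdeg_GG: "tdeg_le (3 * k + 1) (GG c v w)"
proof -
  have "tdeg_le (1 + 3 * k) (blin (- w) 1 c * (\<Prod>j\<in>I. DD c j ^ 3))"
    by (intro tdeg_le_mult tdeg_le_blin tdeg_prod_DD fin)
  moreover have "tdeg_le (3 * k + 1) (\<Sum>i\<in>I. blin (a i) 0 0 * blin (- tt i) 0 1 * LL c v i * (\<Prod>j\<in>I-{i}. DD c j ^ 3))"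
    by (rule tdeg_le_mono[of "3 * k - 1"]) (intro tdeg_le_sum tdeg_term, auto)
  ultimately show ?thesis
    unfolding GG_def by (intro tdeg_le_add) (simp_all add: add.commute)
qed

text \<open>All forms vanish at the centre of the distinguished camera, the point at infinity \<open>x = 0\<close>.\<close>
lemma hform_common_root:
  assumes "c \<noteq> 0"
  shows "poly (hform (3 * k - 1) (FF c v)) (- 1 / c) = 0" "poly (hform (3 * k + 1) (GG c v w)) (- 1 / c) = 0"
proof -
  show "poly (hform (3 * k - 1) (FF c v)) (- 1 / c) = 0"
    unfolding FF_def hform_sum poly_sum
  proof (intro sum.neutral ballI)
    fix i assume i: "i \<in> I"
    show "poly (hform (3 * k - 1) (blin (a i) 0 0 * blin (- xx i) 1 c * LL c v i * (\<Prod>j\<in>I-{i}. DD c j ^ 3))) (- 1 / c) = 0"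
      unfolding tdeg_term(2)[OF i] poly_mult using assms by simp
  qed
  have "hform (1 + 3 * k) (blin (- w) 1 c * (\<Prod>j\<in>I. DD c j ^ 3)) = [:1, c:] * (\<Prod>j\<in>I. [:- al j, 1 - al j * c:] ^ 3)"
    unfolding hform_mult_tdeg[OF tdeg_le_blin tdeg_prod_DD(1)[OF fin]] hform_blin tdeg_prod_DD(2)[OF fin] ..
  moreover have "hform (3 * k + 1) (\<Sum>i\<in>I. blin (a i) 0 0 * blin (- tt i) 0 1 * LL c v i * (\<Prod>j\<in>I-{i}. DD c j ^ 3)) = 0"
    by (rule hform_tdeg_less[of "3 * k - 1"]) (intro tdeg_le_sum tdeg_term, auto)
  ultimately show "poly (hform (3 * k + 1) (GG c v w)) (- 1 / c) = 0"
    unfolding GG_def hform_add using assms by (simp add: add.commute)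
qed

definition lcF :: "complex \<Rightarrow> ('i \<Rightarrow> complex) \<Rightarrow> complex" where
  "lcF c v = (\<Sum>i\<in>I. a i * c * (a i * c - v i * (1 - al i * c)) * (\<Prod>j\<in>I-{i}. (1 - al j * c) ^ 3))"

lemma lead_FF: "coeff (coeff (FF c v) (3 * k - 1)) 0 = lcF c v"
proof -
  have "coeff (coeff (FF c v) (3 * k - 1)) 0 = coeff (hform (3 * k - 1) (FF c v)) (3 * k - 1)"
    by (simp add: coeff_hform)
  also have "\<dots> = (\<Sum>i\<in>I. a i * c * (a i * c - v i * (1 - al i * c)) * (\<Prod>j\<in>I-{i}. (1 - al j * c) ^ 3))"
    unfolding FF_def hform_sum coeff_sum
  proof (rule sum.cong)
    fix i assume i: "i \<in> I"
    have l0: "top_le 0 [:b:]" and l1: "top_le 1 [:b, b':]" for b b' :: complex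
      by (auto simp: top_le_def coeff_pCons split: nat.splits)
    have h0: "hcoef 0 [:b:] = b" and h1: "hcoef 1 [:b, b':] = b'" for b b' :: complex
      by (simp_all add: hcoef_def)
    have t3: "top_le 3 ([:b, b':] ^ 3)" "hcoef 3 ([:b, b':] ^ 3) = b' ^ 3" for b b' :: complex
      using top_le_power[OF l1, of 3 b b'] h1 by simp_all
    have tp: "top_le (\<Sum>j\<in>I-{i}. 3) (\<Prod>j\<in>I-{i}. [:- al j, 1 - al j * c:] ^ 3)"
      "hcoef (\<Sum>j\<in>I-{i}. 3) (\<Prod>j\<in>I-{i}. [:- al j, 1 - al j * c:] ^ 3) = (\<Prod>j\<in>I-{i}. (1 - al j * c) ^ 3)"
      using top_le_prod[of "I - {i}" "\<lambda>_. 3" "\<lambda>j. [:- al j, 1 - al j * c:] ^ 3"] fin t3 by auto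
    note m1 = top_le_mult[OF l0[of "a i"] l1[of 1 c]]
    note m2 = top_le_mult[OF m1(1) l1[of "a i + v i * al i" "a i * c - v i * (1 - al i * c)"]]
    note m3 = top_le_mult[OF m2(1) tp(1)]
    have e: "0 + 1 + 1 + (\<Sum>j\<in>I-{i}. 3) = int (3 * k - 1)"
      using card_remove[OF i] by simp
    show "coeff (hform (3 * k - 1) (blin (a i) 0 0 * blin (- xx i) 1 c * LL c v i * (\<Prod>j\<in>I-{i}. DD c j ^ 3))) (3 * k - 1)
        = a i * c * (a i * c - v i * (1 - al i * c)) * (\<Prod>j\<in>I-{i}. (1 - al j * c) ^ 3)"
      using m3(2) unfolding m2(2) m1(2) tp(2) h0 h1 e tdeg_term(2)[OF i] by (simp only: hcoef_int)
  qed simp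
  finally show ?thesis by (simp add: lcF_def)
qed

text \<open>The second condition keeps the degree of \<open>FF c v\<close> in \<open>z\<close> at
  \<open>3 * k - 1\<close> for every \<open>y\<close>. The third keeps the tangent that both curves
  share at centre \<open>i\<close> from being the direction of projection, which
  \<open>hform\<close>, dehomogenised at \<open>y = 1\<close>, cannot represent.\<close>

definition good :: "complex \<Rightarrow> ('i \<Rightarrow> complex) \<Rightarrow> bool" where
  "good c v \<longleftrightarrow> c \<noteq> 0 \<and> lcF c v \<noteq> 0 \<and> (\<forall>i\<in>I. a i * c - v i * (1 - al i * c) \<noteq> 0)"

lemma finite_bad: "finite {c. \<not> good c v}"
proof -
  define P where "P = (\<Sum>i\<in>I. [:0, a i:] * [:- v i, a i + v i * al i:] * (\<Prod>j\<in>I-{i}. [:1, - al j:] ^ 3))"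
  have P: "poly P c = lcF c v" for c
    by (simp add: P_def lcF_def poly_sum poly_prod algebra_simps)
  obtain i0 where i0: "i0 \<in> I" using card2 by fastforce
  \<comment> \<open>At this value the factor \<open>1 - al i0 * c\<close> vanishes, so only the
    summand \<open>i0\<close> of \<open>lcF\<close> survives; it is nonzero because the slopes are
    distinct.\<close>
  let ?c = "1 / al i0"
  have "lcF ?c v = (\<Sum>i\<in>{i0}. a i * ?c * (a i * ?c - v i * (1 - al i * ?c)) * (\<Prod>j\<in>I-{i}. (1 - al j * ?c) ^ 3))"
    unfolding lcF_def
  proof (rule sum.mono_neutral_right[OF fin])
    show "\<forall>i\<in>I-{i0}. a i * ?c * (a i * ?c - v i * (1 - al i * ?c)) * (\<Prod>j\<in>I-{i}. (1 - al j * ?c) ^ 3) = 0"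
    proof
      fix i assume i: "i \<in> I - {i0}"
      have "(\<Prod>j\<in>I-{i}. (1 - al j * ?c) ^ 3) = 0"
        using i i0 fin al_nz by (intro prod_zero bexI[of _ i0]) auto
      then show "a i * ?c * (a i * ?c - v i * (1 - al i * ?c)) * (\<Prod>j\<in>I-{i}. (1 - al j * ?c) ^ 3) = 0" by simp
    qed
  qed (use i0 in auto)
  also have "\<dots> \<noteq> 0"
    using i0 a_nz al_nz al_inj fin by (auto simp: field_simps inj_on_def)
  finally have "P \<noteq> 0" using P by (metis poly_0)
  then have f1: "finite {c. lcF c v = 0}"
    using poly_roots_finite[of P] P by simp
  have f2: "finite {c. a i * c - v i * (1 - al i * c) = 0}" if "i \<in> I" for i
  proof -
    have "[:- v i, a i + v i * al i:] \<noteq> 0" using a_nz[OF that] by auto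
    then have "finite {c. poly [:- v i, a i + v i * al i:] c = 0}" by (rule poly_roots_finite)
    then show ?thesis by (rule rev_finite_subset) (auto simp: algebra_simps)
  qed
  have "{c. \<not> good c v} \<subseteq> {0} \<union> {c. lcF c v = 0} \<union> (\<Union>i\<in>I. {c. a i * c - v i * (1 - al i * c) = 0})"
    by (auto simp: good_def)
  then show ?thesis
    using f1 f2 fin by (auto intro: finite_subset)
qed

lemma bshift_DD: "bshift (x - c * t) t (DD c i) = blin (dd i x t) (- al i) (1 - al i * c)"
  unfolding DD_def bshift_simps by (rule arg_cong[where f = "\<lambda>s. blin s _ _"]) (simp add: dd_def algebra_simps)

lemma ord_prod_DD:
  assumes "finite J" "j \<in> J" "dd j x t = 0"
  shows "ord_ge 3 (bshift (x - c * t) t (\<Prod>j\<in>J. DD c j ^ 3))"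
proof -
  have "ord_ge (3 + 0) (bshift (x - c * t) t (DD c j) ^ 3 * (\<Prod>j\<in>J-{j}. bshift (x - c * t) t (DD c j) ^ 3))"
    using ord_ge_power[OF ord_ge_blin, of 3 "- al j" "1 - al j * c"] assms(3)
    by (intro ord_ge_mult ord_ge_0) (simp add: bshift_DD)
  then show ?thesis
    unfolding bshift_simps by (simp add: prod.remove[OF assms(1,2)])
qed

lemma ord_term:
  assumes "j \<in> I" "j \<noteq> i" "dd j x t = 0"
  shows "ord_ge 3 (bshift (x - c * t) t (A * (\<Prod>j\<in>I-{i}. DD c j ^ 3)))"
  unfolding bshift_simps(2)
  using ord_ge_mult[OF ord_ge_0 ord_prod_DD[of "I - {i}" j x t c]] assms fin by simp

text \<open>A product with one index removed still contains the cube of one of the two lines through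
  the crossing. So every summand of both polynomials has order at least 3 there.\<close>

lemma ord_Pts:
  assumes "(x, t) \<in> Pts"
  shows "ord_ge 3 (bshift (x - c * t) t (FF c v))" "ord_ge 3 (bshift (x - c * t) t (GG c v w))"
proof -
  have ex: "\<exists>j\<in>I. j \<noteq> i \<and> dd j x t = 0" for i
    using assms unfolding Pts_def by (auto, metis)
  have *: "\<And>A i. ord_ge 3 (bshift (x - c * t) t (A * (\<Prod>j\<in>I-{i}. DD c j ^ 3)))"
  proof -
    fix A i
    obtain j where "j \<in> I" "j \<noteq> i" "dd j x t = 0" using ex by blast
    then show "ord_ge 3 (bshift (x - c * t) t (A * (\<Prod>j\<in>I-{i}. DD c j ^ 3)))" by (rule ord_term)
  qed
  show "ord_ge 3 (bshift (x - c * t) t (FF c v))"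
    unfolding FF_def bshift_simps(4) by (intro ord_ge_sum *)
  obtain j where j: "j \<in> I" "dd j x t = 0" using ex by blast
  have "ord_ge (0 + 3) (bshift (x - c * t) t (blin (- w) 1 c) * bshift (x - c * t) t (\<Prod>j\<in>I. DD c j ^ 3))"
    by (intro ord_ge_mult ord_ge_0 ord_prod_DD[OF fin j])
  then have 1: "ord_ge 3 (bshift (x - c * t) t (blin (- w) 1 c * (\<Prod>j\<in>I. DD c j ^ 3)))"
    unfolding bshift_simps(2) by simp
  have 2: "ord_ge 3 (bshift (x - c * t) t (\<Sum>i\<in>I. blin (a i) 0 0 * blin (- tt i) 0 1 * LL c v i * (\<Prod>j\<in>I-{i}. DD c j ^ 3)))"
    unfolding bshift_simps(4) by (intro ord_ge_sum *)
  show "ord_ge 3 (bshift (x - c * t) t (GG c v w))"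
    unfolding GG_def bshift_simps(1) by (rule ord_ge_add[OF 1 2])
qed

text \<open>At centre \<open>i\<close> all summands with another index, and the leading product of
  \<open>GG\<close>, contain the cube of \<open>DD c i\<close>. The \<open>i\<close>-th summands
  begin with \<open>(x - xx i) * LL\<close> and \<open>(t - tt i) * LL\<close>: both have two linear
  factors, and the zero line of \<open>LL c v i\<close> is the common tangent, recorded by its slope
  \<open>s\<close>.\<close>

lemma ord_Ept:
  assumes "i \<in> I" "good c v"
  defines "sh \<equiv> bshift (xx i - c * tt i) (tt i)"
  obtains s where "ord_ge 2 (sh (FF c v))" "ord_ge 2 (sh (GG c v w))"
    "poly (hform 2 (sh (FF c v))) s = 0" "poly (hform 2 (sh (GG c v w))) s = 0"
proof -
  let ?A = "a i + v i * al i" and ?B = "a i * c - v i * (1 - al i * c)"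
  define s where "s = - ?A / ?B"
  have B: "?B \<noteq> 0" using assms by (simp add: good_def)
  have d0: "dd i (xx i) (tt i) = 0" by (simp add: dd_def)
  have main: "ord_ge 2 (blin (a i) 0 0 * blin 0 b b' * blin 0 ?A ?B * Q)"
    "poly (hform 2 (blin (a i) 0 0 * blin 0 b b' * blin 0 ?A ?B * Q)) s = 0" for b b' Q
  proof -
    have o1: "ord_ge (0 + 1) (blin (a i) 0 0 * blin 0 b b')"
      by (intro ord_ge_mult ord_ge_0 ord_ge_blin)
    have o2: "ord_ge (0 + 1 + 1) (blin (a i) 0 0 * blin 0 b b' * blin 0 ?A ?B)"
      by (intro ord_ge_mult[OF o1] ord_ge_blin)
    have o3: "ord_ge (0 + 1 + 1 + 0) (blin (a i) 0 0 * blin 0 b b' * blin 0 ?A ?B * Q)"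
      by (intro ord_ge_mult[OF o2] ord_ge_0)
    show "ord_ge 2 (blin (a i) 0 0 * blin 0 b b' * blin 0 ?A ?B * Q)" using o3 by (simp add: numeral_2_eq_2)
    have two: "(2::nat) = 0 + 1 + 1 + 0" by simp
    have "hform 2 (blin (a i) 0 0 * blin 0 b b' * blin 0 ?A ?B * Q) =
        hform (0 + 1) (blin (a i) 0 0 * blin 0 b b') * [:?A, ?B:] * hform 0 Q"
      unfolding two hform_mult_ord[OF o2 ord_ge_0] hform_mult_ord[OF o1 ord_ge_blin] hform_blin ..
    moreover have "poly [:?A, ?B:] s = 0" using B by (simp add: s_def)
    ultimately show "poly (hform 2 (blin (a i) 0 0 * blin 0 b b' * blin 0 ?A ?B * Q)) s = 0"
      by (simp only: poly_mult mult_zero_left mult_zero_right)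
  qed
  have split: "(\<Sum>l\<in>I. h l) = h i + (\<Sum>l\<in>I-{i}. h l)" for h :: "'i \<Rightarrow> complex poly poly"
    by (rule sum.remove[OF fin assms(1)])
  have LLs: "sh (LL c v i) = blin 0 ?A ?B"
    unfolding sh_def LL_def bshift_simps by (rule arg_cong[where f = "\<lambda>s. blin s _ _"]) (simp add: algebra_simps)
  define QF where "QF = (\<Sum>l\<in>I-{i}. sh (blin (a l) 0 0 * blin (- xx l) 1 c * LL c v l * (\<Prod>j\<in>I-{l}. DD c j ^ 3)))"
  define QG where "QG = sh (blin (- w) 1 c * (\<Prod>j\<in>I. DD c j ^ 3)) +
     (\<Sum>l\<in>I-{i}. sh (blin (a l) 0 0 * blin (- tt l) 0 1 * LL c v l * (\<Prod>j\<in>I-{l}. DD c j ^ 3)))"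
  have oF: "ord_ge 3 QF"
    unfolding QF_def sh_def by (intro ord_ge_sum ord_term[of i]) (use assms d0 in auto)
  have "ord_ge (0 + 3) (sh (blin (- w) 1 c) * sh (\<Prod>j\<in>I. DD c j ^ 3))"
    unfolding sh_def by (intro ord_ge_mult ord_ge_0 ord_prod_DD[OF fin assms(1) d0])
  then have 1: "ord_ge 3 (sh (blin (- w) 1 c * (\<Prod>j\<in>I. DD c j ^ 3)))"
    unfolding sh_def bshift_simps(2) by simp
  have 2: "ord_ge 3 (\<Sum>l\<in>I-{i}. sh (blin (a l) 0 0 * blin (- tt l) 0 1 * LL c v l * (\<Prod>j\<in>I-{l}. DD c j ^ 3)))"
    unfolding sh_def by (intro ord_ge_sum ord_term[of i]) (use assms d0 in auto)
  have oG: "ord_ge 3 QG"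
    unfolding QG_def by (rule ord_ge_add[OF 1 2])
  have mult: "sh (A * B) = sh A * sh B" for A B
    by (simp only: sh_def bshift_simps(2))
  have c1: "sh (blin (a i) 0 0) = blin (a i) 0 0" "sh (blin (- xx i) 1 c) = blin 0 1 c" "sh (blin (- tt i) 0 1) = blin 0 0 1"
    by (simp_all add: sh_def bshift_simps(6))
  have "sh (FF c v) = sh (blin (a i) 0 0 * blin (- xx i) 1 c * LL c v i * (\<Prod>j\<in>I-{i}. DD c j ^ 3)) + QF"
    unfolding FF_def QF_def sh_def bshift_simps(4) by (rule split)
  then have eF: "sh (FF c v) = blin (a i) 0 0 * blin 0 1 c * blin 0 ?A ?B * sh (\<Prod>j\<in>I-{i}. DD c j ^ 3) + QF"
    by (simp only: mult c1 LLs)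
  have "sh (GG c v w) = sh (blin (- w) 1 c * (\<Prod>j\<in>I. DD c j ^ 3)) +
      (\<Sum>l\<in>I. sh (blin (a l) 0 0 * blin (- tt l) 0 1 * LL c v l * (\<Prod>j\<in>I-{l}. DD c j ^ 3)))"
    unfolding GG_def sh_def bshift_simps(1,4) ..
  also have "\<dots> = sh (blin (a i) 0 0 * blin (- tt i) 0 1 * LL c v i * (\<Prod>j\<in>I-{i}. DD c j ^ 3)) + QG"
    unfolding split QG_def by (simp only: add_ac)
  finally have eG: "sh (GG c v w) = blin (a i) 0 0 * blin 0 0 1 * blin 0 ?A ?B * sh (\<Prod>j\<in>I-{i}. DD c j ^ 3) + QG"
    by (simp only: mult c1 LLs)
  show ?thesis
  proof (rule that[of s])
    show "ord_ge 2 (sh (FF c v))" "ord_ge 2 (sh (GG c v w))"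
      unfolding eF eG using ord_ge_mono[OF oF, of 2] ord_ge_mono[OF oG, of 2] by (simp_all add: ord_ge_add main(1))
    show "poly (hform 2 (sh (FF c v))) s = 0" "poly (hform 2 (sh (GG c v w))) s = 0"
      unfolding eF eG hform_add using main(2) hform_ord_greater[OF oF] hform_ord_greater[OF oG] by simp_all
  qed
qed

section \<open>The resultant of the critical equations and the upper bound\<close>

definition mlt :: "complex \<times> complex \<Rightarrow> nat" where
  "mlt s = (if s \<in> Pts then 9 else if s \<in> Ept then 5 else 1)"

definition Rs :: "complex \<Rightarrow> ('i \<Rightarrow> complex) \<Rightarrow> complex \<Rightarrow> complex poly" where
  "Rs c v w = sylv (3 * k - 1) (3 * k + 1) (FF c v) (GG c v w)"

definition proj :: "complex \<Rightarrow> complex \<times> complex \<Rightarrow> complex" where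
  "proj c = (\<lambda>(x, t). x - c * t)"

definition NN :: nat where "NN = 9 * (k choose 2) + 4 * k - 2"

lemma kpos: "3 * k - 1 \<ge> 3" "3 * k + 1 \<ge> 3"
  using card2 by auto

lemma Rs_dvd:
  assumes "good c v" "(x, t) \<in> Pts \<union> Ept \<union> zeros v w"
  shows "[:- proj c (x, t), 1:] ^ mlt (x, t) dvd Rs c v w"
proof -
  consider "(x, t) \<in> Pts" | "(x, t) \<in> Ept" "(x, t) \<notin> Pts" | "(x, t) \<notin> Pts" "(x, t) \<notin> Ept" "(x, t) \<in> zeros v w"
    using assms by auto
  then show ?thesis
  proof cases
    case 1
    then show ?thesis
      using sylv_dvd_triple[OF tdeg_FF tdeg_GG kpos ord_Pts(1)[OF 1, of c v] ord_Pts(2)[OF 1, of c v]]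
      unfolding Rs_def by (simp add: mlt_def proj_def)
  next
    case 2
    then obtain i where i: "i \<in> I" "x = xx i" "t = tt i" by (auto simp: Ept_def)
    have k2: "3 * k - 1 \<ge> 2" "3 * k + 1 \<ge> 2" using kpos by auto
    obtain s where s: "ord_ge 2 (bshift (xx i - c * tt i) (tt i) (FF c v))" "ord_ge 2 (bshift (xx i - c * tt i) (tt i) (GG c v w))"
      "poly (hform 2 (bshift (xx i - c * tt i) (tt i) (FF c v))) s = 0"
      "poly (hform 2 (bshift (xx i - c * tt i) (tt i) (GG c v w))) s = 0"
      using ord_Ept[OF i(1) assms(1)] by blast
    show ?thesis
      using sylv_dvd_double[OF tdeg_FF tdeg_GG k2 s] 2 i unfolding Rs_def by (simp add: mlt_def proj_def)
  next
    case 3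
    have "poly (Rs c v w) (x - c * t) = 0"
      unfolding Rs_def
    proof (subst sylv_zero_iff[OF tdeg_FF tdeg_GG])
      show "coeff (coeff (FF c v) (3 * k - 1)) 0 \<noteq> 0"
        unfolding lead_FF using assms(1) by (simp add: good_def)
      show "\<exists>z. bev (FF c v) (x - c * t) z = 0 \<and> bev (GG c v w) (x - c * t) z = 0"
        using 3 by (intro exI[of _ t]) (simp add: bev_FF bev_GG zeros_def)
    qed (use kpos in auto)
    then show ?thesis
      using 3 by (simp add: mlt_def proj_def poly_eq_0_iff_dvd)
  qed
qed

lemma Rs_zero_iff:
  assumes "good c v"
  shows "poly (Rs c v w) y = 0 \<longleftrightarrow> (\<exists>t. (y + c * t, t) \<in> zeros v w)"
  unfolding Rs_def
proof (subst sylv_zero_iff[OF tdeg_FF tdeg_GG])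
  show "coeff (coeff (FF c v) (3 * k - 1)) 0 \<noteq> 0"
    unfolding lead_FF using assms(1) by (simp add: good_def)
qed (use kpos in \<open>auto simp: bev_FF bev_GG zeros_def\<close>)

lemma finite_zeros_iff:
  assumes "good c v"
  shows "finite (zeros v w) \<longleftrightarrow> Rs c v w \<noteq> 0"
proof -
  have l: "coeff (coeff (FF c v) (3 * k - 1)) 0 \<noteq> 0"
    unfolding lead_FF using assms(1) by (simp add: good_def)
  let ?Z = "{(y, z). bev (FF c v) y z = 0 \<and> bev (GG c v w) y z = 0}"
  have eq1: "zeros v w = (\<lambda>(y, z). (y + c * z, z)) ` ?Z"
  proof (intro equalityI subsetI)
    fix s assume "s \<in> zeros v w"
    then show "s \<in> (\<lambda>(y, z). (y + c * z, z)) ` ?Z"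
      by (intro image_eqI[of _ _ "(fst s - c * snd s, snd s)"]) (auto simp: bev_FF bev_GG zeros_def)
  qed (auto simp: bev_FF bev_GG zeros_def)
  have "inj_on (\<lambda>(y, z). (y + c * z, z)) ?Z"
    by (auto simp: inj_on_def)
  then have "finite (zeros v w) \<longleftrightarrow> finite ?Z"
    unfolding eq1 by (rule finite_image_iff)
  also have "\<dots> \<longleftrightarrow> Rs c v w \<noteq> 0"
    unfolding Rs_def using finite_zeros_iff_sylv[OF tdeg_FF tdeg_GG l] kpos by simp
  finally show ?thesis .
qed

lemma degree_Rs: "c \<noteq> 0 \<Longrightarrow> degree (Rs c v w) < (3 * k - 1) * (3 * k + 1)"
  unfolding Rs_def using kpos by (intro degree_sylv_less[OF tdeg_FF tdeg_GG _ _ hform_common_root]) auto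

lemma sum_mlt:
  assumes "finite S" "S \<inter> (Pts \<union> Ept) = {}"
  shows "(\<Sum>s\<in>S \<union> (Pts \<union> Ept). mlt s) = card S + 9 * (k choose 2) + 5 * k"
proof -
  have "(\<Sum>s\<in>S \<union> (Pts \<union> Ept). mlt s) = (\<Sum>s\<in>S. mlt s) + ((\<Sum>s\<in>Pts. mlt s) + (\<Sum>s\<in>Ept. mlt s))"
    using assms finite_Pts finite_Ept disj_Pts_Ept by (simp add: sum.union_disjoint)
  also have "(\<Sum>s\<in>S. mlt s) = (\<Sum>s\<in>S. 1)"
    using assms by (intro sum.cong) (auto simp: mlt_def)
  also have "(\<Sum>s\<in>Pts. mlt s) = (\<Sum>s\<in>Pts. 9)"
    by (intro sum.cong) (auto simp: mlt_def)
  also have "(\<Sum>s\<in>Ept. mlt s) = (\<Sum>s\<in>Ept. 5)"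
    using disj_Pts_Ept by (intro sum.cong) (auto simp: mlt_def)
  finally show ?thesis
    by (simp add: card_Pts card_Ept)
qed

lemma degree_prod_linear_powers:
  fixes m :: "'b \<Rightarrow> nat"
  shows "degree (\<Prod>s\<in>A. [:- f s, 1::complex:] ^ m s) = (\<Sum>s\<in>A. m s)"
  by (subst degree_prod_eq_sum_degree) (auto simp: degree_power_eq)

lemma pq_eq: "(3 * k - 1) * (3 * k + 1) = NN + 9 * (k choose 2) + 5 * k + 1"
proof -
  have c: "2 * (k choose 2) = k * (k - 1)"
    unfolding choose_two by (rule dvd_mult_div_cancel) (cases k, auto)
  obtain n where n: "k = Suc (Suc n)"
    using card2 by (metis Suc_le_D numeral_2_eq_2 Suc_le_mono)
  show ?thesis
    using c unfolding NN_def n by (simp add: algebra_simps)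
qed

text \<open>In a direction \<open>c\<close> that separates all points involved their factors of the
  resultant are coprime, so the multiplicities add up to at most its degree.\<close>

lemma card_genuine_le:
  assumes "finite (zeros v w)"
  shows "card (genuine v w) \<le> NN"
proof -
  let ?S = "genuine v w \<union> (Pts \<union> Ept)"
  have fing: "finite (genuine v w)"
    using finite_subset[OF genuine_subset assms] .
  then have finS: "finite ?S"
    using finite_Pts finite_Ept by simp
  have "finite ({c. \<not> good c v} \<union> {c. \<not> inj_on (\<lambda>(x, t). x - c * t) ?S})"
    using finite_bad finite_not_inj_projection[OF finS] by auto
  then obtain c where c: "good c v" "inj_on (proj c) ?S"
    using ex_new_if_finite[OF infinite_UNIV_char_0] unfolding proj_def by blast
  have R: "Rs c v w \<noteq> 0" using finite_zeros_iff[OF c(1)] assms by simp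
  have "(\<Prod>s\<in>?S. [:- proj c s, 1:] ^ mlt s) dvd Rs c v w"
  proof (rule prod_linear_powers_dvd[OF finS c(2)])
    fix s assume "s \<in> ?S"
    then show "[:- proj c s, 1:] ^ mlt s dvd Rs c v w"
      using Rs_dvd[OF c(1), of "fst s" "snd s" w] genuine_subset by auto
  qed
  then have "degree (\<Prod>s\<in>?S. [:- proj c s, 1:] ^ mlt s) \<le> degree (Rs c v w)"
    by (rule dvd_imp_degree_le[OF _ R])
  then have "(\<Sum>s\<in>?S. mlt s) \<le> degree (Rs c v w)"
    by (simp only: degree_prod_linear_powers)
  also have "\<dots> < (3 * k - 1) * (3 * k + 1)"
    using c(1) by (intro degree_Rs) (simp add: good_def)
  finally show ?thesis
    unfolding sum_mlt[OF fing disj_genuine] pq_eq by simp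
qed

end

section \<open>Persistence of nondegenerate zeros\<close>

text \<open>An invertible derivative, recorded through its inverse \<open>E\<close> in the form in
  which the Newton map of \<open>persistence\<close> uses it.\<close>

definition nondeg :: "(complex \<times> complex \<Rightarrow> complex \<times> complex) \<Rightarrow> complex \<times> complex \<Rightarrow> bool" where
  "nondeg \<phi> z \<longleftrightarrow> \<phi> z = 0 \<and> (\<exists>D E. (\<phi> has_derivative D) (at z) \<and> bounded_linear E \<and>
     (\<forall>h. E (D h) = h) \<and> (\<forall>y. E y = 0 \<longrightarrow> y = 0))"

lemma nondegI:
  assumes "\<phi> z = 0"
    and "((\<lambda>z. fst (\<phi> z)) has_derivative (\<lambda>h. A * fst h + B * snd h)) (at z)"
    and "((\<lambda>z. snd (\<phi> z)) has_derivative (\<lambda>h. C * fst h + D * snd h)) (at z)"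
    and det: "A * D - B * C \<noteq> 0"
  shows "nondeg \<phi> z"
proof -
  define E where "E p = ((D * fst p - B * snd p) / (A * D - B * C), (A * snd p - C * fst p) / (A * D - B * C))" for p
  have "((\<lambda>z. (fst (\<phi> z), snd (\<phi> z))) has_derivative (\<lambda>h. (A * fst h + B * snd h, C * fst h + D * snd h))) (at z)"
    by (rule has_derivative_Pair[OF assms(2,3)])
  then have "(\<phi> has_derivative (\<lambda>h. (A * fst h + B * snd h, C * fst h + D * snd h))) (at z)"
    by simp
  moreover have "bounded_linear E"
    unfolding E_def divide_inverse
    by (intro bounded_linear_Pair bounded_linear_mult_const bounded_linear_sub
        bounded_linear_const_mult bounded_linear_fst bounded_linear_snd)
  moreover have "E (A * fst h + B * snd h, C * fst h + D * snd h) = h" for h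
  proof -
    have "D * (A * fst h + B * snd h) - B * (C * fst h + D * snd h) = (A * D - B * C) * fst h"
      "A * (C * fst h + D * snd h) - C * (A * fst h + B * snd h) = (A * D - B * C) * snd h"
      by (simp_all add: algebra_simps)
    then show ?thesis using det by (simp add: E_def)
  qed
  moreover have "y = 0" if "E y = 0" for y
  proof -
    have e: "D * fst y - B * snd y = 0" "A * snd y - C * fst y = 0"
      using that det by (auto simp: E_def prod_eq_iff)
    have "(A * D - B * C) * fst y = A * (D * fst y - B * snd y) + B * (A * snd y - C * fst y)"
      "(A * D - B * C) * snd y = C * (D * fst y - B * snd y) + D * (A * snd y - C * fst y)"
      by (simp_all add: algebra_simps)
    then have "(A * D - B * C) * fst y = 0" "(A * D - B * C) * snd y = 0"
      unfolding e by simp_all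
    then show ?thesis using det by (simp add: prod_eq_iff)
  qed
  ultimately show ?thesis
    using assms(1) unfolding nondeg_def by blast
qed

text \<open>For small \<kappa> the Newton map \<open>z - E (\<Phi> \<kappa> z)\<close> sends a small
  ball into itself: the linearisation error at \<kappa> = 0 and the change of \<Phi> with \<kappa>
  each cost at most half the radius. Brouwer's theorem gives a fixed point, and the trivial kernel
  of \<open>E\<close> makes it a zero. Existence is enough, since the upper bound closes the
  count.\<close>

lemma persistence:
  fixes \<Phi> :: "complex \<Rightarrow> complex \<times> complex \<Rightarrow> complex \<times> complex"
  assumes cont: "continuous_on UNIV (\<lambda>p. \<Phi> (fst p) (snd p))"
    and nd: "nondeg (\<Phi> 0) z0" and "\<epsilon> > 0"
  shows "eventually (\<lambda>\<kappa>. \<exists>z\<in>cball z0 \<epsilon>. \<Phi> \<kappa> z = 0) (at 0)"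
proof -
  obtain D E where D: "(\<Phi> 0 has_derivative D) (at z0)" and E: "bounded_linear E"
    and ED: "\<And>h. E (D h) = h" and E0: "\<And>y. E y = 0 \<Longrightarrow> y = 0" and z0: "\<Phi> 0 z0 = 0"
    using nd unfolding nondeg_def by blast
  interpret E: bounded_linear E by fact
  obtain B where B: "B > 0" "\<And>y. norm (E y) \<le> norm y * B"
    using E.pos_bounded by blast
  have "\<exists>d>0. \<forall>y. norm (y - z0) < d \<longrightarrow> norm (\<Phi> 0 y - \<Phi> 0 z0 - D (y - z0)) \<le> 1 / (2 * B) * norm (y - z0)"
  proof -
    have "\<forall>e>0. \<exists>d>0. \<forall>y. norm (y - z0) < d \<longrightarrow> norm (\<Phi> 0 y - \<Phi> 0 z0 - D (y - z0)) \<le> e * norm (y - z0)"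
      using D unfolding has_derivative_at_alt by blast
    moreover have "1 / (2 * B) > 0" using B(1) by simp
    ultimately show ?thesis by blast
  qed
  then obtain d where d: "d > 0"
    "\<And>y. norm (y - z0) < d \<Longrightarrow> norm (\<Phi> 0 y - D (y - z0)) \<le> 1 / (2 * B) * norm (y - z0)"
    using z0 by auto
  define r where "r = min \<epsilon> (d / 2)"
  have r: "r > 0" "r \<le> \<epsilon>" "r < d" using d(1) \<open>\<epsilon> > 0\<close> by (auto simp: r_def)
  have "uniformly_continuous_on (cball 0 1 \<times> cball z0 r) (\<lambda>p. \<Phi> (fst p) (snd p))"
    by (intro compact_uniformly_continuous continuous_on_subset[OF cont] compact_Times compact_cball) auto
  then obtain \<rho> where \<rho>: "\<rho> > 0" "\<And>p p'. p \<in> cball 0 1 \<times> cball z0 r \<Longrightarrow> p' \<in> cball 0 1 \<times> cball z0 r \<Longrightarrow>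
      dist p' p < \<rho> \<Longrightarrow> dist (\<Phi> (fst p') (snd p')) (\<Phi> (fst p) (snd p)) < r / (2 * B)"
    unfolding uniformly_continuous_on_def using r(1) B(1) by (elim allE[of _ "r / (2 * B)"]) auto
  have "\<exists>z\<in>cball z0 \<epsilon>. \<Phi> \<kappa> z = 0" if \<kappa>: "dist \<kappa> 0 < min \<rho> 1" for \<kappa>
  proof -
    define g where "g z = z - E (\<Phi> \<kappa> z)" for z
    have "continuous_on UNIV (\<lambda>z. \<Phi> (fst (\<kappa>, z)) (snd (\<kappa>, z)))"
      by (rule continuous_on_compose2[OF cont]) (auto intro!: continuous_intros)
    then have "continuous_on (cball z0 r) g"
      unfolding g_def by (intro continuous_intros E.continuous_on) (auto intro: continuous_on_subset)
    moreover have "g ` cball z0 r \<subseteq> cball z0 r"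
    proof
      fix y assume "y \<in> g ` cball z0 r"
      then obtain z where z: "z \<in> cball z0 r" "y = g z" by auto
      have nz: "norm (z - z0) \<le> r" using z(1) by (simp add: dist_norm norm_minus_commute)
      have "norm (\<Phi> 0 z - D (z - z0)) \<le> 1 / (2 * B) * norm (z - z0)"
        using d(2) nz r(3) by simp
      also have "\<dots> \<le> 1 / (2 * B) * r" using nz B(1) by (intro mult_left_mono) auto
      finally have n1: "norm (\<Phi> 0 z - D (z - z0)) \<le> r / (2 * B)" by simp
      have "dist (\<Phi> (fst (\<kappa>, z)) (snd (\<kappa>, z))) (\<Phi> (fst (0, z)) (snd (0, z))) < r / (2 * B)"
        using \<rho>(2)[of "(0, z)" "(\<kappa>, z)"] \<kappa> z(1) by (simp add: dist_Pair_Pair dist_commute)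
      then have n2: "norm (\<Phi> \<kappa> z - \<Phi> 0 z) \<le> r / (2 * B)" by (simp add: dist_norm)
      have "z0 - y = E (\<Phi> \<kappa> z) - E (D (z - z0))"
        unfolding z(2) g_def ED by simp
      also have "\<dots> = E ((\<Phi> \<kappa> z - \<Phi> 0 z) + (\<Phi> 0 z - D (z - z0)))"
        by (simp add: E.diff[symmetric])
      finally have "norm (z0 - y) \<le> norm ((\<Phi> \<kappa> z - \<Phi> 0 z) + (\<Phi> 0 z - D (z - z0))) * B"
        using B(2) by simp
      also have "\<dots> \<le> (r / (2 * B) + r / (2 * B)) * B"
        using n1 n2 B(1) by (intro mult_right_mono norm_triangle_le add_mono) auto
      also have "\<dots> = r" using B(1) by simp
      finally show "y \<in> cball z0 r" by (simp add: dist_norm)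
    qed
    ultimately obtain z where "z \<in> cball z0 r" "g z = z"
      using brouwer_ball[OF r(1), of z0 g] by blast
    then have "z \<in> cball z0 \<epsilon>" "\<Phi> \<kappa> z = 0"
      using r(2) E0 by (auto simp: g_def)
    then show ?thesis by blast
  qed
  then show ?thesis
    unfolding eventually_at using \<rho>(1) by (intro exI[of _ "min \<rho> 1"]) auto
qed

lemma finite_separated:
  fixes Z :: "'a::metric_space set"
  assumes "finite Z"
  obtains \<epsilon> where "\<epsilon> > 0" "\<And>z z'. z \<in> Z \<Longrightarrow> z' \<in> Z \<Longrightarrow> z \<noteq> z' \<Longrightarrow> 2 * \<epsilon> < dist z z'"
proof -
  define S where "S = insert 1 ((\<lambda>(z, z'). dist z z') ` {p \<in> Z \<times> Z. fst p \<noteq> snd p})"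
  have S: "finite S" "S \<noteq> {}" "\<And>s. s \<in> S \<Longrightarrow> s > 0"
    using assms by (auto simp: S_def)
  then have pos: "Min S > 0" by simp
  show ?thesis
  proof (rule that[of "Min S / 3"])
    fix z z' assume "z \<in> Z" "z' \<in> Z" "z \<noteq> z'"
    then have "dist z z' \<in> S" unfolding S_def by force
    then have "Min S \<le> dist z z'" using S by simp
    then show "2 * (Min S / 3) < dist z z'" using pos by linarith
  qed (use pos in simp)
qed

text \<open>\<Phi> is the system in blown-up coordinates, and \<open>pnt \<kappa>\<close> leads back
  to the plane. The zeros of \<Phi> 0 are enclosed in disjoint balls, so their continuations stay
  distinct; the condition on \<open>U\<close> tells where the corresponding points of the original
  system lie.\<close>

lemma cluster:
  fixes \<Phi> pnt :: "complex \<Rightarrow> complex \<times> complex \<Rightarrow> complex \<times> complex"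
  assumes Z: "finite Z" "Z \<subseteq> W" "open W"
    and cont: "continuous_on UNIV (\<lambda>p. \<Phi> (fst p) (snd p))"
    and nd: "\<And>z. z \<in> Z \<Longrightarrow> nondeg (\<Phi> 0) z"
    and inj: "\<And>\<kappa>. \<kappa> \<noteq> 0 \<Longrightarrow> inj_on (pnt \<kappa>) W"
    and sol: "\<And>\<kappa> z. \<kappa> \<noteq> 0 \<Longrightarrow> z \<in> W \<Longrightarrow> \<Phi> \<kappa> z = 0 \<Longrightarrow> pnt \<kappa> z \<in> Sol \<kappa>"
    and U: "\<And>z. z \<in> Z \<Longrightarrow> eventually (\<lambda>p. fst p \<noteq> 0 \<longrightarrow> pnt (fst p) (snd p) \<in> U) (nhds (0, z))"
  shows "eventually (\<lambda>\<kappa>. \<exists>B. finite B \<and> card B = card Z \<and> B \<subseteq> Sol \<kappa> \<inter> U) (at 0)"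
proof -
  obtain \<epsilon> where \<epsilon>: "\<epsilon> > 0" "\<And>z z'. z \<in> Z \<Longrightarrow> z' \<in> Z \<Longrightarrow> z \<noteq> z' \<Longrightarrow> 2 * \<epsilon> < dist z z'"
    using finite_separated[OF Z(1)] by blast
  have "eventually (\<lambda>\<kappa>. \<exists>w\<in>cball z \<epsilon>. w \<in> W \<and> \<Phi> \<kappa> w = 0 \<and> pnt \<kappa> w \<in> U) (at 0)" if z: "z \<in> Z" for z
  proof -
    obtain d where d: "d > 0" "\<And>p. dist p (0, z) < d \<Longrightarrow> fst p \<noteq> 0 \<Longrightarrow> pnt (fst p) (snd p) \<in> U"
      using U[OF z] unfolding eventually_nhds_metric by blast
    obtain e where e: "e > 0" "cball z e \<subseteq> W"
      using Z(2,3) z unfolding open_contains_cball by blast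
    define r where "r = min \<epsilon> (min e (d / 3))"
    have r: "r > 0" "r \<le> \<epsilon>" "r \<le> e" "r \<le> d / 3" using \<epsilon>(1) e(1) d(1) by (auto simp: r_def)
    have "eventually (\<lambda>\<kappa>. dist \<kappa> 0 < d / 3 \<and> \<kappa> \<noteq> 0) (at (0::complex))"
      using d(1) by (auto simp: eventually_at intro!: exI[of _ "d / 3"])
    then show ?thesis
      using persistence[OF cont nd[OF z] r(1)]
    proof eventually_elim
      case (elim \<kappa>)
      then obtain w where w: "w \<in> cball z r" "\<Phi> \<kappa> w = 0" by blast
      have "dist (\<kappa>, w) (0, z) \<le> dist \<kappa> 0 + dist w z"
        unfolding dist_Pair_Pair by (rule sqrt_sum_squares_le_sum) auto
      also have "\<dots> < d" using elim w(1) r(4) d(1) by (simp add: dist_commute)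
      finally have "pnt \<kappa> w \<in> U" using d(2)[of "(\<kappa>, w)"] elim by simp
      then show ?case using w r e by (intro bexI[of _ w]) auto
    qed
  qed
  then have "eventually (\<lambda>\<kappa>. \<forall>z\<in>Z. \<exists>w\<in>cball z \<epsilon>. w \<in> W \<and> \<Phi> \<kappa> w = 0 \<and> pnt \<kappa> w \<in> U) (at 0)"
    using Z(1) by (simp add: eventually_ball_finite)
  moreover have "eventually (\<lambda>\<kappa>. \<kappa> \<noteq> 0) (at (0::complex))"
    by (simp add: eventually_at_filter)
  ultimately show ?thesis
  proof eventually_elim
    case (elim \<kappa>)
    then have "\<forall>z\<in>Z. \<exists>w. w \<in> cball z \<epsilon> \<and> w \<in> W \<and> \<Phi> \<kappa> w = 0 \<and> pnt \<kappa> w \<in> U"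
      by blast
    from bchoice[OF this] obtain f where
      f: "\<And>z. z \<in> Z \<Longrightarrow> f z \<in> cball z \<epsilon> \<and> f z \<in> W \<and> \<Phi> \<kappa> (f z) = 0 \<and> pnt \<kappa> (f z) \<in> U"
      by blast
    have "inj_on f Z"
    proof (rule inj_onI, rule ccontr)
      fix z z' assume "z \<in> Z" "z' \<in> Z" "f z = f z'" "z \<noteq> z'"
      then show False
        using f[of z] f[of z'] \<epsilon>(2)[of z z'] dist_triangle[of z z' "f z"] by (simp add: dist_commute)
    qed
    moreover have "inj_on (pnt \<kappa>) (f ` Z)"
      using inj[OF elim(2)] by (rule inj_on_subset) (use f in auto)
    ultimately have "card (pnt \<kappa> ` f ` Z) = card Z"
      by (simp add: card_image)
    moreover have "pnt \<kappa> ` f ` Z \<subseteq> Sol \<kappa> \<inter> U"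
    proof (intro subsetI, elim imageE, hypsubst)
      fix z assume "z \<in> Z"
      then show "pnt \<kappa> (f z) \<in> Sol \<kappa> \<inter> U"
        using f[of z] sol[OF elim(2), of "f z"] by blast
    qed
    ultimately show ?case
      using Z(1) by (intro exI[of _ "pnt \<kappa> ` f ` Z"]) simp
  qed
qed

lemma eventually_inverse_cube_large: "eventually (\<lambda>\<kappa>. norm (1 / \<kappa> ^ 3) > M) (at (0::complex))"
proof -
  have "((\<lambda>\<kappa>::complex. \<kappa> ^ 3) \<longlongrightarrow> 0) (at 0)"
    by (auto intro!: tendsto_eq_intros)
  then have "eventually (\<lambda>\<kappa>::complex. dist (\<kappa> ^ 3) 0 < 1 / (\<bar>M\<bar> + 1)) (at 0)"
    by (rule tendstoD) auto
  moreover have "eventually (\<lambda>\<kappa>. \<kappa> \<noteq> 0) (at (0::complex))"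
    by (simp add: eventually_at_filter)
  ultimately show ?thesis
  proof eventually_elim
    case (elim \<kappa>)
    then have "norm (\<kappa> ^ 3) > 0" "norm (\<kappa> ^ 3) * (\<bar>M\<bar> + 1) < 1" by (simp_all add: field_simps)
    then have "\<bar>M\<bar> + 1 < 1 / norm (\<kappa> ^ 3)" by (simp add: field_simps)
    then show ?case by (simp add: norm_divide)
  qed
qed

text \<open>If \<open>t\<close> is a multiple root for the parameter \<beta>, then \<beta> is the
  value of \<open>- P / Q\<close> at \<open>t\<close>, and \<open>t\<close> is a zero of the
  Wronskian \<open>V\<close>. At the simple zero \<open>r\<close> of \<open>Q\<close> the Wronskian
  takes the value of \<open>- P * pderiv Q\<close>, so it is not the zero polynomial and only
  finitely many \<beta> occur.\<close>

lemma finite_nonsquarefree_pencil: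
  fixes P Q :: "complex poly"
  assumes ncr: "\<And>t. poly P t = 0 \<Longrightarrow> poly Q t \<noteq> 0" and r: "poly Q r = 0" "poly (pderiv Q) r \<noteq> 0"
  shows "finite {\<beta>. \<not> rsquarefree (P + Polynomial.smult \<beta> Q)}"
proof -
  define V where "V = pderiv P * Q - P * pderiv Q"
  have "poly V r \<noteq> 0" using ncr r by (auto simp: V_def)
  then have "V \<noteq> 0" by auto
  have "{\<beta>. \<not> rsquarefree (P + Polynomial.smult \<beta> Q)} \<subseteq> (\<lambda>t. - poly P t / poly Q t) ` {t. poly V t = 0}"
  proof
    fix \<beta> assume "\<beta> \<in> {\<beta>. \<not> rsquarefree (P + Polynomial.smult \<beta> Q)}"
    then obtain t where t: "poly P t + \<beta> * poly Q t = 0" "poly (pderiv P) t + \<beta> * poly (pderiv Q) t = 0"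
      unfolding rsquarefree_roots by (auto simp: pderiv_add pderiv_smult)
    have Qt: "poly Q t \<noteq> 0"
    proof
      assume "poly Q t = 0"
      then show False using t(1) ncr[of t] by simp
    qed
    have "poly V t = (poly (pderiv P) t + \<beta> * poly (pderiv Q) t) * poly Q t - (poly P t + \<beta> * poly Q t) * poly (pderiv Q) t"
      by (simp add: V_def algebra_simps)
    then have "poly V t = 0" unfolding t by simp
    moreover have "\<beta> = - poly P t / poly Q t"
      using t(1) Qt by (simp add: field_simps add_eq_0_iff)
    ultimately show "\<beta> \<in> (\<lambda>t. - poly P t / poly Q t) ` {t. poly V t = 0}" by blast
  qed
  then show ?thesis
    using poly_roots_finite[OF \<open>V \<noteq> 0\<close>] finite_surj by blast
qed

lemma rsquarefree_card_roots:
  fixes Q :: "complex poly"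
  assumes "rsquarefree Q" shows "card {x. poly Q x = 0} = degree Q"
proof -
  have Q: "Q \<noteq> 0" using assms by (auto simp: rsquarefree_def)
  have "Polynomial.smult (lead_coeff Q) (\<Prod>z | poly Q z = 0. [:-z, 1:]) = Q"
    using assms by (rule complex_poly_decompose_rsquarefree)
  then have "degree Q = degree (Polynomial.smult (lead_coeff Q) (\<Prod>z | poly Q z = 0. [:-z, 1:]))"
    by simp
  also have "\<dots> = card {x. poly Q x = 0}"
    using Q by (simp add: degree_prod_eq_sum_degree)
  finally show ?thesis ..
qed

lemma eventually_nhds_cont:
  fixes f :: "'a::topological_space \<Rightarrow> 'b::topological_space"
  assumes "continuous_on UNIV f" "open S" "f a \<in> S"
  shows "eventually (\<lambda>x. f x \<in> S) (nhds a)"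
proof -
  have "(f \<longlongrightarrow> f a) (nhds a)"
    using assms(1) unfolding tendsto_at_iff_tendsto_nhds[symmetric] by (simp add: continuous_on_def)
  then show ?thesis
    using assms(2,3) by (rule topological_tendstoD)
qed

subsection \<open>Critical points for a large last coordinate\<close>

context plane_system
begin

text \<open>The part common to both equations. Splitting off one or two summands exhibits the powers
  of the pole-line factors, hence the powers of \<kappa> that are divided out in the
  blow-ups.\<close>

definition nsum :: "('i \<Rightarrow> complex) \<Rightarrow> complex \<Rightarrow> complex \<Rightarrow> complex" where
  "nsum h x t = (\<Sum>i\<in>I. h i * (\<Prod>j\<in>I-{i}. dd j x t ^ 3))"

definition hF :: "('i \<Rightarrow> complex) \<Rightarrow> complex \<Rightarrow> complex \<Rightarrow> 'i \<Rightarrow> complex" where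
  "hF v x t i = a i * (x - xx i) * (a i * (x - xx i) - v i * dd i x t)"

definition hG :: "('i \<Rightarrow> complex) \<Rightarrow> complex \<Rightarrow> complex \<Rightarrow> 'i \<Rightarrow> complex" where
  "hG v x t i = a i * (t - tt i) * (a i * (x - xx i) - v i * dd i x t)"

lemma fh_nsum: "fh v x t = nsum (hF v x t) x t"
  by (simp add: fh_def nsum_def hF_def)

lemma gh_nsum: "gh v w x t = (x - w) * (\<Prod>j\<in>I. dd j x t ^ 3) + nsum (hG v x t) x t"
  by (simp add: gh_def nsum_def hG_def)

lemma nsum_split1:
  assumes "i \<in> I"
  shows "nsum h x t = h i * (\<Prod>j\<in>I-{i}. dd j x t ^ 3) +
    dd i x t ^ 3 * (\<Sum>l\<in>I-{i}. h l * (\<Prod>m\<in>I-{l}-{i}. dd m x t ^ 3))"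
proof -
  have "nsum h x t = h i * (\<Prod>j\<in>I-{i}. dd j x t ^ 3) + (\<Sum>l\<in>I-{i}. h l * (\<Prod>j\<in>I-{l}. dd j x t ^ 3))"
    unfolding nsum_def by (rule sum.remove[OF fin assms])
  also have "(\<Sum>l\<in>I-{i}. h l * (\<Prod>j\<in>I-{l}. dd j x t ^ 3)) =
      (\<Sum>l\<in>I-{i}. dd i x t ^ 3 * (h l * (\<Prod>m\<in>I-{l}-{i}. dd m x t ^ 3)))"
  proof (rule sum.cong)
    fix l assume "l \<in> I - {i}"
    then have "(\<Prod>j\<in>I-{l}. dd j x t ^ 3) = dd i x t ^ 3 * (\<Prod>m\<in>I-{l}-{i}. dd m x t ^ 3)"
      using fin assms by (intro prod.remove) auto
    then show "h l * (\<Prod>j\<in>I-{l}. dd j x t ^ 3) = dd i x t ^ 3 * (h l * (\<Prod>m\<in>I-{l}-{i}. dd m x t ^ 3))"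
      by simp
  qed simp
  finally show ?thesis by (simp only: sum_distrib_left)
qed

lemma nsum_split2:
  assumes "i \<in> I" "j \<in> I" "i \<noteq> j"
  shows "nsum h x t = (h i * dd j x t ^ 3 + h j * dd i x t ^ 3) * (\<Prod>l\<in>I-{i}-{j}. dd l x t ^ 3) +
    dd i x t ^ 3 * dd j x t ^ 3 * (\<Sum>l\<in>I-{i}-{j}. h l * (\<Prod>m\<in>I-{l}-{i}-{j}. dd m x t ^ 3))"
proof -
  have 1: "(\<Prod>l\<in>I-{i}. dd l x t ^ 3) = dd j x t ^ 3 * (\<Prod>l\<in>I-{i}-{j}. dd l x t ^ 3)"
    using fin assms by (intro prod.remove) auto
  have 2: "(\<Sum>l\<in>I-{i}. h l * (\<Prod>m\<in>I-{l}-{i}. dd m x t ^ 3)) =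
     h j * (\<Prod>m\<in>I-{j}-{i}. dd m x t ^ 3) + (\<Sum>l\<in>I-{i}-{j}. h l * (\<Prod>m\<in>I-{l}-{i}. dd m x t ^ 3))"
    using fin assms by (intro sum.remove) auto
  have 3: "I - {j} - {i} = I - {i} - {j}" by auto
  have "(\<Sum>l\<in>I-{i}-{j}. h l * (\<Prod>m\<in>I-{l}-{i}. dd m x t ^ 3)) =
      (\<Sum>l\<in>I-{i}-{j}. dd j x t ^ 3 * (h l * (\<Prod>m\<in>I-{l}-{i}-{j}. dd m x t ^ 3)))"
  proof (rule sum.cong)
    fix l assume "l \<in> I - {i} - {j}"
    then have "(\<Prod>m\<in>I-{l}-{i}. dd m x t ^ 3) = dd j x t ^ 3 * (\<Prod>m\<in>I-{l}-{i}-{j}. dd m x t ^ 3)"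
      using fin assms by (intro prod.remove) auto
    then show "h l * (\<Prod>m\<in>I-{l}-{i}. dd m x t ^ 3) = dd j x t ^ 3 * (h l * (\<Prod>m\<in>I-{l}-{i}-{j}. dd m x t ^ 3))"
      by simp
  qed simp
  then have 4: "(\<Sum>l\<in>I-{i}-{j}. h l * (\<Prod>m\<in>I-{l}-{i}. dd m x t ^ 3)) =
      dd j x t ^ 3 * (\<Sum>l\<in>I-{i}-{j}. h l * (\<Prod>m\<in>I-{l}-{i}-{j}. dd m x t ^ 3))"
    by (simp only: sum_distrib_left)
  show ?thesis
    unfolding nsum_split1[OF assms(1)] 1 2 3 4 by (simp add: algebra_simps)
qed

lemma dd_add: "dd l (p + \<kappa> * \<xi>) (q + \<kappa> * \<eta>) = dd l p q + \<kappa> * (\<eta> - al l * \<xi>)"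
  by (simp add: dd_def algebra_simps)

text \<open>With \<open>w = 1 / \<kappa> ^ 3\<close>, \<open>dd i = \<kappa> * X\<close> and
  \<open>dd j = \<kappa> * Y\<close>, the term with \<open>w\<close> and the two dominant summands
  of \<open>nsum\<close> all have order \<open>\<kappa> ^ 3\<close>. Dividing by it gives the limit
  system \<open>\<alpha> * X^3 + \<beta> * Y^3 = 0\<close>,
  \<open>\<gamma> * Y^3 + \<delta> * X^3 = X^3 * Y^3\<close>, up to the nonzero factor
  \<open>P0\<close>. It has nine solutions other than the origin, all nondegenerate.\<close>

lemma cluster_Pts:
  assumes pq: "(p, q) \<in> Pts" and "e > 0"
  shows "eventually (\<lambda>\<kappa>. \<exists>B. finite B \<and> card B = 9 \<and>
    B \<subseteq> zeros v (1 / \<kappa> ^ 3) \<inter> (ball (p, q) e - {(p, q)})) (at 0)"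
proof -
  obtain i j where ij: "i \<in> I" "j \<in> I" "i \<noteq> j" and d0: "dd i p q = 0" "dd j p q = 0"
    using pq by (auto simp: Pts_def)
  have s: "al j - al i \<noteq> 0" using al_inj ij by (auto simp: inj_on_def)
  define s' where "s' = 1 / (al j - al i)"
  have s': "s' * (al j - al i) = 1" using s by (simp add: s'_def)
  have Xi: "p \<noteq> xx i"
  proof
    assume "p = xx i"
    moreover from this have "q = tt i" using d0(1) by (simp add: dd_def)
    ultimately show False using dd_Ept[OF ij(2,1)] d0(2) ij(3) by simp
  qed
  have Xj: "p \<noteq> xx j"
  proof
    assume "p = xx j"
    moreover from this have "q = tt j" using d0(2) by (simp add: dd_def)
    ultimately show False using dd_Ept[OF ij(1,2)] d0(1) ij(3) by simp
  qed
  \<comment> \<open>The inverse of the linear change from \<open>(x, t)\<close> to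
    \<open>(dd i, dd j)\<close>, scaled by \<kappa>; \<open>di\<close> and \<open>dj\<close> confirm
    it.\<close>
  define xk where "xk \<kappa> z = p + \<kappa> * ((fst z - snd z) * s')" for \<kappa> and z :: "complex \<times> complex"
  define tk where "tk \<kappa> z = q + \<kappa> * (fst z + al i * ((fst z - snd z) * s'))" for \<kappa> and z :: "complex \<times> complex"
  have di: "dd i (xk \<kappa> z) (tk \<kappa> z) = \<kappa> * fst z" for \<kappa> z
    unfolding xk_def tk_def dd_add d0 by (simp add: algebra_simps)
  have dj: "dd j (xk \<kappa> z) (tk \<kappa> z) = \<kappa> * snd z" for \<kappa> z
  proof -
    have "fst z + al i * ((fst z - snd z) * s') - al j * ((fst z - snd z) * s') = fst z - (fst z - snd z) * (s' * (al j - al i))"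
      by (simp add: algebra_simps)
    then show ?thesis unfolding xk_def tk_def dd_add d0 s' by simp
  qed
  define PP where "PP \<kappa> z = (\<Prod>l\<in>I-{i}-{j}. dd l (xk \<kappa> z) (tk \<kappa> z) ^ 3)" for \<kappa> z
  define SS where "SS h \<kappa> z = (\<Sum>l\<in>I-{i}-{j}. h v (xk \<kappa> z) (tk \<kappa> z) l * (\<Prod>m\<in>I-{l}-{i}-{j}. dd m (xk \<kappa> z) (tk \<kappa> z) ^ 3))"
    for h :: "('i \<Rightarrow> complex) \<Rightarrow> complex \<Rightarrow> complex \<Rightarrow> 'i \<Rightarrow> complex" and \<kappa> z
  define NS where "NS h \<kappa> z = (h v (xk \<kappa> z) (tk \<kappa> z) i * snd z ^ 3 + h v (xk \<kappa> z) (tk \<kappa> z) j * fst z ^ 3) * PP \<kappa> z +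
      \<kappa> ^ 3 * fst z ^ 3 * snd z ^ 3 * SS h \<kappa> z"
    for h :: "('i \<Rightarrow> complex) \<Rightarrow> complex \<Rightarrow> complex \<Rightarrow> 'i \<Rightarrow> complex" and \<kappa> z
  have NS: "nsum (h v (xk \<kappa> z) (tk \<kappa> z)) (xk \<kappa> z) (tk \<kappa> z) = \<kappa> ^ 3 * NS h \<kappa> z" for h \<kappa> z
    unfolding nsum_split2[OF ij] di dj NS_def PP_def SS_def by (simp add: power_mult_distrib algebra_simps)
  have PI: "(\<Prod>l\<in>I. dd l (xk \<kappa> z) (tk \<kappa> z) ^ 3) = \<kappa> ^ 3 * \<kappa> ^ 3 * fst z ^ 3 * snd z ^ 3 * PP \<kappa> z" for \<kappa> z
  proof -
    have "(\<Prod>l\<in>I. dd l (xk \<kappa> z) (tk \<kappa> z) ^ 3) = dd i (xk \<kappa> z) (tk \<kappa> z) ^ 3 * (dd j (xk \<kappa> z) (tk \<kappa> z) ^ 3 * PP \<kappa> z)"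
      unfolding PP_def using fin ij by (simp add: prod.remove[of I i] prod.remove[of "I - {i}" j])
    then show ?thesis unfolding di dj by (simp add: power_mult_distrib algebra_simps)
  qed
  define \<Phi> where "\<Phi> \<kappa> z = (NS hF \<kappa> z, (\<kappa> ^ 3 * xk \<kappa> z - 1) * fst z ^ 3 * snd z ^ 3 * PP \<kappa> z + NS hG \<kappa> z)" for \<kappa> z
  define \<alpha> \<beta> \<gamma> \<delta> P0 where "\<alpha> = hF v p q j" and "\<beta> = hF v p q i" and "\<gamma> = hG v p q i" and "\<delta> = hG v p q j"
    and "P0 = (\<Prod>l\<in>I-{i}-{j}. dd l p q ^ 3)"
  have P0: "P0 \<noteq> 0"
    unfolding P0_def using no3[OF ij(1,2) _ ij(3)] d0 fin by (auto simp: dd_def)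
  have \<Phi>0: "\<Phi> 0 z = ((\<beta> * snd z ^ 3 + \<alpha> * fst z ^ 3) * P0,
      (\<gamma> * snd z ^ 3 + \<delta> * fst z ^ 3 - fst z ^ 3 * snd z ^ 3) * P0)" for z
    by (simp add: \<Phi>_def NS_def PP_def xk_def tk_def \<alpha>_def \<beta>_def \<gamma>_def \<delta>_def P0_def algebra_simps)
  have ab: "\<alpha> \<noteq> 0" "\<beta> \<noteq> 0"
    using Xi Xj d0 a_nz ij by (auto simp: \<alpha>_def \<beta>_def hF_def)
  have "q - tt i = al i * (p - xx i)" "q - tt j = al j * (p - xx j)"
    using d0 by (simp_all add: dd_def)
  then have hh: "\<alpha> = a j * (p - xx j) * (a j * (p - xx j))" "\<beta> = a i * (p - xx i) * (a i * (p - xx i))"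
    "\<gamma> = a i * (al i * (p - xx i)) * (a i * (p - xx i))" "\<delta> = a j * (al j * (p - xx j)) * (a j * (p - xx j))"
    using d0 by (simp_all add: \<alpha>_def \<beta>_def \<gamma>_def \<delta>_def hF_def hG_def)
  have "\<alpha> * \<gamma> - \<beta> * \<delta> = (a i * a j * (p - xx i) * (p - xx j))^2 * (al i - al j)"
    unfolding hh by (simp add: power2_eq_square algebra_simps)
  then have \<Delta>: "\<alpha> * \<gamma> - \<beta> * \<delta> \<noteq> 0"
    using Xi Xj a_nz ij s by auto
  \<comment> \<open>The values of \<open>X ^ 3\<close> and \<open>Y ^ 3\<close> in the limit system,
    which becomes linear in their reciprocals after division by
    \<open>X ^ 3 * Y ^ 3\<close>.\<close>
  define P Q where "P = (\<alpha> * \<gamma> - \<beta> * \<delta>) / \<alpha>" and "Q = - (\<alpha> * \<gamma> - \<beta> * \<delta>) / \<beta>"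
  have PQ: "P \<noteq> 0" "Q \<noteq> 0" "\<alpha> * P = \<alpha> * \<gamma> - \<beta> * \<delta>" "\<beta> * Q = - (\<alpha> * \<gamma> - \<beta> * \<delta>)"
    using ab \<Delta> by (simp_all add: P_def Q_def)
  have PQ2: "\<gamma> * Q + \<delta> * P - P * Q = 0"
  proof -
    have "\<alpha> * \<beta> * (\<gamma> * Q + \<delta> * P - P * Q) = \<alpha> * \<gamma> * (\<beta> * Q) + \<beta> * \<delta> * (\<alpha> * P) - (\<alpha> * P) * (\<beta> * Q)"
      by (simp add: algebra_simps)
    also have "\<dots> = 0" unfolding PQ(3,4) by (simp add: algebra_simps)
    finally show ?thesis using ab by simp
  qed
  let ?Z = "{X. X ^ 3 = P} \<times> {Y. Y ^ 3 = Q}"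
  have cZ: "card ?Z = 9" "finite ?Z"
    using card_nth_roots[of P 3] card_nth_roots[of Q 3] finite_nth_roots[of 3] PQ by (auto simp: card_cartesian_product)
  have nd: "nondeg (\<Phi> 0) z" if z: "z \<in> ?Z" for z
  proof (rule nondegI)
    have z3: "fst z ^ 3 = P" "snd z ^ 3 = Q" using z by auto
    then have nz: "fst z \<noteq> 0" "snd z \<noteq> 0" using PQ by auto
    show "\<Phi> 0 z = 0"
      unfolding \<Phi>0 z3 PQ2 PQ(3,4) by (simp add: zero_prod_def)
    show "((\<lambda>z. fst (\<Phi> 0 z)) has_derivative
        (\<lambda>h. (3 * \<alpha> * fst z ^ 2 * P0) * fst h + (3 * \<beta> * snd z ^ 2 * P0) * snd h)) (at z)"
      unfolding \<Phi>0 fst_conv by (auto intro!: derivative_eq_intros ext simp: algebra_simps)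
    show "((\<lambda>z. snd (\<Phi> 0 z)) has_derivative
        (\<lambda>h. (3 * (\<delta> - snd z ^ 3) * fst z ^ 2 * P0) * fst h + (3 * (\<gamma> - fst z ^ 3) * snd z ^ 2 * P0) * snd h)) (at z)"
      unfolding \<Phi>0 snd_conv by (auto intro!: derivative_eq_intros ext simp: algebra_simps)
    have "(3 * \<alpha> * fst z ^ 2 * P0) * (3 * (\<gamma> - fst z ^ 3) * snd z ^ 2 * P0) - (3 * \<beta> * snd z ^ 2 * P0) * (3 * (\<delta> - snd z ^ 3) * fst z ^ 2 * P0)
       = 9 * P0 ^ 2 * fst z ^ 2 * snd z ^ 2 * (\<alpha> * \<gamma> - \<alpha> * fst z ^ 3 - \<beta> * \<delta> + \<beta> * snd z ^ 3)"
      by (simp add: power2_eq_square algebra_simps)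
    also have "\<alpha> * \<gamma> - \<alpha> * fst z ^ 3 - \<beta> * \<delta> + \<beta> * snd z ^ 3 = - (\<alpha> * \<gamma> - \<beta> * \<delta>)"
      unfolding z3 PQ(3,4) by simp
    finally show "(3 * \<alpha> * fst z ^ 2 * P0) * (3 * (\<gamma> - fst z ^ 3) * snd z ^ 2 * P0) -
        (3 * \<beta> * snd z ^ 2 * P0) * (3 * (\<delta> - snd z ^ 3) * fst z ^ 2 * P0) \<noteq> 0"
      using P0 nz \<Delta> by simp
  qed
  have contpnt: "continuous_on UNIV (\<lambda>p. (xk (fst p) (snd p), tk (fst p) (snd p)))"
    unfolding xk_def tk_def by (intro continuous_intros)
  have "eventually (\<lambda>\<kappa>. \<exists>B. finite B \<and> card B = card ?Z \<and>
     B \<subseteq> zeros v (1 / \<kappa> ^ 3) \<inter> (ball (p, q) e - {(p, q)})) (at 0)"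
  proof (rule cluster[where W = "- {0}" and \<Phi> = \<Phi> and pnt = "\<lambda>\<kappa> z. (xk \<kappa> z, tk \<kappa> z)"])
    show "continuous_on UNIV (\<lambda>p. \<Phi> (fst p) (snd p))"
      unfolding \<Phi>_def NS_def PP_def SS_def xk_def tk_def hF_def hG_def dd_def
      by (intro continuous_intros continuous_on_prod)
    fix \<kappa> :: complex assume \<kappa>: "\<kappa> \<noteq> 0"
    show "inj_on (\<lambda>z. (xk \<kappa> z, tk \<kappa> z)) (- {0})"
    proof (rule inj_onI)
      fix z z' assume "(xk \<kappa> z, tk \<kappa> z) = (xk \<kappa> z', tk \<kappa> z')"
      then have "\<kappa> * fst z = \<kappa> * fst z'" "\<kappa> * snd z = \<kappa> * snd z'"
        using di[of \<kappa> z] di[of \<kappa> z'] dj[of \<kappa> z] dj[of \<kappa> z'] by auto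
      then show "z = z'" using \<kappa> by (simp add: prod_eq_iff)
    qed
    fix z assume "\<Phi> \<kappa> z = 0"
    then have ph: "NS hF \<kappa> z = 0" "(\<kappa> ^ 3 * xk \<kappa> z - 1) * fst z ^ 3 * snd z ^ 3 * PP \<kappa> z + NS hG \<kappa> z = 0"
      by (simp_all add: \<Phi>_def prod_eq_iff)
    have "gh v (1 / \<kappa> ^ 3) (xk \<kappa> z) (tk \<kappa> z) =
        \<kappa> ^ 3 * ((\<kappa> ^ 3 * xk \<kappa> z - 1) * fst z ^ 3 * snd z ^ 3 * PP \<kappa> z + NS hG \<kappa> z)"
      unfolding gh_nsum NS PI using \<kappa> by (simp add: field_simps)
    then show "(xk \<kappa> z, tk \<kappa> z) \<in> zeros v (1 / \<kappa> ^ 3)"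
      unfolding zeros_def fh_nsum by (simp add: NS ph)
  next
    fix z assume z: "z \<in> ?Z"
    have "eventually (\<lambda>p'. (xk (fst p') (snd p'), tk (fst p') (snd p')) \<in> ball (p, q) e) (nhds (0, z))"
      by (rule eventually_nhds_cont[OF contpnt]) (use \<open>e > 0\<close> in \<open>auto simp: xk_def tk_def\<close>)
    moreover have "eventually (\<lambda>p'. snd p' \<in> - {0}) (nhds (0::complex, z))"
      by (rule eventually_nhds_cont) (use z PQ in \<open>auto intro!: continuous_intros simp: zero_prod_def\<close>)
    ultimately show "eventually (\<lambda>p'. fst p' \<noteq> 0 \<longrightarrow> (xk (fst p') (snd p'), tk (fst p') (snd p')) \<in> ball (p, q) e - {(p, q)}) (nhds (0, z))"
    proof eventually_elim
      case (elim p')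
      have "(xk (fst p') (snd p'), tk (fst p') (snd p')) \<noteq> (p, q)" if "fst p' \<noteq> 0"
      proof
        assume "(xk (fst p') (snd p'), tk (fst p') (snd p')) = (p, q)"
        then have "fst p' * fst (snd p') = 0" "fst p' * snd (snd p') = 0"
          using di[of "fst p'" "snd p'"] dj[of "fst p'" "snd p'"] d0 by auto
        then show False using that elim(2) by (simp add: prod_eq_iff)
      qed
      then show ?case using elim(1) by simp
    qed
  qed (use cZ nd PQ in \<open>auto simp: zero_prod_def\<close>)
  then show ?thesis using cZ(1) by simp
qed

text \<open>Here both coordinates are scaled by \<open>\<kappa> ^ 3\<close>, so that the double
  point of \<open>nsum\<close>, of order \<open>\<kappa> ^ 6\<close>, balances
  \<open>w * dd i ^ 3\<close>. In the limit the line \<open>X = 0\<close> meets the second curve at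
  \<open>T = - a i * v i\<close> besides the origin; this zero is nondegenerate because
  \<open>v i\<close> is nonzero.\<close>

lemma cluster_Ept:
  assumes i: "i \<in> I" and v: "v i \<noteq> 0" and "e > 0"
  shows "eventually (\<lambda>\<kappa>. \<exists>B. finite B \<and> card B = 1 \<and>
    B \<subseteq> zeros v (1 / \<kappa> ^ 3) \<inter> (ball (xx i, tt i) e - {(xx i, tt i)})) (at 0)"
proof -
  define xk where "xk \<kappa> z = xx i + \<kappa> ^ 3 * fst z" for \<kappa> and z :: "complex \<times> complex"
  define tk where "tk \<kappa> z = tt i + \<kappa> ^ 3 * snd z" for \<kappa> and z :: "complex \<times> complex"
  have d0: "dd i (xx i) (tt i) = 0" by (simp add: dd_def)
  have di: "dd i (xk \<kappa> z) (tk \<kappa> z) = \<kappa> ^ 3 * (snd z - al i * fst z)" for \<kappa> z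
    unfolding xk_def tk_def dd_add d0 by simp
  define PP where "PP \<kappa> z = (\<Prod>l\<in>I-{i}. dd l (xk \<kappa> z) (tk \<kappa> z) ^ 3)" for \<kappa> z
  define SS where "SS h \<kappa> z = (\<Sum>l\<in>I-{i}. h v (xk \<kappa> z) (tk \<kappa> z) l * (\<Prod>m\<in>I-{l}-{i}. dd m (xk \<kappa> z) (tk \<kappa> z) ^ 3))"
    for h :: "('i \<Rightarrow> complex) \<Rightarrow> complex \<Rightarrow> complex \<Rightarrow> 'i \<Rightarrow> complex" and \<kappa> z
  define \<Phi> where "\<Phi> \<kappa> z =
     (a i * fst z * (a i * fst z - v i * (snd z - al i * fst z)) * PP \<kappa> z + \<kappa> ^ 3 * (snd z - al i * fst z) ^ 3 * SS hF \<kappa> z,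
      (\<kappa> ^ 3 * xk \<kappa> z - 1) * (snd z - al i * fst z) ^ 3 * PP \<kappa> z +
      a i * snd z * (a i * fst z - v i * (snd z - al i * fst z)) * PP \<kappa> z + \<kappa> ^ 3 * (snd z - al i * fst z) ^ 3 * SS hG \<kappa> z)" for \<kappa> z
  have F: "fh v (xk \<kappa> z) (tk \<kappa> z) = \<kappa> ^ 3 * \<kappa> ^ 3 * fst (\<Phi> \<kappa> z)" for \<kappa> z
  proof -
    have e: "hF v (xk \<kappa> z) (tk \<kappa> z) i = \<kappa> ^ 3 * \<kappa> ^ 3 * (a i * fst z * (a i * fst z - v i * (snd z - al i * fst z)))"
      unfolding hF_def di by (simp add: xk_def algebra_simps)
    show ?thesis
      unfolding fh_nsum nsum_split1[OF i] di \<Phi>_def fst_conv PP_def[symmetric] SS_def[symmetric] e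
      by (simp add: power_mult_distrib algebra_simps power3_eq_cube)
  qed
  have G: "gh v (1 / \<kappa> ^ 3) (xk \<kappa> z) (tk \<kappa> z) = \<kappa> ^ 3 * \<kappa> ^ 3 * snd (\<Phi> \<kappa> z)" if "\<kappa> \<noteq> 0" for \<kappa> z
  proof -
    have "hG v (xk \<kappa> z) (tk \<kappa> z) i = \<kappa> ^ 3 * \<kappa> ^ 3 * (a i * snd z * (a i * fst z - v i * (snd z - al i * fst z)))"
      unfolding hG_def di by (simp add: xk_def tk_def algebra_simps)
    moreover have "(\<Prod>l\<in>I. dd l (xk \<kappa> z) (tk \<kappa> z) ^ 3) = (\<kappa> ^ 3 * (snd z - al i * fst z)) ^ 3 * PP \<kappa> z"
      unfolding PP_def di[symmetric] by (rule prod.remove[OF fin i])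
    moreover have "(xk \<kappa> z - 1 / \<kappa> ^ 3) * \<kappa> ^ 3 = \<kappa> ^ 3 * xk \<kappa> z - 1"
      using that by (simp add: field_simps)
    then have "(xk \<kappa> z - 1 / \<kappa> ^ 3) * ((\<kappa> ^ 3 * (snd z - al i * fst z)) ^ 3 * PP \<kappa> z) =
       \<kappa> ^ 3 * \<kappa> ^ 3 * ((\<kappa> ^ 3 * xk \<kappa> z - 1) * (snd z - al i * fst z) ^ 3 * PP \<kappa> z)"
      by (simp add: power_mult_distrib power3_eq_cube mult_ac)
    ultimately show ?thesis
      unfolding gh_nsum nsum_split1[OF i] di \<Phi>_def snd_conv PP_def[symmetric] SS_def[symmetric]
      by (simp add: power_mult_distrib distrib_left power3_eq_cube mult_ac)
  qed
  define P0 where "P0 = (\<Prod>l\<in>I-{i}. dd l (xx i) (tt i) ^ 3)"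
  have P0: "P0 \<noteq> 0"
    unfolding P0_def using dd_Ept[OF _ i] fin by auto
  have \<Phi>0: "\<Phi> 0 z = (a i * fst z * (a i * fst z - v i * (snd z - al i * fst z)) * P0,
      (a i * snd z * (a i * fst z - v i * (snd z - al i * fst z)) - (snd z - al i * fst z) ^ 3) * P0)" for z
    by (simp add: \<Phi>_def PP_def xk_def tk_def P0_def algebra_simps)
  define y where "y = - (a i * v i)"
  have nd: "nondeg (\<Phi> 0) (0, y)"
  proof (rule nondegI)
    show "\<Phi> 0 (0, y) = 0"
      unfolding \<Phi>0 by (simp add: power3_eq_cube zero_prod_def y_def)
    show "((\<lambda>z. fst (\<Phi> 0 z)) has_derivative (\<lambda>h. ((- a i) * v i * y * P0) * fst h + 0 * snd h)) (at (0, y))"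
      unfolding \<Phi>0 fst_conv by (auto intro!: derivative_eq_intros ext simp: algebra_simps)
    have y2: "a i * v i = - y" by (simp add: y_def)
    have y3: "a i * (v i * s) = - y * s" for s using y2 by (simp only: mult.assoc[symmetric])
    show "((\<lambda>z. snd (\<Phi> 0 z)) has_derivative
       (\<lambda>h. ((a i * y * (a i + v i * al i) + 3 * al i * y ^ 2) * P0) * fst h + ((- (y ^ 2)) * P0) * snd h)) (at (0, y))"
      unfolding \<Phi>0 snd_conv by (auto intro!: derivative_eq_intros ext simp: algebra_simps power2_eq_square y3)
    show "(- a i) * v i * y * P0 * ((- (y ^ 2)) * P0) - 0 * ((a i * y * (a i + v i * al i) + 3 * al i * y ^ 2) * P0) \<noteq> 0"
      using P0 v a_nz[OF i] by (simp add: y_def)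
  qed
  have contpnt: "continuous_on UNIV (\<lambda>p. (xk (fst p) (snd p), tk (fst p) (snd p)))"
    unfolding xk_def tk_def by (intro continuous_intros)
  have "eventually (\<lambda>\<kappa>. \<exists>B. finite B \<and> card B = card {(0::complex, y)} \<and>
     B \<subseteq> zeros v (1 / \<kappa> ^ 3) \<inter> (ball (xx i, tt i) e - {(xx i, tt i)})) (at 0)"
  proof (rule cluster[where W = "- {0}" and \<Phi> = \<Phi> and pnt = "\<lambda>\<kappa> z. (xk \<kappa> z, tk \<kappa> z)"])
    show "continuous_on UNIV (\<lambda>p. \<Phi> (fst p) (snd p))"
      unfolding \<Phi>_def PP_def SS_def xk_def tk_def hF_def hG_def dd_def
      by (intro continuous_intros continuous_on_prod)
    fix \<kappa> :: complex assume \<kappa>: "\<kappa> \<noteq> 0"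
    show "inj_on (\<lambda>z. (xk \<kappa> z, tk \<kappa> z)) (- {0})"
      using \<kappa> by (auto simp: inj_on_def xk_def tk_def)
    fix z assume "\<Phi> \<kappa> z = 0"
    then show "(xk \<kappa> z, tk \<kappa> z) \<in> zeros v (1 / \<kappa> ^ 3)"
      unfolding zeros_def using F[of \<kappa> z] G[OF \<kappa>, of z] by simp
  next
    fix z assume z: "z \<in> {(0::complex, y)}"
    have "eventually (\<lambda>p'. (xk (fst p') (snd p'), tk (fst p') (snd p')) \<in> ball (xx i, tt i) e) (nhds (0, z))"
      by (rule eventually_nhds_cont[OF contpnt]) (use \<open>e > 0\<close> in \<open>auto simp: xk_def tk_def\<close>)
    moreover have "eventually (\<lambda>p'. snd p' \<in> - {0}) (nhds (0::complex, z))"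
      by (rule eventually_nhds_cont) (use z v a_nz[OF i] in \<open>auto intro!: continuous_intros simp: prod_eq_iff y_def\<close>)
    ultimately show "eventually (\<lambda>p'. fst p' \<noteq> 0 \<longrightarrow> (xk (fst p') (snd p'), tk (fst p') (snd p')) \<in> ball (xx i, tt i) e - {(xx i, tt i)}) (nhds (0, z))"
    proof eventually_elim
      case (elim p')
      then show ?case by (auto simp: xk_def tk_def prod_eq_iff)
    qed
  qed (use nd v a_nz[OF i] in \<open>auto simp: prod_eq_iff y_def\<close>)
  then show ?thesis by simp
qed

text \<open>The form of degree \<open>3 * k - 1\<close> of \<open>fh\<close>, dehomogenised at
  \<open>x = 1\<close>; its variable is the slope \<open>s = t / x\<close>. Its degree is at most
  \<open>3 * k - 2\<close>, since the form vanishes in the direction \<open>x = 0\<close>.\<close>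

definition HH :: "('i \<Rightarrow> complex) \<Rightarrow> complex poly" where
  "HH v = (\<Sum>i\<in>I. [:a i:] * [:a i + v i * al i, - v i:] * (\<Prod>j\<in>I-{i}. [:- al j, 1:] ^ 3))"

lemma poly_HH: "poly (HH v) s = (\<Sum>i\<in>I. a i * (a i - v i * (s - al i)) * (\<Prod>j\<in>I-{i}. (s - al j) ^ 3))"
  by (simp add: HH_def poly_sum poly_prod algebra_simps)

lemma poly_HH_al: "i \<in> I \<Longrightarrow> poly (HH v) (al i) = a i ^ 2 * (\<Prod>j\<in>I-{i}. (al i - al j) ^ 3)"
proof -
  assume i: "i \<in> I"
  have "poly (HH v) (al i) = (\<Sum>l\<in>{i}. a l * (a l - v l * (al i - al l)) * (\<Prod>j\<in>I-{l}. (al i - al j) ^ 3))"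
    unfolding poly_HH
  proof (rule sum.mono_neutral_right[OF fin])
    show "\<forall>l\<in>I-{i}. a l * (a l - v l * (al i - al l)) * (\<Prod>j\<in>I-{l}. (al i - al j) ^ 3) = 0"
    proof
      fix l assume "l \<in> I - {i}"
      then have "(\<Prod>j\<in>I-{l}. (al i - al j) ^ 3) = 0"
        using fin i by (intro prod_zero bexI[of _ i]) auto
      then show "a l * (a l - v l * (al i - al l)) * (\<Prod>j\<in>I-{l}. (al i - al j) ^ 3) = 0" by simp
    qed
  qed (use i in auto)
  then show ?thesis by (simp add: power2_eq_square)
qed

lemma poly_HH_al_nz: "i \<in> I \<Longrightarrow> poly (HH v) (al i) \<noteq> 0"
  unfolding poly_HH_al using fin a_nz al_inj by (auto simp: inj_on_def)

text \<open>With \<open>x = X * w\<close> and \<open>t = s * x\<close> the limit of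
  \<open>fh\<close> is \<open>X ^ (3 * k - 1)\<close> times the value of \<open>HH v\<close> at
  \<open>s\<close>, and the limit of \<open>gh\<close> is a multiple of \<open>X - 1\<close>. The
  zeros used are \<open>X = 1\<close> with \<open>s\<close> a root of \<open>HH v\<close>; since
  such a root is none of the slopes \<open>al i\<close>, they are nondegenerate. The corresponding
  points lie near \<open>(w, s * w)\<close> and leave every bounded set.\<close>

lemma cluster_inf:
  assumes H: "rsquarefree (HH v)"
  shows "eventually (\<lambda>\<kappa>. \<exists>B. finite B \<and> card B = degree (HH v) \<and>
    B \<subseteq> zeros v (1 / \<kappa> ^ 3) \<inter> - cball 0 M) (at 0)"
proof -
  define xk where "xk \<kappa> z = fst z / \<kappa> ^ 3" for \<kappa> and z :: "complex \<times> complex"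
  define tk where "tk \<kappa> z = fst z * snd z / \<kappa> ^ 3" for \<kappa> and z :: "complex \<times> complex"
  define X where "X \<kappa> z l = fst z - \<kappa> ^ 3 * xx l" for \<kappa> l and z :: "complex \<times> complex"
  define T where "T \<kappa> z l = fst z * snd z - \<kappa> ^ 3 * tt l" for \<kappa> l and z :: "complex \<times> complex"
  define dl where "dl \<kappa> z l = T \<kappa> z l - al l * X \<kappa> z l" for \<kappa> l and z :: "complex \<times> complex"
  define SS where "SS Y \<kappa> z = (\<Sum>l\<in>I. a l * Y \<kappa> z l * (a l * X \<kappa> z l - v l * dl \<kappa> z l) * (\<Prod>m\<in>I-{l}. dl \<kappa> z m ^ 3))"
    for Y :: "complex \<Rightarrow> complex \<times> complex \<Rightarrow> 'i \<Rightarrow> complex" and \<kappa> z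
  define \<Phi> where "\<Phi> \<kappa> z = (SS X \<kappa> z, (fst z - 1) * (\<Prod>l\<in>I. dl \<kappa> z l ^ 3) + \<kappa> ^ 3 * \<kappa> ^ 3 * SS T \<kappa> z)" for \<kappa> z
  have e: "\<kappa> ^ 3 * (xk \<kappa> z - xx l) = X \<kappa> z l" "\<kappa> ^ 3 * (tk \<kappa> z - tt l) = T \<kappa> z l"
    "\<kappa> ^ 3 * dd l (xk \<kappa> z) (tk \<kappa> z) = dl \<kappa> z l" if "\<kappa> \<noteq> 0" for \<kappa> z l
    using that by (simp_all add: xk_def tk_def X_def T_def dl_def dd_def field_simps)
  have pr: "(\<Prod>m\<in>J. dl \<kappa> z m ^ 3) = (\<kappa> ^ 9) ^ card J * (\<Prod>m\<in>J. dd m (xk \<kappa> z) (tk \<kappa> z) ^ 3)" if "\<kappa> \<noteq> 0" for J \<kappa> z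
    unfolding e(3)[OF that, symmetric] by (simp add: power_mult_distrib prod.distrib flip: power_mult)
  have cI: "card (I - {l}) = k - 1" if "l \<in> I" for l using that fin by simp
  have SX: "SS X \<kappa> z = \<kappa> ^ 6 * (\<kappa> ^ 9) ^ (k - 1) * fh v (xk \<kappa> z) (tk \<kappa> z)" if "\<kappa> \<noteq> 0" for \<kappa> z
    unfolding SS_def fh_def sum_distrib_left
  proof (rule sum.cong)
    fix l assume l: "l \<in> I"
    show "a l * X \<kappa> z l * (a l * X \<kappa> z l - v l * dl \<kappa> z l) * (\<Prod>m\<in>I-{l}. dl \<kappa> z m ^ 3) =
      \<kappa> ^ 6 * (\<kappa> ^ 9) ^ (k - 1) * (a l * (xk \<kappa> z - xx l) * (a l * (xk \<kappa> z - xx l) - v l * dd l (xk \<kappa> z) (tk \<kappa> z)) * (\<Prod>j\<in>I-{l}. dd j (xk \<kappa> z) (tk \<kappa> z) ^ 3))"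
      unfolding pr[OF that] cI[OF l] unfolding e(1,3)[OF that, symmetric]
      by (simp add: algebra_simps flip: power_add)
  qed simp
  have ST: "SS T \<kappa> z = \<kappa> ^ 6 * (\<kappa> ^ 9) ^ (k - 1) * (\<Sum>i\<in>I. a i * (tk \<kappa> z - tt i) * (a i * (xk \<kappa> z - xx i) - v i * dd i (xk \<kappa> z) (tk \<kappa> z)) * (\<Prod>j\<in>I-{i}. dd j (xk \<kappa> z) (tk \<kappa> z) ^ 3))"
    if "\<kappa> \<noteq> 0" for \<kappa> z
    unfolding SS_def sum_distrib_left
  proof (rule sum.cong)
    fix l assume l: "l \<in> I"
    show "a l * T \<kappa> z l * (a l * X \<kappa> z l - v l * dl \<kappa> z l) * (\<Prod>m\<in>I-{l}. dl \<kappa> z m ^ 3) =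
      \<kappa> ^ 6 * (\<kappa> ^ 9) ^ (k - 1) * (a l * (tk \<kappa> z - tt l) * (a l * (xk \<kappa> z - xx l) - v l * dd l (xk \<kappa> z) (tk \<kappa> z)) * (\<Prod>j\<in>I-{l}. dd j (xk \<kappa> z) (tk \<kappa> z) ^ 3))"
      unfolding pr[OF that] cI[OF l] unfolding e[OF that, symmetric]
      by (simp add: algebra_simps flip: power_add)
  qed simp
  have k1: "k = Suc (k - 1)" using card2 by simp
  have G: "snd (\<Phi> \<kappa> z) = \<kappa> ^ 3 * (\<kappa> ^ 9) ^ k * gh v (1 / \<kappa> ^ 3) (xk \<kappa> z) (tk \<kappa> z)" if "\<kappa> \<noteq> 0" for \<kappa> z
  proof -
    have 1: "fst z - 1 = \<kappa> ^ 3 * (xk \<kappa> z - 1 / \<kappa> ^ 3)" using that by (simp add: xk_def field_simps)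
    have 2: "\<kappa> ^ 3 * \<kappa> ^ 3 * (\<kappa> ^ 6 * (\<kappa> ^ 9) ^ (k - 1)) = \<kappa> ^ 3 * (\<kappa> ^ 9) ^ k"
      by (subst (2) k1) (simp flip: power_add mult.assoc)
    have 3: "\<kappa> ^ 3 * \<kappa> ^ 3 * (\<kappa> ^ 6 * (\<kappa> ^ 9) ^ (k - 1) * s) = \<kappa> ^ 3 * (\<kappa> ^ 9) ^ k * s" for s
      using arg_cong[OF 2, of "\<lambda>t. t * s"] by (simp only: mult.assoc)
    show ?thesis
      unfolding \<Phi>_def snd_conv ST[OF that] pr[OF that] gh_def 1 3 by (simp only: distrib_left mult_ac)
  qed
  have \<Phi>0: "\<Phi> 0 z = (fst z ^ (3 * k - 1) * poly (HH v) (snd z), (fst z - 1) * fst z ^ (3 * k) * (\<Prod>l\<in>I. (snd z - al l) ^ 3))" for z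
  proof -
    have d: "dl 0 z l = fst z * (snd z - al l)" for l
      by (simp add: dl_def X_def T_def algebra_simps)
    have p: "(\<Prod>m\<in>J. dl 0 z m ^ 3) = fst z ^ (3 * card J) * (\<Prod>m\<in>J. (snd z - al m) ^ 3)" for J
      unfolding d by (simp add: power_mult_distrib prod.distrib flip: power_mult)
    have "SS X 0 z = (\<Sum>l\<in>I. fst z ^ (3 * k - 1) * (a l * (a l - v l * (snd z - al l)) * (\<Prod>m\<in>I-{l}. (snd z - al m) ^ 3)))"
      unfolding SS_def
    proof (rule sum.cong)
      fix l assume l: "l \<in> I"
      have "fst z ^ (3 * k - 1) = fst z * fst z * fst z ^ (3 * card (I - {l}))"
        unfolding card_remove[OF l, symmetric] by (simp add: power_add)
      then show "a l * X 0 z l * (a l * X 0 z l - v l * dl 0 z l) * (\<Prod>m\<in>I-{l}. dl 0 z m ^ 3) =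
          fst z ^ (3 * k - 1) * (a l * (a l - v l * (snd z - al l)) * (\<Prod>m\<in>I-{l}. (snd z - al m) ^ 3))"
        unfolding p unfolding d by (simp add: X_def algebra_simps)
    qed simp
    then show ?thesis
      by (simp add: \<Phi>_def poly_HH p sum_distrib_left)
  qed
  let ?Z = "Pair (1::complex) ` {s. poly (HH v) s = 0}"
  have H0: "HH v \<noteq> 0" using H by (auto simp: rsquarefree_def)
  have cZ: "card ?Z = degree (HH v)"
    using rsquarefree_card_roots[OF H] by (subst card_image) (auto simp: inj_on_def)
  have fZ: "finite ?Z" using poly_roots_finite[OF H0] by simp
  have nd: "nondeg (\<Phi> 0) z" if "z \<in> ?Z" for z
  proof -
    obtain s where z: "z = (1, s)" and s: "poly (HH v) s = 0" using \<open>z \<in> ?Z\<close> by auto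
    have s': "poly (pderiv (HH v)) s \<noteq> 0" using H s unfolding rsquarefree_roots by blast
    define Pr where "Pr y = (\<Prod>l\<in>I. (y - al l) ^ 3)" for y
    have P0: "Pr s \<noteq> 0"
      using fin s poly_HH_al_nz[of _ v] by (auto simp: Pr_def)
    have Pr: "Pr y = poly (\<Prod>l\<in>I. [:- al l, 1:] ^ 3) y" for y
      by (simp add: Pr_def poly_prod)
    have dp: "((\<lambda>z::complex \<times> complex. poly p (snd z)) has_derivative (\<lambda>h. poly (pderiv p) (snd z) * snd h)) (at z)" for p and z :: "complex \<times> complex"
    proof -
      have "((poly p) has_derivative (\<lambda>h. poly (pderiv p) (snd z) * h)) (at (snd z))"
        using poly_DERIV[of p "snd z"] by (simp add: has_field_derivative_def)
      from has_derivative_compose[where f = snd and g = "poly p", OF has_derivative_snd[OF has_derivative_ident] this]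
      show ?thesis by simp
    qed
    show ?thesis
    proof (rule nondegI)
      show "\<Phi> 0 z = 0" unfolding \<Phi>0 z by (simp add: s zero_prod_def)
      show "((\<lambda>z. fst (\<Phi> 0 z)) has_derivative (\<lambda>h. 0 * fst h + poly (pderiv (HH v)) s * snd h)) (at z)"
        unfolding \<Phi>0 fst_conv z
        by (rule has_derivative_eq_rhs[OF has_derivative_mult[OF has_derivative_power[OF has_derivative_fst[OF has_derivative_ident]] dp]])
           (simp add: s fun_eq_iff)
      show "((\<lambda>z. snd (\<Phi> 0 z)) has_derivative (\<lambda>h. Pr s * fst h + 0 * snd h)) (at z)"
        unfolding \<Phi>0 snd_conv z Pr_def[symmetric] unfolding Pr
        by (rule has_derivative_eq_rhs[OF has_derivative_mult[OF has_derivative_mult[OF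
              has_derivative_diff[OF has_derivative_fst[OF has_derivative_ident] has_derivative_const]
              has_derivative_power[OF has_derivative_fst[OF has_derivative_ident]]] dp]])
           (simp add: fun_eq_iff mult_ac)
      show "0 * 0 - poly (pderiv (HH v)) s * Pr s \<noteq> 0" using s' P0 by simp
    qed
  qed
  have "eventually (\<lambda>\<kappa>. \<exists>B. finite B \<and> card B = card ?Z \<and> B \<subseteq> zeros v (1 / \<kappa> ^ 3) \<inter> - cball 0 M) (at 0)"
  proof (rule cluster[where W = "{z. fst z \<noteq> 0}" and \<Phi> = \<Phi> and pnt = "\<lambda>\<kappa> z. (xk \<kappa> z, tk \<kappa> z)"])
    show "open {z::complex \<times> complex. fst z \<noteq> 0}"
      by (intro open_Collect_neq continuous_intros)
    show "continuous_on UNIV (\<lambda>p. \<Phi> (fst p) (snd p))"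
      unfolding \<Phi>_def SS_def dl_def X_def T_def
      by (intro continuous_intros continuous_on_prod)
    fix \<kappa> :: complex assume \<kappa>: "\<kappa> \<noteq> 0"
    show "inj_on (\<lambda>z. (xk \<kappa> z, tk \<kappa> z)) {z. fst z \<noteq> 0}"
      using \<kappa> by (auto simp: inj_on_def xk_def tk_def prod_eq_iff)
    fix z assume "\<Phi> \<kappa> z = 0"
    then have "SS X \<kappa> z = 0" "snd (\<Phi> \<kappa> z) = 0" by (simp_all add: \<Phi>_def prod_eq_iff)
    then show "(xk \<kappa> z, tk \<kappa> z) \<in> zeros v (1 / \<kappa> ^ 3)"
      unfolding zeros_def using SX[OF \<kappa>, of z] G[OF \<kappa>, of z] \<kappa> by simp
  next
    fix z assume z: "z \<in> ?Z"
    have "eventually (\<lambda>\<kappa>. norm (1 / \<kappa> ^ 3) > 2 * \<bar>M\<bar>) (at (0::complex))"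
      by (rule eventually_inverse_cube_large)
    then have "eventually (\<lambda>\<kappa>. \<kappa> \<noteq> 0 \<longrightarrow> norm (1 / \<kappa> ^ 3) > 2 * \<bar>M\<bar>) (nhds (0::complex))"
      by (simp add: eventually_at_filter)
    then have "eventually (\<lambda>p'. fst p' \<noteq> 0 \<longrightarrow> norm (1 / fst p' ^ 3) > 2 * \<bar>M\<bar>) (nhds (0::complex, z))"
      using filterlim_fst[of "nhds (0::complex)" "nhds z"] unfolding nhds_prod filterlim_iff by blast
    moreover have "eventually (\<lambda>p'. fst (snd p') \<in> - cball 0 (1/2)) (nhds (0::complex, z))"
      by (rule eventually_nhds_cont) (use z in \<open>auto intro!: continuous_intros\<close>)
    ultimately show "eventually (\<lambda>p'. fst p' \<noteq> 0 \<longrightarrow> (xk (fst p') (snd p'), tk (fst p') (snd p')) \<in> - cball 0 M) (nhds (0, z))"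
    proof eventually_elim
      case (elim p')
      show ?case
      proof
        assume nz: "fst p' \<noteq> 0"
        have "\<bar>M\<bar> \<le> 1/2 * norm (1 / fst p' ^ 3)" using elim(1) nz by simp
        also have "\<dots> < norm (fst (snd p')) * norm (1 / fst p' ^ 3)"
          using elim(2) nz by (intro mult_strict_right_mono) auto
        also have "\<dots> = norm (xk (fst p') (snd p'))"
          by (simp add: xk_def norm_divide)
        also have "\<dots> \<le> norm (xk (fst p') (snd p'), tk (fst p') (snd p'))"
          using norm_fst_le by blast
        finally show "(xk (fst p') (snd p'), tk (fst p') (snd p')) \<in> - cball 0 M" by simp
      qed
    qed
  qed (use fZ nd in auto)
  then show ?thesis using cZ by simp
qed

end

subsection \<open>The generic number of critical points\<close>

context plane_system
begin

lemma degree_HH: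
  assumes "(\<Sum>i\<in>I. a i * v i) \<noteq> 0"
  shows "degree (HH v) = 3 * k - 2"
proof -
  have l0: "top_le 0 [:b:]" and l1: "top_le 1 [:b, b':]" for b b' :: complex
    by (auto simp: top_le_def coeff_pCons split: nat.splits)
  have h0: "hcoef 0 [:b:] = b" and h1: "hcoef 1 [:b, b':] = b'" for b b' :: complex
    by (simp_all add: hcoef_def)
  have t3: "top_le 3 ([:b, 1:] ^ 3)" "hcoef 3 ([:b, 1:] ^ 3) = 1" for b :: complex
    using top_le_power[OF l1, of 3 b 1] h1 by simp_all
  have e: "0 + 1 + (\<Sum>j\<in>I-{i}. 3) = int (3 * k - 2)" if "i \<in> I" for i
    using card_remove[OF that] card2 by simp
  have tm: "top_le (int (3 * k - 2)) ([:a i:] * [:a i + v i * al i, - v i:] * (\<Prod>j\<in>I-{i}. [:- al j, 1:] ^ 3))"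
    "hcoef (int (3 * k - 2)) ([:a i:] * [:a i + v i * al i, - v i:] * (\<Prod>j\<in>I-{i}. [:- al j, 1:] ^ 3)) = - (a i * v i)"
    if "i \<in> I" for i
  proof -
    have tp: "top_le (\<Sum>j\<in>I-{i}. 3) (\<Prod>j\<in>I-{i}. [:- al j, 1:] ^ 3)"
      "hcoef (\<Sum>j\<in>I-{i}. 3) (\<Prod>j\<in>I-{i}. [:- al j, 1:] ^ 3) = 1"
      using top_le_prod[of "I - {i}" "\<lambda>_. 3" "\<lambda>j. [:- al j, 1:] ^ 3"] fin t3 by auto
    note m1 = top_le_mult[OF l0[of "a i"] l1[of "a i + v i * al i" "- v i"]]
    note m2 = top_le_mult[OF m1(1) tp(1)]
    show "top_le (int (3 * k - 2)) ([:a i:] * [:a i + v i * al i, - v i:] * (\<Prod>j\<in>I-{i}. [:- al j, 1:] ^ 3))"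
      using m2(1) unfolding e[OF that] .
    show "hcoef (int (3 * k - 2)) ([:a i:] * [:a i + v i * al i, - v i:] * (\<Prod>j\<in>I-{i}. [:- al j, 1:] ^ 3)) = - (a i * v i)"
      using m2(2) unfolding e[OF that] m1(2) tp(2) h0 h1 by simp
  qed
  have "top_le (int (3 * k - 2)) (HH v)"
    unfolding HH_def by (intro top_le_sum tm)
  then have "coeff (HH v) j = 0" if "j > 3 * k - 2" for j
    using that unfolding top_le_def by simp
  then have "degree (HH v) \<le> 3 * k - 2"
    by (intro degree_le) simp
  moreover have "hcoef (int (3 * k - 2)) (HH v) = - (\<Sum>i\<in>I. a i * v i)"
    unfolding HH_def hcoef_sum using tm(2) by (simp add: sum_negf)
  then have "coeff (HH v) (3 * k - 2) \<noteq> 0"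
    using assms by (simp only: hcoef_int) simp
  then have "3 * k - 2 \<le> degree (HH v)" by (rule le_degree)
  ultimately show ?thesis by simp
qed

text \<open>A pencil in the single datum \<open>v i0\<close>. Its direction \<open>Q\<close>
  vanishes only at the slopes \<open>al i\<close>, where \<open>HH\<close> never vanishes, and has a
  simple zero at \<open>al i0\<close>, as \<open>finite_nonsquarefree_pencil\<close> requires. The
  excluded values \<open>0\<close> and \<open>c\<close> keep the data nonzero and preserve the
  leading coefficient.\<close>

lemma ex_squarefree_HH:
  obtains v where "rsquarefree (HH v)" "degree (HH v) = 3 * k - 2" "\<And>i. i \<in> I \<Longrightarrow> v i \<noteq> 0"
proof -
  obtain i0 where i0: "i0 \<in> I" using card2 by fastforce
  define vb where "vb \<beta> = (\<lambda>i. if i = i0 then \<beta> else 1)" for \<beta> :: complex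
  define Q where "Q = [:a i0:] * [:al i0, - 1:] * (\<Prod>j\<in>I-{i0}. [:- al j, 1:] ^ 3)"
  have pQ: "poly Q s = a i0 * (al i0 - s) * (\<Prod>j\<in>I-{i0}. (s - al j) ^ 3)" for s
    by (simp add: Q_def poly_prod algebra_simps)
  have pencil: "HH (vb \<beta>) = HH (vb 0) + Polynomial.smult \<beta> Q" for \<beta>
  proof -
    have "poly (HH (vb \<beta>)) s = poly (HH (vb 0) + Polynomial.smult \<beta> Q) s" for s
    proof -
      have "(\<Sum>i\<in>I-{i0}. a i * (a i - vb \<beta> i * (s - al i)) * (\<Prod>j\<in>I-{i}. (s - al j) ^ 3)) =
        (\<Sum>i\<in>I-{i0}. a i * (a i - vb 0 i * (s - al i)) * (\<Prod>j\<in>I-{i}. (s - al j) ^ 3))"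
        by (rule sum.cong) (auto simp: vb_def)
      then show ?thesis
        by (simp add: poly_HH pQ sum.remove[OF fin i0]) (simp add: vb_def algebra_simps)
    qed
    then have "poly (HH (vb \<beta>)) = poly (HH (vb 0) + Polynomial.smult \<beta> Q)" by (rule ext)
    then show ?thesis by (simp only: poly_eq_poly_eq_iff)
  qed
  have ncr: "poly Q t \<noteq> 0" if "poly (HH (vb 0)) t = 0" for t
  proof
    assume "poly Q t = 0"
    then have "\<exists>i\<in>I. t = al i" using fin i0 a_nz by (auto simp: pQ)
    then show False using that poly_HH_al_nz by blast
  qed
  have r1: "poly Q (al i0) = 0" by (simp add: pQ)
  define Pr where "Pr = (\<Prod>j\<in>I-{i0}. [:- al j, 1:] ^ 3)"
  have "Q = Polynomial.smult (a i0) ([:al i0, - 1:] * Pr)"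
    unfolding Q_def Pr_def[symmetric] mult.assoc by simp
  then have "poly (pderiv Q) (al i0) = - a i0 * poly Pr (al i0)"
    by (simp only: pderiv_smult pderiv_mult) (simp add: pderiv_pCons)
  moreover have "poly Pr (al i0) \<noteq> 0"
    using fin i0 al_inj by (auto simp: Pr_def poly_prod inj_on_def)
  ultimately have r2: "poly (pderiv Q) (al i0) \<noteq> 0" using a_nz[OF i0] by simp
  define c where "c = - (\<Sum>i\<in>I-{i0}. a i) / a i0"
  have "finite ({\<beta>. \<not> rsquarefree (HH (vb \<beta>))} \<union> {0, c})"
  proof -
    define P where "P = HH (vb 0)"
    have "finite {\<beta>. \<not> rsquarefree (P + Polynomial.smult \<beta> Q)}"
      unfolding P_def by (rule finite_nonsquarefree_pencil[OF ncr r1 r2])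
    then show ?thesis
      unfolding P_def pencil[symmetric] by simp
  qed
  then obtain \<beta> where \<beta>: "\<beta> \<notin> {\<beta>. \<not> rsquarefree (HH (vb \<beta>))} \<union> {0, c}"
    using ex_new_if_finite[OF infinite_UNIV_char_0] by blast
  have "(\<Sum>i\<in>I. a i * vb \<beta> i) = a i0 * \<beta> + (\<Sum>i\<in>I-{i0}. a i * vb \<beta> i)"
    by (simp add: sum.remove[OF fin i0] vb_def)
  also have "(\<Sum>i\<in>I-{i0}. a i * vb \<beta> i) = (\<Sum>i\<in>I-{i0}. a i)"
    by (rule sum.cong) (auto simp: vb_def)
  also have "a i0 * \<beta> + (\<Sum>i\<in>I-{i0}. a i) \<noteq> 0"
    using \<beta> a_nz[OF i0] by (auto simp: c_def field_simps add_eq_0_iff)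
  finally show ?thesis
    using \<beta> by (intro that[of "vb \<beta>"] degree_HH) (auto simp: vb_def)
qed

text \<open>On a line of constant \<open>y\<close> that avoids all crossings and centres,
  \<open>fh = 0\<close> has finitely many solutions, and at each of them \<open>gh = 0\<close>
  determines \<open>w\<close>. For \<open>w\<close> of larger norm the resultant does not vanish at
  this \<open>y\<close>, so it is not the zero polynomial.\<close>

lemma eventually_finite_zeros: "eventually (\<lambda>\<kappa>. finite (zeros v (1 / \<kappa> ^ 3))) (at 0)"
proof -
  obtain c where c: "good c v"
    using ex_new_if_finite[OF infinite_UNIV_char_0 finite_bad[of v]] by auto
  have l: "coeff (coeff (FF c v) (3 * k - 1)) 0 \<noteq> 0"
    unfolding lead_FF using c by (simp add: good_def)
  obtain y where y: "y \<notin> proj c ` (Pts \<union> Ept)"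
    using ex_new_if_finite[OF infinite_UNIV_char_0, of "proj c ` (Pts \<union> Ept)"] finite_Pts finite_Ept by auto
  define S where "S = {z. fh v (y + c * z) z = 0}"
  have "S = {z. poly (map_poly (\<lambda>c. poly c y) (FF c v)) z = 0}"
    unfolding S_def by (simp add: bev_conv[symmetric] bev_FF)
  then have fS: "finite S"
    using poly_roots_finite[OF degree_map_eval(2)[OF tdeg_FF l]] by simp
  define g where "g z = y + c * z + nsum (hG v (y + c * z) z) (y + c * z) z / (\<Prod>j\<in>I. dd j (y + c * z) z ^ 3)" for z
  obtain M where M: "\<And>z. z \<in> S \<Longrightarrow> norm (g z) \<le> M"
    using finite_imp_bounded[OF finite_imageI[OF fS, of g]] unfolding bounded_iff by blast
  have "finite (zeros v w)" if "norm w > M" for w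
  proof -
    have "poly (Rs c v w) y \<noteq> 0"
    proof
      assume "poly (Rs c v w) y = 0"
      then obtain z where z: "fh v (y + c * z) z = 0" "gh v w (y + c * z) z = 0"
        using Rs_zero_iff[OF c, of w y] by (auto simp: zeros_def)
      have "proj c (y + c * z, z) = y" by (simp add: proj_def)
      then have "(y + c * z, z) \<notin> Pts \<union> Ept" using y by (metis imageI)
      then have "dd j (y + c * z) z \<noteq> 0" if "j \<in> I" for j
        using fh_zero_on_line[OF that _ z(1)] by blast
      then have "(\<Prod>j\<in>I. dd j (y + c * z) z ^ 3) \<noteq> 0" using fin by simp
      then have "w = g z"
        using z(2) unfolding gh_nsum g_def by (simp add: field_simps)
      then show False using M[of z] z(1) \<open>norm w > M\<close> by (simp add: S_def)
    qed
    then have "Rs c v w \<noteq> 0" by auto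
    then show ?thesis using finite_zeros_iff[OF c] by simp
  qed
  then show ?thesis
    using eventually_inverse_cube_large[of M] by (rule eventually_mono[rotated])
qed

text \<open>Puncturing the balls keeps the clusters off the crossings and centres themselves, so by
  \<open>zeros_cases\<close> all their points are genuine. The number
  \<open>9 * (k choose 2) + k + (3 * k - 2)\<close> is \<open>NN\<close>, which is also the upper
  bound.\<close>

lemma ex_many_genuine: "\<exists>v w. finite (zeros v w) \<and> card (genuine v w) = NN"
proof -
  obtain v where v: "rsquarefree (HH v)" "degree (HH v) = 3 * k - 2" "\<And>i. i \<in> I \<Longrightarrow> v i \<noteq> 0"
    using ex_squarefree_HH by blast
  let ?S = "Pts \<union> Ept"
  have fS: "finite ?S" using finite_Pts finite_Ept by simp
  obtain e where e: "e > 0" "\<And>z z'. z \<in> ?S \<Longrightarrow> z' \<in> ?S \<Longrightarrow> z \<noteq> z' \<Longrightarrow> 2 * e < dist z z'"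
    using finite_separated[OF fS] by blast
  obtain M0 where M0: "\<And>s. s \<in> ?S \<Longrightarrow> norm s \<le> M0"
    using finite_imp_bounded[OF fS] unfolding bounded_iff by blast
  define M where "M = M0 + e"
  define n where "n s = (if s \<in> Pts then 9 else 1 :: nat)" for s
  define U where "U s = ball s e - {s}" for s :: "complex \<times> complex"
  have ev: "eventually (\<lambda>\<kappa>. \<exists>B. finite B \<and> card B = n s \<and> B \<subseteq> zeros v (1 / \<kappa> ^ 3) \<inter> U s) (at 0)" if "s \<in> ?S" for s
  proof (cases "s \<in> Pts")
    case True
    then show ?thesis using cluster_Pts[of "fst s" "snd s" e v] e(1) by (simp add: n_def U_def)
  next
    case False
    from \<open>s \<in> ?S\<close> False obtain i where "i \<in> I" "s = (xx i, tt i)" by (auto simp: Ept_def)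
    then show ?thesis using cluster_Ept[of i v e] e(1) v(3) False by (simp add: n_def U_def)
  qed
  have "eventually (\<lambda>\<kappa>. \<forall>s\<in>?S. \<exists>B. finite B \<and> card B = n s \<and> B \<subseteq> zeros v (1 / \<kappa> ^ 3) \<inter> U s) (at 0)"
    using fS ev by (simp add: eventually_ball_finite)
  then have evall: "eventually (\<lambda>\<kappa>. (\<forall>s\<in>?S. \<exists>B. finite B \<and> card B = n s \<and> B \<subseteq> zeros v (1 / \<kappa> ^ 3) \<inter> U s) \<and>
     (\<exists>B. finite B \<and> card B = degree (HH v) \<and> B \<subseteq> zeros v (1 / \<kappa> ^ 3) \<inter> - cball 0 M) \<and>
     finite (zeros v (1 / \<kappa> ^ 3))) (at 0)"
    using cluster_inf[OF v(1), of M] eventually_finite_zeros[of v] by eventually_elim blast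
  from eventually_happens'[OF at_neq_bot evall] obtain \<kappa> where
    B0: "(\<forall>s\<in>?S. \<exists>B. finite B \<and> card B = n s \<and> B \<subseteq> zeros v (1 / \<kappa> ^ 3) \<inter> U s) \<and>
     (\<exists>B. finite B \<and> card B = degree (HH v) \<and> B \<subseteq> zeros v (1 / \<kappa> ^ 3) \<inter> - cball 0 M) \<and>
     finite (zeros v (1 / \<kappa> ^ 3))" by (rule exE)
  note B1 = B0[THEN conjunct1] and B2 = B0[THEN conjunct2, THEN conjunct1] and fz = B0[THEN conjunct2, THEN conjunct2]
  define w where "w = 1 / \<kappa> ^ 3"
  obtain B where B: "\<And>s. s \<in> ?S \<Longrightarrow> finite (B s) \<and> card (B s) = n s \<and> B s \<subseteq> zeros v w \<inter> U s"
    using bchoice[OF B1] unfolding w_def by blast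
  obtain Bi where Bi: "finite Bi" "card Bi = 3 * k - 2" "Bi \<subseteq> zeros v w \<inter> - cball 0 M"
    using B2 v(2) unfolding w_def by auto
  have far: "p \<in> cball 0 M" if "s \<in> ?S" "p \<in> ball s e" for s p
  proof -
    have "norm p \<le> norm s + dist s p" using norm_triangle_sub[of p s] by (simp add: dist_norm norm_minus_commute)
    then show ?thesis using that M0[of s] by (simp add: M_def)
  qed
  have disj: "U s \<inter> U s' = {}" if "s \<in> ?S" "s' \<in> ?S" "s \<noteq> s'" for s s'
  proof (rule ccontr)
    assume "U s \<inter> U s' \<noteq> {}"
    then obtain p where "p \<in> U s" "p \<in> U s'" by blast
    then have "dist s p < e" "dist s' p < e" by (simp_all add: U_def)
    then show False using e(2)[OF that] dist_triangle[of s s' p] by (simp add: dist_commute)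
  qed
  have US: "U s \<inter> ?S = {}" if "s \<in> ?S" for s
  proof (rule ccontr)
    assume "U s \<inter> ?S \<noteq> {}"
    then obtain p where "p \<in> ?S" "p \<in> U s" by blast
    then have p: "p \<in> ?S" "dist s p < e" "p \<noteq> s" by (simp_all add: U_def)
    then have "2 * e < dist s p" using e(2)[OF that p(1)] by auto
    then show False using p(2) e(1) by linarith
  qed
  have "Bi \<inter> ?S = {}" using far e(1) Bi(3) by fastforce
  have sub: "(\<Union>s\<in>?S. B s) \<union> Bi \<subseteq> genuine v w"
  proof
    fix p assume p: "p \<in> (\<Union>s\<in>?S. B s) \<union> Bi"
    have "p \<in> zeros v w \<and> p \<notin> ?S"
    proof (cases "p \<in> Bi")
      case True
      then show ?thesis using Bi(3) \<open>Bi \<inter> ?S = {}\<close> by blast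
    next
      case False
      then obtain s where s: "s \<in> ?S" "p \<in> B s" using p by blast
      then have "p \<in> zeros v w" "p \<in> U s" using B[OF s(1)] by auto
      then show ?thesis using US[OF s(1)] by blast
    qed
    then show "p \<in> genuine v w" using zeros_cases[of "fst p" "snd p"] by simp
  qed
  have fg: "finite (genuine v w)"
    using finite_subset[OF genuine_subset] fz unfolding w_def by blast
  have "card (\<Union>s\<in>?S. B s) = (\<Sum>s\<in>?S. card (B s))"
  proof (rule card_UN_disjoint[OF fS])
    show "\<forall>s\<in>?S. finite (B s)" using B by simp
    show "\<forall>s\<in>?S. \<forall>s'\<in>?S. s \<noteq> s' \<longrightarrow> B s \<inter> B s' = {}"
    proof (intro ballI impI)
      fix s s' assume "s \<in> ?S" "s' \<in> ?S" "s \<noteq> s'"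
      then show "B s \<inter> B s' = {}" using B[of s] B[of s'] disj[of s s'] by auto
    qed
  qed
  also have "\<dots> = (\<Sum>s\<in>?S. n s)" using B by simp
  also have "\<dots> = (\<Sum>s\<in>Pts. n s) + (\<Sum>s\<in>Ept. n s)"
    using finite_Pts finite_Ept disj_Pts_Ept by (rule sum.union_disjoint)
  also have "(\<Sum>s\<in>Pts. n s) = (\<Sum>s\<in>Pts. 9)"
    by (rule sum.cong) (auto simp: n_def)
  also have "(\<Sum>s\<in>Ept. n s) = (\<Sum>s\<in>Ept. 1)"
    using disj_Pts_Ept by (intro sum.cong) (auto simp: n_def)
  finally have c1: "card (\<Union>s\<in>?S. B s) = 9 * (k choose 2) + k"
    by (simp add: card_Pts card_Ept)
  have "B s \<inter> Bi = {}" if s: "s \<in> ?S" for s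
  proof -
    have "B s \<subseteq> cball 0 M" using B[OF s] far[OF s] unfolding U_def by blast
    then show ?thesis using Bi(3) by blast
  qed
  then have "(\<Union>s\<in>?S. B s) \<inter> Bi = {}" by blast
  then have "card ((\<Union>s\<in>?S. B s) \<union> Bi) = 9 * (k choose 2) + k + (3 * k - 2)"
    using c1 Bi B fS by (subst card_Un_disjoint) auto
  also have "\<dots> = NN" using card2 by (simp add: NN_def)
  finally have "NN \<le> card (genuine v w)"
    using card_mono[OF fg sub] by simp
  then show ?thesis
    using card_genuine_le[of v w] fz unfolding w_def by (metis le_antisym)
qed

lemma zeros_cong:
  assumes "\<And>i. i \<in> I \<Longrightarrow> v i = v' i"
  shows "zeros v w = zeros v' w" "genuine v w = genuine v' w"
proof -
  have "fh v x t = fh v' x t" "gh v w x t = gh v' w x t" for x t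
    using assms by (simp_all add: fh_def gh_def)
  then show "zeros v w = zeros v' w" "genuine v w = genuine v' w"
    by (simp_all add: zeros_def genuine_def)
qed

lemma NN_pos: "NN > 0"
  using card2 by (simp add: NN_def)

text \<open>The projection \<open>c\<close> is chosen for one good datum \<open>u0\<close> and then
  kept fixed, so that everything depends polynomially on \<open>u\<close>. For other data it need
  not be injective: \<open>NN\<close> distinct roots of \<open>Q u\<close> already have at least
  \<open>NN\<close> genuine zeros above them, and the upper bound does the rest.\<close>

theorem generic_count:
  fixes vf :: "complex^'n \<Rightarrow> 'i \<Rightarrow> complex" and wf :: "complex^'n \<Rightarrow> complex"
  assumes cp: "\<And>i. i \<in> I \<Longrightarrow> (\<lambda>u. vf u i) \<in> cpoly" "wf \<in> cpoly"
    and surj: "\<And>v w. \<exists>u. (\<forall>i\<in>I. vf u i = v i) \<and> wf u = w"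
  shows "\<exists>G\<in>cpoly. (\<exists>u. G u \<noteq> 0) \<and>
    (\<forall>u. G u \<noteq> 0 \<longrightarrow> finite (zeros (vf u) (wf u)) \<and> card (genuine (vf u) (wf u)) = NN)"
proof -
  obtain u0 where u0: "finite (zeros (vf u0) (wf u0))" "card (genuine (vf u0) (wf u0)) = NN"
  proof -
    obtain v w where vw: "finite (zeros v w)" "card (genuine v w) = NN" using ex_many_genuine by blast
    obtain u where "\<forall>i\<in>I. vf u i = v i" "wf u = w" using surj by blast
    then show ?thesis using that[of u] vw zeros_cong[of "vf u" v w] by simp
  qed
  let ?S = "Pts \<union> Ept"
  let ?g0 = "genuine (vf u0) (wf u0)"
  have fS: "finite ?S" using finite_Pts finite_Ept by simp
  have fg0: "finite ?g0" using finite_subset[OF genuine_subset u0(1)] .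
  have "finite ({c. \<not> good c (vf u0)} \<union> {c. \<not> inj_on (\<lambda>(x, t). x - c * t) (?g0 \<union> ?S)})"
    using finite_bad finite_not_inj_projection[of "?g0 \<union> ?S"] fg0 fS by auto
  then obtain c where c: "good c (vf u0)" "inj_on (proj c) (?g0 \<union> ?S)"
    using ex_new_if_finite[OF infinite_UNIV_char_0] unfolding proj_def by blast
  define R where "R u = Rs c (vf u) (wf u)" for u
  \<comment> \<open>The part of the resultant that is forced by crossings and centres; it depends on
    \<open>c\<close> but not on \<open>u\<close>.\<close>
  define SP where "SP = (\<Prod>s\<in>?S. [:- proj c s, 1:] ^ mlt s)"
  have SP: "SP \<noteq> 0" "degree SP = 9 * (k choose 2) + 5 * k"
  proof -
    show "SP \<noteq> 0" using fS by (auto simp: SP_def)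
    have "degree SP = (\<Sum>s\<in>?S. mlt s)" unfolding SP_def by (rule degree_prod_linear_powers)
    then show "degree SP = 9 * (k choose 2) + 5 * k" using sum_mlt[of "{}"] by simp
  qed
  have c0: "c \<noteq> 0" using c by (simp add: good_def)
  have bF: "bfam (\<lambda>u. FF c (vf u))"
    unfolding FF_def LL_def
    by (intro bfam_sum bfam_mult bfam_const bfam_blin cpoly_intros cp; assumption)
  have bG: "bfam (\<lambda>u. GG c (vf u) (wf u))"
    unfolding GG_def LL_def
    by (intro bfam_add bfam_sum bfam_mult bfam_const bfam_blin cpoly_intros cp; assumption)
  have pR: "pfam R"
    unfolding R_def Rs_def by (rule pfam_sylv[OF bF bG])
  define M where "M = (3 * k - 1) * (3 * k + 1)"
  have dR: "degree (R u) < M" for u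
    unfolding R_def M_def by (rule degree_Rs[OF c0])
  then have "degree (R u) \<le> M" for u by (rule less_imp_le)
  from pfam_divide[OF SP(1) pR this]
  obtain Q where Q: "pfam Q" "\<And>u. degree (Q u) \<le> M" "\<And>u. SP dvd R u \<Longrightarrow> R u = SP * Q u" by blast
  have RQ: "R u = SP * Q u" if "good c (vf u)" for u
    unfolding SP_def
  proof (rule Q(3)[unfolded SP_def], rule prod_linear_powers_dvd[OF fS inj_on_subset[OF c(2)]])
    fix s assume "s \<in> ?S"
    then show "[:- proj c s, 1:] ^ mlt s dvd R u"
      using Rs_dvd[OF that, of "fst s" "snd s" "wf u"] by (simp add: R_def)
  qed auto
  have dQ: "degree (Q u) \<le> NN" if "good c (vf u)" for u
  proof (cases "Q u = 0")
    case False
    then have "degree (R u) = degree SP + degree (Q u)"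
      using RQ[OF that] SP(1) by (simp add: degree_mult_eq)
    then show ?thesis using dR[of u] SP(2) unfolding M_def pq_eq by simp
  qed simp
  define G1 where "G1 u = lcF c (vf u) * (\<Prod>i\<in>I. a i * c - vf u i * (1 - al i * c))" for u
  \<comment> \<open>The four factors say that \<open>c\<close> is still admissible, that
    \<open>Q u\<close> has full degree, that its roots are simple, and that none of them is the
    projection of a crossing or a centre.\<close>
  define G where "G u = G1 u * coeff (Q u) NN * sylv NN (NN - 1) (Q u) (pderiv (Q u)) * (\<Prod>s\<in>?S. poly (Q u) (proj c s))" for u
  have G1: "G1 u \<noteq> 0 \<longleftrightarrow> good c (vf u)" for u
    using c0 fin by (auto simp: G1_def good_def)
  have "G \<in> cpoly"
  proof -
    have "(\<lambda>u. lcF c (vf u)) \<in> cpoly"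
      unfolding lcF_def by (intro cpoly_intros cp; assumption)
    moreover have "(\<lambda>u. coeff (Q u) NN) \<in> cpoly" using Q(1) by (simp add: pfam_def)
    moreover have "(\<lambda>u. sylv NN (NN - 1) (Q u) (pderiv (Q u))) \<in> cpoly"
      by (intro cpoly_sylv pfam_pderiv Q(1))
    moreover have "(\<lambda>u. \<Prod>s\<in>?S. poly (Q u) (proj c s)) \<in> cpoly"
      by (intro cpoly_prod cpoly_poly_pfam[OF Q(1,2)])
    moreover have "(\<lambda>u. \<Prod>i\<in>I. a i * c - vf u i * (1 - al i * c)) \<in> cpoly"
      by (intro cpoly_intros cp; assumption)
    ultimately show ?thesis
      unfolding G_def G1_def by (intro cpoly_mult)
  qed
  moreover have "G u0 \<noteq> 0"
  proof -
    have R0: "R u0 \<noteq> 0" using finite_zeros_iff[OF c(1)] u0(1) by (simp add: R_def)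
    then have Q0: "Q u0 \<noteq> 0" using RQ[OF c(1)] by auto
    have SP0: "poly SP (proj c s) \<noteq> 0" if "s \<in> ?g0" for s
    proof -
      have "proj c s \<noteq> proj c s'" if "s' \<in> ?S" for s'
        using inj_onD[OF c(2), of s s'] \<open>s \<in> ?g0\<close> that disj_genuine by blast
      then show ?thesis using fS by (auto simp: SP_def poly_prod)
    qed
    have root: "poly (Q u0) (proj c s) = 0" if "s \<in> ?g0" for s
    proof -
      have "mlt s = 1" using that disj_genuine by (auto simp: mlt_def)
      then have "poly (R u0) (proj c s) = 0"
        using Rs_dvd[OF c(1), of "fst s" "snd s" "wf u0"] that genuine_subset[of "vf u0" "wf u0"]
        by (auto simp: R_def poly_eq_0_iff_dvd)
      then show ?thesis using RQ[OF c(1)] SP0[OF that] by simp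
    qed
    have injg: "inj_on (proj c) ?g0" using c(2) by (rule inj_on_subset) auto
    have fr: "finite {y. poly (Q u0) y = 0}" using Q0 by (rule poly_roots_finite)
    have card_roots: "card {y. poly (Q u0) y = 0} \<le> NN"
      using card_poly_roots_bound[OF Q0] dQ[OF c(1)] by linarith
    have sub: "proj c ` ?g0 \<subseteq> {y. poly (Q u0) y = 0}" using root by auto
    have ci: "card (proj c ` ?g0) = NN" using card_image[OF injg] u0(2) by simp
    have eq: "proj c ` ?g0 = {y. poly (Q u0) y = 0}"
      using card_subset_eq[OF fr sub] card_mono[OF fr sub] ci card_roots by simp
    have deg: "degree (Q u0) = NN"
      using card_poly_roots_bound[OF Q0] dQ[OF c(1)] ci unfolding eq by linarith
    have "poly (Q u0) (proj c s) \<noteq> 0" if "s \<in> ?S" for s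
    proof
      assume "poly (Q u0) (proj c s) = 0"
      then obtain s' where "s' \<in> ?g0" "proj c s = proj c s'" using eq by blast
      then show False using inj_onD[OF c(2), of s s'] that disj_genuine by blast
    qed
    moreover have "sylv NN (NN - 1) (Q u0) (pderiv (Q u0)) \<noteq> 0"
      using card_roots_imp_no_common_root[OF deg NN_pos] ci unfolding eq by simp
    moreover have "coeff (Q u0) NN \<noteq> 0" using deg Q0 by (metis leading_coeff_0_iff)
    ultimately show ?thesis
      using G1 c(1) fS by (simp add: G_def)
  qed
  moreover have "finite (zeros (vf u) (wf u)) \<and> card (genuine (vf u) (wf u)) = NN" if Gu: "G u \<noteq> 0" for u
  proof -
    have g: "good c (vf u)" using Gu G1 by (auto simp: G_def)
    have Qn: "coeff (Q u) NN \<noteq> 0" using Gu by (auto simp: G_def)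
    then have dq: "degree (Q u) = NN" using dQ[OF g] le_degree by (metis le_antisym)
    have "Q u \<noteq> 0" using Qn by auto
    then have "R u \<noteq> 0" using RQ[OF g] SP(1) by simp
    then have fz: "finite (zeros (vf u) (wf u))" using finite_zeros_iff[OF g] by (simp add: R_def)
    have cr: "card {y. poly (Q u) y = 0} = NN"
      by (rule no_common_root_imp_card_roots[OF dq NN_pos]) (use Gu in \<open>auto simp: G_def\<close>)
    have sub: "{y. poly (Q u) y = 0} \<subseteq> proj c ` genuine (vf u) (wf u)"
    proof
      fix y assume "y \<in> {y. poly (Q u) y = 0}"
      then have y: "poly (Q u) y = 0" by simp
      then have "poly (R u) y = 0" using RQ[OF g] by simp
      then obtain t where t: "(y + c * t, t) \<in> zeros (vf u) (wf u)"
        using Rs_zero_iff[OF g] by (auto simp: R_def)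
      have p: "proj c (y + c * t, t) = y" by (simp add: proj_def)
      have "(y + c * t, t) \<notin> ?S"
      proof
        assume "(y + c * t, t) \<in> ?S"
        then have "poly (Q u) (proj c (y + c * t, t)) \<noteq> 0"
          using Gu fS by (auto simp: G_def)
        then show False using p y by simp
      qed
      then have "(y + c * t, t) \<in> genuine (vf u) (wf u)" using t by (rule zeros_cases[rotated])
      then show "y \<in> proj c ` genuine (vf u) (wf u)" using p by (metis imageI)
    qed
    have fg: "finite (genuine (vf u) (wf u))" using finite_subset[OF genuine_subset fz] .
    have "NN \<le> card (proj c ` genuine (vf u) (wf u))"
      using card_mono[OF finite_imageI[OF fg] sub] cr by simp
    also have "\<dots> \<le> card (genuine (vf u) (wf u))" by (rule card_image_le[OF fg])
    finally show ?thesis using fz card_genuine_le[OF fz] by simp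
  qed
  ultimately show ?thesis by blast
qed

end

section \<open>Zariski closed sets, tangent spaces and dimension\<close>

text \<open>\<open>G\<close> is the gradient, built along the rules that generate
  \<open>cpoly\<close>. Quantifying over all curves yields both the linearity of
  \<open>dir_deriv\<close> in the direction and its value along holomorphic curves.\<close>

lemma cpoly_chain:
  fixes f :: "complex^'n \<Rightarrow> complex"
  assumes "f \<in> cpoly"
  shows "\<exists>G. \<forall>(\<gamma> :: complex \<Rightarrow> complex^'n) t v. (\<forall>i. ((\<lambda>s. \<gamma> s $ i) has_field_derivative v $ i) (at t)) \<longrightarrow>
     ((\<lambda>s. f (\<gamma> s)) has_field_derivative (\<Sum>i\<in>UNIV. G (\<gamma> t) i * v $ i)) (at t)"
  using assms
proof induction
  case (cpoly_const c)
  then show ?case by (intro exI[of _ "\<lambda>p i. 0"]) simp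
next
  case (cpoly_coord i)
  then show ?case by (intro exI[of _ "\<lambda>p j. if j = i then 1 else 0"]) (simp add: if_distrib[of "\<lambda>x. x * _"] cong: if_cong)
next
  case (cpoly_add f g)
  then obtain F G where
    F: "\<forall>(\<gamma> :: complex \<Rightarrow> complex^'n) t v. (\<forall>i. ((\<lambda>s. \<gamma> s $ i) has_field_derivative v $ i) (at t)) \<longrightarrow>
     ((\<lambda>s. f (\<gamma> s)) has_field_derivative (\<Sum>i\<in>UNIV. F (\<gamma> t) i * v $ i)) (at t)" and
    G: "\<forall>(\<gamma> :: complex \<Rightarrow> complex^'n) t v. (\<forall>i. ((\<lambda>s. \<gamma> s $ i) has_field_derivative v $ i) (at t)) \<longrightarrow>
     ((\<lambda>s. g (\<gamma> s)) has_field_derivative (\<Sum>i\<in>UNIV. G (\<gamma> t) i * v $ i)) (at t)" by blast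
  show ?case
  proof (intro exI[of _ "\<lambda>p i. F p i + G p i"] allI impI)
    fix \<gamma> :: "complex \<Rightarrow> complex^'n" and t v
    assume "\<forall>i. ((\<lambda>s. \<gamma> s $ i) has_field_derivative v $ i) (at t)"
    then show "((\<lambda>s. f (\<gamma> s) + g (\<gamma> s)) has_field_derivative (\<Sum>i\<in>UNIV. (F (\<gamma> t) i + G (\<gamma> t) i) * v $ i)) (at t)"
      using F G by (auto simp: distrib_right sum.distrib intro!: DERIV_add)
  qed
next
  case (cpoly_mult f g)
  then obtain F G where
    F: "\<forall>(\<gamma> :: complex \<Rightarrow> complex^'n) t v. (\<forall>i. ((\<lambda>s. \<gamma> s $ i) has_field_derivative v $ i) (at t)) \<longrightarrow>
     ((\<lambda>s. f (\<gamma> s)) has_field_derivative (\<Sum>i\<in>UNIV. F (\<gamma> t) i * v $ i)) (at t)" and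
    G: "\<forall>(\<gamma> :: complex \<Rightarrow> complex^'n) t v. (\<forall>i. ((\<lambda>s. \<gamma> s $ i) has_field_derivative v $ i) (at t)) \<longrightarrow>
     ((\<lambda>s. g (\<gamma> s)) has_field_derivative (\<Sum>i\<in>UNIV. G (\<gamma> t) i * v $ i)) (at t)" by blast
  show ?case
  proof (intro exI[of _ "\<lambda>p i. F p i * g p + G p i * f p"] allI impI)
    fix \<gamma> :: "complex \<Rightarrow> complex^'n" and t v
    assume d: "\<forall>i. ((\<lambda>s. \<gamma> s $ i) has_field_derivative v $ i) (at t)"
    have "(\<Sum>i\<in>UNIV. (F (\<gamma> t) i * g (\<gamma> t) + G (\<gamma> t) i * f (\<gamma> t)) * v $ i) =
      (\<Sum>i\<in>UNIV. F (\<gamma> t) i * v $ i) * g (\<gamma> t) + (\<Sum>i\<in>UNIV. G (\<gamma> t) i * v $ i) * f (\<gamma> t)"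
      unfolding sum_distrib_right sum.distrib[symmetric] by (rule sum.cong) (simp_all add: algebra_simps)
    then show "((\<lambda>s. f (\<gamma> s) * g (\<gamma> s)) has_field_derivative
       (\<Sum>i\<in>UNIV. (F (\<gamma> t) i * g (\<gamma> t) + G (\<gamma> t) i * f (\<gamma> t)) * v $ i)) (at t)"
      using F d G by (simp only:) (intro DERIV_mult; blast)
  qed
qed

lemma line_deriv: "((\<lambda>s. (p + s *s v) $ i) has_field_derivative v $ i) (at t)" for p v :: "complex^'n"
  by (auto intro!: derivative_eq_intros)

lemma dir_deriv_curve:
  fixes \<gamma> :: "complex \<Rightarrow> complex^'n"
  assumes "f \<in> cpoly" "\<And>i. ((\<lambda>s. \<gamma> s $ i) has_field_derivative v $ i) (at t)"
  shows "((\<lambda>s. f (\<gamma> s)) has_field_derivative dir_deriv f (\<gamma> t) v) (at t)"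
proof -
  obtain G where G: "\<And>(\<gamma> :: complex \<Rightarrow> complex^'n) t v. (\<forall>i. ((\<lambda>s. \<gamma> s $ i) has_field_derivative v $ i) (at t)) \<Longrightarrow>
     ((\<lambda>s. f (\<gamma> s)) has_field_derivative (\<Sum>i\<in>UNIV. G (\<gamma> t) i * v $ i)) (at t)"
    using cpoly_chain[OF assms(1)] by blast
  have "((\<lambda>s. f (\<gamma> t + s *s v)) has_field_derivative (\<Sum>i\<in>UNIV. G (\<gamma> t + 0 *s v) i * v $ i)) (at 0)"
    by (rule G) (use line_deriv in blast)
  then have "dir_deriv f (\<gamma> t) v = (\<Sum>i\<in>UNIV. G (\<gamma> t) i * v $ i)"
    unfolding dir_deriv_def by (simp add: DERIV_imp_deriv)
  then show ?thesis using G[of \<gamma> v t] assms(2) by simp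
qed

lemma dir_deriv_linear:
  fixes p :: "complex^'n"
  assumes "f \<in> cpoly"
  obtains G where "\<And>v. dir_deriv f p v = (\<Sum>i\<in>UNIV. G i * v $ i)"
proof -
  obtain G where G: "\<And>(\<gamma> :: complex \<Rightarrow> complex^'n) t v. (\<forall>i. ((\<lambda>s. \<gamma> s $ i) has_field_derivative v $ i) (at t)) \<Longrightarrow>
     ((\<lambda>s. f (\<gamma> s)) has_field_derivative (\<Sum>i\<in>UNIV. G (\<gamma> t) i * v $ i)) (at t)"
    using cpoly_chain[OF assms(1)] by blast
  have "dir_deriv f p v = (\<Sum>i\<in>UNIV. G p i * v $ i)" for v
  proof -
    have "((\<lambda>s. f (p + s *s v)) has_field_derivative (\<Sum>i\<in>UNIV. G (p + 0 *s v) i * v $ i)) (at 0)"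
      by (rule G) (use line_deriv in blast)
    then show ?thesis unfolding dir_deriv_def by (simp add: DERIV_imp_deriv)
  qed
  then show ?thesis using that by blast
qed

lemma dir_deriv_lincomb:
  assumes "f \<in> cpoly"
  shows "dir_deriv f p (a *s v + b *s w) = a * dir_deriv f p v + b * dir_deriv f p w"
proof -
  obtain G where "\<And>v. dir_deriv f p v = (\<Sum>i\<in>UNIV. G i * v $ i)"
    using dir_deriv_linear[OF assms] by blast
  then show ?thesis by (simp add: algebra_simps sum.distrib sum_distrib_left)
qed

lemma vanishing_ideal_cpoly: "f \<in> vanishing_ideal V \<Longrightarrow> f \<in> cpoly"
  by (simp add: vanishing_ideal_def)

lemma tangent_lincomb:
  assumes "v \<in> tangent_space V p" "w \<in> tangent_space V p"
  shows "a *s v + b *s w \<in> tangent_space V p"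
  using assms by (auto simp: tangent_space_def dir_deriv_lincomb vanishing_ideal_cpoly)

text \<open>The curve has to lie in \<open>V\<close> only for parameters close to \<open>t\<close>
  and different from it; continuity takes care of \<open>t\<close> itself. So velocities at limit
  points of a parametrisation are available too.\<close>

lemma tangent_curve:
  fixes \<gamma> :: "complex \<Rightarrow> complex^'n"
  assumes d: "\<And>i. ((\<lambda>s. \<gamma> s $ i) has_field_derivative v $ i) (at t)"
    and ev: "eventually (\<lambda>s. \<gamma> s \<in> V) (at t)"
  shows "v \<in> tangent_space V (\<gamma> t)"
  unfolding tangent_space_def
proof (intro CollectI ballI)
  fix f assume f: "f \<in> vanishing_ideal V"
  let ?g = "\<lambda>s. f (\<gamma> s)"
  have D: "(?g has_field_derivative dir_deriv f (\<gamma> t) v) (at t)"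
    using f by (intro dir_deriv_curve d) (simp add: vanishing_ideal_def)
  have ev0: "eventually (\<lambda>s. ?g s = 0) (at t)"
    using ev by eventually_elim (use f in \<open>simp add: vanishing_ideal_def\<close>)
  have "(?g \<longlongrightarrow> ?g t) (at t)"
    using DERIV_isCont[OF D] by (simp add: isCont_def)
  moreover have "(?g \<longlongrightarrow> 0) (at t)"
    using tendsto_eventually[OF ev0] .
  ultimately have "?g t = 0"
    using tendsto_unique[OF at_neq_bot] by blast
  then have "eventually (\<lambda>s. ?g s = 0) (nhds t)"
    using ev0 by (auto simp: eventually_at_filter elim: eventually_mono)
  then have "((\<lambda>s. 0) has_field_derivative dir_deriv f (\<gamma> t) v) (at t)"
    using D DERIV_cong_ev[of t t ?g "\<lambda>s. 0" "dir_deriv f (\<gamma> t) v" "dir_deriv f (\<gamma> t) v"] by simp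
  then show "dir_deriv f (\<gamma> t) v = 0"
    using DERIV_unique DERIV_const by blast
qed

section \<open>Products of nonzero polynomial functions\<close>

lemma cpoly_on_line:
  fixes a b :: "complex^'n"
  assumes "f \<in> cpoly"
  shows "\<exists>p. \<forall>t. f (a + t *s b) = poly p t"
  using assms
proof induction
  case (cpoly_const c)
  then show ?case by (intro exI[of _ "[:c:]"]) simp
next
  case (cpoly_coord i)
  then show ?case by (intro exI[of _ "[:a $ i, b $ i:]"]) simp
next
  case (cpoly_add f g)
  then show ?case by (metis poly_add)
next
  case (cpoly_mult f g)
  then show ?case by (metis poly_mult)
qed

text \<open>On the line through \<open>a\<close> and \<open>b\<close> both functions restrict to
  nonzero polynomials in one variable, which together have finitely many zeros.\<close>

lemma cpoly_mult_nonzero: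
  assumes "f \<in> cpoly" "g \<in> cpoly" "f a \<noteq> 0" "g b \<noteq> 0"
  shows "\<exists>c. f c * g c \<noteq> 0"
proof -
  obtain p q where p: "\<And>t. f (a + t *s (b - a)) = poly p t" and q: "\<And>t. g (a + t *s (b - a)) = poly q t"
    using cpoly_on_line assms(1,2) by metis
  have "p \<noteq> 0" using p[of 0] assms(3) by auto
  moreover have "q \<noteq> 0" using q[of 1] assms(4) by auto
  ultimately have "finite ({t. poly p t = 0} \<union> {t. poly q t = 0})"
    using poly_roots_finite by blast
  then obtain t where "poly p t \<noteq> 0" "poly q t \<noteq> 0"
    using ex_new_if_finite[OF infinite_UNIV_char_0] by blast
  then show ?thesis using p q by (intro exI[of _ "a + t *s (b - a)"]) simp
qed

lemma cpoly_prod_nonzero: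
  assumes "finite A" "\<And>i. i \<in> A \<Longrightarrow> f i \<in> cpoly" "\<And>i. i \<in> A \<Longrightarrow> \<exists>u. f i u \<noteq> 0"
  shows "\<exists>u. (\<Prod>i\<in>A. f i u) \<noteq> 0"
  using assms
proof (induction A rule: finite_induct)
  case (insert i A)
  obtain a where "f i a \<noteq> 0" using insert.prems(2)[of i] by blast
  moreover obtain b where "(\<Prod>i\<in>A. f i b) \<noteq> 0" using insert.IH insert.prems by blast
  moreover have "f i \<in> cpoly" "(\<lambda>u. \<Prod>i\<in>A. f i u) \<in> cpoly"
    using insert.prems by auto
  ultimately show ?case
    using cpoly_mult_nonzero[of "f i" "\<lambda>u. \<Prod>i\<in>A. f i u" a b] insert by simp
qed auto

section \<open>Zariski closure and irreducibility\<close>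

lemma zariski_closed_zero_set: "f \<in> cpoly \<Longrightarrow> zariski_closed {u. f u = 0}"
  unfolding zariski_closed_def by (intro exI[of _ "{f}"]) auto

lemma proper_zero_set: "f \<in> cpoly \<Longrightarrow> \<exists>u. f u \<noteq> 0 \<Longrightarrow> proper_zariski_closed {u. f u = 0}"
  unfolding proper_zariski_closed_def using zariski_closed_zero_set by auto

lemma zclosure_closed: "zariski_closed (zclosure S)"
proof -
  have "zclosure S = {x. \<forall>f\<in>{f \<in> cpoly. \<forall>s\<in>S. f s = 0}. f x = 0}"
    unfolding zclosure_def
  proof (intro equalityI subsetI)
    fix x assume x: "x \<in> \<Inter> {T. zariski_closed T \<and> S \<subseteq> T}"
    have "f x = 0" if "f \<in> cpoly" "\<forall>s\<in>S. f s = 0" for f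
      using x zariski_closed_zero_set[OF that(1)] that(2) by (auto dest: bspec[where x = "{u. f u = 0}"])
    then show "x \<in> {x. \<forall>f\<in>{f \<in> cpoly. \<forall>s\<in>S. f s = 0}. f x = 0}" by simp
  next
    fix x assume x: "x \<in> {x. \<forall>f\<in>{f \<in> cpoly. \<forall>s\<in>S. f s = 0}. f x = 0}"
    show "x \<in> \<Inter> {T. zariski_closed T \<and> S \<subseteq> T}"
    proof (intro InterI)
      fix T assume "T \<in> {T. zariski_closed T \<and> S \<subseteq> T}"
      then obtain F where F: "F \<subseteq> cpoly" "T = {x. \<forall>f\<in>F. f x = 0}" "S \<subseteq> T" by (auto simp: zariski_closed_def)
      have "f x = 0" if "f \<in> F" for f
      proof -
        have "f \<in> cpoly" "\<forall>s\<in>S. f s = 0" using F that by auto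
        then show ?thesis using x by blast
      qed
      then show "x \<in> T" using F(2) by simp
    qed
  qed
  then show ?thesis unfolding zariski_closed_def by (intro exI[of _ "{f \<in> cpoly. \<forall>s\<in>S. f s = 0}"]) auto
qed

lemma subset_zclosure: "S \<subseteq> zclosure S"
  by (auto simp: zclosure_def)

lemma zclosure_minimal: "S \<subseteq> T \<Longrightarrow> zariski_closed T \<Longrightarrow> zclosure S \<subseteq> T"
  by (auto simp: zclosure_def)

lemma zclosure_vanish:
  assumes "f \<in> cpoly" "\<And>s. s \<in> S \<Longrightarrow> f s = 0" "x \<in> zclosure S"
  shows "f x = 0"
  using zclosure_minimal[of S "{u. f u = 0}"] zariski_closed_zero_set[OF assms(1)] assms(2,3) by auto

lemma zclosureI: 
  assumes "\<And>f. f \<in> cpoly \<Longrightarrow> (\<And>s. s \<in> S \<Longrightarrow> f s = 0) \<Longrightarrow> f x = 0"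
  shows "x \<in> zclosure S"
  unfolding zclosure_def
proof (intro InterI)
  fix T assume "T \<in> {T. zariski_closed T \<and> S \<subseteq> T}"
  then obtain F where F: "F \<subseteq> cpoly" "T = {x. \<forall>f\<in>F. f x = 0}" "S \<subseteq> T" by (auto simp: zariski_closed_def)
  have "f x = 0" if "f \<in> F" for f
    using assms[of f] F that by auto
  then show "x \<in> T" using F by simp
qed

lemma zirreducible_mult:
  assumes "zirreducible Z" "f \<in> cpoly" "g \<in> cpoly" "\<And>z. z \<in> Z \<Longrightarrow> f z * g z = 0"
  shows "(\<forall>z\<in>Z. f z = 0) \<or> (\<forall>z\<in>Z. g z = 0)"
proof -
  have "Z \<subseteq> {u. f u = 0} \<union> {u. g u = 0}" using assms(4) by auto
  then have "Z \<subseteq> {u. f u = 0} \<or> Z \<subseteq> {u. g u = 0}"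
    using assms(1) zariski_closed_zero_set[OF assms(2)] zariski_closed_zero_set[OF assms(3)]
    unfolding zirreducible_def by blast
  then show ?thesis by blast
qed

text \<open>The hypothesis on products says that the vanishing ideal of \<open>S\<close> is prime.
  It is stated for \<open>S\<close> and not for the closure because on a parametrised set it can be
  checked by clearing denominators.\<close>

lemma zirreducible_zclosure:
  assumes "S \<noteq> {}" and mult: "\<And>f g. f \<in> cpoly \<Longrightarrow> g \<in> cpoly \<Longrightarrow> (\<And>s. s \<in> S \<Longrightarrow> f s * g s = 0) \<Longrightarrow>
     (\<forall>s\<in>S. f s = 0) \<or> (\<forall>s\<in>S. g s = 0)"
  shows "zirreducible (zclosure S)"
  unfolding zirreducible_def
proof (intro conjI allI impI)
  show "zclosure S \<noteq> {}" using assms(1) subset_zclosure by blast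
  fix A B assume A: "zariski_closed A" and B: "zariski_closed B" and sub: "zclosure S \<subseteq> A \<union> B"
  obtain FA where FA: "FA \<subseteq> cpoly" "A = {x. \<forall>f\<in>FA. f x = 0}" using A by (auto simp: zariski_closed_def)
  obtain FB where FB: "FB \<subseteq> cpoly" "B = {x. \<forall>f\<in>FB. f x = 0}" using B by (auto simp: zariski_closed_def)
  have S: "S \<subseteq> A \<union> B" using sub subset_zclosure by blast
  have "S \<subseteq> A \<or> S \<subseteq> B"
  proof (rule ccontr)
    assume "\<not> (S \<subseteq> A \<or> S \<subseteq> B)"
    then obtain s f s' g where f: "f \<in> FA" "s \<in> S" "f s \<noteq> 0" and g: "g \<in> FB" "s' \<in> S" "g s' \<noteq> 0"
      using FA FB by auto
    have "f z * g z = 0" if "z \<in> S" for z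
      using S that f(1) g(1) FA(2) FB(2) by auto
    then show False using mult[of f g] f g FA(1) FB(1) by blast
  qed
  then show "zclosure S \<subseteq> A \<or> zclosure S \<subseteq> B"
    using zclosure_minimal A B by blast
qed

lemma zclosure_singleton: "zclosure {p} = {p}" for p :: "complex^'n"
proof (intro equalityI subsetI)
  fix x assume x: "x \<in> zclosure {p}"
  have "(\<lambda>u. u $ i - p $ i) x = 0" for i
    by (rule zclosure_vanish[OF _ _ x]) (auto intro!: cpoly_intros)
  then show "x \<in> {p}" by (simp add: Finite_Cartesian_Product.vec_eq_iff)
qed (use subset_zclosure in auto)

lemma zirreducible_singleton: "zirreducible {p}" for p :: "complex^'n"
  using zirreducible_zclosure[of "{p}"] by (simp add: zclosure_singleton)

lemma zariski_closed_singleton: "zariski_closed {p}" for p :: "complex^'n"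
  using zclosure_closed[of "{p}"] by (simp add: zclosure_singleton)

section \<open>Monomials and the length of chains of irreducible sets\<close>

primrec monf :: "(nat \<Rightarrow> 'a \<Rightarrow> complex) \<Rightarrow> nat list \<Rightarrow> 'a \<Rightarrow> complex" where
  "monf f [] z = 1"
| "monf f (j # js) z = f (length js) z ^ j * monf f js z"

text \<open>Exponents from a box instead of bounded total degree, so that there are exactly
  \<open>n ^ d\<close> of them. In \<open>monf\<close> the head of a list is the exponent of the
  function with the highest index; removing it corresponds to one step down in a chain.\<close>

definition expo :: "nat \<Rightarrow> nat \<Rightarrow> nat list set" where
  "expo n d = {xs. length xs = d \<and> set xs \<subseteq> {..<n}}"

lemma finite_expo: "finite (expo n d)" and card_expo: "card (expo n d) = n ^ d"
  using finite_lists_length_eq[of "{..<n}" d] card_lists_length_eq[of "{..<n}" d]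
  by (simp_all add: expo_def conj_commute)

lemma sum_expo_Suc: "(\<Sum>xs\<in>expo n (Suc d). h xs) = (\<Sum>j<n. \<Sum>xs\<in>expo n d. h (j # xs))"
  for h :: "nat list \<Rightarrow> complex"
proof -
  have eq: "expo n (Suc d) = (\<lambda>(j, xs). j # xs) ` ({..<n} \<times> expo n d)"
  proof (intro equalityI subsetI)
    fix ys assume "ys \<in> expo n (Suc d)"
    then obtain j xs where "ys = j # xs" "j < n" "xs \<in> expo n d" by (cases ys) (auto simp: expo_def)
    then show "ys \<in> (\<lambda>(j, xs). j # xs) ` ({..<n} \<times> expo n d)" by auto
  qed (auto simp: expo_def)
  have "(\<Sum>xs\<in>expo n (Suc d). h xs) = (\<Sum>(j, xs)\<in>{..<n} \<times> expo n d. h (j # xs))"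
    unfolding eq by (subst sum.reindex) (auto simp: inj_on_def case_prod_unfold intro!: sum.cong)
  then show ?thesis by (simp add: sum.cartesian_product)
qed

lemma cpoly_monf: "(\<And>i. i < d \<Longrightarrow> f i \<in> cpoly) \<Longrightarrow> length xs \<le> d \<Longrightarrow> monf f xs \<in> cpoly"
proof (induction xs)
  case (Cons j js)
  then have "(\<lambda>z. f (length js) z ^ j * monf f js z) \<in> cpoly"
    by (intro cpoly_mult cpoly_power) auto
  then show ?case by simp
next
  case Nil
  have "monf f [] = (\<lambda>z. 1)" by (rule ext) simp
  then show ?case by (simp only: cpoly_const)
qed

text \<open>Functions separating the members of a chain of irreducible sets are algebraically independent.\<close>
lemma chain_independent:
  fixes S :: "nat \<Rightarrow> (complex^'n) set"
  assumes "\<And>k. k \<le> d \<Longrightarrow> zirreducible (S k)"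
    and "\<And>k. k < d \<Longrightarrow> f k \<in> cpoly" "\<And>k z. k < d \<Longrightarrow> z \<in> S k \<Longrightarrow> f k z = 0"
    and "\<And>k. k < d \<Longrightarrow> \<exists>z\<in>S (Suc k). f k z \<noteq> 0"
    and "\<And>z. z \<in> S d \<Longrightarrow> (\<Sum>xs\<in>expo n d. c xs * monf f xs z) = 0"
    and "xs \<in> expo n d" "\<And>k. k < d \<Longrightarrow> S k \<subseteq> S (Suc k)"
  shows "c xs = 0"
  using assms
proof (induction d arbitrary: c xs)
  case 0
  have "expo n 0 = {[]}" by (auto simp: expo_def)
  moreover obtain z where "z \<in> S 0" using "0.prems"(1)[of 0] by (auto simp: zirreducible_def)
  ultimately show ?case using "0.prems"(5)[of z] "0.prems"(6) by simp
next
  case (Suc d)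
  note IH = Suc.IH and irr = Suc.prems(1) and fc = Suc.prems(2) and f0 = Suc.prems(3) and fn = Suc.prems(4) and sub = Suc.prems(7)
  define P where "P j z = (\<Sum>xs\<in>expo n d. c (j # xs) * monf f xs z)" for j z
  have Pc: "P j \<in> cpoly" for j
    unfolding P_def using Suc.prems(2) by (intro cpoly_intros cpoly_monf[of d]) (auto simp: expo_def)
  have fd: "f d \<in> cpoly" using Suc.prems(2) by simp
  have tot: "(\<Sum>j<n. f d z ^ j * P j z) = 0" if "z \<in> S (Suc d)" for z
  proof -
    have "(\<Sum>j<n. f d z ^ j * P j z) = (\<Sum>xs\<in>expo n (Suc d). c xs * monf f xs z)"
      unfolding sum_expo_Suc P_def sum_distrib_left
      by (intro sum.cong refl) (auto simp: expo_def)
    then show ?thesis using Suc.prems(5)[OF that] by simp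
  qed
  \<comment> \<open>The coefficients of the powers of \<open>f d\<close> vanish one after another.
    If those below \<open>J\<close> do, \<open>f d ^ J\<close> splits off; irreducibility of the
    larger set leaves \<open>H = 0\<close>, and on \<open>S d\<close>, where \<open>f d\<close>
    vanishes, \<open>H\<close> reduces to \<open>P J\<close>.\<close>
  have "J \<le> n \<Longrightarrow> \<forall>j<J. \<forall>xs\<in>expo n d. c (j # xs) = 0" for J
  proof (induction J)
    case (Suc J)
    then have J: "J < n" and lower: "P j z = 0" if "j < J" for j z
      using that by (auto simp: P_def)
    have Jn: "J < n" using Suc.prems by simp
    define H where "H z = (\<Sum>i<n - J. f d z ^ i * P (J + i) z)" for z
    have Hc: "H \<in> cpoly" unfolding H_def using fd Pc by (intro cpoly_intros) 
    have "f d z ^ J * H z = 0" if z: "z \<in> S (Suc d)" for z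
    proof -
      have "(\<Sum>j<n. f d z ^ j * P j z) = (\<Sum>j\<in>{J..<n}. f d z ^ j * P j z)"
        using lower by (intro sum.mono_neutral_right) (auto simp: not_le)
      also have "\<dots> = (\<Sum>i<n - J. f d z ^ (i + J) * P (i + J) z)"
        using Jn sum.shift_bounds_nat_ivl[of "\<lambda>j. f d z ^ j * P j z" 0 J "n - J"] by (simp add: lessThan_atLeast0)
      also have "\<dots> = f d z ^ J * H z"
        unfolding H_def sum_distrib_left by (intro sum.cong refl) (simp add: power_add add.commute mult_ac)
      finally show ?thesis using tot[OF z] by simp
    qed
    then have "(\<forall>z\<in>S (Suc d). f d z ^ J = 0) \<or> (\<forall>z\<in>S (Suc d). H z = 0)"
      using irr[of "Suc d"] fd Hc by (intro zirreducible_mult) (auto intro: cpoly_power)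
    moreover have "\<not> (\<forall>z\<in>S (Suc d). f d z ^ J = 0)"
      using fn[of d] by auto
    ultimately have H0: "H z = 0" if "z \<in> S (Suc d)" for z using that by blast
    have PJ: "P J z = 0" if z: "z \<in> S d" for z
    proof -
      have zs: "z \<in> S (Suc d)" and fz: "f d z = 0"
        using z sub[of d] f0[of d z] by auto
      have "H z = (\<Sum>i\<in>{0}. f d z ^ i * P (J + i) z)"
        unfolding H_def using Jn fz by (intro sum.mono_neutral_right) auto
      then show ?thesis using H0[OF zs] by simp
    qed
    have "c (J # xs) = 0" if "xs \<in> expo n d" for xs
      by (rule IH[of "\<lambda>xs. c (J # xs)"])
         (use irr fc f0 fn sub PJ that in \<open>auto simp: P_def\<close>)
    then show ?case using Suc by (auto simp: less_Suc_eq)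
  qed auto
  then show ?case using Suc.prems(6) by (cases xs) (auto simp: expo_def)
qed

text \<open>Gaussian elimination: every equation costs at most one unknown.\<close>

lemma nontrivial_solution:
  fixes M :: "'a \<Rightarrow> 'b \<Rightarrow> complex"
  assumes "finite B" "finite A" "card B < card A"
  shows "\<exists>c. (\<exists>a\<in>A. c a \<noteq> 0) \<and> (\<forall>b\<in>B. (\<Sum>a\<in>A. c a * M a b) = 0)"
  using assms
proof (induction B arbitrary: A M rule: finite_induct)
  case empty
  then obtain a where "a \<in> A" by fastforce
  then show ?case by (intro exI[of _ "\<lambda>_. 1"]) auto
next
  case (insert b B)
  show ?case
  proof (cases "\<forall>a\<in>A. M a b = 0")
    case True
    obtain c where "\<exists>a\<in>A. c a \<noteq> 0" "\<forall>b\<in>B. (\<Sum>a\<in>A. c a * M a b) = 0"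
      using insert.IH[of A M] insert.prems insert.hyps by auto
    then show ?thesis using True by (intro exI[of _ c]) auto
  next
    case False
    then obtain a0 where a0: "a0 \<in> A" "M a0 b \<noteq> 0" by blast
    let ?A = "A - {a0}"
    have "card B < card ?A" using insert.prems insert.hyps a0 by simp
    then obtain c where c: "\<exists>a\<in>?A. c a \<noteq> 0"
      "\<forall>b'\<in>B. (\<Sum>a\<in>?A. c a * (M a b' - M a b / M a0 b * M a0 b')) = 0"
      using insert.IH[of ?A "\<lambda>a b'. M a b' - M a b / M a0 b * M a0 b'"] insert.prems by auto
    define s where "s = (\<Sum>a\<in>?A. c a * M a b / M a0 b)"
    define c' where "c' a = (if a = a0 then - s else c a)" for a
    have sum': "(\<Sum>a\<in>A. c' a * M a b') = - s * M a0 b' + (\<Sum>a\<in>?A. c a * M a b')" for b'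
    proof -
      have "(\<Sum>a\<in>A. c' a * M a b') = c' a0 * M a0 b' + (\<Sum>a\<in>?A. c' a * M a b')"
        using insert.prems(1) a0(1) by (rule sum.remove)
      also have "(\<Sum>a\<in>?A. c' a * M a b') = (\<Sum>a\<in>?A. c a * M a b')"
        by (rule sum.cong) (auto simp: c'_def)
      finally show ?thesis by (simp add: c'_def)
    qed
    have "(\<Sum>a\<in>A. c' a * M a b') = 0" if "b' \<in> insert b B" for b'
    proof (cases "b' = b")
      case True
      have "s * M a0 b = (\<Sum>a\<in>?A. c a * M a b)"
        unfolding s_def sum_distrib_right using a0(2) by (intro sum.cong) auto
      then show ?thesis unfolding sum' True by simp
    next
      case False
      then have "(\<Sum>a\<in>?A. c a * (M a b' - M a b / M a0 b * M a0 b')) = 0" using c(2) that by auto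
      moreover have "(\<Sum>a\<in>?A. c a * (M a b' - M a b / M a0 b * M a0 b')) = (\<Sum>a\<in>?A. c a * M a b') - s * M a0 b'"
        unfolding s_def sum_distrib_right sum_subtractf[symmetric] by (rule sum.cong) (simp_all add: algebra_simps)
      ultimately show ?thesis unfolding sum' by simp
    qed
    moreover have "\<exists>a\<in>A. c' a \<noteq> 0" using c(1) by (auto simp: c'_def)
    ultimately show ?thesis by blast
  qed
qed

text \<open>\<open>deg_le m h\<close> plays the role of "\<open>h\<close> is a polynomial of degree at most \<open>m\<close> in \<open>r\<close> parameters".\<close>
locale graded_functions =
  fixes r :: nat and deg_le :: "nat \<Rightarrow> ('w \<Rightarrow> complex) \<Rightarrow> bool"
  assumes deg_const: "deg_le 0 (\<lambda>w. c)"
    and deg_add: "deg_le m g \<Longrightarrow> deg_le m h \<Longrightarrow> deg_le m (\<lambda>w. g w + h w)"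
    and deg_mult: "deg_le m g \<Longrightarrow> deg_le m' h \<Longrightarrow> deg_le (m + m') (\<lambda>w. g w * h w)"
    and deg_mono: "deg_le m h \<Longrightarrow> m \<le> m' \<Longrightarrow> deg_le m' h"
    and deg_basis: "\<exists>B bas. finite B \<and> card B \<le> (m + 1) ^ r \<and>
      (\<forall>h. deg_le m h \<longrightarrow> (\<exists>co. \<forall>w. h w = (\<Sum>b\<in>B. co b * bas (b::nat \<times> nat) w)))"
    and deg_no_zero_div: "deg_le m g \<Longrightarrow> deg_le m' h \<Longrightarrow> (\<And>w. g w * h w = 0) \<Longrightarrow> (\<forall>w. g w = 0) \<or> (\<forall>w. h w = 0)"
begin

lemma deg_power: "deg_le m h \<Longrightarrow> deg_le (k * m) (\<lambda>w. h w ^ k)"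
  by (induction k) (auto intro: deg_const deg_mult)

text \<open>\<open>n ^ Suc r\<close> functions lie in a space of dimension at most
  \<open>(C * n + 1) ^ r\<close>, which is at most \<open>(C + 1) ^ r * n ^ r\<close>. As soon as
  \<open>n\<close> exceeds \<open>(C + 1) ^ r\<close> they must be dependent.\<close>

lemma deg_dependent:
  assumes "\<And>n xs. xs \<in> expo n (Suc r) \<Longrightarrow> deg_le (C * n) (H n xs)"
  shows "\<exists>n c. (\<exists>xs\<in>expo n (Suc r). c xs \<noteq> 0) \<and> (\<forall>w. (\<Sum>xs\<in>expo n (Suc r). c xs * H n xs w) = 0)"
proof -
  define n where "n = (C + 1) ^ r + 1"
  obtain B bas where B: "finite B" "card B \<le> (C * n + 1) ^ r"
    "\<And>h. deg_le (C * n) h \<Longrightarrow> \<exists>co. \<forall>w. h w = (\<Sum>b\<in>B. co b * bas (b::nat \<times> nat) w)"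
    using deg_basis[of "C * n"] by blast
  have "C * n + 1 \<le> (C + 1) * n" by (simp add: n_def)
  then have "(C * n + 1) ^ r \<le> (C + 1) ^ r * n ^ r"
    unfolding power_mult_distrib[symmetric] by (rule power_mono) simp
  also have "\<dots> < n * n ^ r" unfolding n_def by (intro mult_strict_right_mono) auto
  finally have "card B < card (expo n (Suc r))"
    using B(2) by (simp add: card_expo)
  have "\<forall>xs\<in>expo n (Suc r). \<exists>co. \<forall>w. H n xs w = (\<Sum>b\<in>B. co b * bas b w)"
    using B(3) assms by blast
  from bchoice[OF this] obtain co where co: "\<And>xs w. xs \<in> expo n (Suc r) \<Longrightarrow> H n xs w = (\<Sum>b\<in>B. co xs b * bas b w)"
    by blast
  obtain c where c: "\<exists>xs\<in>expo n (Suc r). c xs \<noteq> 0" "\<And>b. b \<in> B \<Longrightarrow> (\<Sum>xs\<in>expo n (Suc r). c xs * co xs b) = 0"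
    using nontrivial_solution[OF B(1) finite_expo \<open>card B < card (expo n (Suc r))\<close>, of co] by blast
  have "(\<Sum>xs\<in>expo n (Suc r). c xs * H n xs w) = 0" for w
  proof -
    have "(\<Sum>xs\<in>expo n (Suc r). c xs * H n xs w) = (\<Sum>xs\<in>expo n (Suc r). \<Sum>b\<in>B. c xs * co xs b * bas b w)"
      by (intro sum.cong refl) (simp add: co sum_distrib_left mult.assoc)
    also have "\<dots> = (\<Sum>b\<in>B. (\<Sum>xs\<in>expo n (Suc r). c xs * co xs b) * bas b w)"
      by (subst sum.swap) (simp add: sum_distrib_right)
    also have "\<dots> = 0" using c(2) by simp
    finally show ?thesis .
  qed
  then show ?thesis using c(1) by blast
qed

definition rational_param :: "nat \<Rightarrow> ('w \<Rightarrow> complex) \<Rightarrow> ('n \<Rightarrow> 'w \<Rightarrow> complex) \<Rightarrow> ('w \<Rightarrow> complex^'n::finite) \<Rightarrow> bool" where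
  "rational_param m q N \<phi> \<longleftrightarrow> deg_le m q \<and> (\<exists>w. q w \<noteq> 0) \<and> (\<forall>i. deg_le m (N i)) \<and>
     (\<forall>w i. q w \<noteq> 0 \<longrightarrow> \<phi> w $ i * q w = N i w)"

lemma clear_denominators:
  assumes "rational_param m q N \<phi>" "f \<in> cpoly"
  shows "\<exists>e M h. deg_le M h \<and> (\<forall>w. q w \<noteq> 0 \<longrightarrow> f (\<phi> w) * q w ^ e = h w)"
  using assms(2)
proof induction
  case (cpoly_const c)
  then show ?case using deg_const[of c] by (intro exI[of _ 0] exI[of _ "\<lambda>w. c"]) simp
next
  case (cpoly_coord i)
  then show ?case using assms(1) unfolding rational_param_def
    by (intro exI[of _ 1] exI[of _ m] exI[of _ "N i"]) simp
next
  case (cpoly_add f g)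
  then obtain e M h e' M' h' where f: "deg_le M h" "\<And>w. q w \<noteq> 0 \<Longrightarrow> f (\<phi> w) * q w ^ e = h w"
    and g: "deg_le M' h'" "\<And>w. q w \<noteq> 0 \<Longrightarrow> g (\<phi> w) * q w ^ e' = h' w" by blast
  have q: "deg_le m q" using assms(1) by (simp add: rational_param_def)
  define D where "D = M + e' * m + (M' + e * m)"
  have "deg_le (M + e' * m) (\<lambda>w. h w * q w ^ e')" "deg_le (M' + e * m) (\<lambda>w. h' w * q w ^ e)"
    by (intro deg_mult f(1) g(1) deg_power q)+
  then have "deg_le D (\<lambda>w. h w * q w ^ e' + h' w * q w ^ e)"
    by (intro deg_add) (auto simp: D_def intro: deg_mono)
  moreover have "(f (\<phi> w) + g (\<phi> w)) * q w ^ (e + e') = h w * q w ^ e' + h' w * q w ^ e" if "q w \<noteq> 0" for w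
    unfolding f(2)[OF that, symmetric] g(2)[OF that, symmetric] by (simp add: power_add algebra_simps)
  ultimately show ?case by blast
next
  case (cpoly_mult f g)
  then obtain e M h e' M' h' where f: "deg_le M h" "\<And>w. q w \<noteq> 0 \<Longrightarrow> f (\<phi> w) * q w ^ e = h w"
    and g: "deg_le M' h'" "\<And>w. q w \<noteq> 0 \<Longrightarrow> g (\<phi> w) * q w ^ e' = h' w" by blast
  have "(f (\<phi> w) * g (\<phi> w)) * q w ^ (e + e') = h w * h' w" if "q w \<noteq> 0" for w
    unfolding f(2)[OF that, symmetric] g(2)[OF that, symmetric] by (simp add: power_add algebra_simps)
  then show ?case using deg_mult[OF f(1) g(1)] by blast
qed

lemma param_irreducible:
  assumes P: "rational_param m q N \<phi>"
  shows "zirreducible (zclosure (\<phi> ` {w. q w \<noteq> 0}))"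
proof (rule zirreducible_zclosure)
  have q: "deg_le m q" "\<exists>w. q w \<noteq> 0" using P by (auto simp: rational_param_def)
  then show "\<phi> ` {w. q w \<noteq> 0} \<noteq> {}" by auto
  fix f g
  assume fg: "f \<in> cpoly" "g \<in> cpoly" "\<And>s. s \<in> \<phi> ` {w. q w \<noteq> 0} \<Longrightarrow> f s * g s = 0"
  obtain e M h e' M' h' where f: "deg_le M h" "\<And>w. q w \<noteq> 0 \<Longrightarrow> f (\<phi> w) * q w ^ e = h w"
    and g: "deg_le M' h'" "\<And>w. q w \<noteq> 0 \<Longrightarrow> g (\<phi> w) * q w ^ e' = h' w"
    using clear_denominators[OF P fg(1)] clear_denominators[OF P fg(2)] by blast
  \<comment> \<open>The factor \<open>q w\<close> makes the identity true also where the
    parametrisation is undefined; it cancels afterwards because the parameter ring has no zero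
    divisors.\<close>
  have "q w * (h w * h' w) = 0" for w
  proof (cases "q w = 0")
    case False
    have "h w * h' w = (f (\<phi> w) * g (\<phi> w)) * q w ^ e * q w ^ e'"
      unfolding f(2)[OF False, symmetric] g(2)[OF False, symmetric] by simp
    then show ?thesis using fg(3)[of "\<phi> w"] False by simp
  qed simp
  then have "\<forall>w. h w * h' w = 0"
    using deg_no_zero_div[OF q(1) deg_mult[OF f(1) g(1)]] q(2) by blast
  then have "(\<forall>w. h w = 0) \<or> (\<forall>w. h' w = 0)"
    using deg_no_zero_div[OF f(1) g(1)] by blast
  then show "(\<forall>s\<in>\<phi> ` {w. q w \<noteq> 0}. f s = 0) \<or> (\<forall>s\<in>\<phi> ` {w. q w \<noteq> 0}. g s = 0)"
  proof
    assume "\<forall>w. h w = 0"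
    then have "f (\<phi> w) = 0" if "q w \<noteq> 0" for w using f(2)[OF that] that by simp
    then show ?thesis by auto
  next
    assume "\<forall>w. h' w = 0"
    then have "g (\<phi> w) = 0" if "q w \<noteq> 0" for w using g(2)[OF that] that by simp
    then show ?thesis by auto
  qed
qed

lemma param_dependent:
  assumes P: "rational_param m q N \<phi>" and f: "\<And>i. i < Suc r \<Longrightarrow> f i \<in> cpoly"
  shows "\<exists>n c. (\<exists>xs\<in>expo n (Suc r). c xs \<noteq> 0) \<and>
     (\<forall>z\<in>\<phi> ` {w. q w \<noteq> 0}. (\<Sum>xs\<in>expo n (Suc r). c xs * monf f xs z) = 0)"
proof -
  have q: "deg_le m q" using P by (auto simp: rational_param_def)
  have "\<forall>i\<in>{..<Suc r}. \<exists>p. deg_le (fst (snd p)) (snd (snd p)) \<and> (\<forall>w. q w \<noteq> 0 \<longrightarrow> f i (\<phi> w) * q w ^ fst p = snd (snd p) w)"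
    using clear_denominators[OF P f] by simp
  from bchoice[OF this] obtain pp where
    pp: "\<forall>i\<in>{..<Suc r}. deg_le (fst (snd (pp i))) (snd (snd (pp i))) \<and> (\<forall>w. q w \<noteq> 0 \<longrightarrow> f i (\<phi> w) * q w ^ fst (pp i) = snd (snd (pp i)) w)"
    by blast
  define e where "e i = fst (pp i)" for i
  define M where "M i = fst (snd (pp i))" for i
  define h where "h i = snd (snd (pp i))" for i
  have h: "deg_le (M i) (h i)" "\<And>w. q w \<noteq> 0 \<Longrightarrow> f i (\<phi> w) * q w ^ e i = h i w" if "i < Suc r" for i
    using pp that by (auto simp: e_def M_def h_def)
  define D where "D = (\<Sum>i<Suc r. M i + e i * m)"
  \<comment> \<open>The numerator of a monomial. The factor \<open>f i ^ j\<close> is brought to the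
    denominator \<open>q ^ (e i * n)\<close> whatever \<open>j\<close> is. So all monomials share
    one denominator and relations between numerators are relations between monomials, while the
    degrees grow only linearly in \<open>n\<close>.\<close>
  define Hm where "Hm n = rec_list (\<lambda>w. 1) (\<lambda>j js H w. (h (length js) w ^ j * q w ^ (e (length js) * (n - j))) * H w)" for n
  have Hm: "Hm n [] = (\<lambda>w. 1)" "Hm n (j # js) = (\<lambda>w. (h (length js) w ^ j * q w ^ (e (length js) * (n - j))) * Hm n js w)" for n j js
    by (simp_all add: Hm_def)
  have deg: "length xs \<le> Suc r \<Longrightarrow> set xs \<subseteq> {..<n} \<Longrightarrow> deg_le (D * n * length xs) (Hm n xs)" for n xs
  proof (induction xs)
    case Nil
    then show ?case by (simp add: Hm deg_const)
  next
    case (Cons j js)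
    let ?l = "length js"
    have l: "?l < Suc r" and jn: "j < n" using Cons.prems by auto
    have "deg_le (j * M ?l + e ?l * (n - j) * m) (\<lambda>w. h ?l w ^ j * q w ^ (e ?l * (n - j)))"
      by (intro deg_mult deg_power h(1) l q)
    moreover have "j * M ?l + e ?l * (n - j) * m \<le> D * n"
    proof -
      have "M ?l + e ?l * m \<le> D"
        unfolding D_def using l by (intro member_le_sum) auto
      moreover have "j * M ?l + e ?l * (n - j) * m \<le> n * M ?l + e ?l * n * m"
        using jn by (intro add_mono mult_right_mono mult_left_mono) auto
      moreover have "n * M ?l + e ?l * n * m = (M ?l + e ?l * m) * n" by (simp add: algebra_simps)
      ultimately show ?thesis using mult_right_mono[of "M ?l + e ?l * m" D n] by linarith
    qed
    ultimately have "deg_le (D * n) (\<lambda>w. h ?l w ^ j * q w ^ (e ?l * (n - j)))" by (rule deg_mono)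
    moreover have "deg_le (D * n * ?l) (Hm n js)" using Cons by auto
    ultimately have "deg_le (D * n + D * n * ?l) (Hm n (j # js))"
      unfolding Hm by (rule deg_mult)
    then show ?case by simp
  qed
  have val: "length xs \<le> Suc r \<Longrightarrow> set xs \<subseteq> {..<n} \<Longrightarrow> q w \<noteq> 0 \<Longrightarrow>
      Hm n xs w = monf f xs (\<phi> w) * q w ^ (n * (\<Sum>i<length xs. e i))" for n xs w
  proof (induction xs)
    case Nil
    then show ?case by (simp add: Hm)
  next
    case (Cons j js)
    let ?l = "length js"
    have l: "?l < Suc r" and jn: "j < n" using Cons.prems by auto
    have IH: "Hm n js w = monf f js (\<phi> w) * q w ^ (n * (\<Sum>i<length js. e i))"
      using Cons by auto
    have "h ?l w ^ j * q w ^ (e ?l * (n - j)) = f ?l (\<phi> w) ^ j * (q w ^ (e ?l * j) * q w ^ (e ?l * (n - j)))"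
      unfolding h(2)[OF l Cons.prems(3), symmetric] by (simp add: power_mult_distrib power_mult)
    also have "q w ^ (e ?l * j) * q w ^ (e ?l * (n - j)) = q w ^ (e ?l * n)"
      using jn by (simp add: power_add[symmetric] distrib_left[symmetric])
    finally show ?case
      unfolding Hm IH by (simp add: power_add algebra_simps)
  qed
  have "deg_le (D * Suc r * n) (Hm n xs)" if "xs \<in> expo n (Suc r)" for n xs
  proof -
    have l: "length xs = Suc r" "set xs \<subseteq> {..<n}" using that by (auto simp: expo_def)
    have "deg_le (D * n * length xs) (Hm n xs)" by (rule deg) (use l in auto)
    moreover have "D * n * length xs = D * Suc r * n" unfolding l(1) by (rule mult.commute[THEN trans]) (simp only: mult_ac)
    ultimately show ?thesis by (simp only:)
  qed
  from deg_dependent[OF this] obtain n where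
    "\<exists>c. (\<exists>xs\<in>expo n (Suc r). c xs \<noteq> 0) \<and> (\<forall>w. (\<Sum>xs\<in>expo n (Suc r). c xs * Hm n xs w) = 0)"
    by (rule exE)
  then obtain c where c0: "(\<exists>xs\<in>expo n (Suc r). c xs \<noteq> 0) \<and> (\<forall>w. (\<Sum>xs\<in>expo n (Suc r). c xs * Hm n xs w) = 0)"
    by (rule exE)
  note c = c0[THEN conjunct1] c0[THEN conjunct2, rule_format]
  have "(\<Sum>xs\<in>expo n (Suc r). c xs * monf f xs (\<phi> w)) = 0" if w: "q w \<noteq> 0" for w
  proof -
    have "(\<Sum>xs\<in>expo n (Suc r). c xs * Hm n xs w) =
        (\<Sum>xs\<in>expo n (Suc r). c xs * monf f xs (\<phi> w)) * q w ^ (n * (\<Sum>i<Suc r. e i))"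
      unfolding sum_distrib_right by (rule sum.cong) (auto simp: val[OF _ _ w] expo_def)
    then show ?thesis using c(2)[of w] w by simp
  qed
  then show ?thesis using c(1) by blast
qed

text \<open>The transcendence degree argument in elementary form. A chain of length
  \<open>r + 1\<close> yields \<open>r + 1\<close> functions, each vanishing on one member but not
  on the next. By \<open>param_dependent\<close> they satisfy a nontrivial polynomial relation on
  the image and hence on its closure, which \<open>chain_independent\<close> forbids.\<close>

lemma param_chain_bound:
  fixes S :: "nat \<Rightarrow> (complex^'n::finite) set"
  assumes P: "rational_param m q N \<phi>"
    and S: "\<And>k. k \<le> d \<Longrightarrow> zariski_closed (S k) \<and> zirreducible (S k) \<and> S k \<subseteq> zclosure (\<phi> ` {w. q w \<noteq> 0})"
    and strict: "\<And>k. k < d \<Longrightarrow> S k \<subset> S (Suc k)"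
  shows "d \<le> r"
proof (rule ccontr)
  assume "\<not> d \<le> r"
  then have rd: "Suc r \<le> d" by simp
  have "\<exists>f\<in>cpoly. (\<forall>z\<in>S k. f z = 0) \<and> (\<exists>z\<in>S (Suc k). f z \<noteq> 0)" if "k < Suc r" for k
  proof -
    have "zariski_closed (S k)" using S[of k] rd that by simp
    then obtain F where F: "F \<subseteq> cpoly" "S k = {x. \<forall>f\<in>F. f x = 0}" by (auto simp: zariski_closed_def)
    have "S k \<subset> S (Suc k)" using rd that by (intro strict) simp
    then obtain z where z: "z \<in> S (Suc k)" "z \<notin> S k" by blast
    then obtain f where "f \<in> F" "f z \<noteq> 0" using F(2) by auto
    then show ?thesis using F z by blast
  qed
  then have "\<forall>k\<in>{..<Suc r}. \<exists>f. f \<in> cpoly \<and> (\<forall>z\<in>S k. f z = 0) \<and> (\<exists>z\<in>S (Suc k). f z \<noteq> 0)" by blast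
  from bchoice[OF this] obtain f where
    f: "\<And>k. k < Suc r \<Longrightarrow> f k \<in> cpoly \<and> (\<forall>z\<in>S k. f k z = 0) \<and> (\<exists>z\<in>S (Suc k). f k z \<noteq> 0)" by blast
  obtain n c where c: "\<exists>xs\<in>expo n (Suc r). c xs \<noteq> 0"
    "\<And>z. z \<in> \<phi> ` {w. q w \<noteq> 0} \<Longrightarrow> (\<Sum>xs\<in>expo n (Suc r). c xs * monf f xs z) = 0"
    using param_dependent[OF P, of f] f by blast
  have cp: "(\<lambda>z. \<Sum>xs\<in>expo n (Suc r). c xs * monf f xs z) \<in> cpoly"
    using f by (intro cpoly_intros cpoly_monf[of "Suc r"]) (auto simp: expo_def)
  have van: "(\<Sum>xs\<in>expo n (Suc r). c xs * monf f xs z) = 0" if "z \<in> S (Suc r)" for z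
    by (rule zclosure_vanish[OF cp c(2)]) (use that S[OF rd] in auto)
  obtain xs where xs: "xs \<in> expo n (Suc r)" "c xs \<noteq> 0" using c(1) by blast
  have "c xs = 0"
  proof (rule chain_independent[where d = "Suc r" and S = S and f = f and n = n and c = c])
    show "S k \<subseteq> S (Suc k)" if "k < Suc r" for k
    proof -
      have "S k \<subset> S (Suc k)" using rd that by (intro strict) simp
      then show ?thesis by blast
    qed
  qed (use S f rd van xs in auto)
  then show False using xs(2) by simp
qed

end

section \<open>Local dimension and rational parametrisations in one and two variables\<close>

lemma local_dim_eqI:
  fixes V :: "(complex^'n) set"
  assumes "\<And>d S. (\<And>k. k \<le> d \<Longrightarrow> zariski_closed (S k) \<and> zirreducible (S k) \<and> S k \<subseteq> V) \<Longrightarrow>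
      (\<And>k. k < d \<Longrightarrow> S k \<subset> S (Suc k)) \<Longrightarrow> d \<le> r"
    and "\<And>k. k \<le> r \<Longrightarrow> zariski_closed (S0 k) \<and> zirreducible (S0 k) \<and> S0 k \<subseteq> V"
    and "\<And>k. k < r \<Longrightarrow> S0 k \<subset> S0 (Suc k)" and "p \<in> S0 r"
  shows "local_dim V p = r"
  unfolding local_dim_def
proof (rule cSup_eq_maximum)
  show "r \<in> {d. \<exists>S. (\<forall>k\<le>d. zariski_closed (S k) \<and> zirreducible (S k) \<and> S k \<subseteq> V) \<and>
      (\<forall>k<d. S k \<subset> S (Suc k)) \<and> p \<in> S d}"
    using assms(2-4) by blast
qed (use assms(1) in blast)

lemma bev_as_sum:
  fixes F :: "'a::comm_ring_1 poly poly"
  assumes "tdeg_le m F"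
  shows "bev F y z = (\<Sum>(l, j)\<in>{..m} \<times> {..m}. coeff (coeff F l) j * (y ^ j * z ^ l))"
proof -
  let ?m = "map_poly (\<lambda>c. poly c y) F"
  have "degree ?m < Suc m"
    using degree_map_poly_le[of "\<lambda>c. poly c y" F] tdeg_le_degree[OF assms] by linarith
  then have "bev F y z = (\<Sum>l<Suc m. coeff ?m l * z ^ l)"
    unfolding bev_conv by (rule poly_sum_coeff_less[symmetric])
  also have "\<dots> = (\<Sum>l\<le>m. (\<Sum>j\<le>m. coeff (coeff F l) j * (y ^ j * z ^ l)))"
    unfolding lessThan_Suc_atMost
  proof (rule sum.cong)
    fix l assume "l \<in> {..m}"
    have "degree (coeff F l) < Suc m"
      using assms by (intro le_imp_less_Suc degree_le) (auto simp: tdeg_le_def)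
    then have "(\<Sum>j<Suc m. coeff (coeff F l) j * y ^ j) = poly (coeff F l) y"
      by (rule poly_sum_coeff_less)
    moreover have "coeff ?m l = poly (coeff F l) y" by (simp add: coeff_map_poly)
    ultimately have "coeff ?m l = (\<Sum>j<Suc m. coeff (coeff F l) j * y ^ j)" by (simp only:)
    then show "coeff ?m l * z ^ l = (\<Sum>j\<le>m. coeff (coeff F l) j * (y ^ j * z ^ l))"
      unfolding lessThan_Suc_atMost by (simp only: sum_distrib_right mult.assoc)
  qed simp
  finally show ?thesis by (simp add: sum.cartesian_product)
qed

lemma bev_eq_0_imp:
  fixes F :: "complex poly poly"
  assumes "\<And>y z. bev F y z = 0"
  shows "F = 0"
proof -
  have "map_poly (\<lambda>c. poly c y) F = 0" for y
    using assms[of y] poly_all_0_iff_0[of "map_poly (\<lambda>c. poly c y) F"] unfolding bev_conv by blast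
  then have "coeff (map_poly (\<lambda>c. poly c y) F) l = 0" for y l by simp
  then have "poly (coeff F l) y = 0" for y l by (simp add: coeff_map_poly)
  then have "coeff F l = 0" for l using poly_all_0_iff_0 by blast
  then show ?thesis by (intro poly_eqI) simp
qed

interpretation uni: graded_functions 1 "\<lambda>m h. \<exists>p. degree p \<le> m \<and> h = poly (p :: complex poly)"
proof
  show "\<exists>p. degree p \<le> 0 \<and> (\<lambda>w. c) = poly p" for c :: complex
    by (intro exI[of _ "[:c:]"]) auto
next
  fix m g h assume "\<exists>p. degree p \<le> m \<and> g = poly (p :: complex poly)" "\<exists>p. degree p \<le> m \<and> h = poly (p :: complex poly)"
  then obtain p p' :: "complex poly" where "degree p \<le> m" "g = poly p" "degree p' \<le> m" "h = poly p'" by blast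
  then show "\<exists>p. degree p \<le> m \<and> (\<lambda>w. g w + h w) = poly p"
    by (intro exI[of _ "p + p'"]) (auto intro: degree_add_le)
next
  fix m m' g h assume "\<exists>p. degree p \<le> m \<and> g = poly (p :: complex poly)" "\<exists>p. degree p \<le> m' \<and> h = poly (p :: complex poly)"
  then obtain p p' :: "complex poly" where "degree p \<le> m" "g = poly p" "degree p' \<le> m'" "h = poly p'" by blast
  then show "\<exists>p. degree p \<le> m + m' \<and> (\<lambda>w. g w * h w) = poly p"
    using degree_mult_le[of p p'] by (intro exI[of _ "p * p'"]) auto
next
  fix m h m' assume "\<exists>p. degree p \<le> m \<and> h = poly (p :: complex poly)" "m \<le> (m' :: nat)"
  then obtain p :: "complex poly" where "degree p \<le> m" "m \<le> m'" "h = poly p" by blast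
  then have "degree p \<le> m'" "h = poly p" by simp_all
  then show "\<exists>p. degree p \<le> m' \<and> h = poly (p :: complex poly)" by blast
next
  fix m :: nat
  let ?B = "(\<lambda>i. (i, 0 :: nat)) ` {..m}"
  show "\<exists>B bas. finite B \<and> card B \<le> (m + 1) ^ 1 \<and> (\<forall>h. (\<exists>p. degree p \<le> m \<and> h = poly (p :: complex poly)) \<longrightarrow>
     (\<exists>co. \<forall>w. h w = (\<Sum>b\<in>B. co b * bas (b::nat \<times> nat) w)))"
  proof (intro exI[of _ ?B] exI[of _ "\<lambda>b w. w ^ fst b"] conjI allI impI)
    show "card ?B \<le> (m + 1) ^ 1" by (simp add: card_image inj_on_def)
    fix h assume "\<exists>p. degree p \<le> m \<and> h = poly (p :: complex poly)"
    then obtain p :: "complex poly" where "degree p \<le> m" "h = poly p" by blast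
    then have p: "degree p < Suc m" "h = poly p" by simp_all
    have "h w = (\<Sum>b\<in>?B. coeff p (fst b) * w ^ fst b)" for w
      using poly_sum_coeff_less[OF p(1), of w] p(2) by (simp add: sum.reindex inj_on_def lessThan_Suc_atMost)
    then show "\<exists>co. \<forall>w. h w = (\<Sum>b\<in>?B. co b * w ^ fst b)" by (intro exI[of _ "\<lambda>b. coeff p (fst b)"]) simp
  qed simp
next
  fix m m' g h assume "\<exists>p. degree p \<le> m \<and> g = poly (p :: complex poly)" "\<exists>p. degree p \<le> m' \<and> h = poly (p :: complex poly)"
    and 0: "\<And>w. g w * h w = 0"
  then obtain p p' :: "complex poly" where p: "g = poly p" "h = poly p'" by blast
  have "poly (p * p') w = 0" for w using 0[of w] unfolding p by simp
  then have "p * p' = 0" using poly_all_0_iff_0 by blast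
  then show "(\<forall>w. g w = 0) \<or> (\<forall>w. h w = 0)" unfolding p by auto
qed

interpretation biv: graded_functions 2 "\<lambda>m h. \<exists>F. tdeg_le m F \<and> h = (\<lambda>w. bev (F :: complex poly poly) (fst w) (snd w))"
proof
  show "\<exists>F. tdeg_le 0 F \<and> (\<lambda>w. c) = (\<lambda>w. bev F (fst w) (snd w))" for c :: complex
    by (intro exI[of _ "blin c 0 0"]) (auto simp: tdeg_le_blin0)
next
  fix m and g h :: "complex \<times> complex \<Rightarrow> complex"
  assume "\<exists>F. tdeg_le m F \<and> g = (\<lambda>w. bev F (fst w) (snd w))" "\<exists>F. tdeg_le m F \<and> h = (\<lambda>w. bev F (fst w) (snd w))"
  then obtain F F' where "tdeg_le m F" "g = (\<lambda>w. bev F (fst w) (snd w))" "tdeg_le m F'" "h = (\<lambda>w. bev F' (fst w) (snd w))" by blast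
  then show "\<exists>F. tdeg_le m F \<and> (\<lambda>w. g w + h w) = (\<lambda>w. bev F (fst w) (snd w))"
    by (intro exI[of _ "F + F'"]) (auto intro: tdeg_le_add)
next
  fix m m' and g h :: "complex \<times> complex \<Rightarrow> complex"
  assume "\<exists>F. tdeg_le m F \<and> g = (\<lambda>w. bev F (fst w) (snd w))" "\<exists>F. tdeg_le m' F \<and> h = (\<lambda>w. bev F (fst w) (snd w))"
  then obtain F F' where "tdeg_le m F" "g = (\<lambda>w. bev F (fst w) (snd w))" "tdeg_le m' F'" "h = (\<lambda>w. bev F' (fst w) (snd w))" by blast
  then show "\<exists>F. tdeg_le (m + m') F \<and> (\<lambda>w. g w * h w) = (\<lambda>w. bev F (fst w) (snd w))"
    by (intro exI[of _ "F * F'"]) (auto intro: tdeg_le_mult)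
next
  fix m h m' assume "\<exists>F. tdeg_le m F \<and> h = (\<lambda>w. bev (F :: complex poly poly) (fst w) (snd w))" "m \<le> (m' :: nat)"
  then show "\<exists>F. tdeg_le m' F \<and> h = (\<lambda>w. bev (F :: complex poly poly) (fst w) (snd w))" using tdeg_le_mono by blast
next
  fix m :: nat
  let ?B = "{..m} \<times> {..m}"
  show "\<exists>B bas. finite B \<and> card B \<le> (m + 1) ^ 2 \<and> (\<forall>h. (\<exists>F. tdeg_le m F \<and> h = (\<lambda>w. bev (F :: complex poly poly) (fst w) (snd w))) \<longrightarrow>
     (\<exists>co. \<forall>w. h w = (\<Sum>b\<in>B. co b * bas (b::nat \<times> nat) w)))"
  proof (intro exI[of _ ?B] exI[of _ "\<lambda>b w. fst w ^ snd b * snd w ^ fst b"] conjI allI impI)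
    show "card ?B \<le> (m + 1) ^ 2" by (simp add: power2_eq_square)
    fix h assume "\<exists>F. tdeg_le m F \<and> h = (\<lambda>w. bev (F :: complex poly poly) (fst w) (snd w))"
    then obtain F :: "complex poly poly" where F: "tdeg_le m F" "h = (\<lambda>w. bev F (fst w) (snd w))" by blast
    show "\<exists>co. \<forall>w. h w = (\<Sum>b\<in>?B. co b * (fst w ^ snd b * snd w ^ fst b))"
      unfolding F(2) by (intro exI[of _ "\<lambda>b. coeff (coeff F (fst b)) (snd b)"]) (simp add: bev_as_sum[OF F(1)] case_prod_unfold)
  qed simp
next
  fix m m' and g h :: "complex \<times> complex \<Rightarrow> complex"
  assume "\<exists>F. tdeg_le m F \<and> g = (\<lambda>w. bev F (fst w) (snd w))" "\<exists>F. tdeg_le m' F \<and> h = (\<lambda>w. bev F (fst w) (snd w))"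
    and 0: "\<And>w. g w * h w = 0"
  then obtain F F' where F: "g = (\<lambda>w. bev F (fst w) (snd w))" "h = (\<lambda>w. bev F' (fst w) (snd w))" by blast
  have "bev (F * F') y z = 0" for y z using 0[of "(y, z)"] unfolding F by simp
  then have "F * F' = 0" by (rule bev_eq_0_imp)
  then show "(\<forall>w. g w = 0) \<or> (\<forall>w. h w = 0)" unfolding F by (auto simp: bev_def)
qed

lemma ex_tdeg: "\<exists>m. tdeg_le m F" for F :: "'a::comm_ring_1 poly poly"
proof (intro exI)
  show "tdeg_le (degree F + (\<Sum>l\<le>degree F. degree (coeff F l))) F"
    unfolding tdeg_le_def
  proof (intro allI impI)
    fix l j assume lj: "degree F + (\<Sum>l\<le>degree F. degree (coeff F l)) < l + j"
    show "coeff (coeff F l) j = 0"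
    proof (cases "l \<le> degree F")
      case True
      then have "degree (coeff F l) \<le> (\<Sum>l\<le>degree F. degree (coeff F l))"
        by (intro member_le_sum) auto
      then show ?thesis using lj True by (intro coeff_eq_0) linarith
    qed (simp add: coeff_eq_0)
  qed
qed

lemma rational_param_bivI:
  fixes N :: "'n::finite \<Rightarrow> complex poly poly" and \<phi> :: "complex \<times> complex \<Rightarrow> complex^'n"
  assumes "bev Q y0 z0 \<noteq> 0" "\<And>y z i. bev Q y z \<noteq> 0 \<Longrightarrow> \<phi> (y, z) $ i * bev Q y z = bev (N i) y z"
  shows "\<exists>m. biv.rational_param m (\<lambda>w. bev Q (fst w) (snd w)) (\<lambda>i w. bev (N i) (fst w) (snd w)) \<phi>"
proof -
  obtain d where d: "\<And>F :: complex poly poly. tdeg_le (d F) F" using ex_tdeg by metis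
  define m where "m = d Q + (\<Sum>i\<in>UNIV. d (N i))"
  have "tdeg_le m Q" using tdeg_le_mono[OF d] by (simp add: m_def)
  moreover have "tdeg_le m (N i)" for i
  proof -
    have "d (N i) \<le> (\<Sum>i\<in>UNIV. d (N i))" by (intro member_le_sum) auto
    then show ?thesis by (intro tdeg_le_mono[OF d]) (simp add: m_def)
  qed
  ultimately show ?thesis
    unfolding biv.rational_param_def using assms by (intro exI[of _ m]) auto
qed

lemma rational_param_uniI:
  fixes N :: "'n::finite \<Rightarrow> complex poly" and \<phi> :: "complex \<Rightarrow> complex^'n"
  assumes "poly Q z0 \<noteq> 0" "\<And>z i. poly Q z \<noteq> 0 \<Longrightarrow> \<phi> z $ i * poly Q z = poly (N i) z"
  shows "\<exists>m. uni.rational_param m (poly Q) (\<lambda>i. poly (N i)) \<phi>"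
proof -
  define m where "m = degree Q + (\<Sum>i\<in>UNIV. degree (N i))"
  have "degree Q \<le> m" by (simp add: m_def)
  moreover have "degree (N i) \<le> m" for i
  proof -
    have "degree (N i) \<le> (\<Sum>i\<in>UNIV. degree (N i))" by (intro member_le_sum) auto
    then show ?thesis by (simp add: m_def)
  qed
  ultimately show ?thesis
    unfolding uni.rational_param_def using assms by (intro exI[of _ m]) auto
qed

section \<open>Tangent spaces of dimension one and two\<close>

lemma vec_independent_pair:
  fixes v w :: "complex^'n"
  assumes "\<And>\<alpha> \<beta>. \<alpha> *s v + \<beta> *s w = 0 \<Longrightarrow> \<alpha> = 0 \<and> \<beta> = 0"
  shows "vec.independent {v, w}" "v \<noteq> w"
proof -
  show "v \<noteq> w"
  proof
    assume "v = w"
    then have "1 *s v + (-1) *s w = 0" by simp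
    then show False using assms by fastforce
  qed
  have w: "w \<noteq> 0" using assms[of 0 1] by auto
  have "v \<notin> vec.span {w}"
  proof
    assume "v \<in> vec.span {w}"
    then obtain k where "v = k *s w" unfolding vec.span_singleton by auto
    then have "1 *s v + (- k) *s w = 0" by simp
    then show False using assms by fastforce
  qed
  then show "vec.independent {v, w}"
    using w \<open>v \<noteq> w\<close> by (simp add: vec.independent_insert)
qed

lemma tangent_dim_2:
  assumes "v \<in> tangent_space V p" "w \<in> tangent_space V p"
    and "\<And>\<alpha> \<beta>. \<alpha> *s v + \<beta> *s w = 0 \<Longrightarrow> \<alpha> = 0 \<and> \<beta> = 0"
    and "\<And>u. u \<in> tangent_space V p \<Longrightarrow> \<exists>\<alpha> \<beta>. u = \<alpha> *s v + \<beta> *s w"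
  shows "vec.dim (tangent_space V p) = 2"
proof -
  have "tangent_space V p = vec.span {v, w}"
  proof (intro equalityI subsetI)
    fix u assume "u \<in> tangent_space V p"
    then obtain \<alpha> \<beta> where "u = \<alpha> *s v + \<beta> *s w" using assms(4) by blast
    moreover have "\<alpha> *s v + \<beta> *s w \<in> vec.span {v, w}"
      by (rule vec.span_add; rule vec.span_scale; rule vec.span_base) auto
    ultimately show "u \<in> vec.span {v, w}" by simp
  next
    fix u assume "u \<in> vec.span {v, w}"
    then obtain k where "u - k *s v \<in> vec.span {w}" unfolding vec.span_breakdown_eq[of u v] by blast
    then obtain l where "u - k *s v = l *s w" unfolding vec.span_singleton by auto
    then have "u = k *s v + l *s w" by (simp add: algebra_simps)
    then show "u \<in> tangent_space V p" using tangent_lincomb[OF assms(1,2)] by simp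
  qed
  then show ?thesis
    using vec_independent_pair[of v w] assms(3) by (simp add: vec.dim_eq_card_independent)
qed

lemma tangent_dim_1:
  assumes "v \<in> tangent_space V p" "v \<noteq> 0" "\<And>u. u \<in> tangent_space V p \<Longrightarrow> \<exists>\<alpha>. u = \<alpha> *s v"
  shows "vec.dim (tangent_space V p) = 1"
proof -
  have "tangent_space V p = vec.span {v}"
  proof (intro equalityI subsetI)
    fix u assume "u \<in> vec.span {v}"
    then obtain l where "u = l *s v" unfolding vec.span_singleton by auto
    then show "u \<in> tangent_space V p" using tangent_lincomb[OF assms(1,1), of l 0] by simp
  qed (use assms(3) in \<open>auto simp: vec.span_singleton\<close>)
  moreover have "vec.independent {v}" using assms(2) by simp
  ultimately show ?thesis by (simp add: vec.dim_eq_card_independent)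
qed

section \<open>The surface of images of the lines through a point\<close>

text \<open>Factor \<open>i\<close> of the surface lies on the affine line \<open>P i + s R i\<close>; the scalar coordinates
  \<open>s\<close> are orthonormalised so that the squared distance is the sum of \<open>(s i - sg i u)^2\<close> up to a constant.\<close>
locale framed_lines =
  fixes P R :: "'m::finite \<Rightarrow> complex^2"
  assumes R1: "\<And>i. (\<Sum>k\<in>UNIV. R i $ k * R i $ k) = 1"
begin

definition emb :: "('m \<Rightarrow> complex) \<Rightarrow> complex^('m \<times> 2)" where
  "emb s = (\<chi> p. P (fst p) $ snd p + s (fst p) * R (fst p) $ snd p)"

definition embd :: "('m \<Rightarrow> complex) \<Rightarrow> complex^('m \<times> 2)" where
  "embd \<nu> = (\<chi> p. \<nu> (fst p) * R (fst p) $ snd p)"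

text \<open>The coordinate along the line of factor \<open>i\<close>, extended to the whole space as
  the bilinear product with \<open>R i\<close>. It is thus a polynomial function also of data off
  these lines, and \<open>R1\<close> makes it a left inverse of \<open>emb\<close>.\<close>

definition sg :: "'m \<Rightarrow> complex^('m \<times> 2) \<Rightarrow> complex" where
  "sg i z = (\<Sum>k\<in>UNIV. (z $ (i, k) - P i $ k) * R i $ k)"

definition sgd :: "'m \<Rightarrow> complex^('m \<times> 2) \<Rightarrow> complex" where
  "sgd i v = (\<Sum>k\<in>UNIV. v $ (i, k) * R i $ k)"

lemma sg_emb: "sg i (emb s) = s i"
proof -
  have "sg i (emb s) = s i * (\<Sum>k\<in>UNIV. R i $ k * R i $ k)"
    by (simp add: sg_def emb_def sum_distrib_left mult.assoc)
  then show ?thesis by (simp add: R1)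
qed

lemma sgd_embd: "sgd i (embd \<nu>) = \<nu> i"
proof -
  have "sgd i (embd \<nu>) = \<nu> i * (\<Sum>k\<in>UNIV. R i $ k * R i $ k)"
    by (simp add: sgd_def embd_def sum_distrib_left mult.assoc)
  then show ?thesis by (simp add: R1)
qed

lemma sg_line: "sg i (z + t *s v) = sg i z + t * sgd i v"
  unfolding sg_def sgd_def sum_distrib_left sum.distrib[symmetric]
  by (rule sum.cong) (simp_all add: algebra_simps)

lemma sgd_lincomb: "sgd i (\<alpha> *s v + \<beta> *s w) = \<alpha> * sgd i v + \<beta> * sgd i w"
  unfolding sgd_def sum_distrib_left sum.distrib[symmetric]
  by (rule sum.cong) (simp_all add: algebra_simps)

lemma sg_cpoly: "sg i \<in> cpoly"
proof -
  have "(\<lambda>z. \<Sum>k\<in>UNIV. (z $ (i, k) - P i $ k) * R i $ k) \<in> cpoly"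
    by (intro cpoly_intros)
  then show ?thesis by (simp add: sg_def[abs_def])
qed

lemma emb_line: "emb s + t *s embd \<nu> = emb (\<lambda>i. s i + t * \<nu> i)"
  by (simp add: emb_def embd_def Finite_Cartesian_Product.vec_eq_iff algebra_simps)

lemma embd_lincomb: "\<alpha> *s embd \<nu> + \<beta> *s embd \<nu>' = embd (\<lambda>i. \<alpha> * \<nu> i + \<beta> * \<nu>' i)"
  by (simp add: embd_def Finite_Cartesian_Product.vec_eq_iff algebra_simps)

lemma emb_cpoly_zero: "(\<lambda>z. z $ (i, k) - P i $ k - sg i z * R i $ k) \<in> cpoly"
  using sg_cpoly by (intro cpoly_intros)

lemma emb_deriv:
  assumes "\<And>i. ((\<lambda>s. g s i) has_field_derivative \<nu> i) (at t)"
  shows "((\<lambda>s. emb (g s) $ p) has_field_derivative embd \<nu> $ p) (at t)"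
  unfolding emb_def embd_def by (auto intro!: derivative_eq_intros assms)

lemma emb_surj: "\<exists>u. \<forall>i. sg i u = v i"
  using sg_emb by blast

text \<open>Components of the data orthogonal to \<open>R i\<close> do not contribute in these
  directions, so the critical equations see the data only through \<open>sg i u\<close>.\<close>

lemma dir_deriv_sqdist:
  "dir_deriv (sqdist_fun u) (emb s) (embd \<nu>) = 2 * (\<Sum>i\<in>UNIV. (s i - sg i u) * \<nu> i)"
proof -
  have "((\<lambda>t. sqdist_fun u (emb s + t *s embd \<nu>)) has_field_derivative
      (\<Sum>p\<in>UNIV. 2 * (emb s $ p - u $ p) * embd \<nu> $ p)) (at 0)"
    unfolding sqdist_fun_def
    by (rule derivative_eq_intros | rule refl | simp)+ (simp add: algebra_simps)
  then have "dir_deriv (sqdist_fun u) (emb s) (embd \<nu>) = (\<Sum>p\<in>UNIV. 2 * (emb s $ p - u $ p) * embd \<nu> $ p)"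
    unfolding dir_deriv_def by (rule DERIV_imp_deriv)
  also have "\<dots> = (\<Sum>i\<in>UNIV. \<Sum>k\<in>UNIV. 2 * (emb s $ (i, k) - u $ (i, k)) * embd \<nu> $ (i, k))"
    by (simp add: sum.cartesian_product)
  also have "\<dots> = (\<Sum>i\<in>UNIV. 2 * ((s i - sg i u) * \<nu> i))"
  proof (rule sum.cong)
    fix i
    have "(\<Sum>k\<in>UNIV. 2 * (emb s $ (i, k) - u $ (i, k)) * embd \<nu> $ (i, k)) =
       2 * (\<nu> i * (sg i (emb s) - sg i u))"
      unfolding sg_def sum_subtractf[symmetric] sum_distrib_left
      by (rule sum.cong) (simp_all add: embd_def algebra_simps)
    then show "(\<Sum>k\<in>UNIV. 2 * (emb s $ (i, k) - u $ (i, k)) * embd \<nu> $ (i, k)) = 2 * ((s i - sg i u) * \<nu> i)"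
      by (simp add: sg_emb mult.commute)
  qed simp
  finally show ?thesis by (simp add: sum_distrib_left)
qed

lemma zclosure_emb:
  assumes "S \<subseteq> range emb" "z \<in> zclosure S"
  shows "z = emb (\<lambda>i. sg i z)"
proof -
  have "z $ (i, k) - P i $ k - sg i z * R i $ k = 0" for i k
  proof (rule zclosure_vanish[OF emb_cpoly_zero _ assms(2)])
    fix s assume "s \<in> S"
    then obtain c where "s = emb c" using assms(1) by blast
    then show "s $ (i, k) - P i $ k - sg i s * R i $ k = 0" by (simp add: sg_emb) (simp add: emb_def)
  qed
  then have "(z $ (i, k) - P i $ k - sg i z * R i $ k) + (P i $ k + sg i z * R i $ k) = P i $ k + sg i z * R i $ k" for i k
    by (simp only: add_0_left)
  then have "z $ (i, k) = P i $ k + sg i z * R i $ k" for i k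
    by (simp only: diff_diff_eq diff_add_cancel)
  then show ?thesis by (simp add: emb_def Finite_Cartesian_Product.vec_eq_iff)
qed

lemma tangent_embd:
  assumes "\<And>z. z \<in> V \<Longrightarrow> z \<in> range emb" "v \<in> tangent_space V p"
  shows "v = embd (\<lambda>i. sgd i v)"
proof -
  have "v $ (i, k) - sgd i v * R i $ k = 0" for i k
  proof -
    let ?f = "\<lambda>z. z $ (i, k) - P i $ k - sg i z * R i $ k"
    have "?f z = 0" if "z \<in> V" for z
    proof -
      from assms(1)[OF \<open>z \<in> V\<close>] obtain c where "z = emb c" by blast
      then show ?thesis by (simp add: sg_emb) (simp add: emb_def)
    qed
    then have "?f \<in> vanishing_ideal V" using emb_cpoly_zero by (simp add: vanishing_ideal_def)
    then have "dir_deriv ?f p v = 0" using assms(2) by (simp add: tangent_space_def)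
    moreover have "((\<lambda>t. ?f (p + t *s v)) has_field_derivative v $ (i, k) - sgd i v * R i $ k) (at 0)"
      unfolding sg_line by (auto intro!: derivative_eq_intros)
    then have "dir_deriv ?f p v = v $ (i, k) - sgd i v * R i $ k"
      unfolding dir_deriv_def by (rule DERIV_imp_deriv)
    ultimately show ?thesis by simp
  qed
  then show ?thesis by (simp add: embd_def Finite_Cartesian_Product.vec_eq_iff)
qed

end

locale line_surface = framed_lines P R + plane_system "UNIV - {m0}" a al xx tt
  for P R :: "'m::finite \<Rightarrow> complex^2" and m0 :: 'm and a al xx tt :: "'m \<Rightarrow> complex"
begin

abbreviation I where "I \<equiv> UNIV - {m0}"

definition sc :: "complex \<Rightarrow> complex \<Rightarrow> 'm \<Rightarrow> complex" where
  "sc x t i = (if i = m0 then x else a i * (x - xx i) / dd i x t)"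

definition dx :: "complex \<Rightarrow> complex \<Rightarrow> 'm \<Rightarrow> complex" where
  "dx x t i = (if i = m0 then 1 else a i * (t - tt i) / dd i x t ^ 2)"

definition dt :: "complex \<Rightarrow> complex \<Rightarrow> 'm \<Rightarrow> complex" where
  "dt x t i = (if i = m0 then 0 else - a i * (x - xx i) / dd i x t ^ 2)"

definition U :: "(complex \<times> complex) set" where
  "U = {(x, t). \<forall>i\<in>I. dd i x t \<noteq> 0}"

definition S :: "(complex^('m \<times> 2)) set" where
  "S = (\<lambda>(x, t). emb (sc x t)) ` U"

definition V :: "(complex^('m \<times> 2)) set" where
  "V = zclosure S"

definition tau :: "'m \<Rightarrow> complex \<Rightarrow> complex" where
  "tau i x = tt i + al i * (x - xx i)"

lemma dd_tau: "dd i x t = t - tau i x"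
  by (simp add: dd_def tau_def)

lemma sc_deriv:
  assumes "i \<noteq> m0 \<Longrightarrow> dd i x t \<noteq> 0"
  shows "((\<lambda>s. sc (x + s * p) (t + s * q) i) has_field_derivative p * dx x t i + q * dt x t i) (at 0)"
proof (cases "i = m0")
  case True
  then show ?thesis by (auto simp: sc_def dx_def dt_def intro!: derivative_eq_intros)
next
  case False
  then have d: "dd i x t \<noteq> 0" using assms by simp
  have "((\<lambda>s. a i * (x + s * p - xx i) / (t + s * q - tt i - al i * (x + s * p - xx i))) has_field_derivative
     (a i * p * dd i x t - a i * (x - xx i) * (q - al i * p)) / (dd i x t * dd i x t)) (at 0)"
    using d by (auto intro!: derivative_eq_intros simp: dd_def algebra_simps)
  moreover have "(a i * p * dd i x t - a i * (x - xx i) * (q - al i * p)) / (dd i x t * dd i x t) = p * dx x t i + q * dt x t i"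
    using False d by (simp add: dx_def dt_def power2_eq_square add_divide_distrib[symmetric] diff_divide_distrib[symmetric])
      (simp add: dd_def algebra_simps)
  ultimately show ?thesis using False by (simp add: sc_def dd_def)
qed

lemma S_range: "S \<subseteq> range emb"
  by (auto simp: S_def)

lemma V_emb: "z \<in> V \<Longrightarrow> z = emb (\<lambda>i. sg i z)"
  unfolding V_def by (rule zclosure_emb[OF S_range])

lemma V_range: "z \<in> V \<Longrightarrow> z \<in> range emb"
  using V_emb by blast

lemma S_subset_V: "S \<subseteq> V"
  unfolding V_def by (rule subset_zclosure)

lemma U_open: "(x, t) \<in> U \<Longrightarrow> eventually (\<lambda>s. (x + s * p, t + s * q) \<in> U) (at 0)"
proof -
  assume u: "(x, t) \<in> U"
  have "eventually (\<lambda>s. \<forall>i\<in>I. dd i (x + s * p) (t + s * q) \<noteq> 0) (nhds 0)"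
  proof (rule eventually_ball_finite[OF fin], rule ballI)
    fix i assume i: "i \<in> I"
    have "continuous_on UNIV (\<lambda>s. dd i (x + s * p) (t + s * q))"
      unfolding dd_def by (intro continuous_intros)
    then have "eventually (\<lambda>s. dd i (x + s * p) (t + s * q) \<in> - {0}) (nhds 0)"
      using u i by (intro eventually_nhds_cont) (auto simp: U_def)
    then show "eventually (\<lambda>s. dd i (x + s * p) (t + s * q) \<noteq> 0) (nhds 0)" by simp
  qed
  then show ?thesis by (auto simp: U_def eventually_at_filter elim: eventually_mono)
qed

lemma emb_S: "(x, t) \<in> U \<Longrightarrow> emb (sc x t) \<in> S"
  by (auto simp: S_def)

lemma tangent_S:
  assumes u: "(x, t) \<in> U"
  shows "embd (\<lambda>i. p * dx x t i + q * dt x t i) \<in> tangent_space V (emb (sc x t))"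
proof -
  define g where "g s = emb (sc (x + s * p) (t + s * q))" for s
  have 1: "((\<lambda>s. g s $ r) has_field_derivative embd (\<lambda>i. p * dx x t i + q * dt x t i) $ r) (at 0)" for r
    unfolding g_def by (rule emb_deriv, rule sc_deriv) (use u in \<open>auto simp: U_def\<close>)
  have 2: "eventually (\<lambda>s. g s \<in> V) (at 0)"
    using U_open[OF u, of p q] unfolding g_def by eventually_elim (use emb_S S_subset_V in blast)
  show ?thesis
    using tangent_curve[OF 1 2] by (simp add: g_def)
qed

text \<open>What remains after eliminating \<open>t\<close> from
  \<open>sc x t i * (t - tau i x) = a i * (x - xx i)\<close> for two cameras. Unlike the
  parametrisation this equation makes sense on the whole closure.\<close>

definition pe :: "'m \<Rightarrow> 'm \<Rightarrow> complex^('m \<times> 2) \<Rightarrow> complex" where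
  "pe i j z = sg i z * sg j z * (tau i (sg m0 z) - tau j (sg m0 z)) +
     a i * (sg m0 z - xx i) * sg j z - a j * (sg m0 z - xx j) * sg i z"

lemma pe_cpoly: "pe i j \<in> cpoly"
proof -
  have "(\<lambda>z. pe i j z) \<in> cpoly"
    unfolding pe_def tau_def using sg_cpoly by (intro cpoly_intros)
  then show ?thesis by simp
qed

lemma sc_mult: "i \<in> I \<Longrightarrow> dd i x t \<noteq> 0 \<Longrightarrow> sc x t i * (t - tau i x) = a i * (x - xx i)"
  by (simp add: sc_def dd_tau)

lemma pe_S:
  assumes "i \<in> I" "j \<in> I" "z \<in> S"
  shows "pe i j z = 0"
proof -
  obtain x t where xt: "(x, t) \<in> U" "z = emb (sc x t)" using assms(3) by (auto simp: S_def)
  have i: "sc x t i * (t - tau i x) = a i * (x - xx i)" and j: "sc x t j * (t - tau j x) = a j * (x - xx j)"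
    using xt(1) assms(1,2) by (auto simp: U_def intro!: sc_mult)
  have m: "sc x t m0 = x" by (simp add: sc_def)
  have "pe i j z = sc x t i * sc x t j * (tau i x - tau j x) + sc x t i * (t - tau i x) * sc x t j - sc x t j * (t - tau j x) * sc x t i"
    unfolding pe_def xt(2) sg_emb m i j ..
  also have "\<dots> = 0" by (simp add: algebra_simps)
  finally show ?thesis .
qed

lemma pe_V: "i \<in> I \<Longrightarrow> j \<in> I \<Longrightarrow> z \<in> V \<Longrightarrow> pe i j z = 0"
  unfolding V_def by (rule zclosure_vanish[OF pe_cpoly pe_S])

text \<open>A line that passes through the centre of camera \<open>j\<close> has no well-defined image in factor \<open>j\<close>;
  these lines account for the points of \<open>V\<close> outside \<open>S\<close>.\<close>
lemma V_cases:
  assumes z: "z \<in> V"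
  obtains (main) x t where "(x, t) \<in> U" "z = emb (sc x t)"
  | (exc) j where "j \<in> I" "sg m0 z = xx j" "\<And>i. i \<in> I - {j} \<Longrightarrow> sg i z = sc (xx j) (tt j) i"
  | (excm) "\<And>i. i \<in> I \<Longrightarrow> sg i z = 0"
proof (cases "\<forall>i\<in>I. sg i z = 0")
  case True
  then show ?thesis using excm by blast
next
  case False
  then obtain i where i: "i \<in> I" "sg i z \<noteq> 0" by blast
  define x where "x = sg m0 z"
  \<comment> \<open>One camera with nonzero coordinate determines \<open>t\<close>; the equations
    \<open>pe\<close> carry it over to all the others.\<close>
  define t where "t = tau i x + a i * (x - xx i) / sg i z"
  have ti: "sg i z * (t - tau i x) = a i * (x - xx i)"
    using i(2) by (simp add: t_def)
  have tj: "sg j z * (t - tau j x) = a j * (x - xx j)" if "j \<in> I" for j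
  proof -
    have "sg i z * (sg j z * (t - tau j x) - a j * (x - xx j)) = pe i j z"
      unfolding pe_def x_def[symmetric] ti[symmetric] by (simp add: algebra_simps)
    then show ?thesis using pe_V[OF i(1) that z] i(2) by simp
  qed
  show ?thesis
  proof (cases "(x, t) \<in> U")
    case True
    have "sg j z = sc x t j" for j
    proof (cases "j = m0")
      case False
      then have "dd j x t \<noteq> 0" using True by (simp add: U_def)
      then show ?thesis using tj[of j] False by (simp add: sc_def dd_tau field_simps)
    qed (simp add: sc_def x_def)
    then have "z = emb (sc x t)" using V_emb[OF z] by simp
    then show ?thesis using main True by blast
  next
    case False
    then obtain j where j: "j \<in> I" "dd j x t = 0" by (auto simp: U_def)
    \<comment> \<open>Camera \<open>j\<close> can have a pole here only if its numerator vanishes as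
      well, that is, at its centre.\<close>
    then have xj: "x = xx j" using tj[OF j(1)] a_nz by (simp add: dd_tau)
    then have tj': "t = tt j" using j(2) by (simp add: dd_def)
    have "sg l z = sc (xx j) (tt j) l" if l: "l \<in> I - {j}" for l
    proof -
      have "dd l (xx j) (tt j) \<noteq> 0" using dd_Ept[of l j] l j(1) by auto
      then show ?thesis using tj[of l] l unfolding xj tj' by (simp add: sc_def dd_tau field_simps)
    qed
    then show ?thesis using exc[OF j(1)] xj x_def by simp
  qed
qed

lemma ex_other: "\<exists>i\<in>I. x \<noteq> xx i"
proof (rule ccontr)
  assume "\<not> (\<exists>i\<in>I. x \<noteq> xx i)"
  then have eq: "xx i = x" if "i \<in> I" for i using that by auto
  have "\<not> card I \<le> Suc 0" using card2 by simp
  then obtain i j where ij: "i \<in> I" "j \<in> I" "i \<noteq> j"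
    unfolding card_le_Suc0_iff_eq[OF fin] by blast
  then show False
    using inj_onD[OF xx_inj, of i j] eq[OF ij(1)] eq[OF ij(2)] by simp
qed

text \<open>Subtracting the velocity of the parametrisation that agrees in the coordinates
  \<open>m0\<close> and \<open>i\<close> leaves a tangent vector \<open>w\<close>. The derivative of
  \<open>pe i j\<close> in this direction is \<open>sc x t i * dd j x t\<close> times its coordinate
  \<open>j\<close>; the factor is nonzero, so \<open>w\<close> vanishes.\<close>

lemma tangent_V_S:
  assumes u: "(x, t) \<in> U" and v: "v \<in> tangent_space V (emb (sc x t))"
  shows "\<exists>p q. v = embd (\<lambda>i. p * dx x t i + q * dt x t i)"
proof -
  obtain i where i: "i \<in> I" "x \<noteq> xx i" using ex_other by blast
  have di: "dd i x t \<noteq> 0" using u i by (simp add: U_def)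
  have dti: "dt x t i \<noteq> 0" using i di a_nz[OF i(1)] by (simp add: dt_def)
  define p where "p = sgd m0 v"
  define q where "q = (sgd i v - p * dx x t i) / dt x t i"
  define w where "w = 1 *s v + (-1) *s embd (\<lambda>i. p * dx x t i + q * dt x t i)"
  have w: "w \<in> tangent_space V (emb (sc x t))"
    unfolding w_def by (rule tangent_lincomb[OF v tangent_S[OF u]])
  have w0: "sgd m0 w = 0" "sgd i w = 0"
    unfolding w_def sgd_lincomb sgd_embd using dti by (simp_all add: p_def q_def dx_def dt_def)
  have "sgd j w = 0" for j
  proof (cases "j = m0 \<or> j = i")
    case False
    then have j: "j \<in> I" "j \<noteq> i" by auto
    have "pe i j \<in> vanishing_ideal V"
      using pe_V[OF i(1) j(1)] pe_cpoly by (simp add: vanishing_ideal_def)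
    then have "dir_deriv (pe i j) (emb (sc x t)) w = 0" using w by (simp add: tangent_space_def)
    moreover have "((\<lambda>s. pe i j (emb (sc x t) + s *s w)) has_field_derivative
       (sc x t i * (tau i x - tau j x) + a i * (x - xx i)) * sgd j w) (at 0)"
      unfolding pe_def sg_line sg_emb w0 by (auto intro!: derivative_eq_intros simp: sc_def[of x t m0] algebra_simps)
    then have "dir_deriv (pe i j) (emb (sc x t)) w = (sc x t i * (tau i x - tau j x) + a i * (x - xx i)) * sgd j w"
      unfolding dir_deriv_def by (rule DERIV_imp_deriv)
    moreover have "sc x t i * (tau i x - tau j x) + a i * (x - xx i) = sc x t i * dd j x t"
      unfolding sc_mult[OF i(1) di, symmetric] by (simp add: dd_tau algebra_simps)
    moreover have "sc x t i \<noteq> 0" using i di a_nz[OF i(1)] by (simp add: sc_def)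
    moreover have "dd j x t \<noteq> 0" using u j by (simp add: U_def)
    ultimately show ?thesis by simp
  qed (use w0 in auto)
  then have "w = embd (\<lambda>i. 0)"
    using tangent_embd[OF V_range w] by simp
  then have "w = 0" by (simp add: embd_def Finite_Cartesian_Product.vec_eq_iff)
  then have "v = embd (\<lambda>i. p * dx x t i + q * dt x t i)" by (simp add: w_def)
  then show ?thesis by blast
qed

lemma tangent_dim_S:
  assumes u: "(x, t) \<in> U"
  shows "vec.dim (tangent_space V (emb (sc x t))) = 2"
proof (rule tangent_dim_2)
  obtain i where i: "i \<in> I" "x \<noteq> xx i" using ex_other by blast
  have di: "dd i x t \<noteq> 0" using u i by (simp add: U_def)
  have dti: "dt x t i \<noteq> 0" using i di a_nz[OF i(1)] by (simp add: dt_def)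
  show "embd (dx x t) \<in> tangent_space V (emb (sc x t))" using tangent_S[OF u, of 1 0] by simp
  show "embd (dt x t) \<in> tangent_space V (emb (sc x t))" using tangent_S[OF u, of 0 1] by simp
  show "\<alpha> = 0 \<and> \<beta> = 0" if "\<alpha> *s embd (dx x t) + \<beta> *s embd (dt x t) = 0" for \<alpha> \<beta>
  proof -
    have *: "\<alpha> * dx x t j + \<beta> * dt x t j = 0" for j
    proof -
      have "sgd j (\<alpha> *s embd (dx x t) + \<beta> *s embd (dt x t)) = 0"
        unfolding that by (simp add: sgd_def)
      then show ?thesis unfolding sgd_lincomb sgd_embd .
    qed
    have "\<alpha> = 0" using *[of m0] by (simp add: dx_def dt_def)
    then show ?thesis using *[of i] dti by simp
  qed
  show "\<exists>\<alpha> \<beta>. v = \<alpha> *s embd (dx x t) + \<beta> *s embd (dt x t)" if "v \<in> tangent_space V (emb (sc x t))" for v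
    using tangent_V_S[OF u that] unfolding embd_lincomb .
qed

end

section \<open>Dimension and critical points on the parametrised part of the surface\<close>

context line_surface
begin

lemma ex_t: "\<exists>t. (x, t) \<in> U \<and> t \<noteq> t0"
proof -
  have "finite (insert t0 ((\<lambda>i. tau i x) ` I))" using fin by simp
  then obtain t where "t \<notin> insert t0 ((\<lambda>i. tau i x) ` I)"
    using ex_new_if_finite[OF infinite_UNIV_char_0] by blast
  then show ?thesis by (intro exI[of _ t]) (auto simp: U_def dd_tau)
qed

lemma sc_inj:
  assumes "(x, t) \<in> U" "(x', t') \<in> U" "emb (sc x t) = emb (sc x' t')"
  shows "x = x' \<and> t = t'"
proof -
  have s: "sc x t i = sc x' t' i" for i using assms(3) sg_emb by metis
  have x: "x = x'" using s[of m0] by (simp add: sc_def)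
  obtain i where i: "i \<in> I" "x \<noteq> xx i" using ex_other by blast
  have d: "dd i x t \<noteq> 0" "dd i x t' \<noteq> 0" using assms(1,2) i x by (auto simp: U_def)
  have "a i * (x - xx i) / dd i x t = a i * (x - xx i) / dd i x t'"
    using s[of i] i x by (simp add: sc_def)
  then have "dd i x t = dd i x t'" using i d a_nz[OF i(1)] by (simp add: field_simps)
  then show ?thesis using x by (simp add: dd_def)
qed

lemma param_V:
  obtains m q N where "biv.rational_param m q N (\<lambda>w. emb (sc (fst w) (snd w)))"
    "V = zclosure ((\<lambda>w. emb (sc (fst w) (snd w))) ` {w. q w \<noteq> 0})"
proof -
  define Q where "Q = (\<Prod>i\<in>I. DD 0 i)"
  have Q: "bev Q y z = (\<Prod>i\<in>I. dd i y z)" for y z by (simp add: Q_def bev_DD)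
  have Qn: "bev Q y z \<noteq> 0 \<longleftrightarrow> (y, z) \<in> U" for y z using fin by (simp add: Q U_def)
  define N where "N p = (if fst p = m0 then blin (P m0 $ snd p) (R m0 $ snd p) 0 * Q
     else blin (P (fst p) $ snd p) 0 0 * Q + blin (a (fst p) * R (fst p) $ snd p) 0 0 * blin (- xx (fst p)) 1 0 * (\<Prod>j\<in>I-{fst p}. DD 0 j))" for p
  have "emb (sc y z) $ p * bev Q y z = bev (N p) y z" if u: "bev Q y z \<noteq> 0" for y z p
  proof (cases "fst p = m0")
    case True
    then show ?thesis by (simp add: N_def emb_def sc_def algebra_simps)
  next
    case False
    then have i: "fst p \<in> I" by simp
    have d: "dd (fst p) y z \<noteq> 0" using u i unfolding Qn by (auto simp: U_def)
    have "bev Q y z = dd (fst p) y z * (\<Prod>j\<in>I-{fst p}. dd j y z)"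
      unfolding Q by (rule prod.remove[OF fin i])
    then show ?thesis using False d by (simp add: N_def emb_def sc_def bev_DD field_simps)
  qed
  moreover obtain t where "(0, t) \<in> U" using ex_t by blast
  then have "bev Q 0 t \<noteq> 0" by (simp add: Qn)
  ultimately obtain m where m: "biv.rational_param m (\<lambda>w. bev Q (fst w) (snd w)) (\<lambda>i w. bev (N i) (fst w) (snd w)) (\<lambda>w. emb (sc (fst w) (snd w)))"
    using rational_param_bivI[of Q 0 t "\<lambda>w. emb (sc (fst w) (snd w))" N] by auto
  have "{w. bev Q (fst w) (snd w) \<noteq> 0} = U" using Qn by (auto simp: U_def)
  then have "V = zclosure ((\<lambda>w. emb (sc (fst w) (snd w))) ` {w. bev Q (fst w) (snd w) \<noteq> 0})"
    by (simp add: V_def S_def case_prod_unfold)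
  then show ?thesis using that m by blast
qed

lemma vertical_curve:
  shows "zirreducible (zclosure {emb (sc x t) | t. (x, t) \<in> U})"
proof -
  define Q where "Q = (\<Prod>i\<in>I. [:- tau i x, 1:])"
  have Q: "poly Q z = (\<Prod>i\<in>I. dd i x z)" for z by (simp add: Q_def poly_prod dd_tau)
  have Qn: "poly Q z \<noteq> 0 \<longleftrightarrow> (x, z) \<in> U" for z using fin by (simp add: Q U_def)
  define N where "N p = (if fst p = m0 then [:P m0 $ snd p + x * R m0 $ snd p:] * Q
     else [:P (fst p) $ snd p:] * Q + [:a (fst p) * R (fst p) $ snd p * (x - xx (fst p)):] * (\<Prod>j\<in>I-{fst p}. [:- tau j x, 1:]))" for p
  have "emb (sc x z) $ p * poly Q z = poly (N p) z" if u: "poly Q z \<noteq> 0" for z p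
  proof (cases "fst p = m0")
    case True
    then show ?thesis by (simp add: N_def emb_def sc_def algebra_simps)
  next
    case False
    then have i: "fst p \<in> I" by simp
    have d: "dd (fst p) x z \<noteq> 0" using u i unfolding Qn by (auto simp: U_def)
    have "poly Q z = dd (fst p) x z * (\<Prod>j\<in>I-{fst p}. dd j x z)"
      unfolding Q by (rule prod.remove[OF fin i])
    then show ?thesis using False d by (simp add: N_def emb_def sc_def dd_tau[symmetric] poly_prod field_simps)
  qed
  moreover obtain t where "(x, t) \<in> U" using ex_t by blast
  then have "poly Q t \<noteq> 0" by (simp add: Qn)
  ultimately obtain m where m: "uni.rational_param m (poly Q) (\<lambda>i. poly (N i)) (\<lambda>z. emb (sc x z))"
    using rational_param_uniI[of Q t "\<lambda>z. emb (sc x z)" N] by auto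
  have "{emb (sc x t) | t. (x, t) \<in> U} = (\<lambda>z. emb (sc x z)) ` {z. poly Q z \<noteq> 0}"
    using Qn by auto
  then show ?thesis using uni.param_irreducible[OF m] by simp
qed

text \<open>\<open>local_dim\<close> asks only the top member of a chain to contain the point. As
  \<open>V\<close> is irreducible, one chain, from a point over the curve \<open>x = 0\<close> to
  \<open>V\<close>, serves for all \<open>z\<close> in \<open>V\<close>.\<close>

lemma local_dim_V:
  assumes "z \<in> V"
  shows "local_dim V z = 2"
proof -
  obtain m q N where pV: "biv.rational_param m q N (\<lambda>w. emb (sc (fst w) (snd w)))"
    "V = zclosure ((\<lambda>w. emb (sc (fst w) (snd w))) ` {w. q w \<noteq> 0})" by (rule param_V)
  obtain t1 where t1: "(0, t1) \<in> U" using ex_t[of 0 0] by blast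
  obtain t2 where t2: "(0, t2) \<in> U" "t2 \<noteq> t1" using ex_t[of 0 t1] by blast
  obtain t3 where t3: "(1, t3) \<in> U" using ex_t[of 1 0] by blast
  let ?C = "{emb (sc 0 t) | t. (0, t) \<in> U}"
  define S0 where "S0 k = (if k = 0 then {emb (sc 0 t1)} else if k = 1 then zclosure ?C else V)" for k :: nat
  have CS: "?C \<subseteq> S" by (auto simp: S_def)
  have CV: "zclosure ?C \<subseteq> V" unfolding V_def 
    by (rule zclosure_minimal[OF order_trans[OF CS subset_zclosure] zclosure_closed])
  have Cx: "sg m0 y = 0" if "y \<in> zclosure ?C" for y
  proof -
    have "sg m0 y = 0"
      by (rule zclosure_vanish[OF _ _ that]) (auto simp: sg_emb sc_def intro!: cpoly_intros sg_cpoly)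
    then show ?thesis by simp
  qed
  show ?thesis
  proof (rule local_dim_eqI[of _ _ S0])
    fix d and T :: "nat \<Rightarrow> (complex^('m \<times> 2)) set"
    assume "\<And>k. k \<le> d \<Longrightarrow> zariski_closed (T k) \<and> zirreducible (T k) \<and> T k \<subseteq> V" "\<And>k. k < d \<Longrightarrow> T k \<subset> T (Suc k)"
    then show "d \<le> 2" using biv.param_chain_bound[OF pV(1)] unfolding pV(2) by blast
  next
    fix k :: nat
    have "emb (sc 0 t1) \<in> V" using emb_S[OF t1] S_subset_V by blast
    moreover have "zirreducible V" unfolding pV(2) by (rule biv.param_irreducible[OF pV(1)])
    moreover have "zariski_closed V" unfolding V_def by (rule zclosure_closed)
    ultimately show "zariski_closed (S0 k) \<and> zirreducible (S0 k) \<and> S0 k \<subseteq> V"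
      using CV vertical_curve zclosure_closed[of ?C]
      by (auto simp: S0_def zariski_closed_singleton zirreducible_singleton)
  next
    fix k :: nat assume "k < 2"
    then consider "k = 0" | "k = 1" by linarith
    then show "S0 k \<subset> S0 (Suc k)"
    proof cases
      case 1
      have psub: "{p} \<subset> D" if "p \<in> D" "q \<in> D" "p \<noteq> q" for p q :: "complex^('m \<times> 2)" and D
        using that by auto
      have inC: "emb (sc 0 t1) \<in> zclosure ?C" "emb (sc 0 t2) \<in> zclosure ?C"
        using t1 t2 subset_zclosure[of ?C] by auto
      have "emb (sc 0 t1) \<noteq> emb (sc 0 t2)" using sc_inj[OF t1 t2(1)] t2(2) by auto
      then have "{emb (sc 0 t1)} \<subset> zclosure ?C" by (rule psub[OF inC])
      then show ?thesis using 1 by (simp add: S0_def)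
    next
      case 2
      have "emb (sc 1 t3) \<in> V" using emb_S[OF t3] S_subset_V by blast
      moreover have "emb (sc 1 t3) \<notin> zclosure ?C"
        using Cx[of "emb (sc 1 t3)"] by (auto simp: sg_emb sc_def)
      ultimately show ?thesis using 2 CV by (auto simp: S0_def)
    qed
  qed (use assms in \<open>simp add: S0_def\<close>)
qed

lemma smooth_S: "(x, t) \<in> U \<Longrightarrow> smooth_point V (emb (sc x t))"
  unfolding smooth_point_def using tangent_dim_S local_dim_V emb_S S_subset_V by (simp add: subsetD)

lemma sum_UNIV: "(\<Sum>i\<in>UNIV. h i) = h m0 + (\<Sum>i\<in>I. h i)" for h :: "'m \<Rightarrow> complex"
  by (rule sum.remove) auto

lemma nsum_divide:
  assumes "(x, t) \<in> U"
  shows "nsum h x t = (\<Prod>j\<in>I. dd j x t ^ 3) * (\<Sum>i\<in>I. h i / dd i x t ^ 3)"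
  unfolding nsum_def sum_distrib_left
proof (rule sum.cong)
  fix i assume i: "i \<in> I"
  have "dd i x t \<noteq> 0" using assms i by (auto simp: U_def)
  moreover have "(\<Prod>j\<in>I. dd j x t ^ 3) = dd i x t ^ 3 * (\<Prod>j\<in>I-{i}. dd j x t ^ 3)"
    by (rule prod.remove[OF fin i])
  ultimately show "h i * (\<Prod>j\<in>I-{i}. dd j x t ^ 3) = (\<Prod>j\<in>I. dd j x t ^ 3) * (h i / dd i x t ^ 3)"
    by simp
qed simp

lemma critical_S:
  assumes u: "(x, t) \<in> U"
  shows "(\<forall>v\<in>tangent_space V (emb (sc x t)). dir_deriv (sqdist_fun w) (emb (sc x t)) v = 0) \<longleftrightarrow>
     (x, t) \<in> genuine (\<lambda>i. sg i w) (sg m0 w)"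
proof -
  let ?z = "emb (sc x t)"
  define A where "A = (\<Sum>i\<in>UNIV. (sc x t i - sg i w) * dx x t i)"
  define B where "B = (\<Sum>i\<in>UNIV. (sc x t i - sg i w) * dt x t i)"
  have d: "dir_deriv (sqdist_fun w) ?z (embd (\<lambda>i. p * dx x t i + q * dt x t i)) = 2 * (p * A + q * B)" for p q
    unfolding dir_deriv_sqdist A_def B_def sum_distrib_left sum.distrib[symmetric]
    by (rule sum.cong) (simp_all add: algebra_simps)
  have "(\<forall>v\<in>tangent_space V ?z. dir_deriv (sqdist_fun w) ?z v = 0) \<longleftrightarrow> A = 0 \<and> B = 0"
  proof
    assume h: "\<forall>v\<in>tangent_space V ?z. dir_deriv (sqdist_fun w) ?z v = 0"
    have "2 * (p * A + q * B) = 0" for p q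
      using h tangent_S[OF u, of p q] d[of p q] by simp
    from this[of 1 0] this[of 0 1] show "A = 0 \<and> B = 0" by simp
  next
    assume "A = 0 \<and> B = 0"
    then show "\<forall>v\<in>tangent_space V ?z. dir_deriv (sqdist_fun w) ?z v = 0"
      using tangent_V_S[OF u] d by fastforce
  qed
  moreover have dn: "dd i x t \<noteq> 0" if "i \<in> I" for i using u that by (auto simp: U_def)
  then have Pn: "(\<Prod>j\<in>I. dd j x t ^ 3) \<noteq> 0" using fin by simp
  have "B = - (\<Sum>i\<in>I. hF (\<lambda>i. sg i w) x t i / dd i x t ^ 3)"
    unfolding B_def sum_UNIV sum_negf[symmetric]
  proof -
    have "(\<Sum>i\<in>I. (sc x t i - sg i w) * dt x t i) = (\<Sum>i\<in>I. - (hF (\<lambda>i. sg i w) x t i / dd i x t ^ 3))"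
      by (rule sum.cong) (use dn in \<open>auto simp: sc_def dt_def hF_def field_simps power2_eq_square power3_eq_cube\<close>)
    then show "(sc x t m0 - sg m0 w) * dt x t m0 + (\<Sum>i\<in>I. (sc x t i - sg i w) * dt x t i) = (\<Sum>i\<in>I. - (hF (\<lambda>i. sg i w) x t i / dd i x t ^ 3))"
      by (simp add: dt_def)
  qed
  then have Bf: "fh (\<lambda>i. sg i w) x t = - ((\<Prod>j\<in>I. dd j x t ^ 3) * B)"
    unfolding fh_nsum nsum_divide[OF u] by simp
  have A_eq: "A = x - sg m0 w + (\<Sum>i\<in>I. hG (\<lambda>i. sg i w) x t i / dd i x t ^ 3)"
  proof -
    have "(\<Sum>i\<in>I. (sc x t i - sg i w) * dx x t i) = (\<Sum>i\<in>I. hG (\<lambda>i. sg i w) x t i / dd i x t ^ 3)"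
      by (rule sum.cong) (use dn in \<open>auto simp: sc_def dx_def hG_def field_simps power2_eq_square power3_eq_cube\<close>)
    then show ?thesis unfolding A_def sum_UNIV by (simp add: dx_def sc_def)
  qed
  then have Ag: "gh (\<lambda>i. sg i w) (sg m0 w) x t = (\<Prod>j\<in>I. dd j x t ^ 3) * A"
    unfolding gh_nsum nsum_divide[OF u] A_eq by (simp add: algebra_simps)
  have "(x, t) \<in> genuine (\<lambda>i. sg i w) (sg m0 w) \<longleftrightarrow> A = 0 \<and> B = 0"
    unfolding genuine_def using Bf Ag Pn dn by auto
  ultimately show ?thesis by simp
qed

section \<open>Points of the closure that come from lines through a camera centre\<close>

definition se :: "'m \<Rightarrow> complex \<Rightarrow> 'm \<Rightarrow> complex" where
  "se j c i = (if i = j then c else sc (xx j) (tt j) i)"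

text \<open>If \<open>(x, t)\<close> approaches the centre of camera \<open>j\<close> with slope
  \<open>al j + a j / c\<close>, the quotient that defines coordinate \<open>j\<close> is constantly
  \<open>c\<close>. The limit of the image is \<open>se j c\<close>, and \<open>sed j c\<close> is
  the velocity with which it is reached.\<close>

definition sed :: "'m \<Rightarrow> complex \<Rightarrow> 'm \<Rightarrow> complex" where
  "sed j c i = (if i = j then 0 else dx (xx j) (tt j) i + (al j + a j / c) * dt (xx j) (tt j) i)"

lemma curve_limit_in_V:
  assumes d: "\<And>i. ((\<lambda>s. g s i) has_field_derivative \<nu> i) (at 0)"
    and ev: "eventually (\<lambda>s. emb (g s) \<in> S) (at 0)"
  shows "emb (g 0) \<in> V" "embd \<nu> \<in> tangent_space V (emb (g 0))"
proof -
  have e: "((\<lambda>s. emb (g s) $ r) has_field_derivative embd \<nu> $ r) (at 0)" for r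
    by (rule emb_deriv[OF d])
  show "emb (g 0) \<in> V"
    unfolding V_def
  proof (rule zclosureI)
    fix f assume f: "f \<in> cpoly" "\<And>s. s \<in> S \<Longrightarrow> f s = 0"
    have "((\<lambda>s. f (emb (g s))) has_field_derivative dir_deriv f (emb (g 0)) (embd \<nu>)) (at 0)"
      by (rule dir_deriv_curve[OF f(1) e])
    then have "((\<lambda>s. f (emb (g s))) \<longlongrightarrow> f (emb (g 0))) (at 0)"
      using DERIV_isCont isCont_def by blast
    moreover have "((\<lambda>s. f (emb (g s))) \<longlongrightarrow> 0) (at 0)"
      by (rule tendsto_eventually) (use ev in \<open>eventually_elim, simp add: f(2)\<close>)
    ultimately show "f (emb (g 0)) = 0" using tendsto_unique[OF at_neq_bot] by blast
  qed
  show "embd \<nu> \<in> tangent_space V (emb (g 0))"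
    by (rule tangent_curve[OF e]) (use ev S_subset_V in \<open>auto elim: eventually_mono\<close>)
qed

lemma exc_curve:
  assumes j: "j \<in> I" and c: "c \<noteq> 0"
  shows "emb (se j c) \<in> V" "embd (sed j c) \<in> tangent_space V (emb (se j c))"
proof -
  define sl where "sl = al j + a j / c"
  define g where "g s i = (if i = j then c else sc (xx j + s * 1) (tt j + s * sl) i)" for s i
  have dj: "dd j (xx j + s * 1) (tt j + s * sl) = s * (a j / c)" for s
    by (simp add: dd_def sl_def algebra_simps)
  have d: "((\<lambda>s. g s i) has_field_derivative sed j c i) (at 0)" for i
  proof (cases "i = j")
    case True
    then show ?thesis by (simp add: g_def sed_def)
  next
    case False
    have "i \<noteq> m0 \<Longrightarrow> dd i (xx j) (tt j) \<noteq> 0" using dd_Ept[of i j] j False by auto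
    from sc_deriv[OF this, of 1 sl] show ?thesis using False by (simp add: g_def sed_def sl_def)
  qed
  have "eventually (\<lambda>s. \<forall>i\<in>I-{j}. dd i (xx j + s * 1) (tt j + s * sl) \<noteq> 0) (nhds 0)"
  proof (rule eventually_ball_finite, use fin in simp, rule ballI)
    fix i assume i: "i \<in> I - {j}"
    have "continuous_on UNIV (\<lambda>s. dd i (xx j + s * 1) (tt j + s * sl))"
      unfolding dd_def by (intro continuous_intros)
    then have "eventually (\<lambda>s. dd i (xx j + s * 1) (tt j + s * sl) \<in> - {0}) (nhds 0)"
      using i j dd_Ept[of i j] by (intro eventually_nhds_cont) auto
    then show "eventually (\<lambda>s. dd i (xx j + s * 1) (tt j + s * sl) \<noteq> 0) (nhds 0)" by simp
  qed
  then have "eventually (\<lambda>s. s \<noteq> 0 \<longrightarrow> emb (g s) \<in> S) (nhds 0)"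
  proof eventually_elim
    case (elim s)
    show ?case
    proof
      assume s: "s \<noteq> 0"
      have "(xx j + s * 1, tt j + s * sl) \<in> U"
        using elim dj[of s] s c a_nz[OF j] by (auto simp: U_def)
      moreover have "g s = sc (xx j + s * 1) (tt j + s * sl)"
      proof
        fix i show "g s i = sc (xx j + s * 1) (tt j + s * sl) i"
          using j s c a_nz[OF j] dj[of s] by (auto simp: g_def sc_def)
      qed
      ultimately show "emb (g s) \<in> S" using emb_S by simp
    qed
  qed
  then have ev: "eventually (\<lambda>s. emb (g s) \<in> S) (at 0)" by (simp add: eventually_at_filter)
  have g0: "g 0 = se j c" by (rule ext) (simp add: g_def se_def)
  show "emb (se j c) \<in> V" "embd (sed j c) \<in> tangent_space V (emb (se j c))"
    using curve_limit_in_V[OF d ev] unfolding g0 by auto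
qed

text \<open>The equation on the data forced by a critical point of the form \<open>se j c\<close>.
  Varying \<open>c\<close> gives \<open>c = sg j u\<close>; the direction \<open>sed\<close> then
  gives a relation with \<open>sg j u\<close> in a denominator. It is multiplied by the square of
  \<open>sg j u\<close>, so that \<open>Gj j u \<noteq> 0\<close> also rules out
  \<open>sg j u = 0\<close>.\<close>

definition Gj :: "'m \<Rightarrow> complex^('m \<times> 2) \<Rightarrow> complex" where
  "Gj j u = sg j u * (sg j u * (xx j - sg m0 u) + (\<Sum>i\<in>I-{j}. (sc (xx j) (tt j) i - sg i u) *
     (sg j u * dx (xx j) (tt j) i + (al j * sg j u + a j) * dt (xx j) (tt j) i)))"

text \<open>The analogous equation, up to sign, for the points whose coordinates other than
  \<open>m0\<close> are all 0; it comes from the direction found in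
  \<open>excm_curve\<close>.\<close>

definition Gm :: "complex^('m \<times> 2) \<Rightarrow> complex" where
  "Gm u = (\<Sum>i\<in>I. a i * sg i u * (sg m0 u - xx i))"

text \<open>Two tangent vectors suffice, one along the exceptional line and one transversal to it.
  Both are velocities of curves in \<open>V\<close>, so the argument applies whether or not the
  point is smooth.\<close>

lemma not_critical_exc:
  assumes j: "j \<in> I" and z: "z \<in> V" "sg m0 z = xx j" "\<And>i. i \<in> I - {j} \<Longrightarrow> sg i z = sc (xx j) (tt j) i"
    and crit: "\<forall>v\<in>tangent_space V z. dir_deriv (sqdist_fun u) z v = 0"
  shows "Gj j u = 0"
proof (cases "sg j u = 0")
  case False
  have z_eq: "z = emb (se j (sg j z))"
  proof -
    have "(\<lambda>i. sg i z) = se j (sg j z)"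
    proof
      fix i show "sg i z = se j (sg j z) i"
        using z(2,3) j by (cases "i = m0"; cases "i = j") (auto simp: se_def sc_def)
    qed
    then show ?thesis using V_emb[OF z(1)] by simp
  qed
  define \<delta> where "\<delta> i = (if i = j then 1 else 0 :: complex)" for i
  have line: "z + s *s embd \<delta> = emb (se j (sg j z + s))" for s
    by (subst z_eq) (simp add: emb_line se_def \<delta>_def if_distrib cong: if_cong, rule arg_cong[where f = emb], auto simp: se_def \<delta>_def)
  have "embd \<delta> \<in> tangent_space V ((\<lambda>s. z + s *s embd \<delta>) 0)"
  proof -
    have 1: "((\<lambda>s. (z + s *s embd \<delta>) $ r) has_field_derivative embd \<delta> $ r) (at 0)" for r
      by (rule line_deriv)
    \<comment> \<open>\<open>exc_curve\<close> does not cover \<open>c = 0\<close>, so the parameter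
      producing this value is left out.\<close>
    have "eventually (\<lambda>s. s \<noteq> - sg j z) (at (0::complex))"
      by (rule eventually_neq_at_within)
    then have 2: "eventually (\<lambda>s. z + s *s embd \<delta> \<in> V) (at 0)"
      by eventually_elim (use exc_curve(1)[OF j] in \<open>auto simp: line add_eq_0_iff\<close>)
    show ?thesis using tangent_curve[OF 1 2] by simp
  qed
  then have "embd \<delta> \<in> tangent_space V z" by simp
  then have "dir_deriv (sqdist_fun u) z (embd \<delta>) = 0" using crit by blast
  then have "dir_deriv (sqdist_fun u) (emb (se j (sg j z))) (embd \<delta>) = 0" using z_eq by simp
  then have sj: "sg j z = sg j u"
    unfolding dir_deriv_sqdist by (simp add: \<delta>_def se_def if_distrib cong: if_cong)
  let ?c = "sg j u"
  have z2: "z = emb (se j ?c)" using z_eq sj by simp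
  have "dir_deriv (sqdist_fun u) z (embd (sed j ?c)) = 0"
    using crit exc_curve(2)[OF j False] z2 by simp
  then have "(\<Sum>i\<in>UNIV. (se j ?c i - sg i u) * sed j ?c i) = 0"
    unfolding z2 dir_deriv_sqdist by simp
  moreover have "(\<Sum>i\<in>UNIV. (se j ?c i - sg i u) * sed j ?c i) = (xx j - sg m0 u) +
     (\<Sum>i\<in>I-{j}. (sc (xx j) (tt j) i - sg i u) * (dx (xx j) (tt j) i + (al j + a j / ?c) * dt (xx j) (tt j) i))"
  proof -
    have "(\<Sum>i\<in>UNIV. (se j ?c i - sg i u) * sed j ?c i) = (se j ?c m0 - sg m0 u) * sed j ?c m0 +
       ((se j ?c j - sg j u) * sed j ?c j + (\<Sum>i\<in>I-{j}. (se j ?c i - sg i u) * sed j ?c i))"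
      unfolding sum_UNIV by (simp only: sum.remove[OF fin j])
    also have "(\<Sum>i\<in>I-{j}. (se j ?c i - sg i u) * sed j ?c i) =
       (\<Sum>i\<in>I-{j}. (sc (xx j) (tt j) i - sg i u) * (dx (xx j) (tt j) i + (al j + a j / ?c) * dt (xx j) (tt j) i))"
      by (rule sum.cong) (auto simp: se_def sed_def)
    finally show ?thesis using j by (simp add: se_def sed_def sc_def dx_def dt_def)
  qed
  ultimately have 0: "(xx j - sg m0 u) +
     (\<Sum>i\<in>I-{j}. (sc (xx j) (tt j) i - sg i u) * (dx (xx j) (tt j) i + (al j + a j / ?c) * dt (xx j) (tt j) i)) = 0" by simp
  have "Gj j u = ?c * (?c * ((xx j - sg m0 u) +
     (\<Sum>i\<in>I-{j}. (sc (xx j) (tt j) i - sg i u) * (dx (xx j) (tt j) i + (al j + a j / ?c) * dt (xx j) (tt j) i))))"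
  proof -
    have "(\<Sum>i\<in>I-{j}. (sc (xx j) (tt j) i - sg i u) * (?c * dx (xx j) (tt j) i + (al j * ?c + a j) * dt (xx j) (tt j) i)) =
      ?c * (\<Sum>i\<in>I-{j}. (sc (xx j) (tt j) i - sg i u) * (dx (xx j) (tt j) i + (al j + a j / ?c) * dt (xx j) (tt j) i))"
      unfolding sum_distrib_left by (rule sum.cong) (use False in \<open>auto simp: field_simps\<close>)
    then show ?thesis by (simp add: Gj_def distrib_left)
  qed
  then show ?thesis unfolding 0 by simp
qed (simp add: Gj_def)

text \<open>Lines through the centre of the distinguished camera correspond to infinite
  \<open>t\<close>. With \<open>t = 1 / s\<close> the coordinates become
  \<open>s * (a i * (x - xx i)) / (1 - s * tau i x)\<close>, which are regular at
  \<open>s = 0\<close> and vanish there, while \<open>x\<close> stays free.\<close>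

lemma excm_curve:
  fixes x
  defines "h \<equiv> \<lambda>i. if i = m0 then x else 0"
  defines "\<nu> \<equiv> \<lambda>i. if i = m0 then 0 else a i * (x - xx i)"
  shows "emb h \<in> V" "embd \<nu> \<in> tangent_space V (emb h)"
proof -
  define g where "g s i = (if i = m0 then x else s * (a i * (x - xx i)) / (1 - s * tau i x))" for s i
  have d: "((\<lambda>s. g s i) has_field_derivative \<nu> i) (at 0)" for i
    by (cases "i = m0") (auto simp: g_def \<nu>_def intro!: derivative_eq_intros)
  have "eventually (\<lambda>s. \<forall>i\<in>I. 1 - s * tau i x \<noteq> 0) (nhds 0)"
  proof (rule eventually_ball_finite[OF fin], rule ballI)
    fix i
    have "continuous_on UNIV (\<lambda>s. 1 - s * tau i x)" by (intro continuous_intros)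
    then have "eventually (\<lambda>s. 1 - s * tau i x \<in> - {0}) (nhds 0)"
      by (intro eventually_nhds_cont) auto
    then show "eventually (\<lambda>s. 1 - s * tau i x \<noteq> 0) (nhds 0)" by simp
  qed
  then have "eventually (\<lambda>s. s \<noteq> 0 \<longrightarrow> emb (g s) \<in> S) (nhds 0)"
  proof eventually_elim
    case (elim s)
    show ?case
    proof
      assume s: "s \<noteq> 0"
      have dds: "dd i x (1 / s) = (1 - s * tau i x) / s" for i using s by (simp add: dd_tau field_simps)
      have "(x, 1 / s) \<in> U" using elim s by (auto simp: U_def dds)
      moreover have "g s = sc x (1 / s)"
        by (rule ext) (use s in \<open>simp add: g_def sc_def dds\<close>)
      ultimately show "emb (g s) \<in> S" using emb_S by simp
    qed
  qed
  then have ev: "eventually (\<lambda>s. emb (g s) \<in> S) (at 0)" by (simp add: eventually_at_filter)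
  have g0: "g 0 = h" by (rule ext) (simp add: g_def h_def)
  show "emb h \<in> V" "embd \<nu> \<in> tangent_space V (emb h)"
    using curve_limit_in_V[OF d ev] unfolding g0 by auto
qed

lemma not_critical_excm:
  assumes z: "z \<in> V" "\<And>i. i \<in> I \<Longrightarrow> sg i z = 0"
    and crit: "\<forall>v\<in>tangent_space V z. dir_deriv (sqdist_fun u) z v = 0"
  shows "Gm u = 0"
proof -
  define h where "h x = (\<lambda>i. if i = m0 then x else (0::complex))" for x
  have z_eq: "z = emb (h (sg m0 z))"
  proof -
    have "(\<lambda>i. sg i z) = h (sg m0 z)" by (rule ext) (use z(2) in \<open>auto simp: h_def\<close>)
    then show ?thesis using V_emb[OF z(1)] by simp
  qed
  have line: "z + s *s embd (h 1) = emb (h (sg m0 z + s))" for s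
    by (subst z_eq) (unfold emb_line, rule arg_cong[where f = emb], auto simp: h_def)
  have 1: "((\<lambda>s. (z + s *s embd (h 1)) $ r) has_field_derivative embd (h 1) $ r) (at 0)" for r
    by (rule line_deriv)
  have 2: "eventually (\<lambda>s. z + s *s embd (h 1) \<in> V) (at 0)"
  proof -
    have "emb (h y) \<in> V" for y using excm_curve(1)[of y] unfolding h_def .
    then show ?thesis unfolding line by simp
  qed
  have "embd (h 1) \<in> tangent_space V z" using tangent_curve[OF 1 2] by simp
  then have "dir_deriv (sqdist_fun u) z (embd (h 1)) = 0" using crit by blast
  then have "dir_deriv (sqdist_fun u) (emb (h (sg m0 z))) (embd (h 1)) = 0" using z_eq by simp
  then have s0: "sg m0 z = sg m0 u"
    unfolding dir_deriv_sqdist by (simp add: h_def if_distrib cong: if_cong)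
  let ?x = "sg m0 u"
  have z2: "z = emb (h ?x)" using z_eq s0 by simp
  let ?\<nu> = "\<lambda>i. if i = m0 then 0 else a i * (?x - xx i)"
  have "embd ?\<nu> \<in> tangent_space V z"
    using excm_curve(2)[of ?x] unfolding z2 h_def .
  then have "dir_deriv (sqdist_fun u) z (embd ?\<nu>) = 0" using crit by blast
  then have "(\<Sum>i\<in>UNIV. (h ?x i - sg i u) * ?\<nu> i) = 0"
    unfolding z2 dir_deriv_sqdist by simp
  moreover have "(\<Sum>i\<in>UNIV. (h ?x i - sg i u) * ?\<nu> i) = - Gm u"
    unfolding sum_UNIV Gm_def sum_negf[symmetric] by (simp add: h_def) (rule sum.cong, auto simp: algebra_simps)
  ultimately show ?thesis by simp
qed

lemma Gj_cpoly: "Gj j \<in> cpoly" and Gm_cpoly: "Gm \<in> cpoly"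
proof -
  have "(\<lambda>u. Gj j u) \<in> cpoly" unfolding Gj_def using sg_cpoly by (intro cpoly_intros)
  then show "Gj j \<in> cpoly" by simp
  have "(\<lambda>u. Gm u) \<in> cpoly" unfolding Gm_def using sg_cpoly by (intro cpoly_intros)
  then show "Gm \<in> cpoly" by simp
qed

lemma Gj_nonzero: "j \<in> I \<Longrightarrow> \<exists>u. Gj j u \<noteq> 0"
proof -
  assume j: "j \<in> I"
  \<comment> \<open>The data agree with the exceptional point in the coordinates of
    \<open>I - {j}\<close>, so the sum in \<open>Gj\<close> vanishes and
    \<open>xx j - sg m0 u = -1\<close> remains.\<close>
  from emb_surj[of "\<lambda>i. if i = m0 then xx j + 1 else if i = j then 1 else sc (xx j) (tt j) i"]
  obtain u where u: "\<forall>i. sg i u = (if i = m0 then xx j + 1 else if i = j then 1 else sc (xx j) (tt j) i)"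
    by (rule exE)
  have "Gj j u = -1" using j by (simp add: Gj_def u[rule_format])
  then show ?thesis by (intro exI[of _ u]) simp
qed

lemma Gm_nonzero: "\<exists>u. Gm u \<noteq> 0"
proof -
  obtain i0 where i0: "i0 \<in> I" using ex_other[of 0] by (rule bexE)
  from emb_surj[of "\<lambda>i. if i = m0 then xx i0 + 1 else if i = i0 then 1 else 0"]
  obtain u where u: "\<forall>i. sg i u = (if i = m0 then xx i0 + 1 else if i = i0 then 1 else 0)"
    by (rule exE)
  have "Gm u = (\<Sum>i\<in>I. if i = i0 then a i0 else 0)"
    unfolding Gm_def by (rule sum.cong) (auto simp: u[rule_format])
  then have "Gm u = a i0" using i0 by simp
  then show ?thesis using a_nz[OF i0] by (intro exI[of _ u]) simp
qed

text \<open>Besides the count of \<open>generic_count\<close>, the data must admit no critical point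
  outside \<open>S\<close>; the factors \<open>Gm\<close> and \<open>Gj\<close> of \<open>F\<close>
  ensure this.\<close>

theorem EDD_surface: "EDD_is V NN"
proof -
  obtain G where G: "G \<in> cpoly" "\<exists>u. G u \<noteq> 0"
    "\<And>u. G u \<noteq> 0 \<Longrightarrow> finite (zeros (\<lambda>i. sg i u) (sg m0 u)) \<and> card (genuine (\<lambda>i. sg i u) (sg m0 u)) = NN"
  proof -
    have "\<exists>u. (\<forall>i\<in>I. sg i u = v i) \<and> sg m0 u = w" for v w
    proof -
      from emb_surj[of "\<lambda>i. if i = m0 then w else v i"]
      obtain u where u: "\<forall>i. sg i u = (if i = m0 then w else v i)" by (rule exE)
      show ?thesis by (rule exI[of _ u]) (simp add: u[rule_format])
    qed
    from generic_count[of "\<lambda>u i. sg i u" "\<lambda>u. sg m0 u", OF _ _ this] show ?thesis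
      using sg_cpoly that by auto
  qed
  define F where "F u = G u * (Gm u * (\<Prod>j\<in>I. Gj j u))" for u
  have "(\<lambda>u. \<Prod>j\<in>I. Gj j u) \<in> cpoly" using Gj_cpoly by auto
  then have c2: "(\<lambda>u. Gm u * (\<Prod>j\<in>I. Gj j u)) \<in> cpoly" using Gm_cpoly by (intro cpoly_mult)
  have "\<exists>u. (\<Prod>j\<in>I. Gj j u) \<noteq> 0"
    by (rule cpoly_prod_nonzero[OF fin Gj_cpoly Gj_nonzero])
  then have n2: "\<exists>u. Gm u * (\<Prod>j\<in>I. Gj j u) \<noteq> 0"
    using Gm_nonzero cpoly_mult_nonzero[OF Gm_cpoly \<open>(\<lambda>u. \<Prod>j\<in>I. Gj j u) \<in> cpoly\<close>] by blast
  have "F \<in> cpoly"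
    using cpoly_mult[OF G(1) c2] by (simp add: F_def[abs_def])
  moreover have "\<exists>u. F u \<noteq> 0"
    using cpoly_mult_nonzero[OF G(1) c2] G(2) n2 by (auto simp: F_def)
  ultimately have "proper_zariski_closed {u. F u = 0}" by (rule proper_zero_set)
  moreover have "finite (ed_critical_points V u) \<and> card (ed_critical_points V u) = NN" if "u \<notin> {u. F u = 0}" for u
  proof -
    have Fu: "G u \<noteq> 0" "Gm u \<noteq> 0" "\<And>j. j \<in> I \<Longrightarrow> Gj j u \<noteq> 0" using that fin by (auto simp: F_def)
    let ?g = "genuine (\<lambda>i. sg i u) (sg m0 u)"
    have gU: "?g \<subseteq> U" by (auto simp: genuine_def U_def)
    have eq: "ed_critical_points V u = (\<lambda>(x, t). emb (sc x t)) ` ?g"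
    proof (intro equalityI subsetI)
      fix z assume "z \<in> ed_critical_points V u"
      then have z: "z \<in> V" "\<forall>v\<in>tangent_space V z. dir_deriv (sqdist_fun u) z v = 0"
        by (auto simp: ed_critical_points_def smooth_point_def)
      show "z \<in> (\<lambda>(x, t). emb (sc x t)) ` ?g"
      proof (cases rule: V_cases[OF z(1)])
        case (1 x t)
        then have "(x, t) \<in> ?g" using critical_S[OF 1(1)] z(2) by simp
        then show ?thesis using 1(2) by force
      next
        case (2 j)
        then show ?thesis using not_critical_exc[OF 2(1) z(1) 2(2,3) z(2)] Fu(3)[OF 2(1)] by simp
      next
        case 3
        then show ?thesis using not_critical_excm[OF z(1) 3 z(2)] Fu(2) by simp
      qed
    next
      fix z assume "z \<in> (\<lambda>(x, t). emb (sc x t)) ` ?g"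
      then obtain x t where xt: "(x, t) \<in> ?g" "z = emb (sc x t)" by auto
      then have "(x, t) \<in> U" using gU by auto
      then show "z \<in> ed_critical_points V u"
        using smooth_S critical_S xt by (simp add: ed_critical_points_def)
    qed
    have "inj_on (\<lambda>(x, t). emb (sc x t)) ?g"
    proof (rule inj_onI)
      fix w w' assume w: "w \<in> ?g" "w' \<in> ?g" "(\<lambda>(x, t). emb (sc x t)) w = (\<lambda>(x, t). emb (sc x t)) w'"
      have "(fst w, snd w) \<in> U" "(fst w', snd w') \<in> U" using w(1,2) gU by auto
      from sc_inj[OF this] w(3) show "w = w'" by (simp add: case_prod_unfold prod_eq_iff)
    qed
    then have "card (ed_critical_points V u) = NN"
      unfolding eq using card_image G(3)[OF Fu(1)] by metis
    moreover have "finite ?g" using finite_subset[OF genuine_subset] G(3)[OF Fu(1)] by blast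
    ultimately show ?thesis unfolding eq by simp
  qed
  ultimately show ?thesis unfolding EDD_is_def by blast
qed

end

section \<open>The curve of images of the points of a line\<close>

locale line_curve = framed_lines P R for P R :: "'m::finite \<Rightarrow> complex^2" +
  fixes m0 :: 'm and a tau :: "'m \<Rightarrow> complex"
  assumes c_nz: "\<And>i. i \<noteq> m0 \<Longrightarrow> a i \<noteq> 0" and tau_inj: "inj_on tau (UNIV - {m0})"
    and ex_I: "UNIV - {m0} \<noteq> {}"
begin

abbreviation I where "I \<equiv> UNIV - {m0}"

definition cc :: "complex \<Rightarrow> 'm \<Rightarrow> complex" where
  "cc t i = (if i = m0 then t else a i / (t - tau i))"

definition dc :: "complex \<Rightarrow> 'm \<Rightarrow> complex" where
  "dc t i = (if i = m0 then 1 else - a i / (t - tau i) ^ 2)"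

definition U :: "complex set" where
  "U = {t. \<forall>i\<in>I. t \<noteq> tau i}"

definition W :: "(complex^('m \<times> 2)) set" where
  "W = (\<lambda>t. emb (cc t)) ` U"

definition V :: "(complex^('m \<times> 2)) set" where
  "V = zclosure W"

definition qe :: "'m \<Rightarrow> complex^('m \<times> 2) \<Rightarrow> complex" where
  "qe i z = sg i z * (sg m0 z - tau i) - a i"

lemma qe_cpoly: "qe i \<in> cpoly"
proof -
  have "(\<lambda>z. qe i z) \<in> cpoly"
    unfolding qe_def using sg_cpoly by (intro cpoly_intros)
  then show ?thesis by simp
qed

lemma qe_V: "i \<in> I \<Longrightarrow> z \<in> V \<Longrightarrow> qe i z = 0"
  unfolding V_def by (rule zclosure_vanish[OF qe_cpoly]) (auto simp: W_def U_def qe_def sg_emb cc_def)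

lemma W_subset_V: "W \<subseteq> V"
  unfolding V_def by (rule subset_zclosure)

lemma V_emb: "z \<in> V \<Longrightarrow> z = emb (\<lambda>i. sg i z)"
  unfolding V_def by (rule zclosure_emb[of W]) (auto simp: W_def)

lemma V_range: "z \<in> V \<Longrightarrow> z \<in> range emb"
  using V_emb by blast

text \<open>The image is already closed in the affine chart: \<open>qe\<close> forces
  \<open>sg i z * (t - tau i)\<close> to be the nonzero number \<open>a i\<close>, so
  \<open>t\<close> cannot be a pole.\<close>

lemma V_cases:
  assumes "z \<in> V"
  obtains t where "t \<in> U" "z = emb (cc t)"
proof -
  define t where "t = sg m0 z"
  have e: "sg i z * (t - tau i) = a i" if "i \<in> I" for i
    using qe_V[OF that assms] by (simp add: qe_def t_def)
  have "t \<in> U" unfolding U_def using e c_nz by fastforce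
  moreover have "(\<lambda>i. sg i z) = cc t"
  proof
    fix i show "sg i z = cc t i"
      using e[of i] \<open>t \<in> U\<close> by (cases "i = m0") (auto simp: cc_def t_def U_def field_simps)
  qed
  then have "z = emb (cc t)" using V_emb[OF assms] by simp
  ultimately show ?thesis by (rule that)
qed

lemma emb_W: "t \<in> U \<Longrightarrow> emb (cc t) \<in> W"
  by (auto simp: W_def)

lemma cc_inj: "emb (cc t) = emb (cc t') \<Longrightarrow> t = t'"
proof -
  assume "emb (cc t) = emb (cc t')"
  then have "cc t m0 = cc t' m0" by (metis sg_emb)
  then show ?thesis by (simp add: cc_def)
qed

lemma infinite_U: "infinite U"
proof -
  have "U = - tau ` I" by (auto simp: U_def)
  then show ?thesis using infinite_UNIV_char_0[where 'a = complex] by (simp add: Compl_eq_Diff_UNIV)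
qed

lemma tangent_W:
  assumes u: "t \<in> U"
  shows "embd (dc t) \<in> tangent_space V (emb (cc t))"
proof -
  have d: "((\<lambda>s. cc s i) has_field_derivative dc t i) (at t)" for i
    using u by (cases "i = m0") (auto simp: cc_def dc_def U_def power2_eq_square intro!: derivative_eq_intros)
  have ev: "eventually (\<lambda>s. emb (cc s) \<in> V) (at t)"
  proof -
    have "open U"
    proof -
      have "U = - tau ` I" by (auto simp: U_def)
      moreover have "closed (tau ` I)" by (rule finite_imp_closed) simp
      ultimately show ?thesis by (simp only: open_Compl)
    qed
    then have "eventually (\<lambda>s. s \<in> U) (at t)" using u by (simp add: eventually_at_topological) blast
    then show ?thesis by eventually_elim (use emb_W W_subset_V in blast)
  qed
  show ?thesis by (rule tangent_curve[OF emb_deriv[OF d] ev])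
qed

lemma tangent_V_W:
  assumes u: "t \<in> U" and v: "v \<in> tangent_space V (emb (cc t))"
  shows "v = sgd m0 v *s embd (dc t)"
proof -
  have "sgd i v = sgd m0 v * dc t i" for i
  proof (cases "i = m0")
    case False
    then have i: "i \<in> I" "t - tau i \<noteq> 0" using u by (auto simp: U_def)
    have "qe i \<in> vanishing_ideal V"
      using qe_V[OF i(1)] qe_cpoly by (simp add: vanishing_ideal_def)
    then have "dir_deriv (qe i) (emb (cc t)) v = 0" using v by (simp add: tangent_space_def)
    moreover have "((\<lambda>s. qe i (emb (cc t) + s *s v)) has_field_derivative
       sgd i v * (t - tau i) + cc t i * sgd m0 v) (at 0)"
      unfolding qe_def sg_line sg_emb by (auto intro!: derivative_eq_intros simp: cc_def[of t m0] algebra_simps)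
    then have "dir_deriv (qe i) (emb (cc t)) v = sgd i v * (t - tau i) + cc t i * sgd m0 v"
      unfolding dir_deriv_def by (rule DERIV_imp_deriv)
    ultimately have "sgd i v * (t - tau i) = - (cc t i * sgd m0 v)" by (simp add: eq_neg_iff_add_eq_0)
    then have "sgd i v = - (cc t i * sgd m0 v) / (t - tau i)" by (rule nonzero_eq_divide_eq[OF i(2), THEN iffD2])
    then show ?thesis using False by (simp add: cc_def dc_def power2_eq_square)
  qed (simp add: dc_def)
  then have "(\<lambda>i. sgd i v) = (\<lambda>i. sgd m0 v * dc t i)" by (rule ext)
  then have "embd (\<lambda>i. sgd i v) = embd (\<lambda>i. sgd m0 v * dc t i)" by (rule arg_cong)
  also have "\<dots> = sgd m0 v *s embd (dc t)"
    by (simp add: embd_def Finite_Cartesian_Product.vec_eq_iff)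
  finally have 1: "embd (\<lambda>i. sgd i v) = sgd m0 v *s embd (dc t)" .
  have "v = embd (\<lambda>i. sgd i v)" by (rule tangent_embd[of V, OF _ v]) (rule V_range)
  from trans[OF this 1] show ?thesis .
qed

lemma tangent_dim_W:
  assumes u: "t \<in> U"
  shows "vec.dim (tangent_space V (emb (cc t))) = 1"
proof (rule tangent_dim_1[OF tangent_W[OF u]])
  show "embd (dc t) \<noteq> 0"
  proof
    assume "embd (dc t) = 0"
    then have "sgd m0 (embd (dc t)) = 0" by (simp add: sgd_def)
    then show False unfolding sgd_embd by (simp add: dc_def)
  qed
  show "\<exists>\<alpha>. v = \<alpha> *s embd (dc t)" if "v \<in> tangent_space V (emb (cc t))" for v
    using tangent_V_W[OF u that] by (rule exI)
qed

lemma param_V: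
  obtains m q N where "uni.rational_param m q N (\<lambda>t. emb (cc t))"
    "V = zclosure ((\<lambda>t. emb (cc t)) ` {w. q w \<noteq> 0})"
proof -
  define Q where "Q = (\<Prod>i\<in>I. [:- tau i, 1:])"
  have Q: "poly Q z = (\<Prod>i\<in>I. z - tau i)" for z by (simp add: Q_def poly_prod)
  have Qn: "poly Q z \<noteq> 0 \<longleftrightarrow> z \<in> U" for z by (simp add: Q U_def)
  define N where "N p = (if fst p = m0 then [:P m0 $ snd p, R m0 $ snd p:] * Q
     else [:P (fst p) $ snd p:] * Q + [:a (fst p) * R (fst p) $ snd p:] * (\<Prod>j\<in>I-{fst p}. [:- tau j, 1:]))" for p
  have "emb (cc z) $ p * poly Q z = poly (N p) z" if u: "poly Q z \<noteq> 0" for z p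
  proof (cases "fst p = m0")
    case True
    then show ?thesis by (simp add: N_def emb_def cc_def algebra_simps)
  next
    case False
    then have i: "fst p \<in> I" by simp
    have d: "z - tau (fst p) \<noteq> 0" using u i unfolding Qn by (auto simp: U_def)
    have Qz: "poly Q z = (z - tau (fst p)) * (\<Prod>j\<in>I-{fst p}. z - tau j)"
      unfolding Q by (rule prod.remove[OF _ i]) simp
    then show ?thesis using False d by (simp add: N_def emb_def cc_def poly_prod Qz distrib_right)
  qed
  moreover obtain t where "t \<in> U" using infinite_U infinite_imp_nonempty by blast
  then have "poly Q t \<noteq> 0" by (simp add: Qn)
  ultimately obtain m where m: "uni.rational_param m (poly Q) (\<lambda>i. poly (N i)) (\<lambda>z. emb (cc z))"
    using rational_param_uniI[of Q t "\<lambda>z. emb (cc z)" N] by auto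
  have "{w. poly Q w \<noteq> 0} = U" using Qn by auto
  then have "V = zclosure ((\<lambda>t. emb (cc t)) ` {w. poly Q w \<noteq> 0})" by (simp add: V_def W_def)
  then show ?thesis using that m by blast
qed

lemma local_dim_V:
  assumes "z \<in> V"
  shows "local_dim V z = 1"
proof -
  obtain m q N where pV: "uni.rational_param m q N (\<lambda>t. emb (cc t))"
    "V = zclosure ((\<lambda>t. emb (cc t)) ` {w. q w \<noteq> 0})" by (rule param_V)
  obtain t1 where t1: "t1 \<in> U" using infinite_U infinite_imp_nonempty by blast
  have "infinite (U - {t1})" using infinite_U by simp
  then obtain t2 where t2: "t2 \<in> U" "t2 \<noteq> t1" using infinite_imp_nonempty by blast
  define S0 where "S0 k = (if k = 0 then {emb (cc t1)} else V)" for k :: nat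
  have inV: "emb (cc t1) \<in> V" "emb (cc t2) \<in> V"
    using subsetD[OF W_subset_V emb_W] t1 t2 by auto
  show ?thesis
  proof (rule local_dim_eqI[of _ _ S0])
    fix d and T :: "nat \<Rightarrow> (complex^('m \<times> 2)) set"
    assume "\<And>k. k \<le> d \<Longrightarrow> zariski_closed (T k) \<and> zirreducible (T k) \<and> T k \<subseteq> V" "\<And>k. k < d \<Longrightarrow> T k \<subset> T (Suc k)"
    then show "d \<le> 1" using uni.param_chain_bound[OF pV(1)] unfolding pV(2) by blast
  next
    fix k :: nat
    have "zirreducible V" unfolding pV(2) by (rule uni.param_irreducible[OF pV(1)])
    moreover have "zariski_closed V" unfolding V_def by (rule zclosure_closed)
    ultimately show "zariski_closed (S0 k) \<and> zirreducible (S0 k) \<and> S0 k \<subseteq> V"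
      using inV by (auto simp: S0_def zariski_closed_singleton zirreducible_singleton)
  next
    fix k :: nat assume "k < 1"
    moreover have psub: "{p} \<subset> D" if "p \<in> D" "q \<in> D" "p \<noteq> q" for p q :: "complex^('m \<times> 2)" and D
      using that by auto
    have "emb (cc t1) \<noteq> emb (cc t2)" using cc_inj t2(2) by metis
    then have "{emb (cc t1)} \<subset> V" by (rule psub[OF inV])
    ultimately show "S0 k \<subset> S0 (Suc k)" by (simp add: S0_def)
  qed (use assms in \<open>simp add: S0_def\<close>)
qed

lemma smooth_W: "t \<in> U \<Longrightarrow> smooth_point V (emb (cc t))"
  unfolding smooth_point_def using tangent_dim_W local_dim_V emb_W W_subset_V by (simp add: subsetD)

definition Qi :: "'m \<Rightarrow> complex poly" where
  "Qi i = (\<Prod>j\<in>I-{i}. [:- tau j, 1:] ^ 3)"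

text \<open>The numerator of half the derivative of the squared distance along the curve.\<close>
definition KK :: "('m \<Rightarrow> complex) \<Rightarrow> complex poly" where
  "KK v = [:- v m0, 1:] * (\<Prod>j\<in>I. [:- tau j, 1:] ^ 3) -
     (\<Sum>i\<in>I. [:a i * (a i + v i * tau i), - a i * v i:] * Qi i)"

lemma poly_Qi: "poly (Qi i) t = (\<Prod>j\<in>I-{i}. (t - tau j) ^ 3)"
  by (simp add: Qi_def poly_prod)

lemma poly_KK: "poly (KK v) t = (t - v m0) * (\<Prod>j\<in>I. (t - tau j) ^ 3) -
    (\<Sum>i\<in>I. a i * (a i - v i * (t - tau i)) * poly (Qi i) t)"
proof -
  have "(\<Sum>i\<in>I. poly ([:a i * (a i + v i * tau i), - a i * v i:] * Qi i) t) =
    (\<Sum>i\<in>I. a i * (a i - v i * (t - tau i)) * poly (Qi i) t)"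
    by (rule sum.cong) (simp_all add: algebra_simps)
  then show ?thesis unfolding KK_def poly_diff poly_sum by (simp add: poly_prod algebra_simps)
qed

lemma critical_W:
  assumes u: "t \<in> U"
  shows "(\<forall>v\<in>tangent_space V (emb (cc t)). dir_deriv (sqdist_fun w) (emb (cc t)) v = 0) \<longleftrightarrow>
     poly (KK (\<lambda>i. sg i w)) t = 0"
proof -
  let ?z = "emb (cc t)" and ?D = "\<Prod>j\<in>I. (t - tau j) ^ 3"
  define A where "A = (\<Sum>i\<in>UNIV. (cc t i - sg i w) * dc t i)"
  have d: "dir_deriv (sqdist_fun w) ?z (p *s embd (dc t)) = 2 * (p * A)" for p
  proof -
    have "p *s embd (dc t) = embd (\<lambda>i. p * dc t i)"
      by (simp add: embd_def Finite_Cartesian_Product.vec_eq_iff)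
    then show ?thesis unfolding A_def sum_distrib_left
      by (simp only: dir_deriv_sqdist sum_distrib_left) (rule sum.cong, simp_all)
  qed
  have "(\<forall>v\<in>tangent_space V ?z. dir_deriv (sqdist_fun w) ?z v = 0) \<longleftrightarrow> A = 0"
  proof
    assume "\<forall>v\<in>tangent_space V ?z. dir_deriv (sqdist_fun w) ?z v = 0"
    then have "dir_deriv (sqdist_fun w) ?z (embd (dc t)) = 0" using tangent_W[OF u] by blast
    then show "A = 0" using d[of 1] by simp
  next
    assume "A = 0"
    show "\<forall>v\<in>tangent_space V ?z. dir_deriv (sqdist_fun w) ?z v = 0"
    proof
      fix v assume "v \<in> tangent_space V ?z"
      from tangent_V_W[OF u this] have "dir_deriv (sqdist_fun w) ?z v = 2 * (sgd m0 v * A)" using d by metis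
      then show "dir_deriv (sqdist_fun w) ?z v = 0" using \<open>A = 0\<close> by simp
    qed
  qed
  moreover have "poly (KK (\<lambda>i. sg i w)) t = ?D * A"
  proof -
    have dn: "t - tau i \<noteq> 0" if "i \<in> I" for i using u that by (auto simp: U_def)
    have A_eq: "A = (t - sg m0 w) + (\<Sum>i\<in>I. (cc t i - sg i w) * dc t i)"
      unfolding A_def by (subst sum.remove[of _ m0]) (auto simp: cc_def dc_def)
    have "(\<Sum>i\<in>I. ?D * ((cc t i - sg i w) * dc t i)) =
       (\<Sum>i\<in>I. - (a i * (a i - sg i w * (t - tau i)) * poly (Qi i) t))"
    proof (rule sum.cong)
      fix i assume i: "i \<in> I"
      have D: "?D = (t - tau i) ^ 3 * poly (Qi i) t"
        unfolding poly_Qi by (rule prod.remove[OF _ i]) simp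
      have "(t - tau i) ^ 3 * ((a i / (t - tau i) - sg i w) * (- a i / (t - tau i) ^ 2)) =
        - (a i * (a i - sg i w * (t - tau i)))"
        using dn[OF i] by (simp add: power2_eq_square power3_eq_cube divide_simps) (simp add: algebra_simps)?
      then have "(t - tau i) ^ 3 * ((cc t i - sg i w) * dc t i) = - (a i * (a i - sg i w * (t - tau i)))"
        using i by (simp add: cc_def dc_def)
      then have "poly (Qi i) t * ((t - tau i) ^ 3 * ((cc t i - sg i w) * dc t i)) = poly (Qi i) t * - (a i * (a i - sg i w * (t - tau i)))"
        by (rule arg_cong)
      then show "?D * ((cc t i - sg i w) * dc t i) = - (a i * (a i - sg i w * (t - tau i)) * poly (Qi i) t)"
        unfolding D by (simp only: mult_ac mult_minus_right mult_minus_left)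
    qed simp
    then show ?thesis
      unfolding A_eq poly_KK distrib_left sum_distrib_left sum_negf by (simp add: mult.commute)
  qed
  moreover have "?D \<noteq> 0" using u by (simp add: U_def)
  ultimately show ?thesis by simp
qed

text \<open>Only the summand with \<open>i = j\<close> survives at \<open>tau j\<close>. So clearing
  denominators creates no spurious roots, and every root of \<open>KK v\<close> is a critical
  parameter.\<close>

lemma KK_tau:
  assumes "j \<in> I" shows "poly (KK v) (tau j) \<noteq> 0"
proof -
  have "(\<Sum>i\<in>I. a i * (a i - v i * (tau j - tau i)) * poly (Qi i) (tau j)) =
    (\<Sum>i\<in>I. if i = j then a j * a j * poly (Qi j) (tau j) else 0)"
  proof (rule sum.cong)
    fix i assume i: "i \<in> I"
    have "poly (Qi i) (tau j) = 0" if "i \<noteq> j"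
    proof -
      have "j \<in> I - {i}" using assms that by auto
      then show ?thesis unfolding poly_Qi by (intro prod_zero) auto
    qed
    then show "a i * (a i - v i * (tau j - tau i)) * poly (Qi i) (tau j) =
      (if i = j then a j * a j * poly (Qi j) (tau j) else 0)" by auto
  qed simp
  also have "\<dots> = a j * a j * poly (Qi j) (tau j)" using assms by (subst sum.delta) auto
  finally have s: "(\<Sum>i\<in>I. a i * (a i - v i * (tau j - tau i)) * poly (Qi i) (tau j)) = a j * a j * poly (Qi j) (tau j)" .
  have z: "(\<Prod>i\<in>I. (tau j - tau i) ^ 3) = 0" using assms by (intro prod_zero) auto
  have "poly (KK v) (tau j) = - (a j * a j * poly (Qi j) (tau j))"
    unfolding poly_KK s z by simp
  moreover have "poly (Qi j) (tau j) \<noteq> 0"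
    unfolding poly_Qi using inj_onD[OF tau_inj, of j] assms by (auto simp: prod_zero_iff)
  ultimately show ?thesis using c_nz[of j] assms by simp
qed

text \<open>The first product is monic of degree \<open>3 * card I + 1\<close> and the sum has
  smaller degree, so the degree is the same for all data.\<close>

lemma degree_KK: "degree (KK v) = 3 * card I + 1"
proof -
  have m: "degree ([:- v m0, 1:] * (\<Prod>j\<in>I. [:- tau j, 1:] ^ 3)) = 3 * card I + 1"
    by (subst degree_mult_eq) (simp_all add: degree_prod_eq_sum_degree degree_power_eq mult.commute)
  have "degree ([:a i * (a i + v i * tau i), - a i * v i:] * Qi i) \<le> 3 * card I" if "i \<in> I" for i
  proof -
    have "degree (Qi i) = 3 * card (I - {i})"
      unfolding Qi_def by (subst degree_prod_eq_sum_degree) (simp_all add: degree_power_eq mult.commute)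
    moreover have "card I = Suc (card (I - {i}))" using that by (metis card_Suc_Diff1 finite)
    moreover have "degree ([:a i * (a i + v i * tau i), - a i * v i:] * Qi i) \<le> 1 + degree (Qi i)"
      by (rule order_trans[OF degree_mult_le]) (simp add: degree_pCons_eq_if)
    ultimately show ?thesis by linarith
  qed
  then have "degree (\<Sum>i\<in>I. [:a i * (a i + v i * tau i), - a i * v i:] * Qi i) \<le> 3 * card I"
    by (intro degree_sum_le) auto
  then show ?thesis unfolding KK_def using m
    by (subst diff_conv_add_uminus) (subst degree_add_eq_left, simp_all)
qed

text \<open>A pencil in the single datum \<open>v i0\<close>: the roots of its direction
  \<open>Q\<close> are poles, where \<open>KK\<close> does not vanish, and \<open>tau i0\<close> is
  a simple one among them.\<close>

lemma ex_rsquarefree_KK: "\<exists>v. rsquarefree (KK v)"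
proof -
  obtain i0 where i0: "i0 \<in> I" using ex_I by blast
  define v where "v \<beta> i = (if i = i0 then \<beta> else 0)" for \<beta> :: complex and i
  define Q where "Q = [:- a i0 * tau i0, a i0:] * Qi i0"
  have eq: "KK (v \<beta>) = KK (v 0) + Polynomial.smult \<beta> Q" for \<beta>
  proof -
    have "(\<Sum>i\<in>I. [:a i * (a i + v \<beta> i * tau i), - a i * v \<beta> i:] * Qi i) =
      (\<Sum>i\<in>I. [:a i * (a i + v 0 i * tau i), - a i * v 0 i:] * Qi i - (if i = i0 then Polynomial.smult \<beta> Q else 0))"
    proof (rule sum.cong)
      fix i
      have "[:a i0 * (a i0 + \<beta> * tau i0), - a i0 * \<beta>:] = [:a i0 * a i0, 0:] - Polynomial.smult \<beta> [:- a i0 * tau i0, a i0:]"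
        by (simp add: algebra_simps)
      then have "[:a i0 * (a i0 + \<beta> * tau i0), - a i0 * \<beta>:] * Qi i0 = [:a i0 * a i0, 0:] * Qi i0 - Polynomial.smult \<beta> Q"
        unfolding Q_def by (simp only: left_diff_distrib mult_smult_left)
      then show "[:a i * (a i + v \<beta> i * tau i), - a i * v \<beta> i:] * Qi i =
        [:a i * (a i + v 0 i * tau i), - a i * v 0 i:] * Qi i - (if i = i0 then Polynomial.smult \<beta> Q else 0)"
        by (simp add: v_def)
    qed simp
    also have "\<dots> = (\<Sum>i\<in>I. [:a i * (a i + v 0 i * tau i), - a i * v 0 i:] * Qi i) - Polynomial.smult \<beta> Q"
      using i0 by (subst sum_subtractf) (simp add: sum.delta)
    finally have "KK (v \<beta>) = [:- v \<beta> m0, 1:] * (\<Prod>j\<in>I. [:- tau j, 1:] ^ 3) -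
       ((\<Sum>i\<in>I. [:a i * (a i + v 0 i * tau i), - a i * v 0 i:] * Qi i) - Polynomial.smult \<beta> Q)"
      unfolding KK_def by (rule arg_cong)
    moreover have "v \<beta> m0 = v 0 m0" using i0 by (simp add: v_def)
    ultimately show ?thesis unfolding KK_def by (simp only: diff_diff_eq2 diff_add_eq)
  qed
  have "finite {\<beta>. \<not> rsquarefree (KK (v 0) + Polynomial.smult \<beta> Q)}"
  proof (rule finite_nonsquarefree_pencil)
    show "poly Q t \<noteq> 0" if "poly (KK (v 0)) t = 0" for t
    proof
      assume "poly Q t = 0"
      then have "a i0 * (t - tau i0) = 0 \<or> (\<exists>j\<in>I-{i0}. t = tau j)"
        by (auto simp: Q_def poly_Qi algebra_simps)
      then obtain j where "j \<in> I" "t = tau j" using c_nz[of i0] i0 by auto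
      then show False using KK_tau[of j "v 0"] that by simp
    qed
    show "poly Q (tau i0) = 0" by (simp add: Q_def)
    have "poly (pderiv Q) (tau i0) = a i0 * poly (Qi i0) (tau i0)"
      unfolding Q_def pderiv_mult by (simp add: pderiv_pCons)
    moreover have "poly (Qi i0) (tau i0) \<noteq> 0"
      unfolding poly_Qi using inj_onD[OF tau_inj, of i0] i0 by (auto simp: prod_zero_iff)
    ultimately show "poly (pderiv Q) (tau i0) \<noteq> 0" using c_nz[of i0] i0 by simp
  qed
  then obtain \<beta> where "\<beta> \<notin> {\<beta>. \<not> rsquarefree (KK (v 0) + Polynomial.smult \<beta> Q)}"
    using ex_new_if_finite[OF infinite_UNIV_char_0[where 'a = complex]] by blast
  then have "rsquarefree (KK (v \<beta>))" unfolding eq[of \<beta>] by simp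
  then show ?thesis by blast
qed

theorem EDD_curve: "EDD_is V (3 * CARD('m) - 2)"
proof -
  let ?n = "3 * card I + 1"
  have n: "3 * CARD('m) - 2 = ?n"
  proof -
    have "CARD('m) = Suc (card I)" by (metis UNIV_I card_Suc_Diff1 finite)
    then show ?thesis by linarith
  qed
  define F where "F u = sylv ?n (?n - 1) (KK (\<lambda>i. sg i u)) (pderiv (KK (\<lambda>i. sg i u)))" for u
  have pf: "pfam (\<lambda>u. KK (\<lambda>i. sg i u))"
  proof -
    have "pfam (\<lambda>u. [:- sg m0 u, 1:] * (\<Prod>j\<in>I. [:- tau j, 1:] ^ 3) +
       (\<Sum>i\<in>I. [:- a i * (a i + sg i u * tau i), a i * sg i u:] * Qi i))"
      using sg_cpoly by (intro pfam_add pfam_mult pfam_sum pfam_const pfam_pCons cpoly_intros)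
    moreover have "[:- sg m0 u, 1:] * (\<Prod>j\<in>I. [:- tau j, 1:] ^ 3) +
       (\<Sum>i\<in>I. [:- a i * (a i + sg i u * tau i), a i * sg i u:] * Qi i) = KK (\<lambda>i. sg i u)" for u
      unfolding KK_def diff_conv_add_uminus sum_negf[symmetric] by simp
    ultimately show ?thesis by simp
  qed
  have F: "F \<in> cpoly" unfolding F_def[abs_def] by (rule cpoly_sylv[OF pf pfam_pderiv[OF pf]])
  have sq: "F u \<noteq> 0 \<longleftrightarrow> rsquarefree (KK (\<lambda>i. sg i u))" for u
  proof -
    let ?K = "KK (\<lambda>i. sg i u)"
    have d: "degree ?K = ?n" "degree (pderiv ?K) \<le> ?n - 1" by (simp_all add: degree_KK degree_pderiv)
    then have "?K \<noteq> 0" by auto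
    then have "F u = 0 \<longleftrightarrow> (\<exists>z. poly ?K z = 0 \<and> poly (pderiv ?K) z = 0)"
      unfolding F_def using sylv_eq_0_imp_common_root[OF _ d] sylv_common_root[of ?K ?n "pderiv ?K" "?n - 1"] d by force
    then show ?thesis unfolding rsquarefree_roots by blast
  qed
  have "\<exists>u. F u \<noteq> 0"
  proof -
    obtain v where v: "rsquarefree (KK v)" using ex_rsquarefree_KK by blast
    from emb_surj[of v] obtain u where "\<forall>i. sg i u = v i" by (rule exE)
    then have "(\<lambda>i. sg i u) = v" by auto
    then show ?thesis using sq[of u] v by auto
  qed
  with F have "proper_zariski_closed {u. F u = 0}" by (rule proper_zero_set)
  moreover have "finite (ed_critical_points V u) \<and> card (ed_critical_points V u) = ?n" if "u \<notin> {u. F u = 0}" for u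
  proof -
    let ?K = "KK (\<lambda>i. sg i u)"
    have rK: "rsquarefree ?K" using sq[of u] that by simp
    have KU: "{t. poly ?K t = 0} \<subseteq> U" using KK_tau by (auto simp: U_def)
    have eq: "ed_critical_points V u = (\<lambda>t. emb (cc t)) ` {t. poly ?K t = 0}"
    proof (intro equalityI subsetI)
      fix z assume "z \<in> ed_critical_points V u"
      then have z: "z \<in> V" "\<forall>v\<in>tangent_space V z. dir_deriv (sqdist_fun u) z v = 0"
        by (auto simp: ed_critical_points_def smooth_point_def)
      obtain t where t: "t \<in> U" "z = emb (cc t)" using V_cases[OF z(1)] by blast
      then have "poly ?K t = 0" using critical_W[OF t(1)] z(2) by simp
      then show "z \<in> (\<lambda>t. emb (cc t)) ` {t. poly ?K t = 0}" using t(2) by blast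
    next
      fix z assume "z \<in> (\<lambda>t. emb (cc t)) ` {t. poly ?K t = 0}"
      then obtain t where t: "poly ?K t = 0" "z = emb (cc t)" by auto
      then have "t \<in> U" using KU by auto
      then show "z \<in> ed_critical_points V u"
        using smooth_W critical_W t by (simp add: ed_critical_points_def)
    qed
    have "inj_on (\<lambda>t. emb (cc t)) {t. poly ?K t = 0}" using cc_inj by (blast intro: inj_onI)
    then have "card (ed_critical_points V u) = degree ?K"
      unfolding eq by (simp only: card_image rsquarefree_card_roots[OF rK])
    moreover have "finite {t. poly ?K t = 0}"
      using rK by (intro poly_roots_finite) (auto simp: rsquarefree_def)
    ultimately show ?thesis unfolding eq by (simp add: degree_KK)
  qed
  ultimately show ?thesis unfolding EDD_is_def n by blast
qed

end

section \<open>Generic camera arrangements\<close>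

text \<open>One nonzero polynomial instead of a proper closed set: conjunctions become products, and
  every condition can have its own witness.\<close>

definition generically :: "(complex^'n \<Rightarrow> bool) \<Rightarrow> bool" where
  "generically p \<longleftrightarrow> (\<exists>f\<in>cpoly. (\<exists>A. f A \<noteq> 0) \<and> (\<forall>A. f A \<noteq> 0 \<longrightarrow> p A))"

lemma generically_nonzero: "f \<in> cpoly \<Longrightarrow> f A \<noteq> 0 \<Longrightarrow> generically (\<lambda>A. f A \<noteq> 0)"
  unfolding generically_def by blast

lemma generically_conj:
  assumes "generically p" "generically q" shows "generically (\<lambda>A. p A \<and> q A)"
proof -
  obtain f g where f: "f \<in> cpoly" "\<exists>A. f A \<noteq> 0" "\<And>A. f A \<noteq> 0 \<Longrightarrow> p A"
    and g: "g \<in> cpoly" "\<exists>A. g A \<noteq> 0" "\<And>A. g A \<noteq> 0 \<Longrightarrow> q A"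
    using assms unfolding generically_def by blast
  then have "\<exists>A. f A * g A \<noteq> 0" using cpoly_mult_nonzero by blast
  moreover have "(\<lambda>A. f A * g A) \<in> cpoly" by (rule cpoly_mult[OF f(1) g(1)])
  ultimately show ?thesis
    unfolding generically_def using f(3) g(3) by (intro bexI[of _ "\<lambda>A. f A * g A"]) auto
qed

lemma generically_all:
  fixes p :: "'i \<Rightarrow> complex^'n \<Rightarrow> bool"
  assumes "finite J" "\<And>i. i \<in> J \<Longrightarrow> generically (p i)" shows "generically (\<lambda>A. \<forall>i\<in>J. p i A)"
  using assms
proof (induction J rule: finite_induct)
  case empty
  have "generically (\<lambda>A :: complex^'n. (1 :: complex) \<noteq> 0)"
    by (rule generically_nonzero) (auto intro: cpoly_const)
  then show ?case by simp
next
  case (insert i J)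
  then have "generically (\<lambda>A. p i A \<and> (\<forall>i\<in>J. p i A))" by (intro generically_conj) auto
  then show ?case by simp
qed

lemma generically_mono: "generically p \<Longrightarrow> (\<And>A. p A \<Longrightarrow> q A) \<Longrightarrow> generically q"
  unfolding generically_def by blast

lemma generically_proper:
  assumes "generically p"
  shows "\<exists>Z. proper_zariski_closed Z \<and> (\<forall>A. A \<notin> Z \<longrightarrow> p A)"
proof -
  obtain f where "f \<in> cpoly" "\<exists>A. f A \<noteq> 0" "\<And>A. f A \<noteq> 0 \<Longrightarrow> p A"
    using assms unfolding generically_def by blast
  then show ?thesis by (intro exI[of _ "{A. f A = 0}"]) (auto intro: proper_zero_set)
qed

section \<open>Pairing, dual vectors and entries of cameras\<close>

definition dot :: "complex^'n \<Rightarrow> complex^'n \<Rightarrow> complex" where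
  "dot u v = (\<Sum>c\<in>UNIV. u $ c * v $ c)"

lemma dot_scale: "dot u (c *s v) = c * dot u v"
  by (simp add: dot_def sum_distrib_left algebra_simps)

lemma dot_add_left: "dot (u + v) w = dot u w + dot v w"
  and dot_scale_left: "dot (c *s u) v = c * dot u v"
  by (simp_all add: dot_def sum.distrib sum_distrib_left algebra_simps)

lemma dot_axis: "dot (axis k c) v = c * v $ k"
proof -
  have "dot (axis k c) v = (\<Sum>j\<in>UNIV. if j = k then c * v $ k else 0)"
    unfolding dot_def by (rule sum.cong) (auto simp: axis_def)
  then show ?thesis by simp
qed

text \<open>Some 2 by 2 minor \<open>M\<close> of \<open>a\<close> and \<open>b\<close> is nonzero;
  the inverse of this block is written out on the coordinates \<open>k\<close> and \<open>l\<close>.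
  With \<open>f\<close> and \<open>g\<close> the rows of a camera can be given any values at
  \<open>a\<close> and \<open>b\<close>.\<close>

lemma dual_pair:
  fixes a b :: "complex^'n"
  assumes "vec.independent {a, b}" "a \<noteq> b"
  obtains f g where "dot f a = 1" "dot f b = 0" "dot g a = 0" "dot g b = 1"
proof -
  have a0: "a \<noteq> 0" using vec.dependent_zero[of "{a, b}"] assms(1) by auto
  then obtain k where k: "a $ k \<noteq> 0" by (auto simp: Finite_Cartesian_Product.vec_eq_iff)
  have "b \<noteq> (b $ k / a $ k) *s a"
  proof
    assume "b = (b $ k / a $ k) *s a"
    moreover have "(b $ k / a $ k) *s a \<in> vec.span {a}" by (intro vec.span_scale vec.span_base) simp
    ultimately have "b \<in> vec.span {a}" by simp
    then have "vec.dependent (insert b {a})"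
      using assms(2) unfolding vec.dependent_def by (intro bexI[of _ b]) (auto simp: insert_Diff_if)
    then show False using assms(1) by (simp add: insert_commute)
  qed
  then obtain l where l: "b $ l \<noteq> (b $ k / a $ k) * a $ l" by (auto simp: Finite_Cartesian_Product.vec_eq_iff)
  define M where "M = a $ k * b $ l - a $ l * b $ k"
  have M: "M \<noteq> 0" using l k by (simp add: M_def field_simps)
  show ?thesis
  proof (rule that)
    show "dot (axis k (b $ l / M) + axis l (- b $ k / M)) a = 1"
      using M by (simp add: dot_add_left dot_axis field_simps) (simp add: M_def algebra_simps)
    show "dot (axis k (b $ l / M) + axis l (- b $ k / M)) b = 0"
      by (simp add: dot_add_left dot_axis)
    show "dot (axis k (- a $ l / M) + axis l (a $ k / M)) a = 0"
      by (simp add: dot_add_left dot_axis)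
    show "dot (axis k (- a $ l / M) + axis l (a $ k / M)) b = 1"
      using M by (simp add: dot_add_left dot_axis field_simps) (simp add: M_def algebra_simps)
  qed
qed

definition ent :: "'m::finite \<Rightarrow> 3 \<Rightarrow> complex^4 \<Rightarrow> complex^('m \<times> 3 \<times> 4) \<Rightarrow> complex" where
  "ent i r v A = (\<Sum>c\<in>UNIV. A $ (i, r, c) * v $ c)"

lemma ent_arr_vec: "ent i r v (arr_vec C) = (C i *v v) $ r"
  by (simp add: ent_def arr_vec_def matrix_vector_mult_def)

lemma ent_cpoly: "(\<lambda>A. ent i r v A) \<in> cpoly"
  unfolding ent_def by (intro cpoly_intros)

lemma ent_dual: "ent i r v (\<chi> p. case p of (i, r, c) \<Rightarrow> W i r $ c) = dot (W i r) v"
  by (simp add: ent_def dot_def)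

definition em :: "2 \<Rightarrow> 3" where "em k = (if k = 1 then 1 else 2)"

lemma chart_em: "chart y $ (i, k) = y i $ em k / y i $ 3"
  by (simp add: chart_def em_def)

text \<open>\<open>De i\<close> is the direction of the image of the line in the chart of camera
  \<open>i\<close>, and the last hypothesis says that different cameras send different points of the
  line to infinity.\<close>

lemma EDD_line_images:
  fixes al be :: "'m::finite \<Rightarrow> complex^3" and m0 :: 'm
  defines "De \<equiv> \<lambda>i k. al i $ em k * be i $ 3 - al i $ 3 * be i $ em k"
  assumes two: "CARD('m) \<ge> 2" and b0: "be m0 $ 3 \<noteq> 0" and Q: "\<And>i. (\<Sum>k\<in>UNIV. De i k * De i k) \<noteq> 0"
    and w: "\<And>i j. i \<noteq> j \<Longrightarrow> al i $ 3 * be j $ 3 - al j $ 3 * be i $ 3 \<noteq> 0"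
  shows "EDD_is (zclosure {chart (\<lambda>i. p *s al i + q *s be i) | p q. \<forall>i. (p *s al i + q *s be i) $ 3 \<noteq> 0})
     (3 * CARD('m) - 2)"
proof -
  define N where "N i = csqrt (\<Sum>k\<in>UNIV. De i k * De i k)" for i
  have N2: "N i * N i = (\<Sum>k\<in>UNIV. De i k * De i k)" for i
    using power2_csqrt[of "\<Sum>k\<in>UNIV. De i k * De i k"] by (simp add: N_def power2_eq_square)
  have N: "N i \<noteq> 0" for i using Q[of i] by (simp add: N_def)
  define w3 where "w3 i = al i $ 3 * be m0 $ 3 - al m0 $ 3 * be i $ 3" for i
  have w3: "w3 i \<noteq> 0" if "i \<noteq> m0" for i using w[OF that] by (simp add: w3_def)
  \<comment> \<open>For camera \<open>m0\<close> the base point is the image of the second spanning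
    vector. For the others it is the image of the point that \<open>m0\<close> sends to infinity,
    because there \<open>t\<close> is infinite and \<open>a i / (t - tau i)\<close> tends to
    0.\<close>
  define P :: "'m \<Rightarrow> complex^2" where "P i = (\<chi> k. if i = m0 then be m0 $ em k / be m0 $ 3
    else (al i $ em k * be m0 $ 3 - al m0 $ 3 * be i $ em k) / w3 i)" for i
  define R :: "'m \<Rightarrow> complex^2" where "R i = (\<chi> k. De i k / N i)" for i
  define a where "a i = - N m0 * N i / w3 i ^ 2" for i
  \<comment> \<open>The value of \<open>t\<close> at the point that camera \<open>i\<close> sends to
    infinity.\<close>
  define tau where "tau i = - be i $ 3 * N m0 / (w3 i * be m0 $ 3)" for i
  interpret line_curve P R m0 a tau
  proof
    fix i
    have "(\<Sum>k\<in>UNIV. R i $ k * R i $ k) = (\<Sum>k\<in>UNIV. De i k * De i k) / (N i * N i)"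
      by (simp add: R_def sum_divide_distrib)
    then show "(\<Sum>k\<in>UNIV. R i $ k * R i $ k) = 1" using Q[of i] unfolding N2 by simp
    show "i \<noteq> m0 \<Longrightarrow> a i \<noteq> 0" using N w3 by (simp add: a_def)
  next
    show "inj_on tau (UNIV - {m0})"
    proof (rule inj_onI, rule ccontr)
      fix i j assume ij: "i \<in> UNIV - {m0}" "j \<in> UNIV - {m0}" "tau i = tau j" "i \<noteq> j"
      have "be i $ 3 * w3 j = be j $ 3 * w3 i"
        using ij(1-3) w3[of i] w3[of j] b0 N[of m0] by (simp add: tau_def field_simps)
      moreover have "be j $ 3 * w3 i - be i $ 3 * w3 j = be m0 $ 3 * (al i $ 3 * be j $ 3 - al j $ 3 * be i $ 3)"
        unfolding w3_def by (simp add: algebra_simps)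
      ultimately have "be m0 $ 3 * (al i $ 3 * be j $ 3 - al j $ 3 * be i $ 3) = 0" by simp
      then show False using w[OF ij(4)] b0 by (metis mult_eq_0_iff)
    qed
    show "UNIV - {m0} \<noteq> {}"
    proof
      assume "UNIV - {m0} = {}"
      then have "UNIV = {m0}" by auto
      then have "CARD('m) = card {m0}" by (rule arg_cong)
      then show False using two by simp
    qed
  qed
  define Y where "Y p q i = p *s al i + q *s be i" for p q i
  have key: "p * N m0 / (Y p q m0 $ 3 * be m0 $ 3) \<in> U \<and> chart (Y p q) = emb (cc (p * N m0 / (Y p q m0 $ 3 * be m0 $ 3)))"
    if D: "\<And>i. Y p q i $ 3 \<noteq> 0" for p q
  proof -
    define la where "la = Y p q m0 $ 3"
    define t where "t = p * N m0 / (la * be m0 $ 3)"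
    have la: "la \<noteq> 0" "la = p * al m0 $ 3 + q * be m0 $ 3" using D[of m0] by (auto simp: la_def Y_def)
    have tt: "t - tau i = N m0 * Y p q i $ 3 / (la * w3 i)" if "i \<noteq> m0" for i
    proof -
      have "t - tau i = N m0 * (p * w3 i + la * be i $ 3) / (la * be m0 $ 3 * w3 i)"
        using la(1) b0 w3[OF that] by (simp add: t_def tau_def field_simps)
      moreover have "p * w3 i + la * be i $ 3 = be m0 $ 3 * Y p q i $ 3"
        unfolding la(2) w3_def Y_def by (simp add: algebra_simps)
      ultimately show ?thesis using b0 by (simp add: mult.assoc)
    qed
    have tne: "t - tau i \<noteq> 0" if "i \<noteq> m0" for i
      unfolding tt[OF that] using N D la(1) w3[OF that] by simp
    then have "t \<in> U" by (auto simp: U_def)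
    moreover have "chart (Y p q) $ (i, k) = emb (cc t) $ (i, k)" for i k
    proof (cases "i = m0")
      case True
      have "Y p q m0 $ em k * be m0 $ 3 = be m0 $ em k * la + p * De m0 k"
        unfolding la(2) Y_def De_def by (simp add: algebra_simps)
      then have "Y p q m0 $ em k / la = be m0 $ em k / be m0 $ 3 + p / (la * be m0 $ 3) * De m0 k"
        using la(1) b0 by (simp add: field_simps)
      then show ?thesis using True N[of m0] by (simp add: chart_em emb_def P_def R_def cc_def t_def la_def)
    next
      case False
      have c: "a i / (t - tau i) = - N i * la / (w3 i * Y p q i $ 3)"
        unfolding tt[OF False] a_def using N[of m0] la(1) w3[OF False] D[of i]
        by (simp add: field_simps power2_eq_square)
      have wy: "w3 i * Y p q i $ em k = (al i $ em k * be m0 $ 3 - al m0 $ 3 * be i $ em k) * Y p q i $ 3 - la * De i k"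
        unfolding la(2) Y_def De_def w3_def by (simp add: algebra_simps)
      have "Y p q i $ em k / Y p q i $ 3 = (w3 i * Y p q i $ em k) / (w3 i * Y p q i $ 3)"
        using w3[OF False] by simp
      then have "Y p q i $ em k / Y p q i $ 3 = (al i $ em k * be m0 $ 3 - al m0 $ 3 * be i $ em k) / w3 i
          - la * De i k / (w3 i * Y p q i $ 3)"
        unfolding wy using D[of i] by (simp add: diff_divide_distrib)
      then show ?thesis using False N[of i]
        by (simp add: chart_em emb_def P_def R_def cc_def c)
    qed
    then have "chart (Y p q) = emb (cc t)" by (auto simp: Finite_Cartesian_Product.vec_eq_iff)
    ultimately show ?thesis by (simp add: t_def la_def)
  qed
  have "{chart (\<lambda>i. p *s al i + q *s be i) | p q. \<forall>i. (p *s al i + q *s be i) $ 3 \<noteq> 0} = W"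
  proof (intro equalityI subsetI)
    fix z assume "z \<in> {chart (\<lambda>i. p *s al i + q *s be i) | p q. \<forall>i. (p *s al i + q *s be i) $ 3 \<noteq> 0}"
    then obtain p q where "z = chart (Y p q)" "\<And>i. Y p q i $ 3 \<noteq> 0" unfolding Y_def[abs_def] by blast
    then show "z \<in> W" using key[of p q] emb_W by simp
  next
    fix z assume "z \<in> W"
    then obtain t where t: "t \<in> U" "z = emb (cc t)" by (auto simp: W_def)
    \<comment> \<open>The representative is normalised so that its third coordinate in camera
      \<open>m0\<close> is 1.\<close>
    define p where "p = t * be m0 $ 3 / N m0"
    define q where "q = (1 - p * al m0 $ 3) / be m0 $ 3"
    have q: "q * be m0 $ 3 = 1 - p * al m0 $ 3" using b0 by (simp add: q_def)
    then have 1: "Y p q m0 $ 3 = 1" by (simp add: Y_def)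
    have "Y p q i $ 3 \<noteq> 0" for i
    proof (cases "i = m0")
      case False
      have "be m0 $ 3 * Y p q i $ 3 = p * al i $ 3 * be m0 $ 3 + (q * be m0 $ 3) * be i $ 3"
        by (simp add: Y_def algebra_simps)
      also have "\<dots> = p * w3 i + be i $ 3" unfolding q w3_def by (simp add: algebra_simps)
      also have "\<dots> = w3 i * be m0 $ 3 / N m0 * (t - tau i)"
        using b0 N[of m0] w3[OF False] by (simp add: p_def tau_def field_simps)
      also have "\<dots> \<noteq> 0" using t(1) False b0 N[of m0] w3[OF False] by (auto simp: U_def)
      finally show ?thesis by simp
    qed (simp add: 1)
    note D = this
    have "p * N m0 / (Y p q m0 $ 3 * be m0 $ 3) = t" unfolding 1 using b0 N[of m0] by (simp add: p_def)
    then have "z = chart (Y p q)" using conjunct2[OF key[OF D]] t(2) by simp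
    then have "z = chart (\<lambda>i. p *s al i + q *s be i)" "\<forall>i. (p *s al i + q *s be i) $ 3 \<noteq> 0"
      using D unfolding Y_def[abs_def] by simp_all
    then show "z \<in> {chart (\<lambda>i. p *s al i + q *s be i) | p q. \<forall>i. (p *s al i + q *s be i) $ 3 \<noteq> 0}" by blast
  qed
  then show ?thesis using EDD_curve by (simp add: V_def)
qed

theorem generic_line_multiview:
  fixes a b :: "complex^4"
  assumes two: "CARD('m::finite) \<ge> 2" and ab: "vec.independent {a, b}" "a \<noteq> b"
  shows "generically (\<lambda>A. \<forall>C :: 'm \<Rightarrow> complex^4^3. arr_vec C = A \<longrightarrow>
    EDD_is (line_multiview_affine C a b) (3 * CARD('m) - 2))"
proof -
  obtain f g where fg: "dot f a = 1" "dot f b = 0" "dot g a = 0" "dot g b = 1"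
    using dual_pair[OF ab] by blast
  obtain m0 :: 'm where "m0 \<in> UNIV" by blast
  define De where "De i k A = ent i (em k) a A * ent i 3 b A - ent i 3 a A * ent i (em k) b A" for i :: 'm and k A
  have wit: "\<exists>A :: complex^('m \<times> 3 \<times> 4). \<forall>i r. ent i r a A = x i r \<and> ent i r b A = y i r" for x y
  proof -
    have "dot (x i r *s f + y i r *s g) a = x i r \<and> dot (x i r *s f + y i r *s g) b = y i r" for i r
      by (simp add: dot_add_left dot_scale_left fg)
    then show ?thesis
      by (intro exI[of _ "\<chi> p. case p of (i, r, c) \<Rightarrow> (x i r *s f + y i r *s g) $ c"])
        (simp only: ent_dual, simp)
  qed
  have 1: "generically (\<lambda>A. ent m0 3 b A \<noteq> 0)"
  proof -
    from wit[of "\<lambda>i r. 0" "\<lambda>i r. 1"] obtain A :: "complex^('m \<times> 3 \<times> 4)" where "\<forall>i r. ent i r a A = 0 \<and> ent i r b A = 1"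
      by (rule exE)
    then show ?thesis by (intro generically_nonzero[of _ A] ent_cpoly) simp
  qed
  have 2: "generically (\<lambda>A. \<forall>i\<in>UNIV. (\<Sum>k\<in>UNIV. De i k A * De i k A) \<noteq> 0)"
  proof (rule generically_all)
    fix i :: 'm
    from wit[of "\<lambda>i r. if r = 1 then 1 else 0" "\<lambda>i r. if r = 3 then 1 else 0"]
    obtain A :: "complex^('m \<times> 3 \<times> 4)"
      where "\<forall>i r. ent i r a A = (if r = 1 then 1 else 0) \<and> ent i r b A = (if r = 3 then 1 else 0)"
      by (rule exE)
    then have "(\<Sum>k\<in>UNIV. De i k A * De i k A) = 1" unfolding sum_2 De_def em_def by simp
    then show "generically (\<lambda>A. (\<Sum>k\<in>UNIV. De i k A * De i k A) \<noteq> 0)"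
      unfolding De_def by (intro generically_nonzero[of _ A]) (auto intro!: cpoly_intros ent_cpoly)
  qed simp
  have 3: "generically (\<lambda>A. \<forall>i\<in>(UNIV :: 'm set). \<forall>j\<in>UNIV - {i}. ent i 3 a A * ent j 3 b A - ent j 3 a A * ent i 3 b A \<noteq> 0)"
  proof (rule generically_all, simp, rule generically_all, simp)
    fix i j :: 'm assume j: "j \<in> UNIV - {i}"
    from wit[of "\<lambda>l r. if l = i then 1 else 0" "\<lambda>l r. if l = i then 0 else 1"]
    obtain A :: "complex^('m \<times> 3 \<times> 4)"
      where "\<forall>l r. ent l r a A = (if l = i then 1 else 0) \<and> ent l r b A = (if l = i then 0 else 1)"
      by (rule exE)
    then have "ent i 3 a A * ent j 3 b A - ent j 3 a A * ent i 3 b A = 1" using j by simp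
    then show "generically (\<lambda>A. ent i 3 a A * ent j 3 b A - ent j 3 a A * ent i 3 b A \<noteq> 0)"
      by (intro generically_nonzero[of _ A]) (auto intro!: cpoly_intros ent_cpoly)
  qed
  show ?thesis
  proof (rule generically_mono[OF generically_conj[OF 1 generically_conj[OF 2 3]]], intro allI impI)
    fix A and C :: "'m \<Rightarrow> complex^4^3"
    assume A: "ent m0 3 b A \<noteq> 0 \<and> (\<forall>i\<in>UNIV. (\<Sum>k\<in>UNIV. De i k A * De i k A) \<noteq> 0) \<and>
      (\<forall>i\<in>UNIV. \<forall>j\<in>UNIV - {i}. ent i 3 a A * ent j 3 b A - ent j 3 a A * ent i 3 b A \<noteq> 0)"
      and C: "arr_vec C = A"
    have "EDD_is (zclosure {chart (\<lambda>i. p *s (C i *v a) + q *s (C i *v b)) | p q.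
        \<forall>i. (p *s (C i *v a) + q *s (C i *v b)) $ 3 \<noteq> 0}) (3 * CARD('m) - 2)"
    proof (rule EDD_line_images[where ?m0.0 = m0, OF two])
      show "(C m0 *v b) $ 3 \<noteq> 0" using A unfolding C[symmetric] ent_arr_vec by blast
      show "(\<Sum>k\<in>UNIV. ((C i *v a) $ em k * (C i *v b) $ 3 - (C i *v a) $ 3 * (C i *v b) $ em k) *
          ((C i *v a) $ em k * (C i *v b) $ 3 - (C i *v a) $ 3 * (C i *v b) $ em k)) \<noteq> 0" for i
        using A unfolding C[symmetric] De_def ent_arr_vec by blast
      show "(C i *v a) $ 3 * (C j *v b) $ 3 - (C j *v a) $ 3 * (C i *v b) $ 3 \<noteq> 0" if "i \<noteq> j" for i j
        using A that unfolding C[symmetric] ent_arr_vec by blast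
    qed
    moreover have "{chart (\<lambda>i. p *s (C i *v a) + q *s (C i *v b)) | p q.
        \<forall>i. (p *s (C i *v a) + q *s (C i *v b)) $ 3 \<noteq> 0} =
      {chart (\<lambda>i. C i *v Y) | Y. Y \<in> vec.span {a, b} \<and> Y \<noteq> 0 \<and> (\<forall>i. (C i *v Y) $ 3 \<noteq> 0)}"
    proof -
      have lin: "C i *v (p *s a + q *s b) = p *s (C i *v a) + q *s (C i *v b)" for i p q
        by (simp add: matrix_vector_right_distrib vector_scalar_commute)
      have sp: "Y \<in> vec.span {a, b} \<longleftrightarrow> (\<exists>p q. Y = p *s a + q *s b)" for Y
        unfolding vec.span_breakdown_eq[of Y a] vec.span_singleton image_iff by (simp add: diff_eq_eq add.commute)
      have nz: "(\<forall>i. (C i *v Y) $ 3 \<noteq> 0) \<Longrightarrow> Y \<noteq> 0" for Y by auto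
      show ?thesis
      proof (intro equalityI subsetI)
        fix z assume "z \<in> {chart (\<lambda>i. p *s (C i *v a) + q *s (C i *v b)) | p q.
          \<forall>i. (p *s (C i *v a) + q *s (C i *v b)) $ 3 \<noteq> 0}"
        then obtain p q where "z = chart (\<lambda>i. C i *v (p *s a + q *s b))" "\<forall>i. (C i *v (p *s a + q *s b)) $ 3 \<noteq> 0"
          unfolding lin by blast
        then show "z \<in> {chart (\<lambda>i. C i *v Y) | Y. Y \<in> vec.span {a, b} \<and> Y \<noteq> 0 \<and> (\<forall>i. (C i *v Y) $ 3 \<noteq> 0)}"
          using sp nz by blast
      next
        fix z assume "z \<in> {chart (\<lambda>i. C i *v Y) | Y. Y \<in> vec.span {a, b} \<and> Y \<noteq> 0 \<and> (\<forall>i. (C i *v Y) $ 3 \<noteq> 0)}"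
        then obtain Y where Y: "z = chart (\<lambda>i. C i *v Y)" "Y \<in> vec.span {a, b}" "\<forall>i. (C i *v Y) $ 3 \<noteq> 0"
          by blast
        then obtain p q where "Y = p *s a + q *s b" using sp by blast
        with Y have "z = chart (\<lambda>i. C i *v (p *s a + q *s b))" "\<forall>i. (C i *v (p *s a + q *s b)) $ 3 \<noteq> 0"
          by auto
        then show "z \<in> {chart (\<lambda>i. p *s (C i *v a) + q *s (C i *v b)) | p q.
          \<forall>i. (p *s (C i *v a) + q *s (C i *v b)) $ 3 \<noteq> 0}" unfolding lin by blast
      qed
    qed
    ultimately show "EDD_is (line_multiview_affine C a b) (3 * CARD('m) - 2)"
      by (simp only: line_multiview_affine_def)
  qed
qed

text \<open>Values of the linear form \<open>v\<close> on the basis \<open>(d2, -d1, 0)\<close>, \<open>(-n2, n1, 0)\<close>, \<open>n \<times> d\<close>.\<close>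
definition fcv :: "complex^3 \<Rightarrow> complex^3 \<Rightarrow> complex^3 \<Rightarrow> complex^3" where
  "fcv n d v = vector [v $ 1 * d $ 2 - v $ 2 * d $ 1, v $ 2 * n $ 1 - v $ 1 * n $ 2,
     v $ 1 * (n $ 2 * d $ 3 - n $ 3 * d $ 2) + v $ 2 * (n $ 3 * d $ 1 - n $ 1 * d $ 3) +
     v $ 3 * (n $ 1 * d $ 2 - n $ 2 * d $ 1)]"

text \<open>The point with coordinates \<open>(s, 1, t)\<close> in the basis described above. On
  this basis \<open>n\<close> takes the values \<open>(k, 0, 0)\<close> and \<open>d\<close> the
  values \<open>(0, k, 0)\<close> with \<open>k = n $ 1 * d $ 2 - n $ 2 * d $ 1\<close>. So
  \<open>s\<close> is the quotient \<open>dot n y / dot d y\<close>, the image coordinate of the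
  distinguished camera.\<close>

definition fpt :: "complex^3 \<Rightarrow> complex^3 \<Rightarrow> complex \<Rightarrow> complex \<Rightarrow> complex^3" where
  "fpt n d s t = vector [s * d $ 2 - n $ 2 + t * (n $ 2 * d $ 3 - n $ 3 * d $ 2),
     n $ 1 - s * d $ 1 + t * (n $ 3 * d $ 1 - n $ 1 * d $ 3), t * (n $ 1 * d $ 2 - n $ 2 * d $ 1)]"

lemma dot_3: "dot u v = u $ 1 * v $ 1 + u $ 2 * v $ 2 + u $ 3 * v $ 3" for u v :: "complex^3"
  by (simp add: dot_def sum_3)

lemma dot_fpt: "dot v (fpt n d s t) = s * fcv n d v $ 1 + fcv n d v $ 2 + t * fcv n d v $ 3"
  by (simp add: dot_3 fpt_def fcv_def algebra_simps)

lemma fpt_surj: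
  assumes k: "n $ 1 * d $ 2 - n $ 2 * d $ 1 \<noteq> 0" and y: "dot d y \<noteq> 0"
  obtains c s t where "c \<noteq> 0" "y = c *s fpt n d s t"
proof -
  define k where "k = n $ 1 * d $ 2 - n $ 2 * d $ 1"
  have k0: "k \<noteq> 0" using k by (simp add: k_def)
  define c where "c = dot d y / k"
  define s where "s = dot n y / dot d y"
  define t where "t = y $ 3 / (c * k)"
  have c: "c \<noteq> 0" using y k0 by (simp add: c_def)
  have ck: "c * k = dot d y" and cs: "c * s * k = dot n y" and ct: "c * t * k = y $ 3"
    using y k0 c by (simp_all add: c_def s_def t_def)
  have "k * (y $ 1) = k * ((c *s fpt n d s t) $ 1)"
  proof -
    have "k * ((c *s fpt n d s t) $ 1) = (c * s * k) * d $ 2 - (c * k) * n $ 2 + (c * t * k) * (n $ 2 * d $ 3 - n $ 3 * d $ 2)"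
      by (simp add: fpt_def algebra_simps)
    also have "\<dots> = k * (y $ 1)" unfolding cs ck ct by (simp add: dot_3 k_def algebra_simps)
    finally show ?thesis by (rule sym)
  qed
  moreover have "k * (y $ 2) = k * ((c *s fpt n d s t) $ 2)"
  proof -
    have "k * ((c *s fpt n d s t) $ 2) = (c * k) * n $ 1 - (c * s * k) * d $ 1 + (c * t * k) * (n $ 3 * d $ 1 - n $ 1 * d $ 3)"
      by (simp add: fpt_def algebra_simps)
    also have "\<dots> = k * (y $ 2)" unfolding cs ck ct by (simp add: dot_3 k_def algebra_simps)
    finally show ?thesis by (rule sym)
  qed
  moreover have "y $ 3 = (c *s fpt n d s t) $ 3"
    using ct by (simp add: fpt_def k_def mult.assoc)
  ultimately have "y = c *s fpt n d s t"
    unfolding Finite_Cartesian_Product.vec_eq_iff forall_3 using k0 by simp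
  with c show ?thesis by (rule that)
qed

section \<open>Minors of linear forms and the image line in the chart\<close>

definition e1 :: "complex^3 \<Rightarrow> complex^3 \<Rightarrow> complex" where
  "e1 u v = u $ 1 * v $ 3 - u $ 3 * v $ 1"

text \<open>If \<open>u\<close> and \<open>v\<close> are the numerator and denominator forms of a
  camera in the coordinates \<open>(s, 1, t)\<close>, eliminating \<open>t\<close> leaves
  \<open>e1 u v * s + e2 u v\<close>. Its zero, rescaled by \<open>h m0\<close>, is the coordinate
  \<open>xx\<close> of the camera centre.\<close>

definition e2 :: "complex^3 \<Rightarrow> complex^3 \<Rightarrow> complex" where
  "e2 u v = u $ 2 * v $ 3 - u $ 3 * v $ 2"

definition det3 :: "complex^3 \<Rightarrow> complex^3 \<Rightarrow> complex^3 \<Rightarrow> complex" where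
  "det3 u v w = u $ 1 * (v $ 2 * w $ 3 - v $ 3 * w $ 2) - u $ 2 * (v $ 1 * w $ 3 - v $ 3 * w $ 1) +
     u $ 3 * (v $ 1 * w $ 2 - v $ 2 * w $ 1)"

text \<open>\<open>(s, 1, t)\<close> is a nonzero kernel vector; the identity is Cramer's rule for
  its middle entry.\<close>

lemma det3_zero:
  assumes "s * u $ 1 + u $ 2 + t * u $ 3 = 0" "s * v $ 1 + v $ 2 + t * v $ 3 = 0" "s * w $ 1 + w $ 2 + t * w $ 3 = 0"
  shows "det3 u v w = 0"
proof -
  have "det3 u v w = (v $ 3 * w $ 1 - v $ 1 * w $ 3) * (s * u $ 1 + u $ 2 + t * u $ 3)
    + (u $ 1 * w $ 3 - u $ 3 * w $ 1) * (s * v $ 1 + v $ 2 + t * v $ 3)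
    + (u $ 3 * v $ 1 - u $ 1 * v $ 3) * (s * w $ 1 + w $ 2 + t * w $ 3)"
    by (simp add: det3_def algebra_simps)
  then show ?thesis unfolding assms by simp
qed

definition dirv :: "complex \<Rightarrow> 2 \<Rightarrow> complex" where
  "dirv r k = (if k = 1 then 1 else r)"

text \<open>All image lines of camera \<open>i\<close> pass through the image of the given point, so
  as points of the dual plane they lie on one line, here the affine line through
  \<open>(0, e i)\<close> in direction \<open>(1, r i)\<close>. The quotient of the two forms is the
  first chart coordinate.\<close>

definition ptv :: "('m::finite \<Rightarrow> complex^3) \<Rightarrow> ('m \<Rightarrow> complex^3) \<Rightarrow> ('m \<Rightarrow> complex) \<Rightarrow> ('m \<Rightarrow> complex) \<Rightarrow> complex^3 \<Rightarrow> complex^('m \<times> 2)" where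
  "ptv n d r e y = (\<chi> p. (if snd p = 1 then 0 else e (fst p)) +
     dot (n (fst p)) y / dot (d (fst p)) y * dirv (r (fst p)) (snd p))"

lemma ptv_ratio: "dot (n i) y / dot (d i) y = q \<Longrightarrow>
    ptv n d r e y $ (i, k) = (if k = 1 then 0 else e i) + q * dirv (r i) k"
  by (auto simp: ptv_def)

lemma ptv_scale: "c \<noteq> 0 \<Longrightarrow> ptv n d r e (c *s y) = ptv n d r e y"
  by (simp add: ptv_def dot_scale)

text \<open>In the frame of camera \<open>m0\<close> the hypotheses are the axioms of
  \<open>plane_system\<close> in homogeneous form: \<open>mu3\<close> makes the pole lines graphs
  over \<open>x\<close>, and \<open>mu1\<close>, \<open>e1\<close>, \<open>xd\<close>,
  \<open>ald\<close>, \<open>eo\<close>, \<open>d3\<close> correspond to \<open>al_nz\<close>,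
  \<open>a_nz\<close>, \<open>xx_inj\<close>, \<open>al_inj\<close>, \<open>e_off\<close>,
  \<open>no3\<close>. The condition on \<open>r\<close> excludes isotropic directions, which cannot
  be normalised to length 1.\<close>

lemma EDD_point_images:
  fixes n d :: "'m::finite \<Rightarrow> complex^3" and r e :: "'m \<Rightarrow> complex" and m0 :: 'm
  defines "nu \<equiv> \<lambda>i. fcv (n m0) (d m0) (n i)" and "mu \<equiv> \<lambda>i. fcv (n m0) (d m0) (d i)"
  assumes three: "CARD('m) \<ge> 3" and kap: "n m0 $ 1 * d m0 $ 2 - n m0 $ 2 * d m0 $ 1 \<noteq> 0"
    and r: "\<And>i. 1 + r i * r i \<noteq> 0"
    and mu3: "\<And>i. i \<noteq> m0 \<Longrightarrow> mu i $ 3 \<noteq> 0" and mu1: "\<And>i. i \<noteq> m0 \<Longrightarrow> mu i $ 1 \<noteq> 0"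
    and e1: "\<And>i. i \<noteq> m0 \<Longrightarrow> e1 (nu i) (mu i) \<noteq> 0"
    and xd: "\<And>i j. i \<noteq> m0 \<Longrightarrow> j \<noteq> m0 \<Longrightarrow> i \<noteq> j \<Longrightarrow>
      e2 (nu i) (mu i) * e1 (nu j) (mu j) - e2 (nu j) (mu j) * e1 (nu i) (mu i) \<noteq> 0"
    and ald: "\<And>i j. i \<noteq> m0 \<Longrightarrow> j \<noteq> m0 \<Longrightarrow> i \<noteq> j \<Longrightarrow> mu i $ 1 * mu j $ 3 - mu j $ 1 * mu i $ 3 \<noteq> 0"
    and eo: "\<And>i j. i \<noteq> m0 \<Longrightarrow> j \<noteq> m0 \<Longrightarrow> i \<noteq> j \<Longrightarrow>
      (mu j $ 2 * e1 (nu j) (mu j) - mu j $ 1 * e2 (nu j) (mu j)) * mu i $ 3 -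
      (mu i $ 2 * e1 (nu j) (mu j) - mu i $ 1 * e2 (nu j) (mu j)) * mu j $ 3 \<noteq> 0"
    and d3: "\<And>i j l. i \<noteq> m0 \<Longrightarrow> j \<noteq> m0 \<Longrightarrow> l \<noteq> m0 \<Longrightarrow> i \<noteq> j \<Longrightarrow> i \<noteq> l \<Longrightarrow> j \<noteq> l \<Longrightarrow> det3 (mu i) (mu j) (mu l) \<noteq> 0"
  shows "\<exists>N. EDD_is (zclosure {ptv n d r e y | y. \<forall>i. dot (d i) y \<noteq> 0}) N \<and>
    real N = 9/2 * real (CARD('m))^2 - 19/2 * real (CARD('m)) + 3"
proof -
  define h where "h i = csqrt (1 + r i * r i)" for i
  have h2: "h i * h i = 1 + r i * r i" for i
    using power2_csqrt[of "1 + r i * r i"] by (simp add: h_def power2_eq_square)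
  have h: "h i \<noteq> 0" for i using r[of i] by (simp add: h_def)
  define E1 where "E1 i = e1 (nu i) (mu i)" for i
  define E2 where "E2 i = e2 (nu i) (mu i)" for i
  have E1: "E1 i \<noteq> 0" if "i \<noteq> m0" for i using e1[OF that] by (simp add: E1_def)
  define P :: "'m \<Rightarrow> complex^2" where "P i = (\<chi> k. (if k = 1 then 0 else e i) +
    (if i = m0 then 0 else nu i $ 3 / mu i $ 3) * dirv (r i) k)" for i
  define R :: "'m \<Rightarrow> complex^2" where "R i = (\<chi> k. dirv (r i) k / h i)" for i
  define a where "a i = h i * E1 i / (mu i $ 3 ^ 2 * h m0)" for i
  define al where "al i = - mu i $ 1 / (mu i $ 3 * h m0)" for i
  define xx where "xx i = - h m0 * E2 i / E1 i" for i
  define tt where "tt i = (mu i $ 1 * E2 i / E1 i - mu i $ 2) / mu i $ 3" for i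
  \<comment> \<open>The pole line of camera \<open>i\<close> is the zero line of its denominator
    form, divided by \<open>mu i $ 3\<close>.\<close>
  have dda: "t - tt i - al i * (x - xx i) = (x / h m0 * mu i $ 1 + mu i $ 2 + t * mu i $ 3) / mu i $ 3"
    if "i \<noteq> m0" for i x t
    using mu3[OF that] E1[OF that] h[of m0] by (simp add: tt_def al_def xx_def field_simps)
  interpret line_surface P R m0 a al xx tt
  proof
    fix i
    have "(\<Sum>k\<in>UNIV. R i $ k * R i $ k) = (1 + r i * r i) / (h i * h i)"
      unfolding sum_2 by (simp add: R_def dirv_def add_divide_distrib)
    then show "(\<Sum>k\<in>UNIV. R i $ k * R i $ k) = 1" using r[of i] unfolding h2 by simp
  next
    show "finite (UNIV - {m0})" by simp
    show "2 \<le> card (UNIV - {m0})" using three by (simp add: card_Diff_singleton)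
  next
    fix i assume i: "i \<in> UNIV - {m0}"
    then show "a i \<noteq> 0" "al i \<noteq> 0" using h mu1 mu3 E1 by (simp_all add: a_def al_def)
    fix j assume j: "j \<in> UNIV - {m0}" and ij: "i \<noteq> j"
    have "tt j - tt i - al i * (xx j - xx i) = (xx j / h m0 * mu i $ 1 + mu i $ 2 + tt j * mu i $ 3) / mu i $ 3"
      using dda[of i] i by simp
    also have "xx j / h m0 = - E2 j / E1 j" using h[of m0] by (simp add: xx_def)
    also have "(- E2 j / E1 j * mu i $ 1 + mu i $ 2 + tt j * mu i $ 3) / mu i $ 3 =
      - ((mu j $ 2 * E1 j - mu j $ 1 * E2 j) * mu i $ 3 - (mu i $ 2 * E1 j - mu i $ 1 * E2 j) * mu j $ 3) / (E1 j * mu j $ 3 * mu i $ 3)"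
      using E1[of j] mu3[of j] mu3[of i] i j by (simp add: tt_def field_simps)
    finally show "tt j - tt i - al i * (xx j - xx i) \<noteq> 0"
      using eo[of i j] i j ij mu3[of i] mu3[of j] E1[of j] unfolding E1_def[symmetric] E2_def[symmetric] by simp
  next
    show "inj_on al (UNIV - {m0})"
    proof (rule inj_onI, rule ccontr)
      fix i j assume ij: "i \<in> UNIV - {m0}" "j \<in> UNIV - {m0}" "al i = al j" "i \<noteq> j"
      then have "mu i $ 1 * mu j $ 3 - mu j $ 1 * mu i $ 3 = 0"
        using mu3[of i] mu3[of j] h[of m0] by (simp add: al_def field_simps)
      then show False using ald[of i j] ij by simp
    qed
    show "inj_on xx (UNIV - {m0})"
    proof (rule inj_onI, rule ccontr)
      fix i j assume ij: "i \<in> UNIV - {m0}" "j \<in> UNIV - {m0}" "xx i = xx j" "i \<noteq> j"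
      then have "E2 i * E1 j - E2 j * E1 i = 0"
        using E1[of i] E1[of j] h[of m0] by (simp add: xx_def field_simps)
      then show False using xd[of i j] ij by (simp add: E1_def E2_def)
    qed
  next
    fix i j l x t
    assume ne: "i \<in> UNIV - {m0}" "j \<in> UNIV - {m0}" "l \<in> UNIV - {m0}" "i \<noteq> j" "i \<noteq> l" "j \<noteq> l"
      and z: "t - tt i - al i * (x - xx i) = 0" "t - tt j - al j * (x - xx j) = 0"
    show "t - tt l - al l * (x - xx l) \<noteq> 0"
    proof
      assume z3: "t - tt l - al l * (x - xx l) = 0"
      have l0: "x / h m0 * mu i $ 1 + mu i $ 2 + t * mu i $ 3 = 0"
        if "i \<in> UNIV - {m0}" "t - tt i - al i * (x - xx i) = 0" for i
      proof -
        have im: "i \<noteq> m0" using that(1) by simp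
        have "(x / h m0 * mu i $ 1 + mu i $ 2 + t * mu i $ 3) / mu i $ 3 = 0"
          by (rule trans[OF dda[OF im, symmetric] that(2)])
        then show ?thesis using mu3[OF im] by (simp only: divide_eq_0_iff simp_thms)
      qed
      have "det3 (mu i) (mu j) (mu l) = 0"
        by (rule det3_zero[OF l0[OF ne(1) z(1)] l0[OF ne(2) z(2)] l0[OF ne(3) z3]])
      then show False using d3 ne by auto
    qed
  qed
  define Y where "Y x t = fpt (n m0) (d m0) (x / h m0) t" for x t
  have Yn: "dot (n i) (Y x t) = x / h m0 * nu i $ 1 + nu i $ 2 + t * nu i $ 3"
    and Yd: "dot (d i) (Y x t) = x / h m0 * mu i $ 1 + mu i $ 2 + t * mu i $ 3" for i x t
    by (simp_all add: Y_def dot_fpt nu_def mu_def)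
  define k where "k = n m0 $ 1 * d m0 $ 2 - n m0 $ 2 * d m0 $ 1"
  have k: "k \<noteq> 0" using kap by (simp add: k_def)
  have m: "nu m0 $ 1 = k" "nu m0 $ 2 = 0" "nu m0 $ 3 = 0" "mu m0 $ 1 = 0" "mu m0 $ 2 = k" "mu m0 $ 3 = 0"
    by (simp_all add: nu_def mu_def fcv_def k_def algebra_simps)
  have Ydd: "dot (d i) (Y x t) = mu i $ 3 * dd i x t" if "i \<noteq> m0" for i x t
    unfolding Yd dd_def dda[OF that] using mu3[OF that] by simp
  have YU: "(\<forall>i. dot (d i) (Y x t) \<noteq> 0) \<longleftrightarrow> (x, t) \<in> U" for x t
  proof -
    have m0: "dot (d m0) (Y x t) \<noteq> 0" unfolding Yd m using k by simp
    have "dot (d i) (Y x t) \<noteq> 0 \<longleftrightarrow> dd i x t \<noteq> 0" if "i \<noteq> m0" for i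
      unfolding Ydd[OF that] using mu3[OF that] by simp
    then have "(\<forall>i. dot (d i) (Y x t) \<noteq> 0) \<longleftrightarrow> (\<forall>i. i \<noteq> m0 \<longrightarrow> dd i x t \<noteq> 0)" using m0 by metis
    then show ?thesis unfolding U_def by auto
  qed
  have key: "ptv n d r e (Y x t) = emb (sc x t)" if U: "(x, t) \<in> U" for x t
  proof -
    have "ptv n d r e (Y x t) $ (i, c) = emb (sc x t) $ (i, c)" for i c
    proof (cases "i = m0")
      case True
      have "dot (n m0) (Y x t) / dot (d m0) (Y x t) = x / h m0" unfolding Yn Yd m using k by simp
      then show ?thesis using True by (simp add: ptv_ratio emb_def P_def R_def sc_def)
    next
      case False
      have dn: "dd i x t \<noteq> 0" using U False by (simp add: U_def)
      \<comment> \<open>Division of the numerator form by the denominator form with respect to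
        \<open>t\<close>: the quotient goes into the base point \<open>P i\<close>, and the
        remainder is free of \<open>t\<close>.\<close>
      have "mu i $ 3 * dot (n i) (Y x t) = nu i $ 3 * dot (d i) (Y x t) + (E1 i * (x / h m0) + E2 i)"
        unfolding Yn Yd E1_def E2_def e1_def e2_def by (simp add: algebra_simps)
      also have "E1 i * (x / h m0) + E2 i = E1 i * (x - xx i) / h m0"
        using E1[OF False] h[of m0] by (simp add: xx_def field_simps)
      finally have f: "mu i $ 3 * dot (n i) (Y x t) = nu i $ 3 * dot (d i) (Y x t) + E1 i * (x - xx i) / h m0" .
      have "dot (n i) (Y x t) / dot (d i) (Y x t) = (mu i $ 3 * dot (n i) (Y x t)) / (mu i $ 3 * dot (d i) (Y x t))"
        using mu3[OF False] by simp
      also have "\<dots> = nu i $ 3 / mu i $ 3 + E1 i * (x - xx i) / (mu i $ 3 ^ 2 * h m0 * dd i x t)"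
        unfolding f unfolding Ydd[OF False] using dn mu3[OF False] h[of m0] by (simp add: add_divide_distrib power2_eq_square mult_ac)
      finally have "dot (n i) (Y x t) / dot (d i) (Y x t) = nu i $ 3 / mu i $ 3 + sc x t i / h i"
        using False h[of i] by (simp add: sc_def a_def)
      then show ?thesis using False by (simp add: ptv_ratio emb_def P_def R_def algebra_simps)
    qed
    then show ?thesis by (auto simp: Finite_Cartesian_Product.vec_eq_iff)
  qed
  have "{ptv n d r e y | y. \<forall>i. dot (d i) y \<noteq> 0} = S"
  proof (intro equalityI subsetI)
    fix z assume "z \<in> {ptv n d r e y | y. \<forall>i. dot (d i) y \<noteq> 0}"
    then obtain y where y: "z = ptv n d r e y" "\<forall>i. dot (d i) y \<noteq> 0" by blast
    obtain c s t where c: "c \<noteq> 0" "y = c *s fpt (n m0) (d m0) s t"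
      using fpt_surj[OF kap, of y] y(2) by blast
    have Ys: "fpt (n m0) (d m0) s t = Y (h m0 * s) t" using h[of m0] by (simp add: Y_def)
    have "(h m0 * s, t) \<in> U" using y(2) unfolding YU[symmetric] c(2) Ys by (simp add: dot_scale)
    then show "z \<in> S" unfolding y(1) c(2) Ys ptv_scale[OF c(1)] using key emb_S by simp
  next
    fix z assume "z \<in> S"
    then obtain x t where "(x, t) \<in> U" "z = emb (sc x t)" by (auto simp: S_def)
    then show "z \<in> {ptv n d r e y | y. \<forall>i. dot (d i) y \<noteq> 0}"
      using key[of x t] YU[of x t] by (intro CollectI exI[of _ "Y x t"]) simp
  qed
  then have "EDD_is (zclosure {ptv n d r e y | y. \<forall>i. dot (d i) y \<noteq> 0}) NN"
    using EDD_surface by (simp add: V_def)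
  moreover have "real NN = 9/2 * real (CARD('m))^2 - 19/2 * real (CARD('m)) + 3"
  proof -
    define K where "K = card (UNIV - {m0})"
    have K: "CARD('m) = Suc K" unfolding K_def by (metis UNIV_I card_Suc_Diff1 finite)
    have K2: "K \<ge> 2" using three K by simp
    have "even (K * (K - 1))" using K2 by auto
    then have "2 * (K choose 2) = K * (K - 1)" unfolding choose_two by (rule dvd_mult_div_cancel)
    then have "real (2 * (K choose 2)) = real (K * (K - 1))" by (rule arg_cong)
    then have c: "real (K choose 2) = real K * (real K - 1) / 2" using K2 by (simp add: of_nat_diff)
    have "real NN = 9 * real (K choose 2) + 4 * real K - 2"
      using K2 by (simp add: NN_def K_def[symmetric])
    then show ?thesis unfolding c K by (simp add: field_simps power2_eq_square)
  qed
  ultimately show ?thesis by blast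
qed

section \<open>Cameras as linear forms on the lines through a point\<close>

lemma dual_basis4:
  fixes x :: "complex^4"
  assumes "x \<noteq> 0"
  obtains f0 :: "complex^4" and B :: "3 \<Rightarrow> complex^4" and f :: "3 \<Rightarrow> complex^4"
  where "dot f0 x = 1" "\<forall>k. dot f0 (B k) = 0" "\<forall>k. dot (f k) x = 0"
    "\<forall>k l. dot (f k) (B l) = (if k = l then 1 else 0)"
    "\<forall>w. w = dot f0 w *s x + (\<Sum>k\<in>UNIV. dot (f k) w *s B k)"
proof -
  \<comment> \<open>\<open>x\<close> and the three standard vectors with index other than
    \<open>q\<close> form a basis; \<open>f0\<close> and \<open>f\<close> are its dual
    basis.\<close>
  obtain q where q: "x $ q \<noteq> 0" using assms by (auto simp: Finite_Cartesian_Product.vec_eq_iff)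
  have "card (UNIV :: 3 set) = card (UNIV - {q})" by (simp add: card_Diff_singleton)
  then obtain g where g: "bij_betw g (UNIV :: 3 set) (UNIV - {q})"
    using finite_same_card_bij[of "UNIV :: 3 set" "UNIV - {q}"] by auto
  have gq: "g k \<noteq> q" "q \<noteq> g k" for k using bij_betwE[OF g] by auto
  have gi: "g k = g l \<longleftrightarrow> k = l" for k l using bij_betw_imp_inj_on[OF g] by (auto simp: inj_on_def)
  have ax: "axis k 1 $ l = (if l = k then 1 else (0 :: complex))" for k l :: 4 by (simp add: axis_def)
  show ?thesis
  proof (rule that[of "axis q (1 / x $ q)" "\<lambda>k. axis (g k) 1" "\<lambda>k. axis (g k) 1 + axis q (- x $ g k / x $ q)"])
    show "dot (axis q (1 / x $ q)) x = 1" using q by (simp add: dot_axis)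
    show "\<forall>k. dot (axis q (1 / x $ q)) (axis (g k) 1) = 0" by (simp add: dot_axis ax gq)
    show "\<forall>k. dot (axis (g k) 1 + axis q (- x $ g k / x $ q)) x = 0"
      using q by (simp add: dot_axis dot_add_left)
    show "\<forall>k l. dot (axis (g k) 1 + axis q (- x $ g k / x $ q)) (axis (g l) 1) = (if k = l then 1 else 0)"
      by (simp add: dot_axis dot_add_left ax gq gi)
    show "\<forall>w. w = dot (axis q (1 / x $ q)) w *s x +
      (\<Sum>k\<in>UNIV. dot (axis (g k) 1 + axis q (- x $ g k / x $ q)) w *s axis (g k) 1)"
    proof
      fix w
      have "w $ c = (w $ q / x $ q) * x $ c + (\<Sum>k\<in>UNIV. (w $ g k - x $ g k / x $ q * w $ q) * axis (g k) 1 $ c)" for c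
      proof (cases "c = q")
        case True
        then show ?thesis using q by (simp add: ax gq)
      next
        case False
        then obtain l where l: "c = g l" using bij_betw_imp_surj_on[OF g] by auto
        have "(\<Sum>k\<in>UNIV. (w $ g k - x $ g k / x $ q * w $ q) * axis (g k) 1 $ c) =
          (\<Sum>k\<in>UNIV. if k = l then w $ c - x $ c / x $ q * w $ q else 0)"
          by (rule sum.cong) (auto simp: l ax gi)
        then show ?thesis by (simp add: sum.delta)
      qed
      note w = this
      have "(dot (axis q (1 / x $ q)) w *s x + (\<Sum>k\<in>UNIV. dot (axis (g k) 1 + axis q (- x $ g k / x $ q)) w *s axis (g k) 1)) $ c =
        (w $ q / x $ q) * x $ c + (\<Sum>k\<in>UNIV. (w $ g k - x $ g k / x $ q * w $ q) * axis (g k) 1 $ c)" for c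
        by (simp add: sum_component dot_axis dot_add_left left_diff_distrib)
      from trans[OF w this[symmetric]]
      show "w = dot (axis q (1 / x $ q)) w *s x +
        (\<Sum>k\<in>UNIV. dot (axis (g k) 1 + axis q (- x $ g k / x $ q)) w *s axis (g k) 1)"
        unfolding Finite_Cartesian_Product.vec_eq_iff by (rule allI)
    qed
  qed
qed

text \<open>\<open>nn\<close> and \<open>dn\<close> are the first and the third component of the
  cross product of \<open>C i *v x\<close> and \<open>C i *v w\<close>, as linear forms in the
  coordinates of \<open>w\<close> modulo \<open>x\<close>: numerator and denominator of the first
  chart coordinate.\<close>

definition nn :: "complex^4 \<Rightarrow> (3 \<Rightarrow> complex^4) \<Rightarrow> 'm::finite \<Rightarrow> complex^('m \<times> 3 \<times> 4) \<Rightarrow> complex^3" where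
  "nn x B i A = (\<chi> k. ent i 2 x A * ent i 3 (B k) A - ent i 3 x A * ent i 2 (B k) A)"

definition dn :: "complex^4 \<Rightarrow> (3 \<Rightarrow> complex^4) \<Rightarrow> 'm::finite \<Rightarrow> complex^('m \<times> 3 \<times> 4) \<Rightarrow> complex^3" where
  "dn x B i A = (\<chi> k. ent i 1 x A * ent i 2 (B k) A - ent i 2 x A * ent i 1 (B k) A)"

lemma nn_cpoly: "(\<lambda>A. nn x B i A $ k) \<in> cpoly" and dn_cpoly: "(\<lambda>A. dn x B i A $ k) \<in> cpoly"
  unfolding nn_def dn_def by (auto intro!: cpoly_intros ent_cpoly)

lemma fcv_cpoly:
  assumes "\<And>k. (\<lambda>A. n A $ k) \<in> cpoly" "\<And>k. (\<lambda>A. d A $ k) \<in> cpoly" "\<And>k. (\<lambda>A. v A $ k) \<in> cpoly"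
  shows "(\<lambda>A. fcv (n A) (d A) (v A) $ k) \<in> cpoly"
proof -
  consider "k = 1" | "k = 2" | "k = 3" using exhaust_3[of k] by blast
  then show ?thesis by cases (auto simp: fcv_def intro!: cpoly_intros assms)
qed

lemma ccross_component:
  shows "ccross u v $ 1 = u $ 2 * v $ 3 - u $ 3 * v $ 2" "ccross u v $ 2 = u $ 3 * v $ 1 - u $ 1 * v $ 3"
    "ccross u v $ 3 = u $ 1 * v $ 2 - u $ 2 * v $ 1"
  by (simp_all add: ccross_def)

text \<open>Adding a multiple of \<open>x\<close> to \<open>w\<close> does not change the cross
  product, so only \<open>y\<close> matters. The second component needs no form of its own: the
  cross product is orthogonal to \<open>C i *v x\<close>, and solving for it produces the slope and
  the intercept passed to \<open>ptv\<close>.\<close>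

lemma point_images:
  fixes C :: "'m::finite \<Rightarrow> complex^4^3" and x :: "complex^4" and B :: "3 \<Rightarrow> complex^4"
  assumes x: "x \<noteq> 0" and exp: "\<And>w. \<exists>c y. w = c *s x + (\<Sum>k\<in>UNIV. y $ k *s B k)"
    and p2: "\<And>i. (C i *v x) $ 2 \<noteq> 0"
  defines "A \<equiv> arr_vec C"
  shows "{chart (\<lambda>i. ccross (C i *v x) (C i *v w)) | w. vec.independent {x, w} \<and> x \<noteq> w \<and>
        (\<forall>i. ccross (C i *v x) (C i *v w) $ 3 \<noteq> 0)} =
    {ptv (\<lambda>i. nn x B i A) (\<lambda>i. dn x B i A) (\<lambda>i. - (C i *v x) $ 1 / (C i *v x) $ 2) (\<lambda>i. - (C i *v x) $ 3 / (C i *v x) $ 2) y | y.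
      \<forall>i. dot (dn x B i A) y \<noteq> 0}" (is "?L = ?R")
proof -
  let ?p = "\<lambda>i. - (C i *v x) $ 1 / (C i *v x) $ 2" and ?e = "\<lambda>i. - (C i *v x) $ 3 / (C i *v x) $ 2"
  define w where "w c y = c *s x + (\<Sum>k\<in>UNIV. y $ k *s B k)" for c and y :: "complex^3"
  have Cw: "(C i *v w c y) $ r = c * (C i *v x) $ r + (y $ 1 * (C i *v B 1) $ r + y $ 2 * (C i *v B 2) $ r + y $ 3 * (C i *v B 3) $ r)" for i r c y
    by (simp add: w_def sum_3 matrix_vector_right_distrib vector_scalar_commute)
  have c1: "ccross (C i *v x) (C i *v w c y) $ 1 = dot (nn x B i A) y"
    and c3: "ccross (C i *v x) (C i *v w c y) $ 3 = dot (dn x B i A) y" for i c y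
    unfolding ccross_component Cw A_def by (simp_all add: dot_3 nn_def dn_def ent_arr_vec algebra_simps)
  have c2: "(C i *v x) $ 2 * ccross (C i *v x) v $ 2 = - (C i *v x) $ 1 * ccross (C i *v x) v $ 1 - (C i *v x) $ 3 * ccross (C i *v x) v $ 3" for i v
    unfolding ccross_component by (simp add: algebra_simps)
  have ch: "chart (\<lambda>i. ccross (C i *v x) (C i *v w c y)) = ptv (\<lambda>i. nn x B i A) (\<lambda>i. dn x B i A) ?p ?e y"
    if D: "\<forall>i. dot (dn x B i A) y \<noteq> 0" for c y
  proof -
    have "ccross (C i *v x) (C i *v w c y) $ 2 / dot (dn x B i A) y = ?e i + dot (nn x B i A) y / dot (dn x B i A) y * ?p i" for i
    proof -
      have d: "dot (dn x B i A) y \<noteq> 0" using D by blast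
      have "ccross (C i *v x) (C i *v w c y) $ 2 =
        (- (C i *v x) $ 1 * dot (nn x B i A) y - (C i *v x) $ 3 * dot (dn x B i A) y) / (C i *v x) $ 2"
        using c2[of i "C i *v w c y", unfolded c1 c3] p2[of i] by (simp add: eq_divide_eq mult.commute)
      from arg_cong[OF this, of "\<lambda>q. q / dot (dn x B i A) y"] show ?thesis
        using d p2[of i] by (simp add: diff_divide_distrib mult.commute)
    qed
    then show ?thesis
      by (simp add: Finite_Cartesian_Product.vec_eq_iff chart_def ptv_def dirv_def c1 c3)
  qed
  have ind: "vec.independent {x, w c y}" "x \<noteq> w c y" if D: "\<forall>i. dot (dn x B i A) y \<noteq> 0" for c y
  proof -
    obtain i :: 'm where "i \<in> UNIV" by blast
    have z: "\<alpha> = 0 \<and> \<beta> = 0" if "\<alpha> *s x + \<beta> *s w c y = 0" for \<alpha> \<beta>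
    proof -
      have "\<alpha> *s (C i *v x) + \<beta> *s (C i *v w c y) = C i *v (\<alpha> *s x + \<beta> *s w c y)"
        by (simp add: matrix_vector_right_distrib vector_scalar_commute)
      then have "\<alpha> *s (C i *v x) + \<beta> *s (C i *v w c y) = 0" unfolding that by simp
      then have "\<alpha> * (C i *v x) $ r + \<beta> * (C i *v w c y) $ r = 0" for r
        by (metis vector_add_component vector_smult_component zero_index)
      then have l: "\<alpha> * (C i *v x) $ r = - (\<beta> * (C i *v w c y) $ r)" for r by (simp add: eq_neg_iff_add_eq_0)
      have "\<beta> * ccross (C i *v x) (C i *v w c y) $ 3 =
         (C i *v x) $ 2 * (\<alpha> * (C i *v x) $ 1) - (C i *v x) $ 1 * (\<alpha> * (C i *v x) $ 2)"
        unfolding l ccross_component by (simp add: algebra_simps)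
      then have "\<beta> * ccross (C i *v x) (C i *v w c y) $ 3 = 0" by (simp add: algebra_simps)
      then have "\<beta> = 0" using D unfolding c3 by simp
      then show ?thesis using that x by simp
    qed
    show "vec.independent {x, w c y}" "x \<noteq> w c y" using vec_independent_pair[of x "w c y"] z by blast+
  qed
  show ?thesis
  proof (intro equalityI subsetI)
    fix z assume "z \<in> ?L"
    then obtain v where v: "z = chart (\<lambda>i. ccross (C i *v x) (C i *v v))" "\<forall>i. ccross (C i *v x) (C i *v v) $ 3 \<noteq> 0"
      by blast
    obtain c y where w: "v = w c y" using exp[of v] unfolding w_def by blast
    have D: "\<forall>i. dot (dn x B i A) y \<noteq> 0" using v(2) unfolding w c3 .
    have "z = ptv (\<lambda>i. nn x B i A) (\<lambda>i. dn x B i A) ?p ?e y" using v(1) unfolding w ch[OF D] .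
    with D show "z \<in> ?R" by blast
  next
    fix z assume "z \<in> ?R"
    then obtain y where y: "z = ptv (\<lambda>i. nn x B i A) (\<lambda>i. dn x B i A) ?p ?e y" "\<forall>i. dot (dn x B i A) y \<noteq> 0"
      by blast
    then have "z = chart (\<lambda>i. ccross (C i *v x) (C i *v w 0 y))" "\<forall>i. ccross (C i *v x) (C i *v w 0 y) $ 3 \<noteq> 0"
      using ch[of y 0] unfolding c3 by auto
    then show "z \<in> ?L" using ind[OF y(2), of 0] by blast
  qed
qed

text \<open>In terms of \<open>nn\<close> and \<open>dn\<close> every hypothesis of
  \<open>EDD_point_images\<close> becomes the nonvanishing of polynomials in the camera entries. A
  condition on two or three cameras gets its own witness for each choice of indices.\<close>

theorem generic_point_line_multiview:
  fixes x :: "complex^4"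
  assumes three: "CARD('m::finite) \<ge> 3" and x: "x \<noteq> 0"
  shows "generically (\<lambda>A. \<forall>C :: 'm \<Rightarrow> complex^4^3. arr_vec C = A \<longrightarrow>
    (\<exists>N. EDD_is (point_line_multiview_affine C x) N \<and>
      real N = 9/2 * real (CARD('m))^2 - 19/2 * real (CARD('m)) + 3))"
proof -
  obtain f0 :: "complex^4" and B f :: "3 \<Rightarrow> complex^4" where dual: "dot f0 x = 1" "\<forall>k. dot f0 (B k) = 0"
    "\<forall>k. dot (f k) x = 0" "\<forall>k l. dot (f k) (B l) = (if k = l then 1 else 0)"
    "\<forall>w. w = dot f0 w *s x + (\<Sum>k\<in>UNIV. dot (f k) w *s B k)"
    by (rule dual_basis4[OF x])
  note f0 = dual(1) dual(2)[rule_format] and f = dual(3,4)[rule_format] and exp = dual(5)[rule_format]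
  obtain m0 :: 'm where "m0 \<in> UNIV" by blast
  define nu where "nu i A = fcv (nn x B m0 A) (dn x B m0 A) (nn x B i A)" for i :: 'm and A
  define mu where "mu i A = fcv (nn x B m0 A) (dn x B m0 A) (dn x B i A)" for i :: 'm and A
  have cp: "(\<lambda>A. nu i A $ k) \<in> cpoly" "(\<lambda>A. mu i A $ k) \<in> cpoly" for i k
    unfolding nu_def mu_def by (intro fcv_cpoly nn_cpoly dn_cpoly)+
  have e_cp: "(\<lambda>A. e1 (nu i A) (mu i A)) \<in> cpoly" "(\<lambda>A. e2 (nu i A) (mu i A)) \<in> cpoly" for i
    unfolding e1_def e2_def by (intro cpoly_intros cp)+
  text \<open>In the witness arrangement all cameras send \<open>x\<close> to \<open>(0, 1, 0)\<close>, which leaves the forms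
    \<open>nu i\<close> and \<open>mu i\<close> of the cameras \<open>i \<noteq> m0\<close> arbitrary.\<close>
  have wit: "\<exists>A. \<forall>i. ent i 1 x A = 0 \<and> ent i 2 x A = 1 \<and> nn x B m0 A = vector [1, 0, 0] \<and> dn x B m0 A = vector [0, 1, 0] \<and>
      (i \<noteq> m0 \<longrightarrow> nu i A = nv i \<and> mu i A = dv i)" for nv dv :: "'m \<Rightarrow> complex^3"
  proof -
    define nv' where "nv' i = (if i = m0 then vector [1, 0, 0] else nv i)" for i
    define dv' where "dv' i = (if i = m0 then vector [0, 1, 0] else dv i)" for i
    define W where "W i r = (if r = 2 then 1 else 0) *s f0 +
      (\<Sum>k\<in>UNIV. (if r = 3 then nv' i $ k else if r = 1 then - dv' i $ k else 0) *s f k)" for i and r :: 3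
    define A where "A = (\<chi> p. case p of (i, r, c) \<Rightarrow> W i r $ c)"
    have Wx: "ent i r x A = (if r = 2 then 1 else 0)" for i r
      unfolding A_def ent_dual W_def by (simp add: sum_3 dot_add_left dot_scale_left f0 f)
    have WB: "ent i r (B k) A = (if r = 3 then nv' i $ k else if r = 1 then - dv' i $ k else 0)" for i r k
    proof -
      have "dot (\<Sum>l\<in>UNIV. c l *s f l) (B k) = c k" for c
      proof -
        have "dot (\<Sum>l\<in>UNIV. c l *s f l) (B k) = (\<Sum>l\<in>UNIV. c l * dot (f l) (B k))"
          by (simp add: sum_3 dot_add_left dot_scale_left)
        also have "\<dots> = (\<Sum>l\<in>UNIV. if l = k then c k else 0)"
          by (rule sum.cong) (auto simp: f)
        finally show ?thesis by simp
      qed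
      then show ?thesis
        unfolding A_def ent_dual W_def dot_add_left dot_scale_left f0 by simp
    qed
    have n: "nn x B i A = nv' i" and d: "dn x B i A = dv' i" for i
      by (simp_all add: nn_def dn_def Wx WB Finite_Cartesian_Product.vec_eq_iff)
    have frame: "fcv (vector [1, 0, 0]) (vector [0, 1, 0]) v = v" for v
      by (simp add: fcv_def Finite_Cartesian_Product.vec_eq_iff forall_3)
    show ?thesis
      by (intro exI[of _ A]) (simp add: Wx n d nu_def mu_def frame nv'_def dv'_def)
  qed
  define I where "I = UNIV - {m0}"
  note v3 = e1_def e2_def det3_def
  have 1: "generically (\<lambda>A. nn x B m0 A $ 1 * dn x B m0 A $ 2 - nn x B m0 A $ 2 * dn x B m0 A $ 1 \<noteq> 0)"
  proof -
    from wit[of "\<lambda>i. 0" "\<lambda>i. 0"] obtain A where "\<forall>i. ent i 1 x A = 0 \<and> ent i 2 x A = 1 \<and>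
      nn x B m0 A = vector [1, 0, 0] \<and> dn x B m0 A = vector [0, 1, 0] \<and> (i \<noteq> m0 \<longrightarrow> nu i A = 0 \<and> mu i A = 0)" by (rule exE)
    then show ?thesis by (intro generically_nonzero[of _ A] cpoly_intros nn_cpoly dn_cpoly) simp
  qed
  \<comment> \<open>The first factor allows solving for the second chart coordinate; the second
    keeps the direction of the image line from being isotropic.\<close>
  have 2: "generically (\<lambda>A. \<forall>i\<in>(UNIV :: 'm set). ent i 2 x A * (ent i 1 x A * ent i 1 x A + ent i 2 x A * ent i 2 x A) \<noteq> 0)"
  proof (rule generically_all)
    fix i :: 'm
    from wit[of "\<lambda>i. 0" "\<lambda>i. 0"] obtain A where "\<forall>i. ent i 1 x A = 0 \<and> ent i 2 x A = 1 \<and>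
      nn x B m0 A = vector [1, 0, 0] \<and> dn x B m0 A = vector [0, 1, 0] \<and> (i \<noteq> m0 \<longrightarrow> nu i A = 0 \<and> mu i A = 0)" by (rule exE)
    then show "generically (\<lambda>A. ent i 2 x A * (ent i 1 x A * ent i 1 x A + ent i 2 x A * ent i 2 x A) \<noteq> 0)"
      by (intro generically_nonzero[of _ A] cpoly_intros ent_cpoly) simp
  qed simp
  have 3: "generically (\<lambda>A. \<forall>i\<in>I. mu i A $ 3 * mu i A $ 1 * e1 (nu i A) (mu i A) \<noteq> 0)"
  proof (rule generically_all)
    fix i assume i: "i \<in> I"
    from wit[of "\<lambda>i. vector [1, 0, 0]" "\<lambda>i. vector [1, 0, 1]"] obtain A where "\<forall>i. ent i 1 x A = 0 \<and> ent i 2 x A = 1 \<and>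
      nn x B m0 A = vector [1, 0, 0] \<and> dn x B m0 A = vector [0, 1, 0] \<and>
      (i \<noteq> m0 \<longrightarrow> nu i A = vector [1, 0, 0] \<and> mu i A = vector [1, 0, 1])" by (rule exE)
    then show "generically (\<lambda>A. mu i A $ 3 * mu i A $ 1 * e1 (nu i A) (mu i A) \<noteq> 0)"
      using i by (intro generically_nonzero[of _ A] cpoly_intros cp e_cp) (simp add: I_def v3)
  qed (simp add: I_def)
  have 4: "generically (\<lambda>A. \<forall>i\<in>I. \<forall>j\<in>I - {i}.
    e2 (nu i A) (mu i A) * e1 (nu j A) (mu j A) - e2 (nu j A) (mu j A) * e1 (nu i A) (mu i A) \<noteq> 0)"
  proof (rule generically_all, simp add: I_def, rule generically_all, simp)
    fix i j assume ij: "i \<in> I" "j \<in> I - {i}"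
    from wit[of "\<lambda>l. if l = i then vector [1, 0, 0] else vector [1, 1, 0]" "\<lambda>l. vector [0, 0, 1]"] obtain A where "\<forall>l. ent l 1 x A = 0 \<and> ent l 2 x A = 1 \<and>
      nn x B m0 A = vector [1, 0, 0] \<and> dn x B m0 A = vector [0, 1, 0] \<and>
      (l \<noteq> m0 \<longrightarrow> nu l A = (if l = i then vector [1, 0, 0] else vector [1, 1, 0]) \<and> mu l A = vector [0, 0, 1])" by (rule exE)
    then show "generically (\<lambda>A. e2 (nu i A) (mu i A) * e1 (nu j A) (mu j A) - e2 (nu j A) (mu j A) * e1 (nu i A) (mu i A) \<noteq> 0)"
      using ij by (intro generically_nonzero[of _ A] cpoly_intros cp e_cp) (simp add: I_def v3)
  qed
  have 5: "generically (\<lambda>A. \<forall>i\<in>I. \<forall>j\<in>I - {i}. mu i A $ 1 * mu j A $ 3 - mu j A $ 1 * mu i A $ 3 \<noteq> 0)"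
  proof (rule generically_all, simp add: I_def, rule generically_all, simp)
    fix i j assume ij: "i \<in> I" "j \<in> I - {i}"
    from wit[of "\<lambda>l. 0" "\<lambda>l. if l = i then vector [1, 0, 0] else vector [0, 0, 1]"] obtain A where "\<forall>l. ent l 1 x A = 0 \<and> ent l 2 x A = 1 \<and>
      nn x B m0 A = vector [1, 0, 0] \<and> dn x B m0 A = vector [0, 1, 0] \<and>
      (l \<noteq> m0 \<longrightarrow> nu l A = 0 \<and> mu l A = (if l = i then vector [1, 0, 0] else vector [0, 0, 1]))" by (rule exE)
    then show "generically (\<lambda>A. mu i A $ 1 * mu j A $ 3 - mu j A $ 1 * mu i A $ 3 \<noteq> 0)"
      using ij by (intro generically_nonzero[of _ A] cpoly_intros cp e_cp) (simp add: I_def v3)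
  qed
  have 6: "generically (\<lambda>A. \<forall>i\<in>I. \<forall>j\<in>I - {i}.
      (mu j A $ 2 * e1 (nu j A) (mu j A) - mu j A $ 1 * e2 (nu j A) (mu j A)) * mu i A $ 3 -
      (mu i A $ 2 * e1 (nu j A) (mu j A) - mu i A $ 1 * e2 (nu j A) (mu j A)) * mu j A $ 3 \<noteq> 0)"
  proof (rule generically_all, simp add: I_def, rule generically_all, simp)
    fix i j assume ij: "i \<in> I" "j \<in> I - {i}"
    from wit[of "\<lambda>l. vector [1, 0, 0]" "\<lambda>l. if l = i then vector [0, 1, 0] else vector [0, 0, 1]"] obtain A where "\<forall>l. ent l 1 x A = 0 \<and> ent l 2 x A = 1 \<and>
      nn x B m0 A = vector [1, 0, 0] \<and> dn x B m0 A = vector [0, 1, 0] \<and>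
      (l \<noteq> m0 \<longrightarrow> nu l A = vector [1, 0, 0] \<and> mu l A = (if l = i then vector [0, 1, 0] else vector [0, 0, 1]))" by (rule exE)
    then show "generically (\<lambda>A. (mu j A $ 2 * e1 (nu j A) (mu j A) - mu j A $ 1 * e2 (nu j A) (mu j A)) * mu i A $ 3 -
      (mu i A $ 2 * e1 (nu j A) (mu j A) - mu i A $ 1 * e2 (nu j A) (mu j A)) * mu j A $ 3 \<noteq> 0)"
      using ij by (intro generically_nonzero[of _ A] cpoly_intros cp e_cp) (simp add: I_def v3)
  qed
  have 7: "generically (\<lambda>A. \<forall>i\<in>I. \<forall>j\<in>I - {i}. \<forall>l\<in>I - {i, j}. det3 (mu i A) (mu j A) (mu l A) \<noteq> 0)"
  proof (rule generically_all, simp add: I_def, rule generically_all, simp, rule generically_all, simp)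
    fix i j l assume ij: "i \<in> I" "j \<in> I - {i}" "l \<in> I - {i, j}"
    from wit[of "\<lambda>q. 0" "\<lambda>q. if q = i then vector [1, 0, 0] else if q = j then vector [0, 1, 0] else vector [0, 0, 1]"] obtain A where "\<forall>q. ent q 1 x A = 0 \<and> ent q 2 x A = 1 \<and>
      nn x B m0 A = vector [1, 0, 0] \<and> dn x B m0 A = vector [0, 1, 0] \<and>
      (q \<noteq> m0 \<longrightarrow> nu q A = 0 \<and> mu q A = (if q = i then vector [1, 0, 0] else if q = j then vector [0, 1, 0] else vector [0, 0, 1]))" by (rule exE)
    then show "generically (\<lambda>A. det3 (mu i A) (mu j A) (mu l A) \<noteq> 0)"
      using ij unfolding det3_def by (intro generically_nonzero[of _ A] cpoly_intros cp e_cp) (simp add: I_def)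
  qed
  show ?thesis
  proof (rule generically_mono[OF generically_conj[OF 1 generically_conj[OF 2 generically_conj[OF 3
      generically_conj[OF 4 generically_conj[OF 5 generically_conj[OF 6 7]]]]]]], elim conjE, intro allI impI)
    fix A and C :: "'m \<Rightarrow> complex^4^3"
    assume C: "arr_vec C = A"
      and a1: "nn x B m0 A $ 1 * dn x B m0 A $ 2 - nn x B m0 A $ 2 * dn x B m0 A $ 1 \<noteq> 0"
      and a2: "\<forall>i\<in>(UNIV :: 'm set). ent i 2 x A * (ent i 1 x A * ent i 1 x A + ent i 2 x A * ent i 2 x A) \<noteq> 0"
      and a3: "\<forall>i\<in>I. mu i A $ 3 * mu i A $ 1 * e1 (nu i A) (mu i A) \<noteq> 0"
      and a4: "\<forall>i\<in>I. \<forall>j\<in>I - {i}.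
        e2 (nu i A) (mu i A) * e1 (nu j A) (mu j A) - e2 (nu j A) (mu j A) * e1 (nu i A) (mu i A) \<noteq> 0"
      and a5: "\<forall>i\<in>I. \<forall>j\<in>I - {i}. mu i A $ 1 * mu j A $ 3 - mu j A $ 1 * mu i A $ 3 \<noteq> 0"
      and a6: "\<forall>i\<in>I. \<forall>j\<in>I - {i}.
        (mu j A $ 2 * e1 (nu j A) (mu j A) - mu j A $ 1 * e2 (nu j A) (mu j A)) * mu i A $ 3 -
        (mu i A $ 2 * e1 (nu j A) (mu j A) - mu i A $ 1 * e2 (nu j A) (mu j A)) * mu j A $ 3 \<noteq> 0"
      and a7: "\<forall>i\<in>I. \<forall>j\<in>I - {i}. \<forall>l\<in>I - {i, j}. det3 (mu i A) (mu j A) (mu l A) \<noteq> 0"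
    have p2: "(C i *v x) $ 2 \<noteq> 0" and pq: "(C i *v x) $ 1 * (C i *v x) $ 1 + (C i *v x) $ 2 * (C i *v x) $ 2 \<noteq> 0" for i
      using a2 unfolding C[symmetric] ent_arr_vec by auto
    have ex: "\<exists>c y. w = c *s x + (\<Sum>k\<in>UNIV. y $ k *s B k)" for w
      using exp[of w] by (intro exI[of _ "dot f0 w"] exI[of _ "\<chi> k. dot (f k) w"]) simp
    let ?r = "\<lambda>i. - (C i *v x) $ 1 / (C i *v x) $ 2" and ?e = "\<lambda>i. - (C i *v x) $ 3 / (C i *v x) $ 2"
    have "\<exists>N. EDD_is (zclosure {ptv (\<lambda>i. nn x B i A) (\<lambda>i. dn x B i A) ?r ?e y | y. \<forall>i. dot (dn x B i A) y \<noteq> 0}) N \<and>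
      real N = 9/2 * real (CARD('m))^2 - 19/2 * real (CARD('m)) + 3"
    proof (rule EDD_point_images[where n = "\<lambda>i. nn x B i A" and d = "\<lambda>i. dn x B i A" and ?m0.0 = m0, OF three a1], fold nu_def mu_def)
      show "1 + ?r i * ?r i \<noteq> 0" for i
      proof -
        have "1 + ?r i * ?r i = ((C i *v x) $ 1 * (C i *v x) $ 1 + (C i *v x) $ 2 * (C i *v x) $ 2) / ((C i *v x) $ 2 * (C i *v x) $ 2)"
          using p2[of i] by (simp add: field_simps)
        then show ?thesis using pq[of i] p2[of i] by simp
      qed
    qed (use a3 a4 a5 a6 a7 in \<open>auto simp: I_def\<close>)
    then show "\<exists>N. EDD_is (point_line_multiview_affine C x) N \<and>
      real N = 9/2 * real (CARD('m))^2 - 19/2 * real (CARD('m)) + 3"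
      unfolding point_line_multiview_affine_def point_images[OF x ex p2] C .
  qed
qed

theorem theorem1p8:
  fixes x a b :: "complex^4"
  assumes "CARD('m::finite) \<ge> 2"
    and "x \<noteq> 0"
    and "vec.independent {a, b}" and "a \<noteq> b"
  shows "(\<exists>Z. proper_zariski_closed Z \<and>
            (\<forall>C :: 'm \<Rightarrow> complex^4^3. camera_arrangement C \<and> arr_vec C \<notin> Z \<longrightarrow>
               EDD_is (line_multiview_affine C a b) (3 * CARD('m) - 2)))
       \<and> (CARD('m) \<ge> 3 \<longrightarrow>
          (\<exists>Z. proper_zariski_closed Z \<and>
            (\<forall>C :: 'm \<Rightarrow> complex^4^3. camera_arrangement C \<and> arr_vec C \<notin> Z \<longrightarrow>
               (\<exists>N. EDD_is (point_line_multiview_affine C x) N \<and>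
                  real N = 9/2 * real (CARD('m))^2 - 19/2 * real (CARD('m)) + 3))))"
proof (intro conjI impI)
  show "\<exists>Z. proper_zariski_closed Z \<and> (\<forall>C :: 'm \<Rightarrow> complex^4^3. camera_arrangement C \<and> arr_vec C \<notin> Z \<longrightarrow>
      EDD_is (line_multiview_affine C a b) (3 * CARD('m) - 2))"
    using generically_proper[OF generic_line_multiview[OF assms(1,3,4)]] by (elim ex_forward) auto
  assume "CARD('m) \<ge> 3"
  from generically_proper[OF generic_point_line_multiview[OF this assms(2)]]
  show "\<exists>Z. proper_zariski_closed Z \<and> (\<forall>C :: 'm \<Rightarrow> complex^4^3. camera_arrangement C \<and> arr_vec C \<notin> Z \<longrightarrow>
      (\<exists>N. EDD_is (point_line_multiview_affine C x) N \<and>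
        real N = 9/2 * real (CARD('m))^2 - 19/2 * real (CARD('m)) + 3))"
    by (elim ex_forward) auto
qed

end
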